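(* Let $n\ge2$ and suppose $u=Pf$ is the (classical) Poisson extension of $f\in L^n(\mathbb{R}^n)$. Then $|\nabla f|\in L^n(\mathbb{R}^n)$ if and only if $|\nabla_hu|\in L^{n,\infty}(\mathbb{R}^{n+1}_+,d\mu_h)$.
   Context: $\mathbb{R}^{n+1}_+=\{(x,t):x\in\mathbb{R}^n,\ t>0\}$. The Poisson kernel is $P_t(x)=c_n\,t\,(t^2+|x|^2)^{-(n+1)/2}$, $c_n=\Gamma((n+1)/2)/\pi^{(n+1)/2}$, and $(Pf)(x,t)=(P_t*f)(x)$. Functions are real-valued. $\nabla f=(\partial_1f,\dots,\partial_nf)$ is the distributional gradient of $f$; $|\nabla f|\in L^n(\mathbb{R}^n)$ means that all distributional partial derivatives $\partial_if$ are functions in $L^n(\mathbb{R}^n)$. The hyperbolic gradient of a smooth function $u$ on $\mathbb{R}^{n+1}_+$ is $\nabla_hu(x,t)=t\nabla u(x,t)$, where $\nabla u$ is the full Euclidean gradient in the $n+1$ variables $(x,t)$, and $|\nabla_h u|$ denotes its Euclidean norm; the hyperbolic measure is $d\mu_h=t^{-(n+1)}dx\,dt$. For a measure $\mu$ on a set $A$ and $p\ge1$, $L^{p,\infty}(A,\mu)$ is the space of measurable $g\colon A\to\mathbb{R}$ for which there is $C\ge0$ with $\mu(\{a\in A:|g(a)|>\lambda\})\le C^p/\lambda^p$ for all $\lambda>0$. *)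

theory Defs
  imports "HOL-Analysis.Analysis"
begin

definition Lp :: "real \<Rightarrow> 'a measure \<Rightarrow> ('a \<Rightarrow> real) set" where
  "Lp p M = {f \<in> borel_measurable M. integrable M (\<lambda>x. \<bar>f x\<bar> powr p)}"

definition weak_Lp :: "real \<Rightarrow> 'a measure \<Rightarrow> ('a \<Rightarrow> real) set" where
  "weak_Lp p M = {g \<in> borel_measurable M.
     \<exists>C\<ge>0. \<forall>s>0. emeasure M {a \<in> space M. \<bar>g a\<bar> > s} \<le> ennreal (C powr p / s powr p)}"

definition partial_deriv ::
    "'a::euclidean_space \<Rightarrow> ('a \<Rightarrow> real) \<Rightarrow> 'a \<Rightarrow> real" where
  "partial_deriv b u x = frechet_derivative u (at x) b"

definition gradient :: "('a::euclidean_space \<Rightarrow> real) \<Rightarrow> 'a \<Rightarrow> 'a" where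
  "gradient u x = (\<Sum>b\<in>Basis. partial_deriv b u x *\<^sub>R b)"

primrec C_k :: "nat \<Rightarrow> ('a::euclidean_space \<Rightarrow> real) \<Rightarrow> bool" where
  "C_k 0 u \<longleftrightarrow> continuous_on UNIV u"
| "C_k (Suc k) u \<longleftrightarrow> u differentiable_on UNIV \<and> (\<forall>b\<in>Basis. C_k k (partial_deriv b u))"

definition test_functions :: "('a::euclidean_space \<Rightarrow> real) set" where
  "test_functions = {\<phi>. (\<forall>k. C_k k \<phi>) \<and> compact (closure {x. \<phi> x \<noteq> 0})}"

definition locally_integrable :: "('a::euclidean_space \<Rightarrow> real) \<Rightarrow> bool" where
  "locally_integrable f \<longleftrightarrow> (\<forall>K. compact K \<longrightarrow> set_integrable lebesgue K f)"

text \<open>Local integrability makes both sides of the integration by parts formula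
  genuine integrals; a Bochner integral of a non-integrable function is 0 by convention.\<close>

definition has_distributional_partial ::
    "'a::euclidean_space \<Rightarrow> ('a \<Rightarrow> real) \<Rightarrow> ('a \<Rightarrow> real) \<Rightarrow> bool" where
  "has_distributional_partial b f g \<longleftrightarrow>
     locally_integrable f \<and> locally_integrable g \<and>
     (\<forall>\<phi>\<in>test_functions.
        (LINT x|lebesgue. f x * partial_deriv b \<phi> x) = - (LINT x|lebesgue. g x * \<phi> x))"

definition distributional_gradient_in_Lp ::
    "real \<Rightarrow> ('a::euclidean_space \<Rightarrow> real) \<Rightarrow> bool" where
  "distributional_gradient_in_Lp p f \<longleftrightarrow>
     (\<forall>b\<in>Basis. \<exists>g\<in>Lp p lebesgue. has_distributional_partial b f g)"

definition poisson_kernel :: "real \<Rightarrow> 'a::euclidean_space \<Rightarrow> real" where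
  "poisson_kernel t x =
     Gamma ((real DIM('a) + 1) / 2) / pi powr ((real DIM('a) + 1) / 2)
       * t * (t\<^sup>2 + (norm x)\<^sup>2) powr (- ((real DIM('a) + 1) / 2))"

text \<open>Functions on the half-space are total functions on \<open>'a \<times> real\<close>; only their values at
  points with positive last coordinate are used.\<close>

definition poisson_extension :: "('a::euclidean_space \<Rightarrow> real) \<Rightarrow> 'a \<times> real \<Rightarrow> real" where
  "poisson_extension f = (\<lambda>(x, t). LINT y|lebesgue. poisson_kernel t (x - y) * f y)"

definition upper_half_space :: "('a::euclidean_space \<times> real) set" where
  "upper_half_space = {(x, t). t > 0}"

definition hyperbolic_gradient ::
    "('a::euclidean_space \<times> real \<Rightarrow> real) \<Rightarrow> 'a \<times> real \<Rightarrow> 'a \<times> real" where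
  "hyperbolic_gradient u z = snd z *\<^sub>R gradient u z"

definition hyperbolic_measure :: "('a::euclidean_space \<times> real) measure" where
  "hyperbolic_measure =
     density (lebesgue_on upper_half_space) (\<lambda>(x, t). ennreal (1 / t ^ (DIM('a) + 1)))"

end

theory Submission
  imports Defs
begin

text \<open>Write \<open>n\<close> for the dimension and \<open>w = \<partial>\<^sub>i u\<close> for a tangential derivative of the extension.

  If \<open>\<partial>\<^sub>i f \<in> L\<^sup>n\<close>, then \<open>w\<close> is the Poisson extension of \<open>\<partial>\<^sub>i f\<close>, so its slices \<open>w(\<cdot>, e)\<close> are bounded in
  \<open>L\<^sup>n\<close> uniformly in \<open>e\<close>. For the vertical derivative, singular integrals are avoided: a suitable function
  of the gradient is subharmonic, and comparing it with its Poisson integral at \<open>(0, t)\<close>, \<open>t \<rightarrow> \<infinity>\<close>, bounds the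
  \<open>L\<^sup>n\<close> norm of the vertical derivative by those of the tangential ones. Bounded slices and the
  semigroup property give the weak-type bound by truncation and Fubini.

  Conversely, if \<open>t |w|\<close> is of weak type, the semigroup property bounds a slice of \<open>w\<close> by all lower slices.
  Averaging over \<open>dt / t\<close> compares a length growing linearly in the number of dyadic scales with the
  truncated \<open>n\<close>-th moment of a weak-type function, which grows linearly as well; hence the slices of \<open>w\<close>
  are bounded in \<open>L\<^sup>n\<close>. By uniform convexity they then converge in \<open>L\<^sup>n\<close> as the height tends to \<open>0\<close>, and
  the limit is the distributional derivative \<open>\<partial>\<^sub>i f\<close>.\<close>

section \<open>Homogeneous kernels\<close>

text \<open>The dimension \<open>n\<close>, the exponent and the weight \<open>t ^ (n + 1)\<close>
  are tied by scaling, which makes weak type the right condition. The strong norm of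
  \<open>t |w|\<close> is the integral over \<open>dt / t\<close> of the \<open>n\<close>-th moments
  of the slices of \<open>w\<close>. These moments increase as the height decreases, so the integral
  diverges logarithmically unless \<open>w = 0\<close>. The converse turns this divergence into a
  count: as \<open>|w|\<close> is \<open>O(1 / t\<^sup>2)\<close>, the relevant values of
  \<open>t |w|\<close> at heights between \<open>T / 2 ^ m\<close> and \<open>T\<close> span about
  \<open>2 m\<close> dyadic levels. For the vertical derivative, the Hessian of \<open>u\<close>
  takes the place of Riesz transforms: it is symmetric with trace zero, so its vertical row is
  controlled by the tangential rows. A large multiple of an expression with a tangential factor,
  minus the \<open>n\<close>-th power of the length of the gradient, is then subharmonic. The
  hypothesis \<open>n \<ge> 2\<close> serves three times: \<open>1 / t ^ n\<close> must be
  integrable at infinity, the exponent \<open>n / 2 - 1\<close> in the comparison function must be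
  nonnegative, and Clarkson's inequality is used for exponents of at least two.\<close>

text \<open>A family of kernels homogeneous of degree \<open>- j\<close> that contains the Poisson kernel and is closed under partial
  derivatives. The value at \<open>0\<close>, where the formulas divide by zero, is left free by \<open>hom_kernel_cong\<close>.\<close>

inductive hom_kernel :: "nat \<Rightarrow> ('z::euclidean_space \<Rightarrow> real) \<Rightarrow> bool" where
  hom_kernel_norm: "hom_kernel j (\<lambda>z. 1 / norm z ^ j)"
| hom_kernel_inner: "hom_kernel (Suc j) k \<Longrightarrow> hom_kernel j (\<lambda>z. (z \<bullet> b) * k z)"
| hom_kernel_add: "hom_kernel j k \<Longrightarrow> hom_kernel j l \<Longrightarrow> hom_kernel j (\<lambda>z. k z + l z)"
| hom_kernel_scale: "hom_kernel j k \<Longrightarrow> hom_kernel j (\<lambda>z. c * k z)"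
| hom_kernel_cong: "hom_kernel j k \<Longrightarrow> (\<And>z. z \<noteq> 0 \<Longrightarrow> l z = k z) \<Longrightarrow> hom_kernel j l"

lemma hom_kernel_bound:
  assumes "hom_kernel j k"
  shows "\<exists>C\<ge>0. \<forall>z. z \<noteq> 0 \<longrightarrow> \<bar>k z\<bar> \<le> C / norm z ^ j"
  using assms
proof induction
  case (hom_kernel_norm j)
  show ?case by (intro exI[of _ 1]) auto
next
  case (hom_kernel_inner j k b)
  then obtain C where C: "C \<ge> 0" "\<And>z. z \<noteq> 0 \<Longrightarrow> \<bar>k z\<bar> \<le> C / norm z ^ Suc j" by blast
  have "\<bar>(z \<bullet> b) * k z\<bar> \<le> norm b * C / norm z ^ j" if "z \<noteq> 0" for z
  proof -
    have "\<bar>(z \<bullet> b) * k z\<bar> \<le> (norm z * norm b) * (C / norm z ^ Suc j)"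
      unfolding abs_mult by (intro mult_mono Cauchy_Schwarz_ineq2 C that) auto
    also have "\<dots> = norm b * C / norm z ^ j" using that by (simp add: field_simps)
    finally show ?thesis .
  qed
  then show ?case using C(1) by (intro exI[of _ "norm b * C"]) auto
next
  case (hom_kernel_add j k l)
  then obtain C D where C: "C \<ge> 0" "\<And>z. z \<noteq> 0 \<Longrightarrow> \<bar>k z\<bar> \<le> C / norm z ^ j"
    and D: "D \<ge> 0" "\<And>z. z \<noteq> 0 \<Longrightarrow> \<bar>l z\<bar> \<le> D / norm z ^ j" by blast
  have "\<bar>k z + l z\<bar> \<le> (C + D) / norm z ^ j" if "z \<noteq> 0" for z
    using C(2)[OF that] D(2)[OF that] by (auto simp: add_divide_distrib)
  then show ?case using C(1) D(1) by (intro exI[of _ "C + D"]) auto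
next
  case (hom_kernel_scale j k c)
  then obtain C where C: "C \<ge> 0" "\<And>z. z \<noteq> 0 \<Longrightarrow> \<bar>k z\<bar> \<le> C / norm z ^ j" by blast
  have "\<bar>c * k z\<bar> \<le> \<bar>c\<bar> * C / norm z ^ j" if "z \<noteq> 0" for z
    using mult_left_mono[OF C(2)[OF that], of "\<bar>c\<bar>"] by (auto simp: abs_mult)
  then show ?case using C(1) by (intro exI[of _ "\<bar>c\<bar> * C"]) auto
qed auto

lemma has_derivative_inverse_norm_power_inner:
  fixes z :: "'z::euclidean_space"
  assumes "z \<noteq> 0"
  shows "((\<lambda>z. 1 / norm z ^ j) has_derivative (\<lambda>h. - real j * (z \<bullet> h) / norm z ^ (j + 2))) (at z)"
proof -
  have nz: "norm z \<noteq> 0" using assms by simp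
  have "((\<lambda>r::real. 1 / r ^ j) has_field_derivative - real j / norm z ^ (j + 1)) (at (norm z))"
    unfolding divide_inverse_commute[of 1]
    by (rule DERIV_cong[OF DERIV_cmult_right[OF DERIV_inverse_fun[OF DERIV_pow]]])
      (use nz in \<open>cases j; simp add: field_simps\<close>)+
  from has_derivative_compose[OF has_derivative_norm[OF assms] this[unfolded has_field_derivative_def]]
  have "((\<lambda>z. 1 / norm z ^ j) has_derivative
    (\<lambda>h. - real j / norm z ^ (j + 1) * (h \<bullet> sgn z))) (at z)" .
  moreover have "- real j / norm z ^ (j + 1) * (h \<bullet> sgn z) = - real j * (z \<bullet> h) / norm z ^ (j + 2)" for h
    using nz by (simp add: sgn_div_norm inner_commute field_simps)
  ultimately show ?thesis by simp
qed

lemma has_derivative_inverse_norm_power: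
  fixes z :: "'z::euclidean_space"
  assumes "z \<noteq> 0"
  shows "((\<lambda>z. 1 / norm z ^ j) has_derivative
    (\<lambda>h. \<Sum>b\<in>Basis. (h \<bullet> b) * (- real j * ((z \<bullet> b) * (1 / norm z ^ (j + 2)))))) (at z)"
proof -
  have "(\<Sum>b\<in>Basis. (h \<bullet> b) * (- real j * ((z \<bullet> b) * (1 / norm z ^ (j + 2)))))
      = - real j * (z \<bullet> h) / norm z ^ (j + 2)" for h
    by (subst euclidean_inner[of z h], simp add: sum_distrib_left sum_negf sum_divide_distrib mult_ac)
  then show ?thesis using has_derivative_inverse_norm_power_inner[OF assms] by simp
qed

text \<open>Derivatives are carried as explicit witnesses, indexed by all vectors rather than by
  basis vectors, so that an induction on \<open>hom_kernel\<close> can build them with the product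
  rule. They are matched with \<open>partial_deriv\<close> only afterwards.\<close>

definition second_order_kernel ::
  "('z::euclidean_space \<Rightarrow> real) \<Rightarrow> ('z \<Rightarrow> 'z \<Rightarrow> real) \<Rightarrow> ('z \<Rightarrow> 'z \<Rightarrow> 'z \<Rightarrow> real) \<Rightarrow> bool"
where
  "second_order_kernel k k' k'' \<longleftrightarrow> (\<forall>z. z \<noteq> 0 \<longrightarrow>
     (k has_derivative (\<lambda>h. \<Sum>b\<in>Basis. (h \<bullet> b) * k' b z)) (at z) \<and>
     (\<forall>b. (k' b has_derivative (\<lambda>h. \<Sum>c\<in>Basis. (h \<bullet> c) * k'' b c z)) (at z)) \<and>
     (\<forall>b c. k'' b c z = k'' c b z))"

text \<open>Each derivative raises the degree of the singularity by one, and the product rule stays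
  inside the family. Symmetry of the second derivatives is read off the explicit formulas, case by
  case.\<close>

lemma hom_kernel_C2:
  assumes "hom_kernel j k"
  shows "\<exists>k' k''. (\<forall>b. hom_kernel (j + 1) (k' b)) \<and> (\<forall>b c. hom_kernel (j + 2) (k'' b c)) \<and>
     second_order_kernel k k' k''"
  using assms
proof induction
  case (hom_kernel_norm j)
  define k' :: "'a \<Rightarrow> 'a \<Rightarrow> real" where "k' = (\<lambda>b z. - real j * ((z \<bullet> b) * (1 / norm z ^ (j + 2))))"
  define k'' :: "'a \<Rightarrow> 'a \<Rightarrow> 'a \<Rightarrow> real" where "k'' = (\<lambda>b c z. - real j * ((c \<bullet> b) * (1 / norm z ^ (j + 2)) +
     (z \<bullet> b) * (- real (j + 2) * ((z \<bullet> c) * (1 / norm z ^ (j + 2 + 2))))))"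
  have 1: "hom_kernel (j + 1) (k' b)" for b
    unfolding k'_def by (intro hom_kernel_inner hom_kernel_add hom_kernel_scale) (use hom_kernel.intros(1)[of "j+2"] in simp)
  have 2: "hom_kernel (j + 2) (k'' b c)" for b c
    unfolding k''_def
    by (intro hom_kernel_inner hom_kernel_add hom_kernel_scale; simp only: add_2_eq_Suc'; rule hom_kernel_norm)
  have 3: "(k' b has_derivative (\<lambda>h. \<Sum>c\<in>Basis. (h \<bullet> c) * k'' b c z)) (at z)" if "z \<noteq> 0" for b z
  proof -
    have "(k' b has_derivative (\<lambda>h. - real j * ((h \<bullet> b) * (1 / norm z ^ (j + 2)) +
      (z \<bullet> b) * (\<Sum>c\<in>Basis. (h \<bullet> c) * (- real (j + 2) * ((z \<bullet> c) * (1 / norm z ^ (j + 2 + 2)))))))) (at z)"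
      unfolding k'_def
      by (rule derivative_eq_intros has_derivative_inverse_norm_power[OF that] refl | simp only: add.commute)+
    moreover have "- real j * ((h \<bullet> b) * (1 / norm z ^ (j + 2)) +
      (z \<bullet> b) * (\<Sum>c\<in>Basis. (h \<bullet> c) * (- real (j + 2) * ((z \<bullet> c) * (1 / norm z ^ (j + 2 + 2))))))
      = (\<Sum>c\<in>Basis. (h \<bullet> c) * k'' b c z)" for h
      unfolding k''_def
      by (subst euclidean_inner[of h b], simp add: sum_distrib_left sum.distrib[symmetric] sum_divide_distrib
         sum_subtractf[symmetric] algebra_simps inner_commute del: power_add add_2_eq_Suc add_2_eq_Suc')
    ultimately show ?thesis by simp
  qed
  have 4: "k'' b c z = k'' c b z" for b c z
    unfolding k''_def by (simp add: inner_commute)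
  show ?case
    using 1 2 3 4 has_derivative_inverse_norm_power[of _ j]
    by (intro exI[of _ k'] exI[of _ k'']) (auto simp: second_order_kernel_def k'_def)
next
  case (hom_kernel_inner j k a)
  then obtain k' k'' where k: "\<And>b. hom_kernel (Suc j + 1) (k' b)" "\<And>b c. hom_kernel (Suc j + 2) (k'' b c)"
    and d: "second_order_kernel k k' k''" by blast
  define l' where "l' = (\<lambda>b z. (b \<bullet> a) * k z + (z \<bullet> a) * k' b z)"
  define l'' where "l'' = (\<lambda>b c z. (b \<bullet> a) * k' c z + ((c \<bullet> a) * k' b z + (z \<bullet> a) * k'' b c z))"
  have 1: "hom_kernel (j + 1) (l' b)" for b
    unfolding l'_def using hom_kernel_inner(1) k by (auto intro!: hom_kernel.hom_kernel_inner hom_kernel_add hom_kernel_scale)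
  have 2: "hom_kernel (j + 2) (l'' b c)" for b c
    unfolding l''_def using k by (auto intro!: hom_kernel.hom_kernel_inner hom_kernel_add hom_kernel_scale)
  have 3: "((\<lambda>z. (z \<bullet> a) * k z) has_derivative (\<lambda>h. \<Sum>b\<in>Basis. (h \<bullet> b) * l' b z)) (at z)" if "z \<noteq> 0" for z
  proof -
    have "((\<lambda>z. (z \<bullet> a) * k z) has_derivative
       (\<lambda>h. (z \<bullet> a) * (\<Sum>b\<in>Basis. (h \<bullet> b) * k' b z) + (h \<bullet> a) * k z)) (at z)"
      using d that unfolding second_order_kernel_def by (auto intro!: derivative_eq_intros)
    moreover have "(z \<bullet> a) * (\<Sum>b\<in>Basis. (h \<bullet> b) * k' b z) + (h \<bullet> a) * k z
      = (\<Sum>b\<in>Basis. (h \<bullet> b) * l' b z)" for h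
      unfolding l'_def
      by (subst euclidean_inner[of h a], simp add: sum_distrib_left sum_distrib_right sum.distrib algebra_simps inner_commute)
    ultimately show ?thesis by simp
  qed
  have 4: "(l' b has_derivative (\<lambda>h. \<Sum>c\<in>Basis. (h \<bullet> c) * l'' b c z)) (at z)" if "z \<noteq> 0" for z b
  proof -
    have "(l' b has_derivative
       (\<lambda>h. (b \<bullet> a) * (\<Sum>c\<in>Basis. (h \<bullet> c) * k' c z) + ((z \<bullet> a) * (\<Sum>c\<in>Basis. (h \<bullet> c) * k'' b c z) + (h \<bullet> a) * k' b z))) (at z)"
      using d that unfolding second_order_kernel_def l'_def by (auto intro!: derivative_eq_intros)
    moreover have "(b \<bullet> a) * (\<Sum>c\<in>Basis. (h \<bullet> c) * k' c z) + ((z \<bullet> a) * (\<Sum>c\<in>Basis. (h \<bullet> c) * k'' b c z) + (h \<bullet> a) * k' b z)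
      = (\<Sum>c\<in>Basis. (h \<bullet> c) * l'' b c z)" for h
      unfolding l''_def
      by (subst euclidean_inner[of h a], simp add: sum_distrib_left sum_distrib_right sum.distrib algebra_simps inner_commute)
    ultimately show ?thesis by simp
  qed
  have 5: "l'' b c z = l'' c b z" if "z \<noteq> 0" for b c z
    using d that unfolding second_order_kernel_def l''_def by auto
  show ?case
    using 1 2 3 4 5 by (intro exI[of _ l'] exI[of _ l'']) (auto simp: second_order_kernel_def)
next
  case (hom_kernel_add j k l)
  then obtain k' k'' l' l'' where k: "\<And>b. hom_kernel (j + 1) (k' b)" "\<And>b c. hom_kernel (j + 2) (k'' b c)"
      "second_order_kernel k k' k''"
    and l: "\<And>b. hom_kernel (j + 1) (l' b)" "\<And>b c. hom_kernel (j + 2) (l'' b c)"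
      "second_order_kernel l l' l''" by blast
  show ?case
    using k l
    by (intro exI[of _ "\<lambda>b z. k' b z + l' b z"] exI[of _ "\<lambda>b c z. k'' b c z + l'' b c z"])
      (auto simp: second_order_kernel_def distrib_left sum.distrib intro!: hom_kernel.hom_kernel_add hom_kernel.hom_kernel_scale has_derivative_add)
next
  case (hom_kernel_scale j k a)
  then obtain k' k'' where k: "\<And>b. hom_kernel (j + 1) (k' b)" "\<And>b c. hom_kernel (j + 2) (k'' b c)"
    and d: "second_order_kernel k k' k''" by blast
  have eq: "(\<Sum>b\<in>Basis. (h \<bullet> b) * (a * g b)) = a * (\<Sum>b\<in>Basis. (h \<bullet> b) * g b)" for h :: 'a and g
    by (simp add: sum_distrib_left mult_ac)
  show ?case
    using k d
    by (intro exI[of _ "\<lambda>b z. a * k' b z"] exI[of _ "\<lambda>b c z. a * k'' b c z"])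
      (auto simp: second_order_kernel_def eq intro!: hom_kernel.hom_kernel_add hom_kernel.hom_kernel_scale has_derivative_mult_right)
next
  case (hom_kernel_cong j k l)
  then obtain k' k'' where k: "\<And>b. hom_kernel (j + 1) (k' b)" "\<And>b c. hom_kernel (j + 2) (k'' b c)"
    and d: "second_order_kernel k k' k''" by blast
  have "(l has_derivative D) (at z)" if "(k has_derivative D) (at z)" "z \<noteq> 0" for D z
    by (rule has_derivative_transform_within_open[OF that(1), of "- {0}"]) (use that hom_kernel_cong in auto)
  then show ?case using k d unfolding second_order_kernel_def by blast
qed

lemma frechet_derivative_eq_sum:
  assumes "(k has_derivative (\<lambda>h. \<Sum>b\<in>Basis. (h \<bullet> b) * k' b)) (at z)" "b \<in> Basis"
  shows "partial_deriv b k z = k' b"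
proof -
  have "partial_deriv b k z = (\<Sum>c\<in>Basis. (b \<bullet> c) * k' c)"
    unfolding partial_deriv_def frechet_derivative_at[OF assms(1), symmetric] by simp
  also have "\<dots> = (\<Sum>c\<in>Basis. if c = b then k' c else 0)"
    using assms(2) by (intro sum.cong) (auto simp: inner_Basis)
  finally show ?thesis using assms(2) by simp
qed

text \<open>Away from \<open>0\<close> the witnesses of \<open>hom_kernel_C2\<close> agree with
  \<open>partial_deriv\<close>; whatever value \<open>partial_deriv\<close> takes at
  \<open>0\<close> is absorbed by \<open>hom_kernel_cong\<close>.\<close>

lemma
  fixes k :: "'z::euclidean_space \<Rightarrow> real"
  assumes k: "hom_kernel j k"
  shows hom_kernel_partial_deriv: "b \<in> Basis \<Longrightarrow> hom_kernel (j + 1) (partial_deriv b k)"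
    and hom_kernel_has_derivative:
      "z \<noteq> 0 \<Longrightarrow> (k has_derivative (\<lambda>h. \<Sum>b\<in>Basis. (h \<bullet> b) * partial_deriv b k z)) (at z)"
    and hom_kernel_partial_commute:
      "b \<in> Basis \<Longrightarrow> c \<in> Basis \<Longrightarrow> z \<noteq> 0 \<Longrightarrow> partial_deriv b (partial_deriv c k) z = partial_deriv c (partial_deriv b k) z"
proof -
  obtain k' k'' where k': "\<And>b. hom_kernel (j + 1) (k' b)" "\<And>b c. hom_kernel (j + 2) (k'' b c)"
    and d: "second_order_kernel k k' k''" using hom_kernel_C2[OF k] by blast
  have 1: "partial_deriv b k z = k' b z" if "b \<in> Basis" "z \<noteq> 0" for b z
    using d that by (intro frechet_derivative_eq_sum) (auto simp: second_order_kernel_def)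
  then show "b \<in> Basis \<Longrightarrow> hom_kernel (j + 1) (partial_deriv b k)" for b
    using hom_kernel_cong[OF k'(1)] by blast
  show "z \<noteq> 0 \<Longrightarrow> (k has_derivative (\<lambda>h. \<Sum>b\<in>Basis. (h \<bullet> b) * partial_deriv b k z)) (at z)" for z
    using d by (simp add: second_order_kernel_def 1)
  have 2: "partial_deriv c (partial_deriv b k) z = k'' b c z" if "b \<in> Basis" "c \<in> Basis" "z \<noteq> 0" for b c z
  proof (rule frechet_derivative_eq_sum[OF _ that(2)])
    have "(k' b has_derivative (\<lambda>h. \<Sum>c\<in>Basis. (h \<bullet> c) * k'' b c z)) (at z)"
      using d that unfolding second_order_kernel_def by blast
    then show "(partial_deriv b k has_derivative (\<lambda>h. \<Sum>c\<in>Basis. (h \<bullet> c) * k'' b c z)) (at z)"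
      by (rule has_derivative_transform_within_open[of _ _ _ _ "- {0}"]) (use 1 that in auto)
  qed
  show "b \<in> Basis \<Longrightarrow> c \<in> Basis \<Longrightarrow> z \<noteq> 0 \<Longrightarrow> partial_deriv b (partial_deriv c k) z = partial_deriv c (partial_deriv b k) z" for b c z
    using d by (simp add: 2 second_order_kernel_def)
qed

lemma hom_kernel_measurable:
  "hom_kernel j k \<Longrightarrow> k \<in> borel_measurable borel"
proof (induction rule: hom_kernel.induct)
  case (hom_kernel_cong j k l)
  have "l = (\<lambda>z. if z \<in> {0} then l 0 else k z)" using hom_kernel_cong by auto
  moreover have "(\<lambda>z. if z \<in> {0} then l 0 else k z) \<in> borel_measurable borel"
    using hom_kernel_cong by (intro measurable_If_set) auto
  ultimately show ?case by simp
qed auto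

lemma sum_Basis_bound:
  fixes h :: "'z::euclidean_space"
  assumes "\<And>b. b \<in> Basis \<Longrightarrow> \<bar>a b\<bar> \<le> B"
  shows "\<bar>\<Sum>b\<in>Basis. (h \<bullet> b) * a b\<bar> \<le> (real DIM('z) * B) * norm h"
proof -
  have "\<bar>\<Sum>b\<in>Basis. (h \<bullet> b) * a b\<bar> \<le> (\<Sum>b\<in>Basis. \<bar>(h \<bullet> b) * a b\<bar>)" by (rule sum_abs)
  also have "\<dots> \<le> (\<Sum>b\<in>(Basis::'z set). norm h * B)"
    by (intro sum_mono) (auto simp: abs_mult assms intro!: mult_mono Basis_le_norm)
  finally have "\<bar>\<Sum>b\<in>Basis. (h \<bullet> b) * a b\<bar> \<le> (\<Sum>b\<in>(Basis::'z set). norm h * B)" .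
  then show ?thesis by (simp add: mult_ac)
qed

text \<open>Every point of the ball of radius \<open>norm h\<close> about \<open>w\<close> has norm
  at least \<open>norm w / 2\<close>, so the second derivatives there are bounded by a multiple of
  \<open>1 / norm w ^ (j + 2)\<close>. Two applications of the mean value inequality give the
  quadratic error. The uniform constant is what allows integration of this bound later.\<close>

lemma hom_kernel_taylor:
  fixes k :: "'z::euclidean_space \<Rightarrow> real"
  assumes k: "hom_kernel j k"
  shows "\<exists>C\<ge>0. \<forall>w h. w \<noteq> 0 \<longrightarrow> norm h \<le> norm w / 2 \<longrightarrow>
     \<bar>k (w + h) - k w - (\<Sum>b\<in>Basis. (h \<bullet> b) * partial_deriv b k w)\<bar> \<le> C * norm h ^ 2 / norm w ^ (j + 2)"
proof -
  define k' where "k' = (\<lambda>b. partial_deriv b k)"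
  \<comment> \<open>The default outside the basis is again a kernel of degree \<open>j + 2\<close>,
    so that the bounds can be chosen for all indices at once.\<close>
  define k'' where "k'' = (\<lambda>b c. if b \<in> Basis \<and> c \<in> Basis then partial_deriv c (partial_deriv b k) else (\<lambda>z. 1 / norm z ^ (j + 2)))"
  have hk: "hom_kernel (j + 2) (k'' b c)" for b c
    using hom_kernel_partial_deriv[OF hom_kernel_partial_deriv[OF k]] hom_kernel_norm[of "j + 2"] by (auto simp: k''_def)
  have d1: "(k has_derivative (\<lambda>h. \<Sum>b\<in>Basis. (h \<bullet> b) * k' b z)) (at z)" if "z \<noteq> 0" for z
    using hom_kernel_has_derivative[OF k that] by (simp add: k'_def)
  have d2: "(k' b has_derivative (\<lambda>h. \<Sum>c\<in>Basis. (h \<bullet> c) * k'' b c z)) (at z)" if "z \<noteq> 0" "b \<in> Basis" for b z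
    using hom_kernel_has_derivative[OF hom_kernel_partial_deriv[OF k that(2)] that(1)] that(2)
    by (auto simp: k'_def k''_def cong: sum.cong)
  have "\<forall>b c. \<exists>C\<ge>0. \<forall>z. z \<noteq> 0 \<longrightarrow> \<bar>k'' b c z\<bar> \<le> C / norm z ^ (j + 2)"
    using hom_kernel_bound[OF hk] by blast
  then obtain c0 where c0: "\<And>b c. c0 b c \<ge> 0" "\<And>b c z. z \<noteq> 0 \<Longrightarrow> \<bar>k'' b c z\<bar> \<le> c0 b c / norm z ^ (j + 2)"
    by metis
  define C where "C = (\<Sum>b\<in>(Basis::'z set). \<Sum>c\<in>(Basis::'z set). c0 b c)"
  have C0: "C \<ge> 0" unfolding C_def using c0 by (intro sum_nonneg) auto
  have C: "\<bar>k'' b c z\<bar> \<le> C / norm z ^ (j + 2)" if "z \<noteq> 0" "b \<in> Basis" "c \<in> Basis" for b c z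
  proof -
    have "c0 b c \<le> (\<Sum>c\<in>(Basis::'z set). c0 b c)" using c0 that by (intro member_le_sum) auto
    also have "\<dots> \<le> C" unfolding C_def using c0 that
      by (intro member_le_sum[where f="\<lambda>b. \<Sum>c\<in>(Basis::'z set). c0 b c"] sum_nonneg) auto
    finally show ?thesis using c0(2)[OF that(1), of b c] that(1)
      by (meson divide_right_mono norm_ge_zero order_trans zero_le_power)
  qed
  define D where "D = real DIM('z)"
  have D0: "D \<ge> 0" by (simp add: D_def)
  have k'_fold: "partial_deriv b k = k' b" for b by (simp add: k'_def)
  show ?thesis
    unfolding k'_fold
  proof (intro exI[of _ "D * (D * (C * 2 ^ (j + 2)))"] conjI allI impI)
    show "0 \<le> D * (D * (C * 2 ^ (j + 2)))" using C0 D0 by simp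
    fix w h :: 'z assume w: "w \<noteq> 0" and h: "norm h \<le> norm w / 2"
    define S where "S = cball w (norm h)"
    have S: "norm v \<ge> norm w / 2 \<and> v \<noteq> 0" if "v \<in> S" for v
    proof -
      have "norm (w - v) \<le> norm h" using that by (auto simp: S_def dist_norm)
      then have "norm v \<ge> norm w / 2" using h norm_triangle_sub[of w v] by auto
      then show ?thesis using w by auto
    qed
    define B where "B = C * 2 ^ (j + 2) / norm w ^ (j + 2)"
    have B0: "B \<ge> 0" using C0 by (simp add: B_def)
    have kB: "\<bar>k'' b c v\<bar> \<le> B" if "v \<in> S" "b \<in> Basis" "c \<in> Basis" for b c v
    proof -
      have "\<bar>k'' b c v\<bar> \<le> C / norm v ^ (j + 2)" using C S that by blast
      also have "\<dots> \<le> C / (norm w / 2) ^ (j + 2)"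
        using S[OF that(1)] C0 w by (intro divide_left_mono power_mono mult_pos_pos) auto
      also have "\<dots> = B" by (simp add: B_def power_divide)
      finally show ?thesis .
    qed
    have wS: "w \<in> S" by (simp add: S_def)
    have k'B: "\<bar>k' b v - k' b w\<bar> \<le> D * B * norm h" if "v \<in> S" "b \<in> Basis" for b v
    proof -
      have "norm (k' b v - k' b w) \<le> (D * B) * norm (v - w)"
      proof (rule differentiable_bound)
        show "convex S" by (simp add: S_def)
        show "(k' b has_derivative (\<lambda>h. \<Sum>c\<in>Basis. (h \<bullet> c) * k'' b c x)) (at x within S)" if "x \<in> S" for x
          using d2 S[OF that] \<open>b \<in> Basis\<close> by (blast intro: has_derivative_at_withinI)
        show "onorm (\<lambda>h. \<Sum>c\<in>Basis. (h \<bullet> c) * k'' b c x) \<le> D * B" if "x \<in> S" for x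
          unfolding D_def using kB[OF that \<open>b \<in> Basis\<close>] B0
          by (intro onorm_bound) (auto intro!: sum_Basis_bound simp del: sum_mult_indicator)
      qed (use that wS in auto)
      also have "\<dots> \<le> (D * B) * norm h"
        using that D0 B0 by (intro mult_left_mono) (auto simp: S_def dist_norm norm_minus_commute)
      finally show ?thesis by simp
    qed
    have "norm (k (w + h) - k w - (\<Sum>b\<in>Basis. (((w + h) - w) \<bullet> b) * k' b w)) \<le> norm ((w + h) - w) * (D * (D * B * norm h))"
    proof (rule differentiable_bound_linearization[where S=S and f'="\<lambda>x h. \<Sum>b\<in>Basis. (h \<bullet> b) * k' b x"])
      show "w + t *\<^sub>R (w + h - w) \<in> S" if "t \<in> {0..1}" for t
        using that by (auto simp: S_def dist_norm intro!: mult_left_le_one_le)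
      show "(k has_derivative (\<lambda>h. \<Sum>b\<in>Basis. (h \<bullet> b) * k' b x)) (at x within S)" if "x \<in> S" for x
        using d1 S[OF that] by (blast intro: has_derivative_at_withinI)
      show "onorm ((\<lambda>h. \<Sum>b\<in>Basis. (h \<bullet> b) * k' b x) - (\<lambda>h. \<Sum>b\<in>Basis. (h \<bullet> b) * k' b w)) \<le> D * (D * B * norm h)"
        if "x \<in> S" for x
      proof (rule onorm_bound)
        fix g :: 'z
        have "((\<lambda>h. \<Sum>b\<in>Basis. (h \<bullet> b) * k' b x) - (\<lambda>h. \<Sum>b\<in>Basis. (h \<bullet> b) * k' b w)) g
          = (\<Sum>b\<in>Basis. (g \<bullet> b) * (k' b x - k' b w))"
          by (simp add: sum_subtractf right_diff_distrib)
        then show "norm (((\<lambda>h. \<Sum>b\<in>Basis. (h \<bullet> b) * k' b x) - (\<lambda>h. \<Sum>b\<in>Basis. (h \<bullet> b) * k' b w)) g) \<le> D * (D * B * norm h) * norm g"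
          using sum_Basis_bound[of "\<lambda>b. k' b x - k' b w" "D * B * norm h" g] k'B[OF that]
          by (simp add: D_def)
      qed (use D0 B0 in auto)
    qed (use wS in auto)
    also have "\<dots> = D * (D * (C * 2 ^ (j + 2))) * (norm h)\<^sup>2 / norm w ^ (j + 2)"
      by (simp add: B_def power2_eq_square)
    finally show "\<bar>k (w + h) - k w - (\<Sum>b\<in>Basis. h \<bullet> b * k' b w)\<bar>
       \<le> D * (D * (C * 2 ^ (j + 2))) * (norm h)\<^sup>2 / norm w ^ (j + 2)" by simp
  qed
qed

section \<open>Convolution with boundary data\<close>

text \<open>Kernels live on the whole of \<open>'a \<times> real\<close>; a boundary point \<open>y\<close> is identified with \<open>(y, 0)\<close>.\<close>

definition half_conv :: "('a::euclidean_space \<times> real \<Rightarrow> real) \<Rightarrow> ('a \<Rightarrow> real) \<Rightarrow> 'a \<times> real \<Rightarrow> real" where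
  "half_conv k f z = (LINT y|lborel. k (z - (y, 0)) * f y)"

text \<open>Absolute convergence of the Poisson integral at every point of the half-space, because
  \<open>pkern\<close> is this weight times the height. It is a common home for \<open>L^p\<close>
  functions and for bounded functions, and it covers all kernels of faster decay.\<close>

definition poisson_admissible :: "('a::euclidean_space \<Rightarrow> real) \<Rightarrow> bool" where
  "poisson_admissible f \<longleftrightarrow> f \<in> borel_measurable borel \<and>
     (\<forall>z::'a \<times> real. snd z > 0 \<longrightarrow> integrable lborel (\<lambda>y. \<bar>f y\<bar> / norm (z - (y, 0)) ^ (DIM('a) + 1)))"

lemma poisson_admissible_measurable:
  "poisson_admissible f \<Longrightarrow> f \<in> borel_measurable borel"
  by (simp add: poisson_admissible_def)

lemma poisson_admissible_integrable:
  fixes f :: "'a::euclidean_space \<Rightarrow> real"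
  fixes z :: "'a \<times> real"
  assumes "poisson_admissible f" "snd z > 0"
  shows "integrable lborel (\<lambda>y. \<bar>f y\<bar> / norm (z - (y, 0)) ^ (DIM('a) + 1))"
  using assms unfolding poisson_admissible_def by blast

lemma norm_half_ge:
  fixes z :: "'a::euclidean_space \<times> real"
  shows "snd z \<le> norm (z - (y, 0))"
proof -
  have "\<bar>snd (z - (y, 0))\<bar> \<le> norm (z - (y, 0))"
    using norm_snd_le[of "snd (z - (y, 0))" "fst (z - (y, 0))"] by (simp del: snd_diff fst_diff)
  then show ?thesis by auto
qed

text \<open>The distance to a boundary point is at least the height, so surplus powers of the
  distance can be traded for powers of the height. What remains is the admissible weight.\<close>

lemma half_power_bound:
  fixes z :: "'a::euclidean_space \<times> real"
  assumes "snd z > 0" "i \<ge> DIM('a) + 1" "C \<ge> 0"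
  shows "C / norm (z - (y, 0)) ^ i \<le> C / snd z ^ (i - (DIM('a) + 1)) / norm (z - (y, 0)) ^ (DIM('a) + 1)"
proof -
  let ?r = "norm (z - (y, 0))"
  have r: "snd z \<le> ?r" by (rule norm_half_ge)
  have "snd z ^ (i - (DIM('a) + 1)) * ?r ^ (DIM('a) + 1) \<le> ?r ^ (i - (DIM('a) + 1)) * ?r ^ (DIM('a) + 1)"
    using r assms by (intro mult_right_mono power_mono) auto
  also have "\<dots> = ?r ^ i" using assms by (metis power_add le_add_diff_inverse2)
  finally have "C / ?r ^ i \<le> C / (snd z ^ (i - (DIM('a) + 1)) * ?r ^ (DIM('a) + 1))"
    using assms r by (intro divide_left_mono mult_pos_pos zero_less_power) auto
  then show ?thesis by (simp add: mult_ac)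
qed

lemma hom_kernel_half_integrable:
  fixes k :: "'a::euclidean_space \<times> real \<Rightarrow> real"
  assumes k: "hom_kernel j k" and j: "j \<ge> DIM('a) + 1" and f: "poisson_admissible f" and z: "snd z > 0"
  shows "integrable lborel (\<lambda>y. k (z - (y, 0)) * f y)"
proof -
  obtain C where C: "C \<ge> 0" "\<And>z. z \<noteq> 0 \<Longrightarrow> \<bar>k z\<bar> \<le> C / norm z ^ j"
    using hom_kernel_bound[OF k] by blast
  have [measurable]: "f \<in> borel_measurable borel" "k \<in> borel_measurable borel"
    using f hom_kernel_measurable[OF k] by (auto simp: poisson_admissible_def)
  have "integrable lborel (\<lambda>y. C / snd z ^ (j - (DIM('a) + 1)) * (\<bar>f y\<bar> / norm (z - (y, 0)) ^ (DIM('a) + 1)))"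
    by (intro integrable_mult_right poisson_admissible_integrable f z)
  then show ?thesis
  proof (rule Bochner_Integration.integrable_bound)
    show "AE y in lborel. norm (k (z - (y, 0)) * f y) \<le> norm (C / snd z ^ (j - (DIM('a) + 1)) * (\<bar>f y\<bar> / norm (z - (y, 0)) ^ (DIM('a) + 1)))"
    proof (intro AE_I2)
      fix y
      have nz: "z - (y, 0) \<noteq> 0" using norm_half_ge[of z y] z by auto
      have "\<bar>k (z - (y, 0))\<bar> \<le> C / snd z ^ (j - (DIM('a) + 1)) / norm (z - (y, 0)) ^ (DIM('a) + 1)"
        using C(2)[OF nz] half_power_bound[OF z j C(1), of y] by linarith
      then have "\<bar>k (z - (y, 0))\<bar> * \<bar>f y\<bar> \<le> C / snd z ^ (j - (DIM('a) + 1)) / norm (z - (y, 0)) ^ (DIM('a) + 1) * \<bar>f y\<bar>"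
        by (intro mult_right_mono) auto
      then have "norm (k (z - (y, 0)) * f y) \<le> C / snd z ^ (j - (DIM('a) + 1)) * (\<bar>f y\<bar> / norm (z - (y, 0)) ^ (DIM('a) + 1))"
        by (simp add: abs_mult)
      also have "\<dots> \<le> norm \<dots>" unfolding real_norm_def by (rule abs_ge_self)
      finally show "norm (k (z - (y, 0)) * f y) \<le> norm (C / snd z ^ (j - (DIM('a) + 1)) * (\<bar>f y\<bar> / norm (z - (y, 0)) ^ (DIM('a) + 1)))" .
    qed
  qed simp
qed

text \<open>The Taylor bound of \<open>hom_kernel_taylor\<close> is integrated against
  \<open>f\<close>; the remainder is quadratic in \<open>h\<close>, with the admissible integral of
  \<open>f\<close> as constant. Integrability of the kernel itself is a hypothesis because
  \<open>pkern\<close> has degree \<open>DIM('a)\<close>, one less than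
  \<open>hom_kernel_half_integrable\<close> accepts.\<close>

lemma half_conv_has_derivative:
  fixes k :: "'a::euclidean_space \<times> real \<Rightarrow> real"
  assumes k: "hom_kernel j k"
    and j: "j \<ge> DIM('a)" and f: "poisson_admissible f"
    and int: "\<And>z. snd z > 0 \<Longrightarrow> integrable lborel (\<lambda>y. k (z - (y, 0)) * f y)" and z: "snd z > 0"
  shows "(half_conv k f has_derivative (\<lambda>h. \<Sum>b\<in>Basis. (h \<bullet> b) * half_conv (partial_deriv b k) f z)) (at z)"
proof -
  define k' where "k' = (\<lambda>b. if b \<in> Basis then partial_deriv b k else (\<lambda>z. 1 / norm z ^ (j + 1)))"
  have hk': "hom_kernel (j + 1) (k' b)" for b
    using hom_kernel_partial_deriv[OF k] hom_kernel_norm[of "j + 1"] by (auto simp: k'_def)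
  have k'_eq: "(\<Sum>b\<in>Basis. g b * half_conv (partial_deriv b k) f z) = (\<Sum>b\<in>Basis. g b * half_conv (k' b) f z)" for g z
    by (simp add: k'_def)
  obtain C where C: "C \<ge> 0" "\<And>w h. w \<noteq> 0 \<Longrightarrow> norm h \<le> norm w / 2 \<Longrightarrow>
     \<bar>k (w + h) - k w - (\<Sum>b\<in>Basis. (h \<bullet> b) * k' b w)\<bar> \<le> C * norm h ^ 2 / norm w ^ (j + 2)"
    using hom_kernel_taylor[OF k] by (auto simp: k'_def)
  define M where "M = C / snd z ^ (j + 2 - (DIM('a) + 1))"
  define g where "g = (\<lambda>y. \<bar>f y\<bar> / norm (z - (y, 0)) ^ (DIM('a) + 1))"
  have g: "integrable lborel g" unfolding g_def by (intro poisson_admissible_integrable f z)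
  have g0: "g y \<ge> 0" for y by (simp add: g_def)
  have M0: "M \<ge> 0" using C z by (simp add: M_def)
  have fm [measurable]: "f \<in> borel_measurable borel" using f by (auto simp: poisson_admissible_def)
  note int' = hom_kernel_half_integrable[OF hk' _ f z]
  define R where "R = (\<lambda>h y. k (z + h - (y, 0)) * f y - k (z - (y, 0)) * f y - (\<Sum>b\<in>Basis. (h \<bullet> b) * (k' b (z - (y, 0)) * f y)))"
  have key: "\<bar>half_conv k f (z + h) - half_conv k f z - (\<Sum>b\<in>Basis. (h \<bullet> b) * half_conv (k' b) f z)\<bar>
      \<le> M * integral\<^sup>L lborel g * norm h ^ 2" if h: "norm h \<le> snd z / 2" for h
  proof -
    have "\<bar>snd h\<bar> \<le> norm h" using norm_snd_le[of "snd h" "fst h"] by simp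
    then have zh: "snd (z + h) > 0" using h z by auto
    have Rint: "integrable lborel (R h)"
      unfolding R_def using int[OF zh] int[OF z] j
      by (intro Bochner_Integration.integrable_diff Bochner_Integration.integrable_sum integrable_mult_right int') auto
    have "half_conv k f (z + h) - half_conv k f z - (\<Sum>b\<in>Basis. (h \<bullet> b) * half_conv (k' b) f z) = (LINT y|lborel. R h y)"
      unfolding R_def half_conv_def
      using int[OF zh] int[OF z] j
      by (subst Bochner_Integration.integral_diff Bochner_Integration.integral_sum integral_mult_right; 
         (intro Bochner_Integration.integrable_diff Bochner_Integration.integrable_sum integrable_mult_right int')?; simp?)+
    also have "\<bar>\<dots>\<bar> \<le> (LINT y|lborel. M * norm h ^ 2 * g y)"
    proof -
      have "\<bar>LINT y|lborel. R h y\<bar> \<le> (LINT y|lborel. \<bar>R h y\<bar>)" using integral_norm_bound[of lborel "R h"] by simp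
      also have "\<dots> \<le> (LINT y|lborel. M * norm h ^ 2 * g y)"
      proof (intro integral_mono integrable_mult_right g integrable_abs Rint)
        fix y
        let ?w = "z - (y, 0)"
        have r: "snd z \<le> norm ?w" by (rule norm_half_ge)
        have "\<bar>R h y\<bar> = \<bar>k (?w + h) - k ?w - (\<Sum>b\<in>Basis. (h \<bullet> b) * k' b ?w)\<bar> * \<bar>f y\<bar>"
          unfolding R_def abs_mult[symmetric]
          by (simp add: right_diff_distrib sum_distrib_left mult_ac diff_add_eq)
        also have "\<dots> \<le> (C * norm h ^ 2 / norm ?w ^ (j + 2)) * \<bar>f y\<bar>"
          using r z h by (intro mult_right_mono C) auto
        also have "\<dots> \<le> (C * norm h ^ 2 / snd z ^ (j + 2 - (DIM('a) + 1)) / norm ?w ^ (DIM('a) + 1)) * \<bar>f y\<bar>"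
          using half_power_bound[OF z, of "j + 2" "C * norm h ^ 2" y] C j by (intro mult_right_mono) auto
        finally show "\<bar>R h y\<bar> \<le> M * norm h ^ 2 * g y" by (simp add: M_def g_def mult_ac)
      qed
      finally show ?thesis .
    qed
    also have "\<dots> = M * integral\<^sup>L lborel g * norm h ^ 2" using g by simp
    finally show ?thesis .
  qed
  show ?thesis
    unfolding has_derivative_at k'_eq
  proof (intro conjI)
    show "bounded_linear (\<lambda>h. \<Sum>b\<in>Basis. h \<bullet> b * half_conv (k' b) f z)"
      by (intro bounded_linear_sum bounded_linear_compose[OF bounded_linear_mult_left bounded_linear_inner_left])
    show "(\<lambda>h. norm (half_conv k f (z + h) - half_conv k f z - (\<Sum>b\<in>Basis. h \<bullet> b * half_conv (k' b) f z)) / norm h) \<midarrow>0\<rightarrow> 0"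
    proof (rule tendsto_sandwich[of "\<lambda>_. 0"])
      show "\<forall>\<^sub>F h in at 0. norm (half_conv k f (z + h) - half_conv k f z - (\<Sum>b\<in>Basis. h \<bullet> b * half_conv (k' b) f z)) / norm h
         \<le> M * integral\<^sup>L lborel g * norm h"
        unfolding eventually_at
      proof (intro exI[of _ "snd z / 2"] conjI ballI impI)
        fix h :: "'a \<times> real" assume "h \<noteq> 0 \<and> dist h 0 < snd z / 2"
        then have h: "h \<noteq> 0" "norm h \<le> snd z / 2" by (auto simp: dist_norm)
        have "norm (half_conv k f (z + h) - half_conv k f z - (\<Sum>b\<in>Basis. h \<bullet> b * half_conv (k' b) f z)) / norm h \<le>
            M * integral\<^sup>L lborel g * norm h ^ 2 / norm h"
          using key[OF h(2)] by (intro divide_right_mono) auto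
        also have "\<dots> = M * integral\<^sup>L lborel g * norm h" using h by (simp add: power2_eq_square)
        finally show "norm (half_conv k f (z + h) - half_conv k f z - (\<Sum>b\<in>Basis. h \<bullet> b * half_conv (k' b) f z)) / norm h
         \<le> M * integral\<^sup>L lborel g * norm h" .
      qed (use z in auto)
      show "(\<lambda>h. M * integral\<^sup>L lborel g * norm h) \<midarrow>0\<rightarrow> 0"
        by (auto intro!: tendsto_eq_intros)
    qed (auto intro!: always_eventually)
  qed
qed

lemma nn_integral_lborel_affine:
  fixes F :: "'a::euclidean_space \<Rightarrow> ennreal"
  assumes [measurable]: "F \<in> borel_measurable borel" and c: "c \<noteq> 0"
  shows "(\<integral>\<^sup>+y. F y \<partial>lborel) = ennreal (\<bar>c\<bar> ^ DIM('a)) * (\<integral>\<^sup>+y. F (x + c *\<^sub>R y) \<partial>lborel)"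
  by (subst lborel_affine[OF c, of x]) (simp add: nn_integral_density nn_integral_distr nn_integral_cmult)

section \<open>The Poisson kernel\<close>

text \<open>The normalising constant of the kernel is dropped: its mass only has to be positive and finite, so its
  value in terms of the Gamma function is never needed.\<close>

definition pkern :: "'a::euclidean_space \<times> real \<Rightarrow> real" where
  "pkern z = snd z / norm z ^ (DIM('a) + 1)"

lemma pkern_measurable [measurable]: "pkern \<in> borel_measurable borel"
  unfolding pkern_def [abs_def]
  by (intro borel_measurable_divide borel_measurable_power borel_measurable_norm borel_measurable_continuous_onI continuous_intros)

lemma pkern_nonneg: "snd z \<ge> 0 \<Longrightarrow> pkern z \<ge> 0"
  by (simp add: pkern_def)

lemma pkern_pos: "snd z > 0 \<Longrightarrow> pkern z > 0"
  using norm_snd_le[of "snd z" "fst z"] by (auto simp: pkern_def intro!: divide_pos_pos mult_pos_pos zero_less_power)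

lemma pkern_le:
  fixes z :: "'a::euclidean_space \<times> real"
  assumes "snd z \<ge> 0"
  shows "pkern z \<le> 1 / norm z ^ DIM('a)"
proof (cases "z = 0")
  case False
  have "snd z \<le> norm z" using norm_snd_le[of "snd z" "fst z"] by simp
  then have "snd z / norm z ^ (DIM('a) + 1) \<le> norm z / norm z ^ (DIM('a) + 1)"
    by (intro divide_right_mono) auto
  then show ?thesis using False by (simp add: pkern_def)
qed (auto simp: pkern_def)

lemma pkern_le_height:
  fixes z :: "'a::euclidean_space \<times> real"
  assumes "snd z > 0"
  shows "pkern z \<le> 1 / snd z ^ DIM('a)"
proof -
  have "snd z \<le> norm z" using norm_snd_le[of "snd z" "fst z"] by simp
  then have "1 / norm z ^ DIM('a) \<le> 1 / snd z ^ DIM('a)"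
    using assms by (intro divide_left_mono power_mono mult_pos_pos zero_less_power) auto
  then show ?thesis using pkern_le[of z] assms by auto
qed

lemma pkern_scale:
  fixes y :: "'a::euclidean_space"
  assumes t: "t > 0"
  shows "pkern (t *\<^sub>R y, t) = pkern (y, 1) / t ^ DIM('a)"
proof -
  have "norm (t *\<^sub>R y, t) = norm (t *\<^sub>R (y, 1::real))" by simp
  also have "\<dots> = t * norm (y, 1::real)" using t by (simp only: norm_scaleR abs_of_pos)
  finally show ?thesis using t by (simp add: pkern_def power_mult_distrib)
qed

lemma pkern_minus: "pkern (- y, t) = pkern (y, t)"
  by (simp add: pkern_def norm_Pair)

lemma pkern_diff_commute: "pkern (x - y, t) = pkern (y - x, t)"
  using pkern_minus[of "y - x" t] by simp

text \<open>The kernel is dominated by a sum over the balls of radius \<open>2 ^ k\<close>: weights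
  of order \<open>2 ^ (- k (n + 1))\<close> against volumes of order \<open>2 ^ (k n)\<close> leave
  a geometric series.\<close>

lemma nn_integral_pkern_unit_finite: "(\<integral>\<^sup>+y. ennreal (pkern (y::'a::euclidean_space, 1)) \<partial>lborel) < \<infinity>"
proof -
  let ?n = "DIM('a)"
  define V where "V = unit_ball_vol (real ?n)"
  have V0: "V \<ge> 0" by (simp add: V_def)
  \<comment> \<open>On the shell outside the ball of radius \<open>2 ^ (k - 1)\<close> the kernel is
    bounded by its size at the inner radius, whence the extra \<open>2 ^ (n + 1)\<close>; it also
    makes \<open>c 0 \<ge> 1\<close>, which covers the unit ball.\<close>
  define c where "c = (\<lambda>k::nat. 2 ^ (?n + 1) / 2 ^ (k * (?n + 1)) :: real)"
  have c0: "c k \<ge> 0" for k by (simp add: c_def)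
  have "ennreal (pkern (y::'a, 1)) \<le> (\<Sum>k. ennreal (c k) * indicator (ball 0 (2 ^ k)) y)" for y :: 'a
  proof -
    obtain m where m: "norm y < 2 ^ m" using real_arch_pow[of 2 "norm y"] by auto
    define k where "k = (LEAST k. norm y < 2 ^ k)"
    have k: "norm y < 2 ^ k" unfolding k_def using m by (rule LeastI)
    have "pkern (y, 1) \<le> c k"
    proof (cases k)
      case 0
      have "pkern (y, 1) \<le> 1" using pkern_le_height[of "(y, 1)"] by simp
      also have "1 \<le> c k" using one_le_power[of "2::real" "?n + 1"] by (simp only: 0 c_def) simp
      finally show ?thesis .
    next
      case (Suc i)
      have i: "2 ^ i \<le> norm y" using not_less_Least[of i "\<lambda>k. norm y < 2 ^ k"] Suc by (simp add: k_def)
      have "norm y \<le> norm (y, 1::real)" by (rule norm_fst_le)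
      then have "1 / norm (y, 1::real) ^ (?n + 1) \<le> 1 / (2 ^ i) ^ (?n + 1)"
        using i by (intro divide_left_mono power_mono mult_pos_pos zero_less_power) (auto simp: zero_prod_def)
      also have "\<dots> = c k" by (simp add: c_def Suc power_add power_mult[symmetric])
      finally show ?thesis by (simp add: pkern_def)
    qed
    then have "ennreal (pkern (y, 1)) \<le> ennreal (c k) * indicator (ball 0 (2 ^ k)) y"
      using k by (auto simp: ennreal_leI)
    also have "\<dots> \<le> (\<Sum>k. ennreal (c k) * indicator (ball 0 (2 ^ k)) y)"
    proof -
      define F where "F = (\<lambda>k. ennreal (c k) * indicator (ball 0 (2 ^ k)) y)"
      have "sum F {k} \<le> suminf F" by (rule sum_le_suminf) auto
      then show ?thesis by (simp add: F_def[symmetric] fun_cong[OF F_def, symmetric])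
    qed
    finally show ?thesis .
  qed
  then have "(\<integral>\<^sup>+y. ennreal (pkern (y::'a, 1)) \<partial>lborel) \<le> (\<integral>\<^sup>+y. (\<Sum>k. ennreal (c k) * indicator (ball 0 (2 ^ k)) y) \<partial>(lborel::'a measure))"
    by (intro nn_integral_mono) auto
  also have "\<dots> = (\<Sum>k. ennreal (c k) * emeasure lborel (ball (0::'a) (2 ^ k)))"
    by (subst nn_integral_suminf) (auto simp: nn_integral_cmult_indicator intro!: borel_measurable_times_ennreal borel_measurable_indicator)
  also have "\<dots> = (\<Sum>k. ennreal (2 ^ (?n + 1) * V * (1/2) ^ k))"
    using V0 by (intro suminf_cong)
      (simp add: c_def emeasure_ball V_def ennreal_mult[symmetric] power_mult[symmetric] field_simps power_add power_mult_distrib)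
  also have "\<dots> < \<infinity>"
    using V0 by (subst suminf_ennreal2) (auto intro!: summable_mult)
  finally show ?thesis .
qed

definition poisson_mass :: "'a::euclidean_space itself \<Rightarrow> real" where
  "poisson_mass _ = enn2real (\<integral>\<^sup>+y. ennreal (pkern (y::'a, 1)) \<partial>lborel)"

lemma nn_integral_pkern:
  fixes x :: "'a::euclidean_space"
  assumes t: "t > 0"
  shows "(\<integral>\<^sup>+y. ennreal (pkern (x - y, t)) \<partial>lborel) = ennreal (poisson_mass TYPE('a))"
proof -
  have "(\<integral>\<^sup>+y. ennreal (pkern (x - y, t)) \<partial>lborel) =
     ennreal (t ^ DIM('a)) * (\<integral>\<^sup>+y. ennreal (pkern (x - (x + (-t) *\<^sub>R y), t)) \<partial>lborel)"
    using t by (subst nn_integral_lborel_affine[of _ "-t" x]) auto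
  also have "\<dots> = (\<integral>\<^sup>+y. ennreal (t ^ DIM('a)) * ennreal (pkern (t *\<^sub>R (y::'a), t)) \<partial>lborel)"
    by (subst nn_integral_cmult[symmetric]) auto
  also have "\<dots> = (\<integral>\<^sup>+y. ennreal (pkern (y::'a, 1)) \<partial>lborel)"
    using t by (intro nn_integral_cong) (simp add: pkern_scale pkern_nonneg flip: ennreal_mult)
  also have "\<dots> = ennreal (poisson_mass TYPE('a))"
    unfolding poisson_mass_def using nn_integral_pkern_unit_finite[where 'a='a] by (simp add: less_top)
  finally show ?thesis .
qed

lemma poisson_mass_pos: "poisson_mass TYPE('a::euclidean_space) > 0"
proof (rule ccontr)
  assume "\<not> ?thesis"
  then have "(\<integral>\<^sup>+y. ennreal (pkern (0 - y::'a, 1)) \<partial>lborel) = 0"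
    by (subst nn_integral_pkern) (auto simp: ennreal_neg)
  then have "AE y in lborel. ennreal (pkern (0 - y::'a, 1)) = 0"
    by (subst (asm) nn_integral_0_iff_AE) auto
  moreover have "ennreal (pkern (0 - y::'a, 1)) \<noteq> 0" for y
    using pkern_pos[of "(0 - y::'a, 1)"] by simp
  ultimately have "AE y in (lborel::'a measure). False" by auto
  then have "emeasure lborel (UNIV::'a set) = 0" by (simp add: AE_iff_measurable[OF _ refl])
  then show False by simp
qed

text \<open>The kernel of mass one. Averages are taken with \<open>pker1\<close>, derivatives always
  of \<open>pkern\<close>, so the mass reappears whenever the two are compared.\<close>

definition pker1 :: "'a::euclidean_space \<times> real \<Rightarrow> real" where
  "pker1 z = pkern z / poisson_mass TYPE('a)"

lemma pker1_measurable [measurable]: "pker1 \<in> borel_measurable borel"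
  unfolding pker1_def [abs_def] by measurable

lemma pker1_nonneg:
  fixes z :: "'a::euclidean_space \<times> real"
  shows "snd z \<ge> 0 \<Longrightarrow> pker1 z \<ge> 0"
  using pkern_nonneg[of z] poisson_mass_pos[where 'a='a] by (simp add: pker1_def)

lemma nn_integral_pker1:
  fixes x :: "'a::euclidean_space"
  assumes t: "t > 0"
  shows "(\<integral>\<^sup>+y. ennreal (pker1 (x - y, t)) \<partial>lborel) = 1"
proof -
  have "(\<integral>\<^sup>+y. ennreal (pker1 (x - y, t)) \<partial>lborel) = ennreal (1 / poisson_mass TYPE('a)) * (\<integral>\<^sup>+y. ennreal (pkern (x - y, t)) \<partial>lborel)"
    using t poisson_mass_pos[where 'a='a] 
    by (subst nn_integral_cmult[symmetric]) (auto simp: pker1_def pkern_nonneg simp flip: ennreal_mult)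
  also have "\<dots> = 1" using t poisson_mass_pos[where 'a='a] by (simp add: nn_integral_pkern flip: ennreal_mult)
  finally show ?thesis .
qed

lemma pker1_diff_commute: "pker1 (x - y, t) = pker1 (y - x, t)"
  unfolding pker1_def by (subst pkern_diff_commute) (rule refl)

lemma nn_integral_pker1':
  fixes x :: "'a::euclidean_space"
  shows "t > 0 \<Longrightarrow> (\<integral>\<^sup>+y. ennreal (pker1 (y - x, t)) \<partial>lborel) = 1"
  using nn_integral_pker1[of t x] by (subst pker1_diff_commute)

section \<open>Jensen's inequality for integer powers and the second derivative test\<close>

lemma power_tangent:
  fixes g m :: real
  assumes "g \<ge> 0" "m \<ge> 0" "n \<ge> 1"
  shows "real n * m ^ (n - 1) * g \<le> g ^ n + (real n - 1) * m ^ n"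
proof (cases "m = 0")
  case True
  then show ?thesis using assms by (cases "n = 1") (auto simp: power_0_left)
next
  case False
  then have m: "m > 0" using assms by simp
  \<comment> \<open>Bernoulli's inequality at \<open>g / m - 1\<close> is the tangent line bound for
    \<open>x ^ n\<close> at \<open>m\<close>, after scaling by \<open>m ^ n\<close>.\<close>
  have "1 + real n * (g / m - 1) \<le> (1 + (g / m - 1)) ^ n"
    using assms m by (intro Bernoulli_inequality) (simp add: field_simps)
  then have "(1 + real n * (g / m - 1)) * m ^ n \<le> (g / m) ^ n * m ^ n"
    using m by (intro mult_right_mono) auto
  also have "\<dots> = g ^ n" using m by (simp add: power_divide)
  finally have "m ^ n + real n * (g / m) * m ^ n - real n * m ^ n \<le> g ^ n" by (simp add: algebra_simps)
  moreover have "m ^ n = m ^ (n - 1) * m" using assms by (cases n) auto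
  then have "real n * (g / m) * m ^ n = real n * m ^ (n - 1) * g" using m by simp
  ultimately show ?thesis by (simp add: algebra_simps)
qed

text \<open>The tangent line inequality of \<open>power_tangent\<close> at the mean \<open>m\<close>
  is integrated against the probability density \<open>q\<close>. The right-hand side may be
  infinite; when it is finite, \<open>g \<le> 1 + g ^ n\<close> shows that the mean is finite
  too.\<close>

lemma nn_integral_power_Jensen:
  fixes q g :: "'a \<Rightarrow> real"
  assumes [measurable]: "q \<in> borel_measurable M" "g \<in> borel_measurable M"
    and q: "\<And>y. q y \<ge> 0" and g: "\<And>y. g y \<ge> 0" and one: "(\<integral>\<^sup>+y. ennreal (q y) \<partial>M) = 1" and n: "n \<ge> 1"
  shows "(\<integral>\<^sup>+y. ennreal (q y * g y) \<partial>M) ^ n \<le> (\<integral>\<^sup>+y. ennreal (q y * g y ^ n) \<partial>M)"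
proof (cases "(\<integral>\<^sup>+y. ennreal (q y * g y ^ n) \<partial>M) = \<infinity>")
  case False
  let ?I = "\<integral>\<^sup>+y. ennreal (q y * g y) \<partial>M" and ?J = "\<integral>\<^sup>+y. ennreal (q y * g y ^ n) \<partial>M"
  have "?I \<le> (\<integral>\<^sup>+y. ennreal (q y) + ennreal (q y * g y ^ n) \<partial>M)"
  proof (intro nn_integral_mono)
    fix y
    have "g y \<le> 1 + g y ^ n"
    proof (cases "g y \<le> 1")
      case True then show ?thesis using g[of y] by (simp add: add_increasing2)
    next
      case False then show ?thesis using self_le_power[of "g y" n] n by auto
    qed
    then have "q y * g y \<le> q y * (1 + g y ^ n)" using q by (intro mult_left_mono) auto
    then show "ennreal (q y * g y) \<le> ennreal (q y) + ennreal (q y * g y ^ n)"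
      using q g by (simp add: distrib_left flip: ennreal_plus)
  qed
  also have "\<dots> = 1 + ?J" by (subst nn_integral_add) (auto simp: one)
  also have "\<dots> < \<infinity>" using False by (simp add: less_top)
  finally obtain m where m: "?I = ennreal m" "m \<ge> 0" by (cases ?I) auto
  have "ennreal (real n * m ^ (n - 1)) * ?I = (\<integral>\<^sup>+y. ennreal (real n * m ^ (n - 1)) * ennreal (q y * g y) \<partial>M)"
    by (subst nn_integral_cmult) auto
  also have "\<dots> \<le> (\<integral>\<^sup>+y. ennreal (q y * g y ^ n) + ennreal ((real n - 1) * m ^ n) * ennreal (q y) \<partial>M)"
  proof (intro nn_integral_mono)
    fix y
    have "q y * (real n * m ^ (n - 1) * g y) \<le> q y * (g y ^ n + (real n - 1) * m ^ n)"
      using power_tangent[OF g m(2) n] q by (intro mult_left_mono) auto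
    then show "ennreal (real n * m ^ (n - 1)) * ennreal (q y * g y) \<le> ennreal (q y * g y ^ n) + ennreal ((real n - 1) * m ^ n) * ennreal (q y)"
      using q[of y] g[of y] m n
      by (subst (1 2) ennreal_mult[symmetric], simp, simp, simp, simp, subst ennreal_plus[symmetric], simp, simp)
        (rule ennreal_leI, simp add: algebra_simps)
  qed
  also have "\<dots> = ?J + ennreal ((real n - 1) * m ^ n)"
    by (subst nn_integral_add) (auto simp: nn_integral_cmult one)
  finally have le: "ennreal (real n * m ^ n) \<le> ?J + ennreal ((real n - 1) * m ^ n)"
    using m n by (cases n) (auto simp: mult_ac simp flip: ennreal_mult)
  obtain J where J: "?J = ennreal J" "J \<ge> 0" using False by (cases ?J) auto
  have "real n * m ^ n \<le> J + (real n - 1) * m ^ n"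
    using le m n J by (simp flip: ennreal_plus)
  then have "m ^ n \<le> J" by (simp add: algebra_simps)
  then show ?thesis using m J by (simp add: ennreal_power)
qed simp

lemma abs_snd_le_norm: "\<bar>snd z\<bar> \<le> norm z" for z :: "'a::real_normed_vector \<times> real"
  by (metis norm_snd_le prod.collapse real_norm_def)

text \<open>The first derivative vanishes at the maximum. Were \<open>d\<close> positive, it would
  be positive just to the right of \<open>0\<close>, and the mean value theorem would lift
  \<open>f\<close> above \<open>f 0\<close>.\<close>

lemma second_derivative_local_max:
  fixes f :: "real \<Rightarrow> real"
  assumes r: "r > 0" and f: "\<And>s. \<bar>s\<bar> < r \<Longrightarrow> (f has_real_derivative f1 s) (at s)"
    and f1: "(f1 has_real_derivative d) (at 0)" and max: "\<And>s. \<bar>s\<bar> < r \<Longrightarrow> f s \<le> f 0"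
  shows "d \<le> 0"
proof (rule ccontr)
  assume "\<not> d \<le> 0"
  then have d: "d > 0" by simp
  have f10: "f1 0 = 0"
    by (rule DERIV_local_max[OF f[of 0], of r]) (use r max in auto)
  obtain e where e: "e > 0" "\<And>h. 0 < h \<Longrightarrow> h < e \<Longrightarrow> f1 0 < f1 (0 + h)"
    using DERIV_pos_inc_right[OF f1 d] by auto
  define s where "s = min e r / 2"
  have s: "0 < s" "s < e" "s < r" using e r by (auto simp: s_def)
  have "\<exists>z. 0 < z \<and> z < s \<and> f s - f 0 = (s - 0) * f1 z"
    by (rule MVT2) (use s f in auto)
  then obtain z where z: "0 < z" "z < s" "f s - f 0 = s * f1 z" by auto
  have "f1 z > 0" using e(2)[of z] z s f10 by auto
  then have "f s > f 0" using z s by (smt (verit) mult_pos_pos)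
  then show False using max[of s] s by auto
qed

section \<open>Harmonic functions on the half-space\<close>

text \<open>The Laplacian involves only pure second derivatives, and this weak form of \<open>C\<^sup>2\<close> is preserved by the
  compositions with real powers used below.\<close>

definition dir_C2 :: "('a::euclidean_space \<times> real \<Rightarrow> real) \<Rightarrow>
    ('a \<times> real \<Rightarrow> 'a \<times> real \<Rightarrow> real) \<Rightarrow> ('a \<times> real \<Rightarrow> 'a \<times> real \<Rightarrow> real) \<Rightarrow> bool" where
  "dir_C2 g G1 G2 \<longleftrightarrow> (\<forall>z b. snd z > 0 \<longrightarrow> b \<in> Basis \<longrightarrow>
     ((\<lambda>s. g (z + s *\<^sub>R b)) has_real_derivative G1 b z) (at 0) \<and>
     ((\<lambda>s. G1 b (z + s *\<^sub>R b)) has_real_derivative G2 b z) (at 0))"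

lemma dir_C2D:
  assumes "dir_C2 g G1 G2" "snd z > 0" "b \<in> Basis"
  shows "((\<lambda>s. g (z + s *\<^sub>R b)) has_real_derivative G1 b z) (at 0)"
    and "((\<lambda>s. G1 b (z + s *\<^sub>R b)) has_real_derivative G2 b z) (at 0)"
  using assms unfolding dir_C2_def by blast+

lemma dir_derivative_shift:
  fixes z :: "'z::real_normed_vector"
  assumes "((\<lambda>s. g (z + t *\<^sub>R b + s *\<^sub>R b)) has_real_derivative d) (at 0)"
  shows "((\<lambda>s. g (z + s *\<^sub>R b)) has_real_derivative d) (at t)"
proof -
  have "((\<lambda>s. g (z + t *\<^sub>R b + (s - t) *\<^sub>R b)) has_real_derivative d * 1) (at t)"
    by (rule DERIV_chain2[where g="\<lambda>s. s - t" and f="\<lambda>s. g (z + t *\<^sub>R b + s *\<^sub>R b)"])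
      (use assms in \<open>auto intro!: derivative_eq_intros\<close>)
  moreover have "z + t *\<^sub>R b + (s - t) *\<^sub>R b = z + s *\<^sub>R b" for s
    by (simp add: scaleR_left_diff_distrib)
  ultimately show ?thesis by simp
qed

text \<open>If \<open>g\<close> had a positive value \<open>m\<close>, adding a small multiple of
  the squared norm would keep the maximum over a large half ball in its interior. There every pure
  second derivative of the sum is nonpositive, so the Laplacian of \<open>g\<close> would be
  strictly negative.\<close>

lemma half_space_max_principle:
  fixes g :: "'a::euclidean_space \<times> real \<Rightarrow> real"
  assumes C2: "dir_C2 g G1 G2"
    and sub: "\<And>z. snd z > 0 \<Longrightarrow> (\<Sum>b\<in>Basis. G2 b z) \<ge> 0"
    and cont: "continuous_on {z. snd z \<ge> 0} g"
    and bdry: "\<And>x. g (x, 0) \<le> 0"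
    and inf: "\<And>\<delta>. \<delta> > 0 \<Longrightarrow> \<exists>L. \<forall>z. snd z \<ge> 0 \<longrightarrow> norm z \<ge> L \<longrightarrow> g z \<le> \<delta>"
    and z1: "snd z1 \<ge> 0"
  shows "g z1 \<le> 0"
proof (rule ccontr)
  assume "\<not> g z1 \<le> 0"
  define m where "m = g z1"
  have m: "m > 0" using \<open>\<not> g z1 \<le> 0\<close> by (simp add: m_def)
  obtain L0 where L0: "\<And>z. snd z \<ge> 0 \<Longrightarrow> norm z \<ge> L0 \<Longrightarrow> g z \<le> m / 4"
  proof -
    have "m / 4 > 0" using m by simp
    then show ?thesis using inf that by blast
  qed
  define L where "L = max L0 (norm z1 + 1)"
  have L: "\<And>z. snd z \<ge> 0 \<Longrightarrow> norm z \<ge> L \<Longrightarrow> g z \<le> m / 4" "L > norm z1" "L > 0"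
    using L0 norm_ge_zero[of z1] unfolding L_def by (auto simp del: norm_ge_zero)
  \<comment> \<open>The perturbation is at most \<open>m / 4\<close> on the half ball of radius
    \<open>L\<close>. At the maximiser \<open>g\<close> therefore exceeds \<open>m / 4\<close>,
    which excludes both the boundary plane and the outer sphere.\<close>
  define \<delta> where "\<delta> = m / (4 * L\<^sup>2)"
  have \<delta>: "\<delta> > 0" "\<delta> * L\<^sup>2 = m / 4" using m L by (auto simp: \<delta>_def)
  define S where "S = cball 0 L \<inter> {z::'a \<times> real. snd z \<ge> 0}"
  define f where "f = (\<lambda>z. g z + \<delta> * (z \<bullet> z))"
  have "closed {z::'a \<times> real. snd z \<ge> 0}" by (intro closed_Collect_le continuous_intros)
  then have "compact S" unfolding S_def by (intro compact_Int_closed compact_cball)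
  moreover have z1S: "z1 \<in> S" using z1 L by (auto simp: S_def)
  moreover have "continuous_on S f"
    unfolding f_def by (intro continuous_intros continuous_on_subset[OF cont]) (auto simp: S_def)
  ultimately obtain w where w: "w \<in> S" "\<And>z. z \<in> S \<Longrightarrow> f z \<le> f w"
    using continuous_attains_sup[of S f] by (metis empty_iff)
  have fw: "f w \<ge> m" using w(2)[OF z1S] \<delta> by (auto simp: f_def m_def intro: order_trans[rotated] add_increasing2)
  have nw: "norm w \<le> L" "snd w \<ge> 0" using w by (auto simp: S_def)
  have "w \<bullet> w \<le> L\<^sup>2" using nw by (simp add: dot_square_norm power_mono)
  then have "\<delta> * (w \<bullet> w) \<le> \<delta> * L\<^sup>2" using \<delta> by (intro mult_left_mono) auto
  then have "\<delta> * (w \<bullet> w) \<le> m / 4" using \<delta> by linarith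
  then have gw: "g w > m / 4" using fw m by (simp add: f_def)
  have sw: "snd w > 0"
  proof (rule ccontr)
    assume "\<not> snd w > 0"
    then have "w = (fst w, 0)" using nw by (simp add: prod_eq_iff)
    then show False using gw bdry[of "fst w"] m by simp
  qed
  have lw: "norm w < L" using gw L(1)[of w] nw by linarith
  define r where "r = min (snd w) (L - norm w)"
  have r: "r > 0" using sw lw by (simp add: r_def)
  have G2w: "G2 b w + 2 * \<delta> \<le> 0" if b: "b \<in> Basis" for b
  proof (rule second_derivative_local_max[OF r, where f="\<lambda>s. f (w + s *\<^sub>R b)" and ?f1.0="\<lambda>s. G1 b (w + s *\<^sub>R b) + 2 * \<delta> * ((w + s *\<^sub>R b) \<bullet> b)"])
    have inS: "w + s *\<^sub>R b \<in> S \<and> snd (w + s *\<^sub>R b) > 0" if "\<bar>s\<bar> < r" for s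
    proof -
      have n: "norm (s *\<^sub>R b) < r" using that b by simp
      have "\<bar>snd (s *\<^sub>R b)\<bar> \<le> norm (s *\<^sub>R b)" by (rule abs_snd_le_norm)
      then have "snd (w + s *\<^sub>R b) > 0" using n unfolding r_def min_less_iff_conj snd_add by linarith
      moreover have "norm (w + s *\<^sub>R b) \<le> L"
        using norm_triangle_ineq[of w "s *\<^sub>R b"] n unfolding r_def min_less_iff_conj by linarith
      ultimately show ?thesis by (auto simp: S_def)
    qed
    show "f (w + s *\<^sub>R b) \<le> f (w + 0 *\<^sub>R b)" if "\<bar>s\<bar> < r" for s
      using w(2) inS[OF that] by simp
    show "((\<lambda>s. f (w + s *\<^sub>R b)) has_real_derivative G1 b (w + s *\<^sub>R b) + 2 * \<delta> * ((w + s *\<^sub>R b) \<bullet> b)) (at s)" if "\<bar>s\<bar> < r" for s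
    proof -
      have "((\<lambda>s. g (w + s *\<^sub>R b)) has_real_derivative G1 b (w + s *\<^sub>R b)) (at s)"
        by (rule dir_derivative_shift) (use inS[OF that] b in \<open>blast intro: dir_C2D(1)[OF C2]\<close>)
      moreover have "((\<lambda>s. \<delta> * ((w + s *\<^sub>R b) \<bullet> (w + s *\<^sub>R b))) has_real_derivative 2 * \<delta> * ((w + s *\<^sub>R b) \<bullet> b)) (at s)"
        using b by (auto intro!: derivative_eq_intros simp: inner_add_left inner_add_right inner_commute algebra_simps)
      ultimately show ?thesis unfolding f_def by (rule DERIV_add)
    qed
    have "((\<lambda>s. G1 b (w + s *\<^sub>R b)) has_real_derivative G2 b w) (at 0)"
      by (rule dir_C2D(2)[OF C2 sw b])
    moreover have "((\<lambda>s. 2 * \<delta> * ((w + s *\<^sub>R b) \<bullet> b)) has_real_derivative 2 * \<delta>) (at 0)"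
      using b by (auto simp: inner_add_left intro!: derivative_eq_intros)
    ultimately show "((\<lambda>s. G1 b (w + s *\<^sub>R b) + 2 * \<delta> * ((w + s *\<^sub>R b) \<bullet> b)) has_real_derivative G2 b w + 2 * \<delta>) (at 0)"
      by (rule DERIV_add)
  qed
  have "(\<Sum>b\<in>(Basis::('a \<times> real) set). G2 b w) < (\<Sum>b\<in>(Basis::('a \<times> real) set). 0)"
  proof (rule sum_strict_mono)
    show "G2 b w < 0" if "b \<in> Basis" for b using G2w[OF that] \<delta>(1) by linarith
  qed (use nonempty_Basis in auto)
  then show False using sub[OF sw] by simp
qed

lemma half_conv_pker1_rescale:
  fixes h :: "'a::euclidean_space \<Rightarrow> real"
  assumes [measurable]: "h \<in> borel_measurable borel" and t: "t > 0"
  shows "half_conv pker1 h (x, t) = (LINT y|lborel. pker1 (y, 1) * h (x - t *\<^sub>R y))"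
proof -
  have "(LINT y|lborel. pker1 (x - y, t) * h y) = (LINT y|density (distr lborel borel (\<lambda>y. x + (-t) *\<^sub>R y)) (\<lambda>_. \<bar>-t\<bar> ^ DIM('a)). pker1 (x - y, t) * h y)"
    using t by (subst lborel_affine[of "-t" x]) auto
  also have "\<dots> = (LINT y|lborel. t ^ DIM('a) * (pker1 (t *\<^sub>R y, t) * h (x - t *\<^sub>R y)))"
    using t by (subst integral_density) (auto simp: integral_distr)
  also have "\<dots> = (LINT y|lborel. pker1 (y, 1) * h (x - t *\<^sub>R y))"
    using t by (intro Bochner_Integration.integral_cong) (auto simp: pker1_def pkern_scale)
  finally show ?thesis by (simp add: half_conv_def)
qed

lemma pker1_integrable:
  fixes x :: "'a::euclidean_space"
  assumes "t > 0"
  shows "integrable lborel (\<lambda>y. pker1 (x - y, t))" "(LINT y|lborel. pker1 (x - y, t)) = 1"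
    "integrable lborel (\<lambda>y::'a. pker1 (y, t))" "(LINT y|lborel. pker1 (y::'a, t)) = 1"
proof -
  have "has_bochner_integral lborel (\<lambda>y. pker1 (x - y, t)) 1" for x :: 'a
    using nn_integral_pker1[OF assms, of x] assms
    by (intro has_bochner_integral_nn_integral) (auto simp: pker1_nonneg)
  moreover have "has_bochner_integral lborel (\<lambda>y::'a. pker1 (y, t)) 1"
    using nn_integral_pker1'[OF assms, of 0] assms
    by (intro has_bochner_integral_nn_integral) (auto simp: pker1_nonneg)
  ultimately show "integrable lborel (\<lambda>y. pker1 (x - y, t))" "(LINT y|lborel. pker1 (x - y, t)) = 1"
    "integrable lborel (\<lambda>y::'a. pker1 (y, t))" "(LINT y|lborel. pker1 (y::'a, t)) = 1"
    by (auto simp: has_bochner_integral_iff)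
qed

lemma pker1_le:
  fixes z :: "'a::euclidean_space \<times> real"
  assumes "snd z \<ge> 0"
  shows "pker1 z \<le> 1 / poisson_mass TYPE('a) / norm z ^ DIM('a)"
  using divide_right_mono[OF pkern_le[OF assms], of "poisson_mass TYPE('a)"] poisson_mass_pos[where 'a='a]
  by (simp add: pker1_def mult_ac)

section \<open>Harmonicity of the Poisson kernel and of its integrals\<close>

lemma partial_deriv_eq: "(f has_derivative D) (at z) \<Longrightarrow> partial_deriv b f z = D b"
  unfolding partial_deriv_def by (metis frechet_derivative_at)

lemma hom_kernel_pkern: "hom_kernel DIM('a) (pkern :: 'a::euclidean_space \<times> real \<Rightarrow> real)"
proof -
  have "(pkern :: 'a \<times> real \<Rightarrow> real) = (\<lambda>z. (z \<bullet> (0, 1)) * (1 / norm z ^ Suc DIM('a)))"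
    by (auto simp: pkern_def fun_eq_iff)
  then show ?thesis using hom_kernel_inner[OF hom_kernel_norm, of "DIM('a)" "(0, 1) :: 'a \<times> real"] by metis
qed

text \<open>Up to a constant, \<open>pkern\<close> is the vertical derivative of the fundamental
  solution in dimension \<open>N = DIM('a) + 1\<close>. In the direct computation the coefficients
  of \<open>(z \<bullet> e) / norm z ^ (N + 2)\<close> are \<open>- 2 N\<close>,
  \<open>- N\<^sup>2\<close> and \<open>N (N + 2)\<close>, which cancel.\<close>

lemma pkern_laplacian:
  fixes z :: "'a::euclidean_space \<times> real"
  assumes z: "z \<noteq> 0"
  shows "(\<Sum>b\<in>Basis. partial_deriv b (partial_deriv b pkern) z) = 0"
proof -
  define N where "N = DIM('a) + 1"
  define e :: "'a \<times> real" where "e = (0, 1)"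
  note nd = has_derivative_inverse_norm_power_inner
  define p1 where "p1 = (\<lambda>b z::'a \<times> real. (b \<bullet> e) * (1 / norm z ^ N) - real N * ((z \<bullet> e) * ((z \<bullet> b) * (1 / norm z ^ (N + 2)))))"
  have pk: "(pkern :: 'a \<times> real \<Rightarrow> real) = (\<lambda>z. (z \<bullet> e) * (1 / norm z ^ N))"
    by (auto simp: pkern_def fun_eq_iff e_def N_def)
  have 1: "partial_deriv b pkern w = p1 b w" if "w \<noteq> 0" for b w
  proof -
    have "(pkern has_derivative (\<lambda>h. (w \<bullet> e) * (- real N * (w \<bullet> h) / norm w ^ (N + 2)) + (h \<bullet> e) * (1 / norm w ^ N))) (at w)"
      unfolding pk by (rule derivative_eq_intros nd[OF that] refl | simp)+
    from partial_deriv_eq[OF this, of b] show ?thesis by (simp add: p1_def)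
  qed
  have 2: "partial_deriv b (partial_deriv b pkern) z = - 2 * real N * (b \<bullet> e) * (z \<bullet> b) / norm z ^ (N + 2)
      - real N * (z \<bullet> e) * (b \<bullet> b) / norm z ^ (N + 2)
      + real N * (real N + 2) * (z \<bullet> e) * (z \<bullet> b)\<^sup>2 / norm z ^ (N + 2 + 2)" for b
  proof -
    have "(p1 b has_derivative (\<lambda>h. (b \<bullet> e) * (- real N * (z \<bullet> h) / norm z ^ (N + 2)) -
       real N * ((z \<bullet> e) * ((z \<bullet> b) * (- real (N + 2) * (z \<bullet> h) / norm z ^ (N + 2 + 2)) + (h \<bullet> b) * (1 / norm z ^ (N + 2)))
         + (h \<bullet> e) * ((z \<bullet> b) * (1 / norm z ^ (N + 2)))))) (at z)"
      unfolding p1_def by (rule derivative_eq_intros nd[OF z] refl | simp)+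
    then have "(partial_deriv b pkern has_derivative (\<lambda>h. (b \<bullet> e) * (- real N * (z \<bullet> h) / norm z ^ (N + 2)) -
       real N * ((z \<bullet> e) * ((z \<bullet> b) * (- real (N + 2) * (z \<bullet> h) / norm z ^ (N + 2 + 2)) + (h \<bullet> b) * (1 / norm z ^ (N + 2)))
         + (h \<bullet> e) * ((z \<bullet> b) * (1 / norm z ^ (N + 2)))))) (at z)"
      by (rule has_derivative_transform_within_open[of _ _ _ _ "- {0}"]) (use 1 z in auto)
    then show ?thesis
      by (simp add: partial_deriv_eq inner_commute algebra_simps power2_eq_square add_divide_distrib diff_divide_distrib)
  qed
  have s1: "(\<Sum>b\<in>Basis. (b \<bullet> e) * (z \<bullet> b)) = z \<bullet> e"
    by (subst euclidean_inner[of z e]) (simp add: mult.commute inner_commute)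
  have s2: "(\<Sum>b\<in>Basis. (z \<bullet> b)\<^sup>2) = (norm z)\<^sup>2"
    unfolding power2_norm_eq_inner by (subst euclidean_inner[of z z]) (simp add: power2_eq_square)
  have s3: "(\<Sum>b\<in>(Basis::('a \<times> real) set). b \<bullet> b) = real N"
    by (simp add: N_def inner_Basis)
  have "(\<Sum>b\<in>Basis. partial_deriv b (partial_deriv b pkern) z) =
     (\<Sum>b\<in>Basis. (- 2 * real N / norm z ^ (N + 2)) * ((b \<bullet> e) * (z \<bullet> b)) + (- real N * (z \<bullet> e) / norm z ^ (N + 2)) * (b \<bullet> b)
      + (real N * (real N + 2) * (z \<bullet> e) / norm z ^ (N + 2 + 2)) * (z \<bullet> b)\<^sup>2)"
    by (intro sum.cong) (auto simp: 2)
  also have "\<dots> = (- 2 * real N / norm z ^ (N + 2)) * (z \<bullet> e) + (- real N * (z \<bullet> e) / norm z ^ (N + 2)) * real N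
      + (real N * (real N + 2) * (z \<bullet> e) / norm z ^ (N + 2 + 2)) * (norm z)\<^sup>2"
    unfolding sum.distrib sum_distrib_left[symmetric] s1 s2 s3 ..
  also have "(real N * (real N + 2) * (z \<bullet> e) / norm z ^ (N + 2 + 2)) * (norm z)\<^sup>2 = real N * (real N + 2) * (z \<bullet> e) / norm z ^ (N + 2)"
    using z by (simp add: power_add field_simps power2_eq_square eval_nat_numeral)
  finally show ?thesis by (simp add: algebra_simps add_divide_distrib)
qed

lemma pkern_half_integrable:
  fixes f :: "'a::euclidean_space \<Rightarrow> real"
  assumes f: "poisson_admissible f" and z: "snd z > 0"
  shows "integrable lborel (\<lambda>y. pkern (z - (y, 0)) * f y)"
proof -
  have [measurable]: "f \<in> borel_measurable borel" by (rule poisson_admissible_measurable[OF f])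
  have "integrable lborel (\<lambda>y. snd z * (\<bar>f y\<bar> / norm (z - (y, 0)) ^ (DIM('a) + 1)))"
    by (intro integrable_mult_right poisson_admissible_integrable f z)
  then show ?thesis
    by (rule Bochner_Integration.integrable_bound) (use z in \<open>auto simp: pkern_def abs_mult\<close>)
qed

lemma half_conv_pkern_has_derivative:
  fixes f :: "'a::euclidean_space \<Rightarrow> real"
  assumes "poisson_admissible f" "snd z > 0"
  shows "(half_conv pkern f has_derivative (\<lambda>h. \<Sum>b\<in>Basis. (h \<bullet> b) * half_conv (partial_deriv b pkern) f z)) (at z)"
  using assms by (intro half_conv_has_derivative[OF hom_kernel_pkern] pkern_half_integrable) auto

lemma half_conv_hom_has_derivative:
  fixes f :: "'a::euclidean_space \<Rightarrow> real"
  assumes "hom_kernel j k" "j \<ge> DIM('a) + 1" "poisson_admissible f" "snd z > 0"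
  shows "(half_conv k f has_derivative (\<lambda>h. \<Sum>b\<in>Basis. (h \<bullet> b) * half_conv (partial_deriv b k) f z)) (at z)"
  using assms by (intro half_conv_has_derivative[OF assms(1)] hom_kernel_half_integrable) auto

lemma half_conv_cong_nonzero:
  assumes "\<And>z. z \<noteq> 0 \<Longrightarrow> k z = l z" "snd z > 0"
  shows "half_conv k f z = half_conv l f z"
proof -
  have "z - (y, 0) \<noteq> 0" for y using assms(2) by (auto simp: prod_eq_iff)
  then show ?thesis unfolding half_conv_def using assms(1) by simp
qed

lemma has_derivative_imp_directional:
  fixes f :: "'z::euclidean_space \<Rightarrow> real"
  assumes "(f has_derivative (\<lambda>h. \<Sum>b\<in>Basis. (h \<bullet> b) * D b)) (at z)" "b \<in> Basis"
  shows "((\<lambda>s. f (z + s *\<^sub>R b)) has_real_derivative D b) (at 0)"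
proof -
  have 1: "((\<lambda>s. z + s *\<^sub>R b) has_derivative (\<lambda>s. s *\<^sub>R b)) (at 0)"
    by (auto intro!: derivative_eq_intros)
  have "((\<lambda>s. f (z + s *\<^sub>R b)) has_derivative (\<lambda>s. \<Sum>c\<in>Basis. (s *\<^sub>R b \<bullet> c) * D c)) (at 0)"
    by (rule has_derivative_compose[OF 1]) (use assms(1) in simp)
  moreover have "(\<Sum>c\<in>Basis. (s *\<^sub>R b \<bullet> c) * D c) = D b * s" for s
  proof -
    have "(\<Sum>c\<in>Basis. (s *\<^sub>R b \<bullet> c) * D c) = (\<Sum>c\<in>Basis. if c = b then s * D c else 0)"
      using assms(2) by (intro sum.cong) (auto simp: inner_Basis)
    then show ?thesis using assms(2) by simp
  qed
  ultimately show ?thesis by (simp add: has_field_derivative_def)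
qed

lemma dir_C2_pkern:
  fixes f :: "'a::euclidean_space \<Rightarrow> real"
  assumes f: "poisson_admissible f"
  shows "dir_C2 (half_conv pkern f) (\<lambda>b. half_conv (partial_deriv b pkern) f)
           (\<lambda>b. half_conv (partial_deriv b (partial_deriv b pkern)) f)"
  unfolding dir_C2_def
proof (intro allI impI)
  fix z b :: "'a \<times> real" assume z: "snd z > 0" and b: "b \<in> Basis"
  show "((\<lambda>s. half_conv pkern f (z + s *\<^sub>R b)) has_real_derivative half_conv (partial_deriv b pkern) f z) (at 0) \<and>
    ((\<lambda>s. half_conv (partial_deriv b pkern) f (z + s *\<^sub>R b)) has_real_derivative
      half_conv (partial_deriv b (partial_deriv b pkern)) f z) (at 0)"
    using has_derivative_imp_directional[OF half_conv_pkern_has_derivative[OF f z] b]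
      has_derivative_imp_directional[OF half_conv_hom_has_derivative[OF hom_kernel_partial_deriv[OF hom_kernel_pkern b] _ f z] b]
    by simp
qed

lemma half_conv_pkern_harmonic:
  fixes f :: "'a::euclidean_space \<Rightarrow> real"
  assumes f: "poisson_admissible f" and z: "snd z > 0"
  shows "(\<Sum>b\<in>Basis. half_conv (partial_deriv b (partial_deriv b pkern)) f z) = 0"
proof -
  have "(\<Sum>b\<in>Basis. half_conv (partial_deriv b (partial_deriv b pkern)) f z) =
      (LINT y|lborel. (\<Sum>b\<in>Basis. partial_deriv b (partial_deriv b pkern) (z - (y, 0)) * f y))"
    unfolding half_conv_def
    by (intro Bochner_Integration.integral_sum[symmetric] hom_kernel_half_integrable[OF hom_kernel_partial_deriv[OF hom_kernel_partial_deriv[OF hom_kernel_pkern]] _ f z]) auto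
  also have "\<dots> = (LINT y|(lborel :: 'a measure). 0)"
  proof (rule Bochner_Integration.integral_cong[OF refl])
    fix y :: 'a
    have "z - (y, 0) \<noteq> 0" using z by (auto simp: prod_eq_iff)
    from pkern_laplacian[OF this]
    show "(\<Sum>b\<in>Basis. partial_deriv b (partial_deriv b pkern) (z - (y, 0)) * f y) = 0"
      by (simp flip: sum_distrib_right)
  qed
  finally show ?thesis by simp
qed

text \<open>Uniform decay over the closed half-space, in all directions. The height itself is
  harmonic with boundary values zero, so some condition of this kind must accompany any statement
  that boundary values determine a harmonic function.\<close>

definition vanishing :: "('a::euclidean_space \<times> real \<Rightarrow> real) \<Rightarrow> bool" where
  "vanishing g \<longleftrightarrow> (\<forall>\<delta>>0. \<exists>L. \<forall>z. snd z \<ge> 0 \<longrightarrow> norm z \<ge> L \<longrightarrow> \<bar>g z\<bar> \<le> \<delta>)"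

lemma vanishing_bounded:
  assumes "vanishing g" "continuous_on {z. snd z \<ge> 0} g"
  shows "\<exists>B\<ge>0. \<forall>z. snd z \<ge> 0 \<longrightarrow> \<bar>g z\<bar> \<le> B"
proof -
  obtain L where L: "\<And>z. snd z \<ge> 0 \<Longrightarrow> norm z \<ge> L \<Longrightarrow> \<bar>g z\<bar> \<le> 1"
    using assms(1) unfolding vanishing_def by (metis zero_less_one)
  let ?S = "cball 0 L \<inter> {z::'a \<times> real. snd z \<ge> 0}"
  have "closed {z::'a \<times> real. snd z \<ge> 0}" by (intro closed_Collect_le continuous_intros)
  then have "compact ?S" by (intro compact_Int_closed compact_cball)
  then have "compact (g ` ?S)"
    by (intro compact_continuous_image continuous_on_subset[OF assms(2)]) auto
  then obtain B where B: "\<And>x. x \<in> g ` ?S \<Longrightarrow> norm x \<le> B"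
    using compact_imp_bounded bounded_iff by metis
  have "\<bar>g z\<bar> \<le> max 1 (max 0 B)" if "snd z \<ge> 0" for z
  proof (cases "norm z \<ge> L")
    case True
    then show ?thesis using L[OF that] by auto
  next
    case False
    then have "g z \<in> g ` ?S" using that by (intro imageI) auto
    then show ?thesis using B by fastforce
  qed
  then show ?thesis by (intro exI[of _ "max 1 (max 0 B)"]) auto
qed

lemma poisson_admissible_bounded:
  fixes h :: "'a::euclidean_space \<Rightarrow> real"
  assumes h: "h \<in> borel_measurable borel" and B: "\<And>y. \<bar>h y\<bar> \<le> B"
  shows "poisson_admissible h"
  unfolding poisson_admissible_def
proof (intro conjI allI impI h)
  fix z :: "'a \<times> real" assume z: "snd z > 0"
  have [measurable]: "h \<in> borel_measurable borel" by (rule h)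
  have B0: "B \<ge> 0" using B[of 0] by linarith
  have "integrable lborel (\<lambda>y. (B * poisson_mass TYPE('a) / snd z) * pker1 (fst z - y, snd z))"
    by (intro integrable_mult_right pker1_integrable z)
  then show "integrable lborel (\<lambda>y. \<bar>h y\<bar> / norm (z - (y, 0)) ^ (DIM('a) + 1))"
  proof (rule Bochner_Integration.integrable_bound)
    show "AE y in lborel. norm (\<bar>h y\<bar> / norm (z - (y, 0)) ^ (DIM('a) + 1)) \<le> norm ((B * poisson_mass TYPE('a) / snd z) * pker1 (fst z - y, snd z))"
    proof (rule AE_I2)
      fix y
      have e: "(fst z - y, snd z) = z - (y, 0)" by (simp add: prod_eq_iff)
      have "(B * poisson_mass TYPE('a) / snd z) * pker1 (fst z - y, snd z) = B / norm (z - (y, 0)) ^ (DIM('a) + 1)"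
        unfolding e using z poisson_mass_pos[where 'a='a] by (simp add: pker1_def pkern_def)
      then show "norm (\<bar>h y\<bar> / norm (z - (y, 0)) ^ (DIM('a) + 1)) \<le> norm ((B * poisson_mass TYPE('a) / snd z) * pker1 (fst z - y, snd z))"
        using B[of y] B0 by (simp add: divide_right_mono)
    qed
  qed measurable
qed

text \<open>The substitution \<open>y \<mapsto> x - t y\<close> in the Poisson integral, which makes sense down to \<open>t = 0\<close>.\<close>

definition poisson_closure :: "('a::euclidean_space \<Rightarrow> real) \<Rightarrow> 'a \<times> real \<Rightarrow> real" where
  "poisson_closure h z = (LINT y|lborel. pker1 (y, 1) * h (fst z - snd z *\<^sub>R y))"

lemma poisson_closure_continuous:
  fixes h :: "'a::euclidean_space \<Rightarrow> real"
  assumes h: "continuous_on UNIV h" and B: "\<And>y. \<bar>h y\<bar> \<le> B"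
  shows "continuous_on S (poisson_closure h)"
  unfolding continuous_on_sequentially
proof (intro ballI allI impI)
  fix X z assume "(\<forall>n. X n \<in> S) \<and> X \<longlonglongrightarrow> z"
  then have X: "X \<longlonglongrightarrow> z" by blast
  have [measurable]: "h \<in> borel_measurable borel" by (rule borel_measurable_continuous_onI[OF h])
  have B0: "B \<ge> 0" using B[of 0] by linarith
  show "(poisson_closure h \<circ> X) \<longlonglongrightarrow> poisson_closure h z"
    unfolding poisson_closure_def comp_def
  proof (rule integral_dominated_convergence[where w="\<lambda>y. B * pker1 (y, 1)"])
    show "integrable lborel (\<lambda>y::'a. B * pker1 (y, 1))"
      by (intro integrable_mult_right pker1_integrable) simp
    show "AE y in lborel. (\<lambda>i. pker1 (y, 1) * h (fst (X i) - snd (X i) *\<^sub>R y)) \<longlonglongrightarrow> pker1 (y, 1) * h (fst z - snd z *\<^sub>R y)"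
    proof (rule AE_I2)
      fix y
      have "(\<lambda>i. fst (X i) - snd (X i) *\<^sub>R y) \<longlonglongrightarrow> fst z - snd z *\<^sub>R y"
        by (intro tendsto_intros X)
      then have "(\<lambda>i. h (fst (X i) - snd (X i) *\<^sub>R y)) \<longlonglongrightarrow> h (fst z - snd z *\<^sub>R y)"
        by (rule continuous_on_tendsto_compose[OF h]) auto
      then show "(\<lambda>i. pker1 (y, 1) * h (fst (X i) - snd (X i) *\<^sub>R y)) \<longlonglongrightarrow> pker1 (y, 1) * h (fst z - snd z *\<^sub>R y)"
        by (intro tendsto_intros)
    qed
    show "AE y in lborel. norm (pker1 (y, 1) * h (fst (X i) - snd (X i) *\<^sub>R y)) \<le> B * pker1 (y, 1)" for i
      by (intro AE_I2) (auto simp: abs_mult pker1_nonneg mult.commute[of _ "\<bar>h _\<bar>"] intro!: mult_right_mono B)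
  qed measurable
qed

lemma poisson_closure_eq:
  assumes "h \<in> borel_measurable borel" "snd z > 0"
  shows "poisson_closure h z = half_conv pker1 h z"
  using half_conv_pker1_rescale[OF assms, of "fst z"] by (simp add: poisson_closure_def)

lemma poisson_closure_boundary:
  fixes h :: "'a::euclidean_space \<Rightarrow> real"
  shows "poisson_closure h (x, 0) = h x"
  using pker1_integrable(4)[of 1, where 'a='a] by (simp add: poisson_closure_def)

lemma half_conv_pker1: 
  fixes f :: "'a::euclidean_space \<Rightarrow> real"
  shows "half_conv pker1 f z = half_conv pkern f z / poisson_mass TYPE('a)"
  by (simp add: half_conv_def pker1_def)

text \<open>The data are split at \<open>norm y = R\<close>. Outside, they are below
  \<open>\<delta> / 2\<close> and the kernel has mass one; inside there is only a finite volume
  \<open>V\<close>, on which the kernel is at most \<open>c / Q\<close> once \<open>z\<close> is at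
  distance \<open>Q\<close> from the ball.\<close>

lemma poisson_closure_vanishing:
  fixes h :: "'a::euclidean_space \<Rightarrow> real"
  assumes h: "continuous_on UNIV h" and B: "\<And>y. \<bar>h y\<bar> \<le> B"
    and van: "\<And>\<delta>. \<delta> > 0 \<Longrightarrow> \<exists>R. \<forall>y. norm y \<ge> R \<longrightarrow> \<bar>h y\<bar> \<le> \<delta>"
  shows "vanishing (poisson_closure h)"
  unfolding vanishing_def
proof (intro allI impI)
  fix \<delta> :: real assume \<delta>: "\<delta> > 0"
  have hm [measurable]: "h \<in> borel_measurable borel" by (rule borel_measurable_continuous_onI[OF h])
  have B0: "B \<ge> 0" using B[of 0] by linarith
  obtain R0 where R0: "\<And>y. norm y \<ge> R0 \<Longrightarrow> \<bar>h y\<bar> \<le> \<delta> / 2" using van[of "\<delta> / 2"] \<delta> by auto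
  define R where "R = max R0 1"
  have R: "\<And>y. norm y \<ge> R \<Longrightarrow> \<bar>h y\<bar> \<le> \<delta> / 2" "R > 0" using R0 by (auto simp: R_def)
  define V where "V = measure lborel (ball (0::'a) R)"
  have V0: "V \<ge> 0" by (simp add: V_def)
  define c where "c = 1 / poisson_mass TYPE('a)"
  have c: "c > 0" using poisson_mass_pos[where 'a='a] by (simp add: c_def)
  \<comment> \<open>Makes \<open>B * (c / Q) * V\<close> at most \<open>\<delta> / 2\<close>; the
    lower bound \<open>1\<close> allows \<open>Q ^ DIM('a)\<close> to be replaced by
    \<open>Q\<close>.\<close>
  define Q where "Q = max 1 (2 * B * V * c / \<delta>)"
  have Q: "Q \<ge> 1" "2 * B * V * c / \<delta> \<le> Q" by (auto simp: Q_def)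
  show "\<exists>L. \<forall>z. 0 \<le> snd z \<longrightarrow> L \<le> norm z \<longrightarrow> \<bar>poisson_closure h z\<bar> \<le> \<delta>"
  proof (intro exI[of _ "R + Q"] allI impI)
    fix z :: "'a \<times> real" assume z: "0 \<le> snd z" "R + Q \<le> norm z"
    show "\<bar>poisson_closure h z\<bar> \<le> \<delta>"
    proof (cases "snd z = 0")
      case True
      then have e: "z = (fst z, 0)" by (simp add: prod_eq_iff)
      have "norm (fst z, 0::real) = norm (fst z)" by simp
      then have "norm z = norm (fst z)" by (simp only: e[symmetric])
      then have "norm (fst z) \<ge> R" using z Q by linarith
      then have "\<bar>h (fst z)\<bar> \<le> \<delta>" using R(1)[of "fst z"] \<delta> by linarith
      then show ?thesis using poisson_closure_boundary[of h "fst z"] e by metis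
    next
      case False
      then have t: "snd z > 0" using z by simp
      define w where "w = (\<lambda>y. \<delta> / 2 * pker1 (fst z - y, snd z) + B * (c / Q) * indicator (ball 0 R) y)"
      have w: "integrable lborel w" unfolding w_def
        by (intro Bochner_Integration.integrable_add integrable_mult_right pker1_integrable t)
           (auto intro!: integrable_real_indicator simp: emeasure_bounded_finite[unfolded infinity_ennreal_def])
      have e: "(fst z - y, snd z) = z - (y, 0)" for y by (simp add: prod_eq_iff)
      have bd: "\<bar>pker1 (z - (y, 0)) * h y\<bar> \<le> w y" for y
      proof (cases "norm y < R")
        case True
        have "norm (y, 0::real) = norm y" by simp
        then have nz: "norm (z - (y, 0)) \<ge> Q" using z True norm_triangle_ineq2[of z "(y, 0)"] by linarith
        have "pker1 (z - (y, 0)) \<le> c / norm (z - (y, 0)) ^ DIM('a)"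
          using pker1_le[of "z - (y, 0)"] z by (simp add: c_def)
        also have "\<dots> \<le> c / Q"
        proof -
          have "Q ^ 1 \<le> norm (z - (y, 0)) ^ DIM('a)"
            using nz Q by (intro order_trans[OF power_increasing[of 1 "DIM('a)" Q] power_mono]) (auto simp: Suc_leI)
          then show ?thesis using Q c nz by (intro divide_left_mono mult_pos_pos zero_less_power) auto
        qed
        finally have "pker1 (z - (y, 0)) * \<bar>h y\<bar> \<le> c / Q * B"
          using B Q c by (intro mult_mono) auto
        moreover have "0 \<le> \<delta> / 2 * pker1 (z - (y, 0))" using \<delta> z pker1_nonneg[of "z - (y, 0)"] by auto
        ultimately show ?thesis using True z pker1_nonneg[of "z - (y, 0)"] by (simp add: w_def e abs_mult mult.commute)
      next
        case False
        then have "pker1 (z - (y, 0)) * \<bar>h y\<bar> \<le> pker1 (z - (y, 0)) * (\<delta> / 2)"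
          using R(1)[of y] z by (intro mult_left_mono pker1_nonneg) auto
        then show ?thesis using False z pker1_nonneg[of "z - (y, 0)"] by (simp add: w_def e abs_mult mult.commute)
      qed
      have wi: "integral\<^sup>L lborel w = \<delta> / 2 + B * (c / Q) * V"
        unfolding w_def V_def
        by (subst Bochner_Integration.integral_add)
          (use t in \<open>auto simp: pker1_integrable emeasure_bounded_finite[unfolded infinity_ennreal_def] intro!: integrable_mult_right integrable_real_indicator\<close>)
      have "\<bar>poisson_closure h z\<bar> \<le> integral\<^sup>L lborel w"
        unfolding poisson_closure_eq[OF hm t] half_conv_def
      proof (rule integral_abs_bound_integral[OF _ w])
        have [measurable]: "(\<lambda>y. z - (y, 0)) \<in> borel_measurable borel"
          by (intro borel_measurable_continuous_onI continuous_intros)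
        show "integrable lborel (\<lambda>y. pker1 (z - (y, 0)) * h y)"
          by (rule Bochner_Integration.integrable_bound[OF w]) (use bd in \<open>auto intro: order_trans[OF _ abs_ge_self]\<close>)
      qed (use bd in simp)
      also have "\<dots> \<le> \<delta>"
      proof -
        have "2 * B * V * c \<le> Q * \<delta>" using Q \<delta> by (simp add: field_simps)
        then show ?thesis unfolding wi using Q by (simp add: field_simps)
      qed
      finally show ?thesis .
    qed
  qed
qed

lemma dir_C2_cong:
  assumes C2: "dir_C2 g G1 G2" and eq: "\<And>z. snd z > 0 \<Longrightarrow> g' z = g z"
  shows "dir_C2 g' G1 G2"
  unfolding dir_C2_def
proof (intro allI impI conjI)
  fix z b :: "'a \<times> real" assume z: "snd z > 0" and b: "b \<in> Basis"
  show "((\<lambda>s. G1 b (z + s *\<^sub>R b)) has_real_derivative G2 b z) (at 0)" by (rule dir_C2D[OF C2 z b])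
  have "\<forall>\<^sub>F s in nhds 0. snd (z + s *\<^sub>R b) > 0"
  proof -
    have "open {s. 0 < snd (z + s *\<^sub>R b)}" by (intro open_Collect_less continuous_intros)
    from eventually_nhds_in_open[OF this, of 0] show ?thesis using z by simp
  qed
  then have ev: "\<forall>\<^sub>F s in nhds 0. g' (z + s *\<^sub>R b) = g (z + s *\<^sub>R b)" by eventually_elim (rule eq)
  show "((\<lambda>s. g' (z + s *\<^sub>R b)) has_real_derivative G1 b z) (at 0)"
    using dir_C2D(1)[OF C2 z b] unfolding DERIV_cong_ev[OF refl ev refl] .
qed

lemma dir_C2_diff:
  fixes g h :: "'a::euclidean_space \<times> real \<Rightarrow> real"
  assumes "dir_C2 g G1 G2" "dir_C2 h H1 H2"
  shows "dir_C2 (\<lambda>z. g z - c * h z) (\<lambda>b z. G1 b z - c * H1 b z) (\<lambda>b z. G2 b z - c * H2 b z)"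
  unfolding dir_C2_def
proof (intro allI impI conjI)
  fix z b :: "'a \<times> real" assume z: "snd z > 0" and b: "b \<in> Basis"
  note d = dir_C2D[OF assms(1) z b] dir_C2D[OF assms(2) z b]
  show "((\<lambda>s. g (z + s *\<^sub>R b) - c * h (z + s *\<^sub>R b)) has_real_derivative G1 b z - c * H1 b z) (at 0)"
    by (intro DERIV_diff DERIV_cmult d)
  show "((\<lambda>s. G1 b (z + s *\<^sub>R b) - c * H1 b (z + s *\<^sub>R b)) has_real_derivative G2 b z - c * H2 b z) (at 0)"
    by (intro DERIV_diff DERIV_cmult d)
qed

text \<open>The maximum principle is applied to \<open>g\<close> minus the Poisson integral of its
  boundary values. That integral is harmonic inside, and its extension
  \<open>poisson_closure\<close> is continuous up to the boundary and vanishes at infinity.\<close>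

lemma subharmonic_le_poisson:
  fixes g :: "'a::euclidean_space \<times> real \<Rightarrow> real"
  assumes C2: "dir_C2 g G1 G2" and sub: "\<And>z. snd z > 0 \<Longrightarrow> (\<Sum>b\<in>Basis. G2 b z) \<ge> 0"
    and cont: "continuous_on {z. snd z \<ge> 0} g" and van: "vanishing g" and z: "snd z > 0"
  shows "g z \<le> half_conv pker1 (\<lambda>y. g (y, 0)) z"
proof -
  define h where "h = (\<lambda>y. g (y, 0))"
  obtain B where B: "B \<ge> 0" "\<And>z. snd z \<ge> 0 \<Longrightarrow> \<bar>g z\<bar> \<le> B" using vanishing_bounded[OF van cont] by blast
  have hB: "\<bar>h y\<bar> \<le> B" for y using B(2)[of "(y, 0)"] by (simp add: h_def)
  have hc: "continuous_on UNIV h" unfolding h_def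
    by (intro continuous_on_compose2[OF cont] continuous_intros) auto
  have hm: "h \<in> borel_measurable borel" by (rule borel_measurable_continuous_onI[OF hc])
  have adm: "poisson_admissible h" using poisson_admissible_bounded[OF hm hB] .
  have hv: "\<exists>R. \<forall>y. norm y \<ge> R \<longrightarrow> \<bar>h y\<bar> \<le> \<delta>" if d: "\<delta> > 0" for \<delta>
  proof -
    obtain L where "\<And>z. snd z \<ge> 0 \<Longrightarrow> norm z \<ge> L \<Longrightarrow> \<bar>g z\<bar> \<le> \<delta>" using van d unfolding vanishing_def by blast
    then show ?thesis by (intro exI[of _ L]) (auto simp: h_def)
  qed
  have W: "vanishing (poisson_closure h)" by (rule poisson_closure_vanishing[OF hc hB hv])
  define \<kappa> where "\<kappa> = 1 / poisson_mass TYPE('a)"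
  have "g z - poisson_closure h z \<le> 0"
  proof (rule half_space_max_principle)
    show "dir_C2 (\<lambda>z. g z - poisson_closure h z) (\<lambda>b z. G1 b z - \<kappa> * half_conv (partial_deriv b pkern) h z)
       (\<lambda>b z. G2 b z - \<kappa> * half_conv (partial_deriv b (partial_deriv b pkern)) h z)"
      by (rule dir_C2_cong[OF dir_C2_diff[OF C2 dir_C2_pkern[OF adm], of \<kappa>]])
        (simp add: poisson_closure_eq[OF hm] half_conv_pker1 \<kappa>_def)
    show "0 \<le> (\<Sum>b\<in>Basis. G2 b z - \<kappa> * half_conv (partial_deriv b (partial_deriv b pkern)) h z)" if "snd z > 0" for z
      using sub[OF that] half_conv_pkern_harmonic[OF adm that] by (simp add: sum_subtractf flip: sum_distrib_left)
    show "continuous_on {z. snd z \<ge> 0} (\<lambda>z. g z - poisson_closure h z)"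
      by (intro continuous_intros cont poisson_closure_continuous[OF hc hB])
    show "g (x, 0) - poisson_closure h (x, 0) \<le> 0" for x
      unfolding poisson_closure_boundary by (simp add: h_def)
    show "\<exists>L. \<forall>z. snd z \<ge> 0 \<longrightarrow> norm z \<ge> L \<longrightarrow> g z - poisson_closure h z \<le> \<delta>" if "\<delta> > 0" for \<delta>
    proof -
      have d: "\<delta> / 2 > 0" using that by simp
      obtain L1 where L1: "\<And>z. snd z \<ge> 0 \<Longrightarrow> norm z \<ge> L1 \<Longrightarrow> \<bar>g z\<bar> \<le> \<delta> / 2"
        using van d unfolding vanishing_def by blast
      obtain L2 where L2: "\<And>z. snd z \<ge> 0 \<Longrightarrow> norm z \<ge> L2 \<Longrightarrow> \<bar>poisson_closure h z\<bar> \<le> \<delta> / 2"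
        using W d unfolding vanishing_def by blast
      have "g z - poisson_closure h z \<le> \<delta>" if "snd z \<ge> 0" "norm z \<ge> max L1 L2" for z
        using L1[of z] L2[of z] that by (simp add: abs_le_iff)
      then show ?thesis by blast
    qed
  qed (use z in simp)
  then show ?thesis using poisson_closure_eq[OF hm z] by (simp add: h_def)
qed

text \<open>The comparison for \<open>g\<close> and for \<open>- g\<close>. This uniqueness is the
  source of every semigroup identity below.\<close>

lemma harmonic_eq_poisson:
  fixes g :: "'a::euclidean_space \<times> real \<Rightarrow> real"
  assumes C2: "dir_C2 g G1 G2" and sub: "\<And>z. snd z > 0 \<Longrightarrow> (\<Sum>b\<in>Basis. G2 b z) = 0"
    and cont: "continuous_on {z. snd z \<ge> 0} g" and van: "vanishing g" and z: "snd z > 0"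
  shows "g z = half_conv pker1 (\<lambda>y. g (y, 0)) z"
proof (rule antisym)
  show "g z \<le> half_conv pker1 (\<lambda>y. g (y, 0)) z"
    by (rule subharmonic_le_poisson[OF C2 _ cont van z]) (simp add: sub)
  have "- g z \<le> half_conv pker1 (\<lambda>y. - g (y, 0)) z"
  proof (rule subharmonic_le_poisson[OF _ _ _ _ z])
    show "dir_C2 (\<lambda>z. - g z) (\<lambda>b z. - G1 b z) (\<lambda>b z. - G2 b z)"
      unfolding dir_C2_def by (intro allI impI conjI DERIV_minus dir_C2D[OF C2]) auto
  qed (use sub cont van in \<open>auto simp: vanishing_def sum_negf intro!: continuous_intros\<close>)
  then show "half_conv pker1 (\<lambda>y. g (y, 0)) z \<le> g z" by (simp add: half_conv_def)
qed

section \<open>Poisson integrals of \<open>L^p\<close> functions\<close>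

lemma half_point_measurable [measurable]:
  "(\<lambda>y. z - (y, 0 :: real)) \<in> borel_measurable borel" for z :: "'a::euclidean_space \<times> real"
  by (intro borel_measurable_continuous_onI continuous_intros)

lemma half_point_pair: "z - (y, 0) = (fst z - y, snd z)" for z :: "'a::euclidean_space \<times> real"
  by (simp add: prod_eq_iff)

lemma pker1_le_height:
  fixes z :: "'a::euclidean_space \<times> real"
  assumes "snd z > 0"
  shows "pker1 z \<le> 1 / poisson_mass TYPE('a) / snd z ^ DIM('a)"
  using divide_right_mono[OF pkern_le_height[OF assms], of "poisson_mass TYPE('a)"] poisson_mass_pos[where 'a='a]
  by (simp add: pker1_def mult_ac)

lemma nn_integral_pker1_power:
  fixes f :: "'a::euclidean_space \<Rightarrow> real"
  assumes [measurable]: "f \<in> borel_measurable borel" and z: "snd z > 0" and p: "p \<ge> 1"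
  shows "(\<integral>\<^sup>+y. ennreal (pker1 (z - (y, 0)) * \<bar>f y\<bar>) \<partial>lborel) ^ p \<le> (\<integral>\<^sup>+y. ennreal (pker1 (z - (y, 0)) * \<bar>f y\<bar> ^ p) \<partial>lborel)"
  using nn_integral_pker1[OF z, of "fst z"] z p
  by (intro nn_integral_power_Jensen) (auto simp: half_point_pair pker1_nonneg)

lemma pker1_half_integrable:
  fixes f :: "'a::euclidean_space \<Rightarrow> real"
  assumes "poisson_admissible f" "snd z > 0"
  shows "integrable lborel (\<lambda>y. pker1 (z - (y, 0)) * f y)"
  using integrable_mult_right[OF pkern_half_integrable[OF assms], of "1 / poisson_mass TYPE('a)"]
  by (simp add: pker1_def)

lemma poisson_admissible_abs: "poisson_admissible f \<Longrightarrow> poisson_admissible (\<lambda>y. \<bar>f y\<bar>)"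
  unfolding poisson_admissible_def by auto

lemma pker1_half_integrable_L1:
  fixes g :: "'a::euclidean_space \<Rightarrow> real"
  assumes g: "integrable lborel g" and z: "snd z > 0"
  shows "integrable lborel (\<lambda>y. pker1 (z - (y, 0)) * g y)"
proof -
  have [measurable]: "g \<in> borel_measurable borel" using g by auto
  have "integrable lborel (\<lambda>y. 1 / poisson_mass TYPE('a) / snd z ^ DIM('a) * \<bar>g y\<bar>)"
    using g by (intro integrable_mult_right) auto
  then show ?thesis
  proof (rule Bochner_Integration.integrable_bound)
    show "AE y in lborel. norm (pker1 (z - (y, 0)) * g y) \<le> norm (1 / poisson_mass TYPE('a) / snd z ^ DIM('a) * \<bar>g y\<bar>)"
    proof (rule AE_I2)
      fix y :: 'a
      have "pker1 (z - (y, 0)) * \<bar>g y\<bar> \<le> 1 / poisson_mass TYPE('a) / snd z ^ DIM('a) * \<bar>g y\<bar>"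
        using pker1_le_height[of "z - (y, 0)"] z by (intro mult_right_mono) auto
      then have "norm (pker1 (z - (y, 0)) * g y) \<le> 1 / poisson_mass TYPE('a) / snd z ^ DIM('a) * \<bar>g y\<bar>"
        using z pker1_nonneg[of "z - (y, 0)"] by (simp add: abs_mult)
      also have "\<dots> \<le> norm \<dots>" unfolding real_norm_def by (rule abs_ge_self)
      finally show "norm (pker1 (z - (y, 0)) * g y) \<le> norm (1 / poisson_mass TYPE('a) / snd z ^ DIM('a) * \<bar>g y\<bar>)" .
    qed
  qed measurable
qed

text \<open>Jensen's inequality for the probability density \<open>pker1\<close> reduces the claim
  to the integrable function \<open>\<bar>f\<bar> ^ p\<close>, for which boundedness of the kernel
  at a positive height is enough.\<close>

lemma pker1_integrable_of_power:
  fixes f :: "'a::euclidean_space \<Rightarrow> real"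
  assumes f: "f \<in> borel_measurable borel" "integrable lborel (\<lambda>y. \<bar>f y\<bar> ^ p)" and p: "p \<ge> 1" and z: "snd z > 0"
  shows "integrable lborel (\<lambda>y. pker1 (z - (y, 0)) * \<bar>f y\<bar>)"
proof -
  have [measurable]: "f \<in> borel_measurable borel" by (rule f)
  have "(\<integral>\<^sup>+y. ennreal (pker1 (z - (y, 0)) * \<bar>f y\<bar>) \<partial>lborel) ^ p \<le> (\<integral>\<^sup>+y. ennreal (pker1 (z - (y, 0)) * \<bar>f y\<bar> ^ p) \<partial>lborel)"
    by (rule nn_integral_pker1_power[OF f(1) z p])
  also have "\<dots> < \<infinity>"
    using pker1_half_integrable_L1[OF f(2) z] z
    by (subst (asm) integrable_iff_bounded) (auto simp: abs_mult pker1_nonneg)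
  finally have "(\<integral>\<^sup>+y. ennreal (pker1 (z - (y, 0)) * \<bar>f y\<bar>) \<partial>lborel) < \<infinity>"
    using p by (auto simp: less_top[symmetric] power_eq_top_ennreal)
  then show ?thesis
    using z by (subst integrable_iff_bounded) (auto simp: abs_mult pker1_nonneg)
qed

lemma poisson_admissible_power:
  fixes f :: "'a::euclidean_space \<Rightarrow> real"
  assumes f: "f \<in> borel_measurable borel" "integrable lborel (\<lambda>y. \<bar>f y\<bar> ^ p)" and p: "p \<ge> 1"
  shows "poisson_admissible f"
  unfolding poisson_admissible_def
proof (intro conjI allI impI f)
  fix z :: "'a \<times> real" assume z: "snd z > 0"
  have "integrable lborel (\<lambda>y. poisson_mass TYPE('a) / snd z * (pker1 (z - (y, 0)) * \<bar>f y\<bar>))"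
    by (intro integrable_mult_right pker1_integrable_of_power[OF f p z])
  then show "integrable lborel (\<lambda>y. \<bar>f y\<bar> / norm (z - (y, 0)) ^ (DIM('a) + 1))"
    using z poisson_mass_pos[where 'a='a] by (simp add: pker1_def pkern_def)
qed

lemma half_conv_pker1_nn:
  fixes f :: "'a::euclidean_space \<Rightarrow> real"
  assumes f: "poisson_admissible f" and z: "snd z > 0" and nn: "\<And>y. f y \<ge> 0"
  shows "(\<integral>\<^sup>+y. ennreal (pker1 (z - (y, 0)) * f y) \<partial>lborel) = ennreal (half_conv pker1 f z)"
    and "half_conv pker1 f z \<ge> 0"
  using z nn unfolding half_conv_def
  by (intro nn_integral_eq_integral pker1_half_integrable f Bochner_Integration.integral_nonneg; auto simp: pker1_nonneg)+

lemma half_conv_pker1_abs_le: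
  fixes f :: "'a::euclidean_space \<Rightarrow> real"
  assumes z: "snd z > 0"
  shows "\<bar>half_conv pker1 f z\<bar> \<le> half_conv pker1 (\<lambda>y. \<bar>f y\<bar>) z"
proof -
  have "\<bar>half_conv pker1 f z\<bar> \<le> (LINT y|lborel. \<bar>pker1 (z - (y, 0)) * f y\<bar>)"
    unfolding half_conv_def by (rule integral_abs_bound)
  also have "\<dots> = half_conv pker1 (\<lambda>y. \<bar>f y\<bar>) z"
    unfolding half_conv_def using z by (intro Bochner_Integration.integral_cong) (auto simp: abs_mult pker1_nonneg)
  finally show ?thesis .
qed

lemma half_conv_pker1_power_le:
  fixes f :: "'a::euclidean_space \<Rightarrow> real"
  assumes f: "f \<in> borel_measurable borel" "integrable lborel (\<lambda>y. \<bar>f y\<bar> ^ p)" and p: "p \<ge> 1" and z: "snd z > 0"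
  shows "half_conv pker1 (\<lambda>y. \<bar>f y\<bar>) z ^ p \<le> half_conv pker1 (\<lambda>y. \<bar>f y\<bar> ^ p) z"
proof -
  have fm [measurable]: "f \<in> borel_measurable borel" by (rule f)
  have a1: "poisson_admissible (\<lambda>y. \<bar>f y\<bar>)" by (intro poisson_admissible_abs poisson_admissible_power[OF f p])
  have a2: "poisson_admissible (\<lambda>y. \<bar>f y\<bar> ^ p)" by (rule poisson_admissible_power[of _ 1]) (use f in auto)
  have "ennreal (half_conv pker1 (\<lambda>y. \<bar>f y\<bar>) z) ^ p \<le> ennreal (half_conv pker1 (\<lambda>y. \<bar>f y\<bar> ^ p) z)"
    using nn_integral_pker1_power[OF fm z p] by (simp add: half_conv_pker1_nn[OF a1 z] half_conv_pker1_nn[OF a2 z])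
  then show ?thesis
    using half_conv_pker1_nn(2)[OF a1 z] half_conv_pker1_nn(2)[OF a2 z] by (simp add: ennreal_power)
qed

lemma half_conv_pker1_L1_bound:
  fixes g :: "'a::euclidean_space \<Rightarrow> real"
  assumes g: "integrable lborel g" and nn: "\<And>y. g y \<ge> 0" and z: "snd z > 0"
  shows "half_conv pker1 g z \<le> 1 / poisson_mass TYPE('a) / snd z ^ DIM('a) * (LINT y|lborel. g y)"
  unfolding half_conv_def integral_mult_right_zero[symmetric]
proof (intro integral_mono pker1_half_integrable_L1 integrable_mult_right g z)
  fix y :: 'a
  show "pker1 (z - (y, 0)) * g y \<le> 1 / poisson_mass TYPE('a) / snd z ^ DIM('a) * g y"
    using pker1_le_height[of "z - (y, 0)"] z nn by (intro mult_right_mono) auto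
qed

lemma half_conv_measurable:
  fixes f :: "'a::euclidean_space \<Rightarrow> real"
  assumes [measurable]: "k \<in> borel_measurable borel" "f \<in> borel_measurable borel"
  shows "half_conv k f \<in> borel_measurable borel"
proof -
  have [measurable]: "(\<lambda>p :: ('a \<times> real) \<times> 'a. fst p - (snd p, 0)) \<in> borel_measurable (borel \<Otimes>\<^sub>M borel)"
    unfolding borel_prod by (intro borel_measurable_continuous_onI continuous_intros)
  have "(\<lambda>z. LINT y|lborel. (\<lambda>p. k (fst p - (snd p, 0)) * f (snd p)) (z, y)) \<in> borel_measurable borel"
    by (intro lborel.borel_measurable_lebesgue_integral) (simp add: split_beta')
  then show ?thesis by (simp add: half_conv_def [abs_def])
qed

lemma half_conv_pker1_measurable [measurable]:
  "f \<in> borel_measurable borel \<Longrightarrow> half_conv pker1 f \<in> borel_measurable borel"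
  by (rule half_conv_measurable[OF pker1_measurable])

lemma half_slice_measurable [measurable]:
  "(\<lambda>x. (x, t)) \<in> borel_measurable borel" for t :: real
  by (intro borel_measurable_continuous_onI continuous_intros)

text \<open>Contractivity on \<open>L^p\<close>: Jensen's inequality pointwise in \<open>x\<close>,
  then Tonelli, the kernel having mass one in either variable. Written with nonnegative integrals,
  the statement is trivial when the right-hand side is infinite.\<close>

lemma half_conv_pker1_slice:
  fixes f :: "'a::euclidean_space \<Rightarrow> real"
  assumes fm [measurable]: "f \<in> borel_measurable borel" and p: "p \<ge> 1" and t: "t > 0"
  shows "(\<integral>\<^sup>+x. ennreal (\<bar>half_conv pker1 f (x, t)\<bar> ^ p) \<partial>lborel) \<le> (\<integral>\<^sup>+y. ennreal (\<bar>f y\<bar> ^ p) \<partial>lborel)"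
proof (cases "(\<integral>\<^sup>+y. ennreal (\<bar>f y\<bar> ^ p) \<partial>lborel) < \<infinity>")
  case True
  then have f: "integrable lborel (\<lambda>y. \<bar>f y\<bar> ^ p)" by (simp add: integrable_iff_bounded)
  have a2: "poisson_admissible (\<lambda>y. \<bar>f y\<bar> ^ p)" by (rule poisson_admissible_power[of _ 1]) (use f in auto)
  have [measurable]: "(\<lambda>p :: 'a \<times> 'a. (fst p - snd p, t)) \<in> borel_measurable (borel \<Otimes>\<^sub>M borel)"
    unfolding borel_prod by (intro borel_measurable_continuous_onI continuous_intros)
  have "(\<integral>\<^sup>+x. ennreal (\<bar>half_conv pker1 f (x, t)\<bar> ^ p) \<partial>lborel) \<le> (\<integral>\<^sup>+x. (\<integral>\<^sup>+y. ennreal (pker1 (x - y, t) * \<bar>f y\<bar> ^ p) \<partial>lborel) \<partial>lborel)"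
  proof (intro nn_integral_mono)
    fix x :: 'a
    have z: "snd (x, t) > 0" using t by simp
    have "\<bar>half_conv pker1 f (x, t)\<bar> ^ p \<le> half_conv pker1 (\<lambda>y. \<bar>f y\<bar>) (x, t) ^ p"
      by (intro power_mono half_conv_pker1_abs_le z) auto
    also have "\<dots> \<le> half_conv pker1 (\<lambda>y. \<bar>f y\<bar> ^ p) (x, t)" by (rule half_conv_pker1_power_le[OF fm f p z])
    finally show "ennreal (\<bar>half_conv pker1 f (x, t)\<bar> ^ p) \<le> (\<integral>\<^sup>+y. ennreal (pker1 (x - y, t) * \<bar>f y\<bar> ^ p) \<partial>lborel)"
      using half_conv_pker1_nn(1)[OF a2 z] by (simp add: ennreal_leI)
  qed
  also have "\<dots> = (\<integral>\<^sup>+x. (\<integral>\<^sup>+y. (\<lambda>q. ennreal (pker1 (fst q - snd q, t) * \<bar>f (snd q)\<bar> ^ p)) (x, y) \<partial>lborel) \<partial>lborel)"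
    by simp
  also have "\<dots> = (\<integral>\<^sup>+y. (\<integral>\<^sup>+x. ennreal (pker1 (x - y, t) * \<bar>f y\<bar> ^ p) \<partial>lborel) \<partial>lborel)"
    by (subst lborel_pair.Fubini') (simp_all add: split_beta')
  also have "\<dots> = (\<integral>\<^sup>+y. ennreal (\<bar>f y\<bar> ^ p) \<partial>lborel)"
  proof (intro nn_integral_cong)
    fix y :: 'a
    have [measurable]: "(\<lambda>x. (x - y, t)) \<in> borel_measurable borel"
      by (intro borel_measurable_continuous_onI continuous_intros)
    have "(\<integral>\<^sup>+x. ennreal (pker1 (x - y, t) * \<bar>f y\<bar> ^ p) \<partial>lborel) = (\<integral>\<^sup>+x. ennreal (pker1 (x - y, t)) * ennreal (\<bar>f y\<bar> ^ p) \<partial>lborel)"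
      using t by (intro nn_integral_cong ennreal_mult) (auto simp: pker1_nonneg)
    also have "\<dots> = ennreal (\<bar>f y\<bar> ^ p)"
      using t by (subst nn_integral_multc) (auto simp: nn_integral_pker1')
    finally show "(\<integral>\<^sup>+x. ennreal (pker1 (x - y, t) * \<bar>f y\<bar> ^ p) \<partial>lborel) = ennreal (\<bar>f y\<bar> ^ p)" .
  qed
  finally show ?thesis .
qed (auto simp: not_less top_unique)

section \<open>Derivatives of the Poisson extension\<close>

text \<open>The mass of \<open>g\<close> outside a large ball is small, and there the kernel is
  bounded because the shift keeps the height above \<open>e\<close>. For mass inside the ball the
  kernel itself is small, since \<open>z\<close> is far away.\<close>

lemma half_conv_pker1_shift_vanishing:
  fixes g :: "'a::euclidean_space \<Rightarrow> real"
  assumes g: "integrable lborel g" and nn: "\<And>y. g y \<ge> 0" and e: "e > 0"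
  shows "vanishing (\<lambda>z. half_conv pker1 g (z + (0, e)))"
  unfolding vanishing_def
proof (intro allI impI)
  fix \<delta> :: real assume \<delta>: "\<delta> > 0"
  have [measurable]: "g \<in> borel_measurable borel" using g by auto
  define c where "c = 1 / poisson_mass TYPE('a)"
  have c: "c > 0" using poisson_mass_pos[where 'a='a] by (simp add: c_def)
  define I where "I = (LINT y|lborel. g y)"
  have I0: "I \<ge> 0" unfolding I_def by (intro Bochner_Integration.integral_nonneg nn)
  have "(\<lambda>R. LINT y|lborel. indicator {y. norm y \<ge> real R} y * g y) \<longlonglongrightarrow> (LINT y|(lborel::'a measure). 0)"
  proof (rule integral_dominated_convergence[where w=g])
    show "AE y in lborel. (\<lambda>R. indicator {y. norm y \<ge> real R} y * g y) \<longlonglongrightarrow> 0"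
    proof (rule AE_I2)
      fix y :: 'a
      obtain N where N: "norm y < real N" using reals_Archimedean2 by blast
      have "\<forall>\<^sub>F R in sequentially. indicator {y. norm y \<ge> real R} y * g y = 0"
        using eventually_ge_at_top[of N] by eventually_elim (use N in \<open>auto simp: indicator_def\<close>)
      then show "(\<lambda>R. indicator {y. norm y \<ge> real R} y * g y) \<longlonglongrightarrow> 0" by (rule tendsto_eventually)
    qed
  qed (use g nn in \<open>auto simp: indicator_def\<close>)
  then have lim: "(\<lambda>R. LINT y|lborel. indicator {y. norm y \<ge> real R} y * g y) \<longlonglongrightarrow> 0" by simp
  have "\<delta> / 2 * e ^ DIM('a) / c > 0" using \<delta> e c by simp
  from order_tendstoD(2)[OF lim this] obtain R where
    R: "(LINT y|lborel. indicator {y. norm y \<ge> real R} y * g y) < \<delta> / 2 * e ^ DIM('a) / c"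
    by (auto simp: eventually_sequentially)
  define g1 where "g1 = (\<lambda>y. indicator {y. norm y \<ge> real R} y * g y)"
  have g1: "integrable lborel g1" unfolding g1_def
    by (rule Bochner_Integration.integrable_bound[OF g]) (auto simp: indicator_def)
  define Q where "Q = max 1 (2 * c * I / \<delta>)"
  have Q: "Q \<ge> 1" "2 * c * I / \<delta> \<le> Q" by (auto simp: Q_def)
  show "\<exists>L. \<forall>z. 0 \<le> snd z \<longrightarrow> L \<le> norm z \<longrightarrow> \<bar>half_conv pker1 g (z + (0, e))\<bar> \<le> \<delta>"
  proof (intro exI[of _ "real R + Q + e"] allI impI)
    fix z0 :: "'a \<times> real" assume z0: "0 \<le> snd z0" "real R + Q + e \<le> norm z0"
    define z where "z = z0 + (0, e)"
    have sz: "snd z \<ge> e" "snd z > 0" using z0 e by (auto simp: z_def)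
    have "norm (0::'a, e) = e" using e by simp
    then have nz: "norm z \<ge> real R + Q" using z0(2) norm_diff_ineq[of z0 "(0, e)"] unfolding z_def by linarith
    have bd: "pker1 (z - (y, 0)) * g y \<le> c / e ^ DIM('a) * g1 y + c / Q * g y" for y
    proof (cases "norm y < real R")
      case True
      have "norm (y, 0::real) = norm y" by simp
      then have nzy: "norm (z - (y, 0)) \<ge> Q" using nz True norm_triangle_ineq2[of z "(y, 0)"] by linarith
      have "pker1 (z - (y, 0)) \<le> c / norm (z - (y, 0)) ^ DIM('a)"
        using pker1_le[of "z - (y, 0)"] sz by (simp add: c_def)
      also have "\<dots> \<le> c / Q"
      proof -
        have "Q ^ 1 \<le> norm (z - (y, 0)) ^ DIM('a)"
          using nzy Q by (intro order_trans[OF power_increasing[of 1 "DIM('a)" Q] power_mono]) (auto simp: Suc_leI)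
        then show ?thesis using Q c nzy by (intro divide_left_mono mult_pos_pos zero_less_power) auto
      qed
      finally have "pker1 (z - (y, 0)) * g y \<le> c / Q * g y" by (intro mult_right_mono nn)
      then show ?thesis using True by (simp add: g1_def)
    next
      case False
      have "pker1 (z - (y, 0)) \<le> c / snd z ^ DIM('a)"
        using pker1_le_height[of "z - (y, 0)"] sz by (simp add: c_def)
      also have "\<dots> \<le> c / e ^ DIM('a)"
        using sz e c by (intro divide_left_mono power_mono mult_pos_pos zero_less_power) auto
      finally have "pker1 (z - (y, 0)) * g y \<le> c / e ^ DIM('a) * g y" by (intro mult_right_mono nn)
      moreover have "0 \<le> c / Q * g y" using c Q nn[of y] by simp
      ultimately show ?thesis using False by (simp add: g1_def)
    qed
    have "half_conv pker1 g z \<le> (LINT y|lborel. c / e ^ DIM('a) * g1 y + c / Q * g y)"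
      unfolding half_conv_def
      by (intro integral_mono pker1_half_integrable_L1 g sz Bochner_Integration.integrable_add integrable_mult_right g1 bd)
    also have "\<dots> = c / e ^ DIM('a) * (LINT y|lborel. g1 y) + c / Q * I"
      using g g1 by (simp add: I_def)
    also have "\<dots> \<le> \<delta> / 2 + \<delta> / 2"
    proof (rule add_mono)
      have "c / e ^ DIM('a) * (LINT y|lborel. g1 y) \<le> c / e ^ DIM('a) * (\<delta> / 2 * e ^ DIM('a) / c)"
        using R c e by (intro mult_left_mono) (auto simp: g1_def)
      then show "c / e ^ DIM('a) * (LINT y|lborel. g1 y) \<le> \<delta> / 2" using c e by simp
      have "2 * c * I \<le> Q * \<delta>" using Q \<delta> by (simp add: field_simps)
      then show "c / Q * I \<le> \<delta> / 2" using Q by (simp add: field_simps)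
    qed
    finally have "half_conv pker1 g z \<le> \<delta>" by simp
    moreover have "half_conv pker1 g z \<ge> 0"
      unfolding half_conv_def using sz nn by (intro Bochner_Integration.integral_nonneg mult_nonneg_nonneg pker1_nonneg) auto
    ultimately show "\<bar>half_conv pker1 g (z0 + (0, e))\<bar> \<le> \<delta>" by (simp add: z_def)
  qed
qed

text \<open>Each unit of degree beyond that of the Poisson kernel costs one factor of the inverse
  height. For a first derivative this is the gradient estimate
  \<open>poisson_grad_bound\<close>.\<close>

lemma hom_kernel_half_conv_bound:
  fixes k :: "'a::euclidean_space \<times> real \<Rightarrow> real"
  assumes k: "hom_kernel j k" and j: "j \<ge> DIM('a) + 1"
  shows "\<exists>C\<ge>0. \<forall>f z. poisson_admissible f \<longrightarrow> snd z > 0 \<longrightarrow>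
     \<bar>half_conv k f z\<bar> \<le> C / snd z ^ (j - DIM('a)) * half_conv pker1 (\<lambda>y. \<bar>f y\<bar>) z"
proof -
  obtain C where C: "C \<ge> 0" "\<And>z. z \<noteq> 0 \<Longrightarrow> \<bar>k z\<bar> \<le> C / norm z ^ j"
    using hom_kernel_bound[OF k] by blast
  have mp: "poisson_mass TYPE('a) > 0" by (rule poisson_mass_pos)
  show ?thesis
  proof (intro exI[of _ "C * poisson_mass TYPE('a)"] conjI allI impI)
    fix f :: "'a \<Rightarrow> real" and z :: "'a \<times> real"
    assume f: "poisson_admissible f" and z: "snd z > 0"
    have i1: "integrable lborel (\<lambda>y. k (z - (y, 0)) * f y)" by (rule hom_kernel_half_integrable[OF k j f z])
    have i2: "integrable lborel (\<lambda>y. pker1 (z - (y, 0)) * \<bar>f y\<bar>)"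
      by (intro pker1_half_integrable poisson_admissible_abs f z)
    have "\<bar>half_conv k f z\<bar> \<le> (LINT y|lborel. C * poisson_mass TYPE('a) / snd z ^ (j - DIM('a)) * (pker1 (z - (y, 0)) * \<bar>f y\<bar>))"
      unfolding half_conv_def
    proof (intro integral_abs_bound_integral i1 integrable_mult_right i2)
      fix y :: 'a
      have nz: "z - (y, 0) \<noteq> 0" using norm_half_ge[of z y] z by auto
      have jj: "j - DIM('a) = Suc (j - (DIM('a) + 1))" using j by simp
      have "\<bar>k (z - (y, 0))\<bar> \<le> C / snd z ^ (j - (DIM('a) + 1)) / norm (z - (y, 0)) ^ (DIM('a) + 1)"
        using C(2)[OF nz] half_power_bound[OF z j C(1), of y] by linarith
      also have "\<dots> = C * poisson_mass TYPE('a) / snd z ^ (j - DIM('a)) * pker1 (z - (y, 0))"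
        unfolding jj using z mp by (simp add: pker1_def pkern_def)
      finally have "\<bar>k (z - (y, 0))\<bar> * \<bar>f y\<bar> \<le> C * poisson_mass TYPE('a) / snd z ^ (j - DIM('a)) * pker1 (z - (y, 0)) * \<bar>f y\<bar>"
        by (intro mult_right_mono) auto
      then show "\<bar>k (z - (y, 0)) * f y\<bar> \<le> C * poisson_mass TYPE('a) / snd z ^ (j - DIM('a)) * (pker1 (z - (y, 0)) * \<bar>f y\<bar>)"
        by (simp add: abs_mult mult.assoc)
    qed
    also have "\<dots> = C * poisson_mass TYPE('a) / snd z ^ (j - DIM('a)) * half_conv pker1 (\<lambda>y. \<bar>f y\<bar>) z"
      by (simp add: half_conv_def)
    finally show "\<bar>half_conv k f z\<bar> \<le> C * poisson_mass TYPE('a) / snd z ^ (j - DIM('a)) * half_conv pker1 (\<lambda>y. \<bar>f y\<bar>) z" .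
  qed (use C mp in auto)
qed

lemma partial_deriv_cong_open:
  assumes "open S" "z \<in> S" "\<And>w. w \<in> S \<Longrightarrow> f w = g w" "(f has_derivative D) (at z)"
  shows "partial_deriv b f z = partial_deriv b g z"
  using partial_deriv_eq[OF assms(4)] partial_deriv_eq[OF has_derivative_transform_within_open[OF assms(4,1,2)]] assms(3)
  by metis

text \<open>Away from \<open>0\<close> the partial derivatives commute, so the Laplacian of a
  derivative of \<open>pkern\<close> is the derivative of the zero function.\<close>

lemma pkern_gradient_laplacian:
  fixes z :: "'a::euclidean_space \<times> real"
  assumes z: "z \<noteq> 0" and b: "b \<in> Basis"
  shows "(\<Sum>c\<in>Basis. partial_deriv c (partial_deriv c (partial_deriv b pkern)) z) = 0"
proof -
  let ?D = "\<lambda>c. partial_deriv c :: ('a \<times> real \<Rightarrow> real) \<Rightarrow> 'a \<times> real \<Rightarrow> real"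
  have o: "open (- {0 :: 'a \<times> real})" by auto
  note hk = hom_kernel_pkern[where 'a='a]
  note hk1 = hom_kernel_partial_deriv[OF hk]
  note hk2 = hom_kernel_partial_deriv[OF hk1]
  have "?D c (?D c (?D b pkern)) z = ?D b (?D c (?D c pkern)) z" if c: "c \<in> Basis" for c
  proof -
    have "?D c (?D c (?D b pkern)) z = ?D c (?D b (?D c pkern)) z"
      by (rule partial_deriv_cong_open[OF o _ _ hom_kernel_has_derivative[OF hk2[OF b c] z]])
        (use hom_kernel_partial_commute[OF hk c b] z in auto)
    also have "\<dots> = ?D b (?D c (?D c pkern)) z"
      using hom_kernel_partial_commute[OF hk1[OF c] c b z] .
    finally show ?thesis .
  qed
  then have "(\<Sum>c\<in>Basis. ?D c (?D c (?D b pkern)) z) = (\<Sum>c\<in>Basis. ?D b (?D c (?D c pkern)) z)" by simp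
  also have "\<dots> = ?D b (\<lambda>w. \<Sum>c\<in>Basis. ?D c (?D c pkern) w) z"
  proof -
    have "((\<lambda>w. \<Sum>c\<in>Basis. ?D c (?D c pkern) w) has_derivative
       (\<lambda>h. \<Sum>c\<in>Basis. \<Sum>e\<in>Basis. (h \<bullet> e) * ?D e (?D c (?D c pkern)) z)) (at z)"
      by (intro has_derivative_sum hom_kernel_has_derivative[OF hk2 z]) auto
    from partial_deriv_eq[OF this, of b]
    have "?D b (\<lambda>w. \<Sum>c\<in>Basis. ?D c (?D c pkern) w) z = (\<Sum>c\<in>Basis. \<Sum>e\<in>Basis. (b \<bullet> e) * ?D e (?D c (?D c pkern)) z)" .
    moreover have "(\<Sum>e\<in>Basis. (b \<bullet> e) * F e) = F b" for F :: "'a \<times> real \<Rightarrow> real"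
    proof -
      have "(\<Sum>e\<in>Basis. (b \<bullet> e) * F e) = (\<Sum>e\<in>Basis. if e = b then F e else 0)"
        using b by (intro sum.cong) (auto simp: inner_Basis)
      then show ?thesis using b by simp
    qed
    ultimately show ?thesis by simp
  qed
  also have "\<dots> = ?D b (\<lambda>w. 0) z"
    by (rule partial_deriv_cong_open[OF o, symmetric, where D="\<lambda>_. 0"]) (use z pkern_laplacian in auto)
  also have "\<dots> = 0" by (rule partial_deriv_eq) auto
  finally show ?thesis .
qed

lemma dir_C2_shift:
  assumes "dir_C2 g G1 G2" "e \<ge> 0"
  shows "dir_C2 (\<lambda>z. g (z + (0, e))) (\<lambda>b z. G1 b (z + (0, e))) (\<lambda>b z. G2 b (z + (0, e)))"
  unfolding dir_C2_def
proof (intro allI impI conjI)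
  fix z b :: "'a \<times> real" assume z: "snd z > 0" and b: "b \<in> Basis"
  have z': "snd (z + (0, e)) > 0" using z assms(2) by simp
  have eq: "z + s *\<^sub>R b + (0, e) = z + (0, e) + s *\<^sub>R b" for s by simp
  show "((\<lambda>s. g (z + s *\<^sub>R b + (0, e))) has_real_derivative G1 b (z + (0, e))) (at 0)"
    "((\<lambda>s. G1 b (z + s *\<^sub>R b + (0, e))) has_real_derivative G2 b (z + (0, e))) (at 0)"
    unfolding eq by (rule dir_C2D[OF assms(1) z' b])+
qed

text \<open>The derivative is put on the kernel, which makes sense for every admissible
  \<open>f\<close>. The index \<open>(i, 0)\<close> gives a tangential derivative and
  \<open>(0, 1)\<close> the vertical one; the normalisation is that of \<open>pkern\<close>.\<close>

definition poisson_grad :: "'a \<times> real \<Rightarrow> ('a::euclidean_space \<Rightarrow> real) \<Rightarrow> 'a \<times> real \<Rightarrow> real" where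
  "poisson_grad b f = half_conv (partial_deriv b pkern) f"

lemma poisson_grad_has_derivative:
  fixes f :: "'a::euclidean_space \<Rightarrow> real"
  assumes f: "poisson_admissible f" and b: "b \<in> Basis" and z: "snd z > 0"
  shows "(poisson_grad b f has_derivative (\<lambda>h. \<Sum>c\<in>Basis. (h \<bullet> c) * half_conv (partial_deriv c (partial_deriv b pkern)) f z)) (at z)"
  unfolding poisson_grad_def
  by (intro half_conv_hom_has_derivative[OF hom_kernel_partial_deriv[OF hom_kernel_pkern b] _ f z]) simp

lemma poisson_grad_dir_C2:
  fixes f :: "'a::euclidean_space \<Rightarrow> real"
  assumes f: "poisson_admissible f" and b: "b \<in> Basis"
  shows "dir_C2 (poisson_grad b f) (\<lambda>c. half_conv (partial_deriv c (partial_deriv b pkern)) f)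
     (\<lambda>c. half_conv (partial_deriv c (partial_deriv c (partial_deriv b pkern))) f)"
  unfolding dir_C2_def
proof (intro allI impI conjI)
  fix z c :: "'a \<times> real" assume z: "snd z > 0" and c: "c \<in> Basis"
  show "((\<lambda>s. poisson_grad b f (z + s *\<^sub>R c)) has_real_derivative half_conv (partial_deriv c (partial_deriv b pkern)) f z) (at 0)"
    by (rule has_derivative_imp_directional[OF poisson_grad_has_derivative[OF f b z] c])
  show "((\<lambda>s. half_conv (partial_deriv c (partial_deriv b pkern)) f (z + s *\<^sub>R c)) has_real_derivative
      half_conv (partial_deriv c (partial_deriv c (partial_deriv b pkern))) f z) (at 0)"
    by (rule has_derivative_imp_directional[OF half_conv_hom_has_derivative[OF
        hom_kernel_partial_deriv[OF hom_kernel_partial_deriv[OF hom_kernel_pkern b] c] _ f z] c]) simp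
qed

lemma poisson_grad_harmonic:
  fixes f :: "'a::euclidean_space \<Rightarrow> real"
  assumes f: "poisson_admissible f" and b: "b \<in> Basis" and z: "snd z > 0"
  shows "(\<Sum>c\<in>Basis. half_conv (partial_deriv c (partial_deriv c (partial_deriv b pkern))) f z) = 0"
proof -
  have "(\<Sum>c\<in>Basis. half_conv (partial_deriv c (partial_deriv c (partial_deriv b pkern))) f z) =
      (LINT y|lborel. (\<Sum>c\<in>Basis. partial_deriv c (partial_deriv c (partial_deriv b pkern)) (z - (y, 0)) * f y))"
    unfolding half_conv_def
    by (intro Bochner_Integration.integral_sum[symmetric] hom_kernel_half_integrable[OF
         hom_kernel_partial_deriv[OF hom_kernel_partial_deriv[OF hom_kernel_partial_deriv[OF hom_kernel_pkern b]]] _ f z]) auto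
  also have "\<dots> = (LINT y|(lborel :: 'a measure). 0)"
  proof (rule Bochner_Integration.integral_cong[OF refl])
    fix y :: 'a
    have "z - (y, 0) \<noteq> 0" using z by (auto simp: prod_eq_iff)
    from pkern_gradient_laplacian[OF this b]
    show "(\<Sum>c\<in>Basis. partial_deriv c (partial_deriv c (partial_deriv b pkern)) (z - (y, 0)) * f y) = 0"
      by (simp flip: sum_distrib_right)
  qed
  finally show ?thesis by simp
qed

lemma poisson_grad_symmetric:
  assumes "b \<in> Basis" "c \<in> Basis" "snd z > 0"
  shows "half_conv (partial_deriv c (partial_deriv b pkern)) f z = half_conv (partial_deriv b (partial_deriv c pkern)) f z"
  using hom_kernel_partial_commute[OF hom_kernel_pkern assms(2,1)] assms(3) by (intro half_conv_cong_nonzero) auto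

lemma poisson_grad_bound:
  fixes b :: "'a::euclidean_space \<times> real"
  assumes b: "b \<in> Basis"
  shows "\<exists>C\<ge>0. \<forall>f z. poisson_admissible f \<longrightarrow> snd z > 0 \<longrightarrow>
     \<bar>poisson_grad b f z\<bar> \<le> C / snd z * half_conv pker1 (\<lambda>y. \<bar>f y\<bar>) z"
  using hom_kernel_half_conv_bound[OF hom_kernel_partial_deriv[OF hom_kernel_pkern b]] by (simp add: poisson_grad_def)

lemma continuous_on_poisson_grad:
  assumes "poisson_admissible f" "b \<in> Basis" "\<And>z. z \<in> S \<Longrightarrow> snd z > 0"
  shows "continuous_on S (poisson_grad b f)"
  using poisson_grad_has_derivative[OF assms(1,2)] assms(3)
  by (meson continuous_at_imp_continuous_on has_derivative_continuous)

lemma power_vanishing: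
  assumes "vanishing (\<lambda>z. g z ^ p)" "p \<ge> 1"
  shows "vanishing g"
  unfolding vanishing_def
proof (intro allI impI)
  fix \<delta> :: real assume "\<delta> > 0"
  then have "\<delta> ^ p > 0" by simp
  then obtain L where L: "\<And>z. snd z \<ge> 0 \<Longrightarrow> norm z \<ge> L \<Longrightarrow> \<bar>g z ^ p\<bar> \<le> \<delta> ^ p"
    using assms(1) unfolding vanishing_def by blast
  have "\<bar>g z\<bar> \<le> \<delta>" if "snd z \<ge> 0" "norm z \<ge> L" for z
    using L[OF that] \<open>\<delta> > 0\<close> assms(2) power_le_imp_le_base[of "\<bar>g z\<bar>" "p - 1" \<delta>] by (simp add: power_abs)
  then show "\<exists>L. \<forall>z. 0 \<le> snd z \<longrightarrow> L \<le> norm z \<longrightarrow> \<bar>g z\<bar> \<le> \<delta>" by blast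
qed

lemma vanishing_bound:
  assumes "vanishing g" and "\<And>z. snd z \<ge> 0 \<Longrightarrow> \<bar>h z\<bar> \<le> C * \<bar>g z\<bar>"
  shows "vanishing h"
  unfolding vanishing_def
proof (intro allI impI)
  fix \<delta> :: real assume d: "\<delta> > 0"
  define D where "D = max C 1"
  have D: "D \<ge> C" "D > 0" by (auto simp: D_def)
  have "\<delta> / D > 0" using d D by simp
  then obtain L where L: "\<And>z. snd z \<ge> 0 \<Longrightarrow> norm z \<ge> L \<Longrightarrow> \<bar>g z\<bar> \<le> \<delta> / D"
    using assms(1) unfolding vanishing_def by blast
  have "\<bar>h z\<bar> \<le> \<delta>" if "snd z \<ge> 0" "norm z \<ge> L" for z
  proof -
    have "\<bar>h z\<bar> \<le> C * \<bar>g z\<bar>" by (rule assms(2)[OF that(1)])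
    also have "\<dots> \<le> D * (\<delta> / D)" using D L[OF that] by (intro mult_mono) auto
    finally show ?thesis using D by simp
  qed
  then show "\<exists>L. \<forall>z. 0 \<le> snd z \<longrightarrow> L \<le> norm z \<longrightarrow> \<bar>h z\<bar> \<le> \<delta>" by blast
qed

text \<open>Jensen's inequality bounds the \<open>p\<close>-th power of the Poisson integral of
  \<open>\<bar>f\<bar>\<close> by that of the integrable function \<open>\<bar>f\<bar> ^ p\<close>,
  which vanishes at infinity. The gradient estimate transfers this to the derivative, as the height
  stays above \<open>e\<close>.\<close>

lemma poisson_grad_vanishing:
  fixes f :: "'a::euclidean_space \<Rightarrow> real"
  assumes f: "f \<in> borel_measurable borel" "integrable lborel (\<lambda>y. \<bar>f y\<bar> ^ p)" and p: "p \<ge> 1"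
    and b: "b \<in> Basis" and e: "e > 0"
  shows "vanishing (\<lambda>z. poisson_grad b f (z + (0, e)))"
proof -
  have adm: "poisson_admissible f" by (rule poisson_admissible_power[OF f p])
  obtain C where C: "C \<ge> 0" "\<And>z. snd z > 0 \<Longrightarrow> \<bar>poisson_grad b f z\<bar> \<le> C / snd z * half_conv pker1 (\<lambda>y. \<bar>f y\<bar>) z"
    using poisson_grad_bound[OF b] adm by blast
  have "vanishing (\<lambda>z. half_conv pker1 (\<lambda>y. \<bar>f y\<bar> ^ p) (z + (0, e)))"
    by (rule half_conv_pker1_shift_vanishing[OF f(2) _ e]) auto
  then have "vanishing (\<lambda>z. half_conv pker1 (\<lambda>y. \<bar>f y\<bar>) (z + (0, e)) ^ p)"
  proof (rule vanishing_bound[where C=1])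
    fix z :: "'a \<times> real" assume "snd z \<ge> 0"
    then have z: "snd (z + (0, e)) > 0" using e by simp
    show "\<bar>half_conv pker1 (\<lambda>y. \<bar>f y\<bar>) (z + (0, e)) ^ p\<bar> \<le> 1 * \<bar>half_conv pker1 (\<lambda>y. \<bar>f y\<bar> ^ p) (z + (0, e))\<bar>"
      using half_conv_pker1_power_le[OF f p z] half_conv_pker1_nn(2)[OF poisson_admissible_abs[OF adm] z] by simp
  qed
  then have "vanishing (\<lambda>z. half_conv pker1 (\<lambda>y. \<bar>f y\<bar>) (z + (0, e)))" by (rule power_vanishing[OF _ p])
  then show ?thesis
  proof (rule vanishing_bound[where C="C / e"])
    fix z :: "'a \<times> real" assume z0: "snd z \<ge> 0"
    then have z: "snd (z + (0, e)) > 0" "snd (z + (0, e)) \<ge> e" using e by simp_all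
    have nn: "half_conv pker1 (\<lambda>y. \<bar>f y\<bar>) (z + (0, e)) \<ge> 0"
      by (rule half_conv_pker1_nn(2)[OF poisson_admissible_abs[OF adm] z(1)]) auto
    have "\<bar>poisson_grad b f (z + (0, e))\<bar> \<le> C / snd (z + (0, e)) * half_conv pker1 (\<lambda>y. \<bar>f y\<bar>) (z + (0, e))"
      by (rule C(2)[OF z(1)])
    also have "\<dots> \<le> C / e * half_conv pker1 (\<lambda>y. \<bar>f y\<bar>) (z + (0, e))"
      using z e C nn by (intro mult_right_mono divide_left_mono mult_pos_pos) auto
    finally show "\<bar>poisson_grad b f (z + (0, e))\<bar> \<le> C / e * \<bar>half_conv pker1 (\<lambda>y. \<bar>f y\<bar>) (z + (0, e))\<bar>"
      using nn by simp
  qed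
qed

text \<open>Shifted up by \<open>e\<close>, the derivative is harmonic, continuous down to the
  boundary and vanishing at infinity. By uniqueness it is the Poisson integral of its own slice at
  height \<open>e\<close>.\<close>

lemma poisson_grad_semigroup:
  fixes f :: "'a::euclidean_space \<Rightarrow> real"
  assumes f: "f \<in> borel_measurable borel" "integrable lborel (\<lambda>y. \<bar>f y\<bar> ^ p)" and p: "p \<ge> 1"
    and b: "b \<in> Basis" and e: "e > 0" and t: "t > 0"
  shows "poisson_grad b f (x, t + e) = half_conv pker1 (\<lambda>y. poisson_grad b f (y, e)) (x, t)"
proof -
  have adm: "poisson_admissible f" by (rule poisson_admissible_power[OF f p])
  have "poisson_grad b f ((x, t) + (0, e)) = half_conv pker1 (\<lambda>y. poisson_grad b f ((y, 0) + (0, e))) (x, t)"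
  proof (rule harmonic_eq_poisson[OF dir_C2_shift[OF poisson_grad_dir_C2[OF adm b]]])
    show "continuous_on {z::'a \<times> real. 0 \<le> snd z} (\<lambda>z. poisson_grad b f (z + (0, e)))"
      by (rule continuous_on_compose2[OF continuous_on_poisson_grad[OF adm b, of "{z. snd z > 0}"]])
        (use e in \<open>auto intro!: continuous_intros\<close>)
    show "vanishing (\<lambda>z. poisson_grad b f (z + (0, e)))" by (rule poisson_grad_vanishing[OF f p b e])
    show "(\<Sum>c\<in>Basis. half_conv (partial_deriv c (partial_deriv c (partial_deriv b pkern))) f (z + (0, e))) = 0" if "snd z > 0" for z
      using that e by (intro poisson_grad_harmonic adm b) simp
  qed (use e t in auto)
  then show ?thesis by simp
qed

section \<open>From bounded slices to a weak-type estimate\<close>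

lemma upper_half_space_open: "open (upper_half_space :: ('a::euclidean_space \<times> real) set)"
proof -
  have "upper_half_space = {z :: 'a \<times> real. snd z > 0}" by (auto simp: upper_half_space_def)
  moreover have "open {z :: 'a \<times> real. snd z > 0}" by (intro open_Collect_less continuous_intros)
  ultimately show ?thesis by metis
qed

lemma borel_in_hyperbolic:
  assumes "E \<in> sets borel" "E \<subseteq> upper_half_space"
  shows "E \<in> sets (hyperbolic_measure :: ('a::euclidean_space \<times> real) measure)"
proof -
  have "(upper_half_space :: ('a \<times> real) set) \<in> sets lebesgue"
    by (intro sets_completionI_sets) (simp add: borel_open upper_half_space_open)
  moreover have "E \<in> sets lebesgue" using assms(1) by (intro sets_completionI_sets) simp
  ultimately show ?thesis
    using assms(2) unfolding hyperbolic_measure_def by (auto simp: sets_restrict_space_iff)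
qed

lemma space_hyperbolic: "space hyperbolic_measure = upper_half_space"
  by (simp add: hyperbolic_measure_def space_restrict_space)

lemma borel_measurable_snd [measurable]: "(snd :: 'a::euclidean_space \<times> real \<Rightarrow> real) \<in> borel_measurable borel"
  by (intro borel_measurable_continuous_onI continuous_intros)

lemma nn_integral_hyperbolic:
  fixes h :: "'a::euclidean_space \<times> real \<Rightarrow> ennreal"
  assumes [measurable]: "h \<in> borel_measurable borel"
  shows "(\<integral>\<^sup>+z. h z \<partial>hyperbolic_measure) =
    (\<integral>\<^sup>+t. indicator {0<..} t * (\<integral>\<^sup>+x. ennreal (1 / t ^ (DIM('a) + 1)) * h (x, t) \<partial>lborel) \<partial>lborel)"
proof -
  define w where "w = (\<lambda>z::'a \<times> real. ennreal (1 / snd z ^ (DIM('a) + 1)))"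
  have w [measurable]: "w \<in> borel_measurable borel" unfolding w_def by measurable
  have S [measurable]: "(upper_half_space :: ('a \<times> real) set) \<in> sets borel"
    by (rule borel_open[OF upper_half_space_open])
  have Sl: "(upper_half_space :: ('a \<times> real) set) \<in> sets lebesgue"
    by (intro sets_completionI_sets) (simp add: borel_open upper_half_space_open)
  have wl: "w \<in> borel_measurable lebesgue" "h \<in> borel_measurable lebesgue"
    using measurable_completion[of w lborel borel] measurable_completion[of h lborel borel] by simp_all
  have eq: "hyperbolic_measure = density (lebesgue_on upper_half_space) w"
    unfolding hyperbolic_measure_def w_def by (simp add: split_beta')
  have "(\<integral>\<^sup>+z. h z \<partial>hyperbolic_measure) = (\<integral>\<^sup>+z. w z * h z \<partial>lebesgue_on upper_half_space)"
    unfolding eq by (intro nn_integral_density measurable_restrict_space1 wl)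
  also have "\<dots> = (\<integral>\<^sup>+z. w z * h z * indicator upper_half_space z \<partial>lebesgue)"
    by (subst nn_integral_restrict_space) (use Sl in auto)
  also have "\<dots> = (\<integral>\<^sup>+z. w z * h z * indicator upper_half_space z \<partial>(lborel \<Otimes>\<^sub>M lborel))"
    unfolding nn_integral_completion lborel_prod ..
  also have "\<dots> = (\<integral>\<^sup>+t. (\<integral>\<^sup>+x. w (x, t) * h (x, t) * indicator upper_half_space (x, t) \<partial>lborel) \<partial>lborel)"
    by (subst lborel_pair.nn_integral_snd[symmetric]) (auto simp: lborel_prod)
  also have "\<dots> = (\<integral>\<^sup>+t. indicator {0<..} t * (\<integral>\<^sup>+x. ennreal (1 / t ^ (DIM('a) + 1)) * h (x, t) \<partial>lborel) \<partial>lborel)"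
    by (intro nn_integral_cong) (auto simp: indicator_def upper_half_space_def w_def)
  finally show ?thesis .
qed

lemma emeasure_hyperbolic:
  fixes E :: "('a::euclidean_space \<times> real) set"
  assumes E [measurable]: "E \<in> sets borel" and sub: "E \<subseteq> upper_half_space"
  shows "emeasure hyperbolic_measure E =
    (\<integral>\<^sup>+t. indicator {0<..} t * ennreal (1 / t ^ (DIM('a) + 1)) * emeasure lborel {x. (x, t) \<in> E} \<partial>lborel)"
proof -
  have "emeasure hyperbolic_measure E = (\<integral>\<^sup>+z. indicator E z \<partial>hyperbolic_measure)"
    using borel_in_hyperbolic[OF E sub] by simp
  also have "\<dots> = (\<integral>\<^sup>+t. indicator {0<..} t * (\<integral>\<^sup>+x. ennreal (1 / t ^ (DIM('a) + 1)) * indicator E (x, t) \<partial>lborel) \<partial>lborel)"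
    by (rule nn_integral_hyperbolic) measurable
  also have "\<dots> = (\<integral>\<^sup>+t. indicator {0<..} t * ennreal (1 / t ^ (DIM('a) + 1)) * emeasure lborel {x. (x, t) \<in> E} \<partial>lborel)"
  proof (intro nn_integral_cong)
    fix t :: real
    have s: "{x. (x, t) \<in> E} \<in> sets borel"
      using measurable_sets[OF half_slice_measurable[of t] E] by (simp add: vimage_def)
    have "(\<integral>\<^sup>+x. ennreal (1 / t ^ (DIM('a) + 1)) * indicator E (x, t) \<partial>lborel) = ennreal (1 / t ^ (DIM('a) + 1)) * emeasure lborel {x. (x, t) \<in> E}"
      using s by (subst nn_integral_cmult_indicator[symmetric]) (auto simp: indicator_def)
    then show "indicator {0<..} t * (\<integral>\<^sup>+x. ennreal (1 / t ^ (DIM('a) + 1)) * indicator E (x, t) \<partial>lborel) =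
      indicator {0<..} t * ennreal (1 / t ^ (DIM('a) + 1)) * emeasure lborel {x. (x, t) \<in> E}"
      by (simp only: mult.assoc)
  qed
  finally show ?thesis .
qed

text \<open>The antiderivative tends to \<open>0\<close> at infinity because
  \<open>n \<ge> 2\<close>. The exact value has an additional factor \<open>1 / (n - 1)\<close>,
  which is dropped.\<close>

lemma nn_integral_inverse_power:
  fixes a :: real
  assumes a: "a > 0" and n: "n \<ge> 2"
  shows "(\<integral>\<^sup>+t. ennreal (1 / t ^ n) * indicator {a..} t \<partial>lborel) \<le> ennreal (1 / a ^ (n - 1))"
proof -
  obtain m where m: "n = m + 2" using n by (metis add.commute le_iff_add)
  have "(\<integral>\<^sup>+t. ennreal (1 / t ^ n) * indicator {a..} t \<partial>lborel) = ennreal (0 - (- 1 / (real (m + 1) * a ^ (m + 1))))"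
  proof (rule nn_integral_FTC_atLeast)
    show "((\<lambda>t. - 1 / (real (m + 1) * t ^ (m + 1))) has_real_derivative 1 / x ^ n) (at x)" if "a \<le> x" for x
    proof -
      have x: "x > 0" using that a by simp
      have "((\<lambda>t. - (1 / real (m + 1)) * inverse (t ^ (m + 1))) has_real_derivative 1 / x ^ n) (at x)"
        by (rule DERIV_cong[OF DERIV_cmult[OF DERIV_inverse_fun[OF DERIV_pow]]])
          (use x in \<open>simp add: m field_simps del: of_nat_Suc of_nat_add\<close>)+
      then show ?thesis by (simp add: field_simps del: of_nat_Suc of_nat_add)
    qed
    have "((\<lambda>t::real. inverse (t ^ (m + 1))) \<longlongrightarrow> 0) at_top"
      by (intro tendsto_inverse_0_at_top filterlim_pow_at_top) (auto intro: filterlim_ident)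
    from tendsto_mult_right_zero[OF this, of "- 1 / real (m + 1)"]
    show "((\<lambda>t. - 1 / (real (m + 1) * t ^ (m + 1))) \<longlongrightarrow> 0) at_top"
      by (simp add: field_simps)
  qed (use a in auto)
  also have "\<dots> \<le> ennreal (1 / a ^ (n - 1))"
  proof (rule ennreal_leI)
    have "a ^ (m + 1) \<le> real (m + 1) * a ^ (m + 1)" using a by simp
    then have "1 / (real (m + 1) * a ^ (m + 1)) \<le> 1 / a ^ (m + 1)"
      using a by (intro divide_left_mono mult_pos_pos) auto
    then show "0 - (- 1 / (real (m + 1) * a ^ (m + 1))) \<le> 1 / a ^ (n - 1)" by (simp add: m)
  qed
  finally show ?thesis .
qed

text \<open>The part of \<open>g\<close> below \<open>s / (2 t)\<close> contributes at most half of the level because the kernel has mass one; the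
  rest is handled by Chebyshev's inequality.\<close>

lemma poisson_weak_type_slice:
  fixes g :: "'a::euclidean_space \<Rightarrow> real"
  assumes g: "g \<in> borel_measurable borel" "\<And>y. g y \<ge> 0" and adm: "poisson_admissible g"
    and s: "s > 0" and t: "t > 0"
  shows "emeasure lborel {x. t * half_conv pker1 g (x, t) > s} \<le>
    ennreal (2 * t / s) * (\<integral>\<^sup>+y. ennreal (g y) * indicator {y. g y > s / (2 * t)} y \<partial>lborel)"
proof -
  have [measurable]: "g \<in> borel_measurable borel" by (rule g)
  define gt where "gt = (\<lambda>y. g y * indicator {y. g y > s / (2 * t)} y)"
  have gm [measurable]: "gt \<in> borel_measurable borel" unfolding gt_def by measurable
  have gt0: "gt y \<ge> 0" for y using g(2) by (simp add: gt_def)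
  have admt: "poisson_admissible gt"
    unfolding poisson_admissible_def
  proof (intro conjI allI impI gm)
    fix z :: "'a \<times> real" assume z: "snd z > 0"
    show "integrable lborel (\<lambda>y. \<bar>gt y\<bar> / norm (z - (y, 0)) ^ (DIM('a) + 1))"
      by (rule Bochner_Integration.integrable_bound[OF poisson_admissible_integrable[OF adm z]])
        (auto simp: gt_def indicator_def)
  qed
  have le: "half_conv pker1 g (x, t) \<le> s / (2 * t) + half_conv pker1 gt (x, t)" for x
  proof -
    have z: "snd (x, t) > 0" using t by simp
    have 1: "integrable lborel (\<lambda>y. s / (2 * t) * pker1 ((x, t) - (y, 0)))"
      using pker1_integrable(1)[OF t, of x] by simp
    have "half_conv pker1 g (x, t) \<le> (LINT y|lborel. s / (2 * t) * pker1 ((x, t) - (y, 0)) + pker1 ((x, t) - (y, 0)) * gt y)"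
      unfolding half_conv_def
    proof (intro integral_mono pker1_half_integrable adm z Bochner_Integration.integrable_add 1 admt)
      fix y
      have "g y \<le> s / (2 * t) + gt y" using s t by (auto simp: gt_def indicator_def)
      then have "pker1 ((x, t) - (y, 0)) * g y \<le> pker1 ((x, t) - (y, 0)) * (s / (2 * t) + gt y)"
        using t by (intro mult_left_mono pker1_nonneg) auto
      then show "pker1 ((x, t) - (y, 0)) * g y \<le> s / (2 * t) * pker1 ((x, t) - (y, 0)) + pker1 ((x, t) - (y, 0)) * gt y"
        by (simp add: algebra_simps)
    qed
    also have "\<dots> = s / (2 * t) + half_conv pker1 gt (x, t)"
      using 1 pker1_half_integrable[OF admt z] pker1_integrable(2)[OF t, of x]
      by (subst Bochner_Integration.integral_add) (auto simp: half_conv_def)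
    finally show ?thesis .
  qed
  have c: "2 * t / s > 0" using s t by simp
  have [measurable]: "(\<lambda>x. half_conv pker1 gt (x, t)) \<in> borel_measurable borel" by measurable
  have "emeasure lborel {x. t * half_conv pker1 g (x, t) > s} \<le>
     emeasure lborel {x \<in> space lborel. 1 \<le> ennreal (2 * t / s) * ennreal \<bar>half_conv pker1 gt (x, t)\<bar>}"
  proof (intro emeasure_mono subsetI CollectI conjI)
    fix x assume "x \<in> {x. t * half_conv pker1 g (x, t) > s}"
    then have "s < t * (s / (2 * t) + half_conv pker1 gt (x, t))"
      using le[of x] t by (smt (verit) mem_Collect_eq mult_left_mono)
    then have "s \<le> 2 * t * half_conv pker1 gt (x, t)" using s t by (simp add: field_simps)
    also have "\<dots> \<le> 2 * t * \<bar>half_conv pker1 gt (x, t)\<bar>" using t by (intro mult_left_mono) auto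
    finally have "1 \<le> 2 * t / s * \<bar>half_conv pker1 gt (x, t)\<bar>" using s by (simp add: field_simps)
    then show "1 \<le> ennreal (2 * t / s) * ennreal \<bar>half_conv pker1 gt (x, t)\<bar>"
      using c by (simp flip: ennreal_mult)
  qed auto
  also have "\<dots> \<le> ennreal (2 * t / s) * (\<integral>\<^sup>+x. ennreal \<bar>half_conv pker1 gt (x, t)\<bar> \<partial>lborel)"
    using nn_integral_Markov_inequality[where u="\<lambda>x. ennreal \<bar>half_conv pker1 gt (x, t)\<bar>" and M=lborel and A=UNIV and c="ennreal (2 * t / s)"] by simp
  also have "(\<integral>\<^sup>+x. ennreal \<bar>half_conv pker1 gt (x, t)\<bar> \<partial>lborel) \<le> (\<integral>\<^sup>+y. ennreal (g y) * indicator {y. g y > s / (2 * t)} y \<partial>lborel)"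
  proof -
    have "(\<integral>\<^sup>+x. ennreal \<bar>half_conv pker1 gt (x, t)\<bar> \<partial>lborel) \<le> (\<integral>\<^sup>+y. ennreal \<bar>gt y\<bar> \<partial>lborel)"
      using half_conv_pker1_slice[OF gm order_refl t] by simp
    also have "\<dots> = (\<integral>\<^sup>+y. ennreal (g y) * indicator {y. g y > s / (2 * t)} y \<partial>lborel)"
      using g(2) by (intro nn_integral_cong) (auto simp: gt_def indicator_def)
    finally show ?thesis .
  qed
  finally show ?thesis by (simp add: mult_left_mono)
qed

lemma nn_integral_cmult2:
  assumes "h \<in> borel_measurable M"
  shows "(a::ennreal) * (b * (\<integral>\<^sup>+y. h y \<partial>M)) = (\<integral>\<^sup>+y. a * (b * h y) \<partial>M)"
  using assms by (simp add: nn_integral_cmult)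

text \<open>The slice estimate is integrated over the height. By Tonelli, each \<open>y\<close>
  contributes \<open>g y\<close> times the integral of \<open>1 / t ^ n\<close> over
  \<open>t > s / (2 * g y)\<close>, which is of order \<open>(g y / s) ^ (n - 1)\<close>; together
  with the factor \<open>2 / s\<close> this is exactly the \<open>n\<close>-th power.\<close>

lemma poisson_weak_type:
  fixes g :: "'a::euclidean_space \<Rightarrow> real"
  assumes n: "DIM('a) \<ge> 2" and g: "g \<in> borel_measurable borel" "\<And>y. g y \<ge> 0" and adm: "poisson_admissible g"
    and s: "s > 0"
  shows "(\<integral>\<^sup>+t. indicator {0<..} t * ennreal (1 / t ^ (DIM('a) + 1)) * emeasure lborel {x. t * half_conv pker1 g (x, t) > s} \<partial>lborel)
     \<le> ennreal ((2 / s) ^ DIM('a)) * (\<integral>\<^sup>+y. ennreal (g y ^ DIM('a)) \<partial>lborel)"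
proof -
  let ?n = "DIM('a)"
  have [measurable]: "g \<in> borel_measurable borel" by (rule g)
  \<comment> \<open>One factor \<open>t\<close> of the Chebyshev constant \<open>2 * t / s\<close>
    has been cancelled against the hyperbolic weight \<open>1 / t ^ (n + 1)\<close>.\<close>
  define K where "K = (\<lambda>(t::real) (y::'a). ennreal (1 / t ^ ?n) * (ennreal (2 / s) * ennreal (g y) * (if 0 < t \<and> s / (2 * t) < g y then 1 else 0)))"
  have Km: "case_prod K \<in> borel_measurable (lborel \<Otimes>\<^sub>M lborel)"
  proof -
    have "(\<lambda>p. K (fst p) (snd p)) \<in> borel_measurable (lborel \<Otimes>\<^sub>M lborel)"
      unfolding K_def by measurable
    moreover have "case_prod K = (\<lambda>p. K (fst p) (snd p))" by (simp add: fun_eq_iff)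
    ultimately show ?thesis by simp
  qed
  have "(\<integral>\<^sup>+t. indicator {0<..} t * ennreal (1 / t ^ (?n + 1)) * emeasure lborel {x. t * half_conv pker1 g (x, t) > s} \<partial>lborel)
     \<le> (\<integral>\<^sup>+t. (\<integral>\<^sup>+y. K t y \<partial>lborel) \<partial>lborel)"
  proof (intro nn_integral_mono)
    fix t :: real
    show "indicator {0<..} t * ennreal (1 / t ^ (?n + 1)) * emeasure lborel {x. t * half_conv pker1 g (x, t) > s} \<le> (\<integral>\<^sup>+y. K t y \<partial>lborel)"
    proof (cases "t > 0")
      case True
      have gi: "(\<lambda>y. ennreal (g y) * indicator {y. g y > s / (2 * t)} y) \<in> borel_measurable lborel" by measurable
      have "indicator {0<..} t * ennreal (1 / t ^ (?n + 1)) * emeasure lborel {x. t * half_conv pker1 g (x, t) > s}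
         \<le> ennreal (1 / t ^ (?n + 1)) * (ennreal (2 * t / s) * (\<integral>\<^sup>+y. ennreal (g y) * indicator {y. g y > s / (2 * t)} y \<partial>lborel))"
      proof -
        have "indicator {0<..} t = (1::ennreal)" using True by simp
        then show ?thesis
          using poisson_weak_type_slice[OF g adm s True] by (simp only: mult_1_left mult_left_mono zero_le)
      qed
      also have "\<dots> = (\<integral>\<^sup>+y. ennreal (1 / t ^ (?n + 1)) * (ennreal (2 * t / s) * (ennreal (g y) * indicator {y. g y > s / (2 * t)} y)) \<partial>lborel)"
        by (rule nn_integral_cmult2[OF gi])
      also have "\<dots> = (\<integral>\<^sup>+y. K t y \<partial>lborel)"
      proof (intro nn_integral_cong)
        fix y
        have "ennreal (1 / t ^ (?n + 1)) * ennreal (2 * t / s) = ennreal (1 / t ^ ?n) * ennreal (2 / s)"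
          using True s by (simp flip: ennreal_mult)
        then show "ennreal (1 / t ^ (?n + 1)) * (ennreal (2 * t / s) * (ennreal (g y) * indicator {y. g y > s / (2 * t)} y)) = K t y"
          using True by (simp add: K_def mult.assoc[symmetric] indicator_def)
      qed
      finally show ?thesis .
    qed simp
  qed
  also have "\<dots> = (\<integral>\<^sup>+y. (\<integral>\<^sup>+t. K t y \<partial>lborel) \<partial>lborel)"
    by (rule lborel_pair.Fubini'[symmetric, OF Km])
  also have "\<dots> \<le> (\<integral>\<^sup>+y. ennreal ((2 / s) ^ ?n) * ennreal (g y ^ ?n) \<partial>lborel)"
  proof (intro nn_integral_mono)
    fix y :: 'a
    show "(\<integral>\<^sup>+t. K t y \<partial>lborel) \<le> ennreal ((2 / s) ^ ?n) * ennreal (g y ^ ?n)"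
    proof (cases "g y = 0")
      case True
      then show ?thesis by (simp add: K_def)
    next
      case False
      then have gy: "g y > 0" using g(2)[of y] by simp
      define a where "a = s / (2 * g y)"
      have a: "a > 0" using s gy by (simp add: a_def)
      have "(\<integral>\<^sup>+t. K t y \<partial>lborel) \<le> (\<integral>\<^sup>+t. (ennreal (2 / s) * ennreal (g y)) * (ennreal (1 / t ^ ?n) * indicator {a..} t) \<partial>lborel)"
      proof (intro nn_integral_mono)
        fix t :: real
        have "t \<in> {a..}" if "t > 0" "g y > s / (2 * t)"
          using that gy by (simp add: a_def field_simps)
        then show "K t y \<le> (ennreal (2 / s) * ennreal (g y)) * (ennreal (1 / t ^ ?n) * indicator {a..} t)"
          by (auto simp: K_def indicator_def mult_ac)
      qed
      also have "\<dots> = (ennreal (2 / s) * ennreal (g y)) * (\<integral>\<^sup>+t. ennreal (1 / t ^ ?n) * indicator {a..} t \<partial>lborel)"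
        by (rule nn_integral_cmult) measurable
      also have "\<dots> \<le> (ennreal (2 / s) * ennreal (g y)) * ennreal (1 / a ^ (?n - 1))"
        by (intro mult_left_mono nn_integral_inverse_power a n) auto
      also have "\<dots> = ennreal (2 / s * g y * (1 / a ^ (?n - 1)))"
        using s gy a by (simp flip: ennreal_mult)
      also have "2 / s * g y * (1 / a ^ (?n - 1)) = (2 / s * g y) ^ ?n"
      proof -
        obtain m where m: "?n = Suc m" using n by (cases "DIM('a)") auto
        have "1 / a ^ m = (2 / s * g y) ^ m" using s gy by (simp add: a_def power_divide field_simps power_mult_distrib)
        then show ?thesis by (simp add: m)
      qed
      also have "ennreal ((2 / s * g y) ^ ?n) = ennreal ((2 / s) ^ ?n) * ennreal (g y ^ ?n)"
        using s gy by (simp only: power_mult_distrib) (simp add: ennreal_mult)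
      finally show ?thesis .
    qed
  qed
  also have "\<dots> = ennreal ((2 / s) ^ ?n) * (\<integral>\<^sup>+y. ennreal (g y ^ ?n) \<partial>lborel)"
    by (rule nn_integral_cmult) measurable
  finally show ?thesis .
qed

text \<open>No slice at height \<open>0\<close> is available. The estimate is applied to the slice
  at height \<open>e\<close>, which controls \<open>F\<close> shifted up by \<open>e\<close> with a
  bound independent of \<open>e\<close>, and Fatou's lemma for indicator functions lets
  \<open>e\<close> tend to \<open>0\<close>.\<close>

lemma weak_type_of_semigroup:
  fixes F :: "'a::euclidean_space \<times> real \<Rightarrow> real"
  assumes n: "DIM('a) \<ge> 2" and cont: "continuous_on {z. snd z > 0} F"
    and semi: "\<And>x t e. t > 0 \<Longrightarrow> e > 0 \<Longrightarrow> F (x, t + e) = half_conv pker1 (\<lambda>y. F (y, e)) (x, t)"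
    and bd: "\<And>e. e > 0 \<Longrightarrow> (\<integral>\<^sup>+y. ennreal (\<bar>F (y, e)\<bar> ^ DIM('a)) \<partial>lborel) \<le> ennreal S" and s: "s > 0"
  shows "emeasure hyperbolic_measure {z. snd z > 0 \<and> snd z * \<bar>F z\<bar> > s} \<le> ennreal ((2 / s) ^ DIM('a)) * ennreal S"
proof -
  define E where "E = (\<lambda>e. {z :: 'a \<times> real. snd z > 0 \<and> snd z * \<bar>F (z + (0, e))\<bar> > s})"
  have half_open: "open {z :: 'a \<times> real. snd z > 0}" by (intro open_Collect_less continuous_intros)
  have Eo: "open (E e)" if "e \<ge> 0" for e
  proof -
    have "continuous_on {z :: 'a \<times> real. snd z > 0} (\<lambda>z. snd z * \<bar>F (z + (0, e))\<bar>)"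
      by (intro continuous_intros continuous_on_compose2[OF cont]) (use that in auto)
    from continuous_on_open_vimage[OF half_open, THEN iffD1, rule_format, OF this, of "{s<..}"]
    have "open ((\<lambda>z. snd z * \<bar>F (z + (0, e))\<bar>) -` {s<..} \<inter> {z. snd z > 0})" by simp
    moreover have "(\<lambda>z. snd z * \<bar>F (z + (0, e))\<bar>) -` {s<..} \<inter> {z. snd z > 0} = E e" by (auto simp: E_def)
    ultimately show ?thesis by simp
  qed
  have Esub: "E e \<subseteq> upper_half_space" for e by (auto simp: E_def upper_half_space_def)
  have Em: "E e \<in> sets hyperbolic_measure" if "e \<ge> 0" for e
    using Eo[OF that] by (intro borel_in_hyperbolic Esub) auto
  have Ee: "emeasure hyperbolic_measure (E e) \<le> ennreal ((2 / s) ^ DIM('a)) * ennreal S" if e: "e > 0" for e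
  proof -
    define g where "g = (\<lambda>y. \<bar>F (y, e)\<bar>)"
    have gc: "continuous_on UNIV g" unfolding g_def
      by (intro continuous_intros continuous_on_compose2[OF cont]) (use e in auto)
    have gm: "g \<in> borel_measurable borel" by (rule borel_measurable_continuous_onI[OF gc])
    have "(\<integral>\<^sup>+y. ennreal (\<bar>g y\<bar> ^ DIM('a)) \<partial>lborel) < \<infinity>"
      using bd[OF e] by (simp add: g_def) (meson ennreal_less_top le_less_trans)
    then have "integrable lborel (\<lambda>y. \<bar>g y\<bar> ^ DIM('a))" using gm by (simp add: integrable_iff_bounded)
    then have adm: "poisson_admissible g" by (rule poisson_admissible_power[OF gm]) (use n in simp)
    have Eb: "E e \<in> sets borel" using Eo e by simp
    have "emeasure hyperbolic_measure (E e) =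
       (\<integral>\<^sup>+t. indicator {0<..} t * ennreal (1 / t ^ (DIM('a) + 1)) * emeasure lborel {x. (x, t) \<in> E e} \<partial>lborel)"
      by (rule emeasure_hyperbolic[OF Eb Esub])
    also have "\<dots> \<le> (\<integral>\<^sup>+t. indicator {0<..} t * ennreal (1 / t ^ (DIM('a) + 1)) * emeasure lborel {x. t * half_conv pker1 g (x, t) > s} \<partial>lborel)"
    proof (intro nn_integral_mono)
      fix t :: real
      show "indicator {0<..} t * ennreal (1 / t ^ (DIM('a) + 1)) * emeasure lborel {x. (x, t) \<in> E e} \<le>
         indicator {0<..} t * ennreal (1 / t ^ (DIM('a) + 1)) * emeasure lborel {x. t * half_conv pker1 g (x, t) > s}"
      proof (cases "t > 0")
        case True
        have "(\<lambda>x. half_conv pker1 g (x, t)) \<in> borel_measurable borel" using gm by measurable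
        then have m: "{x. t * half_conv pker1 g (x, t) > s} \<in> sets lborel" by measurable
        have "{x. (x, t) \<in> E e} \<subseteq> {x. t * half_conv pker1 g (x, t) > s}"
        proof
          fix x assume "x \<in> {x. (x, t) \<in> E e}"
          then have "s < t * \<bar>F (x, t + e)\<bar>" by (simp add: E_def)
          also have "\<dots> \<le> t * half_conv pker1 g (x, t)"
            unfolding semi[OF True e] g_def using True by (intro mult_left_mono half_conv_pker1_abs_le) auto
          finally show "x \<in> {x. t * half_conv pker1 g (x, t) > s}" by simp
        qed
        then show ?thesis by (intro mult_left_mono emeasure_mono m) auto
      qed simp
    qed
    also have "\<dots> \<le> ennreal ((2 / s) ^ DIM('a)) * (\<integral>\<^sup>+y. ennreal (g y ^ DIM('a)) \<partial>lborel)"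
      by (rule poisson_weak_type[OF n gm _ adm s]) (simp add: g_def)
    also have "\<dots> \<le> ennreal ((2 / s) ^ DIM('a)) * ennreal S"
      using bd[OF e] by (intro mult_left_mono) (simp_all add: g_def)
    finally show ?thesis .
  qed
  have "{z. snd z > 0 \<and> snd z * \<bar>F z\<bar> > s} = E 0" by (simp add: E_def flip: zero_prod_def)
  then have "emeasure hyperbolic_measure {z. snd z > 0 \<and> snd z * \<bar>F z\<bar> > s} = (\<integral>\<^sup>+z. indicator (E 0) z \<partial>hyperbolic_measure)"
    using Em[of 0] by simp
  \<comment> \<open>The strict inequality defining \<open>E 0\<close> persists under small upward
    shifts by continuity, so a point of \<open>E 0\<close> lies in all but finitely many of the
    shifted sets.\<close>
  also have "\<dots> \<le> (\<integral>\<^sup>+z. liminf (\<lambda>k. indicator (E (1 / real (Suc k))) z) \<partial>hyperbolic_measure)"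
  proof (intro nn_integral_mono)
    fix z :: "'a \<times> real"
    show "indicator (E 0) z \<le> liminf (\<lambda>k. indicator (E (1 / real (Suc k))) z :: ennreal)"
    proof (cases "z \<in> E 0")
      case True
      then have z: "snd z > 0" "s < snd z * \<bar>F z\<bar>" by (auto simp: E_def zero_prod_def[symmetric])
      have "isCont F z" using cont z(1) half_open by (metis (no_types, lifting) continuous_on_eq_continuous_at mem_Collect_eq)
      have l0: "(\<lambda>k. 1 / real (Suc k)) \<longlonglongrightarrow> 0" using LIMSEQ_inverse_real_of_nat by (simp add: inverse_eq_divide)
      have "(\<lambda>k. z + (0, 1 / real (Suc k))) \<longlonglongrightarrow> z + (0, 0)"
        by (intro tendsto_intros l0)
      then have "(\<lambda>k. z + (0, 1 / real (Suc k))) \<longlonglongrightarrow> z" by (simp flip: zero_prod_def)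
      then have "(\<lambda>k. snd z * \<bar>F (z + (0, 1 / real (Suc k)))\<bar>) \<longlonglongrightarrow> snd z * \<bar>F z\<bar>"
        by (intro tendsto_intros isCont_tendsto_compose[OF \<open>isCont F z\<close>])
      from order_tendstoD(1)[OF this z(2)]
      have "\<forall>\<^sub>F k in sequentially. (1::ennreal) \<le> indicator (E (1 / real (Suc k))) z"
        by eventually_elim (use z in \<open>simp add: E_def indicator_def\<close>)
      then have "1 \<le> liminf (\<lambda>k. indicator (E (1 / real (Suc k))) z :: ennreal)" by (rule Liminf_bounded)
      then show ?thesis using True by simp
    qed simp
  qed
  also have "\<dots> \<le> liminf (\<lambda>k. \<integral>\<^sup>+z. indicator (E (1 / real (Suc k))) z \<partial>hyperbolic_measure)"
    by (rule nn_integral_liminf) (use Em in auto)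
  also have "\<dots> \<le> liminf (\<lambda>k::nat. ennreal ((2 / s) ^ DIM('a)) * ennreal S)"
    using Em Ee by (intro Liminf_mono always_eventually) auto
  also have "\<dots> = ennreal ((2 / s) ^ DIM('a)) * ennreal S"
    by (simp add: Liminf_const)
  finally show ?thesis .
qed

section \<open>Bounding the vertical derivative by the tangential ones\<close>

text \<open>With \<open>s = \<Sum>\<^sub>i Y\<^sub>i\<^sup>2\<close> and \<open>\<rho> = s + v\<^sup>2 = s / \<sigma>\<^sup>2\<close>, the Laplacian of \<open>A (s \<rho>\<^sup>k + B s\<^sup>k\<^sup>+\<^sup>1) - \<rho>\<^sup>k\<^sup>+\<^sup>1\<close> is nonnegative:
  the cross terms in \<open>\<Delta>(s \<rho>\<^sup>k)\<close> are absorbed by its main term where \<open>\<sigma>\<close> is small, and by \<open>B \<Delta>(s\<^sup>k\<^sup>+\<^sup>1)\<close> elsewhere.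
  Here \<open>R = \<rho>\<^sup>k\<close>, \<open>T = s\<^sup>k\<close>, and \<open>D\<close>, \<open>D'\<close> are the squared norms of the gradients.\<close>

lemma subharmonic_algebra:
  fixes s \<rho> D D' R T k N A B C1 \<sigma> :: real and s1 s2 r1 r2 :: "'i \<Rightarrow> real"
  assumes fin: "finite J" and s: "s = \<sigma>\<^sup>2 * \<rho>" and \<rho>: "\<rho> > 0" and \<sigma>: "0 < \<sigma>" "\<sigma> \<le> 1" and k: "k \<ge> 0"
    and D: "D \<ge> 0" "D' \<ge> 0" "D' \<le> N * D" and N: "N \<ge> 1" and R: "R \<ge> 0" and T: "T \<ge> 0" and B: "B \<ge> 0"
    and sums: "(\<Sum>c\<in>J. s2 c) = 2 * D" "(\<Sum>c\<in>J. r2 c) = 2 * D'"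
      "(\<Sum>c\<in>J. (s1 c)\<^sup>2) \<le> 4 * s * D" "(\<Sum>c\<in>J. (r1 c)\<^sup>2) \<le> 4 * \<rho> * D'"
    and C1: "C1 = 4 * k * (N + 1) + 4 * k * N" and A: "A = (2 * (k + 1) + 4 * (k + 1) * k) * N"
    and alt: "C1 * \<sigma> \<le> 1 \<or> B * T \<ge> C1 * R"
  shows "0 \<le> (\<Sum>c\<in>J. A * (s2 c * R + 2 * s1 c * (k * (R / \<rho>) * r1 c)
      + s * (k * (R / \<rho>) * r2 c + k * (k - 1) * (R / \<rho>\<^sup>2) * (r1 c)\<^sup>2)
      + B * ((k + 1) * T * s2 c + (k + 1) * k * (T / s) * (s1 c)\<^sup>2))
      - ((k + 1) * R * r2 c + (k + 1) * k * (R / \<rho>) * (r1 c)\<^sup>2))"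
proof -
  define X where "X = (\<Sum>c\<in>J. s1 c * r1 c)"
  define Y where "Y = (\<Sum>c\<in>J. (r1 c)\<^sup>2)"
  define Z where "Z = (\<Sum>c\<in>J. (s1 c)\<^sup>2)"
  have s0: "s > 0" using s \<rho> \<sigma> by simp
  have eq: "(\<Sum>c\<in>J. A * (s2 c * R + 2 * s1 c * (k * (R / \<rho>) * r1 c)
      + s * (k * (R / \<rho>) * r2 c + k * (k - 1) * (R / \<rho>\<^sup>2) * (r1 c)\<^sup>2)
      + B * ((k + 1) * T * s2 c + (k + 1) * k * (T / s) * (s1 c)\<^sup>2))
      - ((k + 1) * R * r2 c + (k + 1) * k * (R / \<rho>) * (r1 c)\<^sup>2))
    = A * (2 * D * R + 2 * k * (R / \<rho>) * X + s * (k * (R / \<rho>) * (2 * D') + k * (k - 1) * (R / \<rho>\<^sup>2) * Y)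
      + B * ((k + 1) * T * (2 * D) + (k + 1) * k * (T / s) * Z)) - ((k + 1) * R * (2 * D') + (k + 1) * k * (R / \<rho>) * Y)"
    (is "(\<Sum>c\<in>J. ?f c) = _")
  proof -
    have "?f c = (A * R + A * B * (k + 1) * T) * s2 c + (A * 2 * k * (R / \<rho>)) * (s1 c * r1 c)
      + (A * s * k * (R / \<rho>) - (k + 1) * R) * r2 c + (A * s * k * (k - 1) * (R / \<rho>\<^sup>2) - (k + 1) * k * (R / \<rho>)) * (r1 c)\<^sup>2
      + (A * B * (k + 1) * k * (T / s)) * (s1 c)\<^sup>2" for c
      by (simp add: algebra_simps diff_divide_distrib)
    then have "(\<Sum>c\<in>J. ?f c) = (A * R + A * B * (k + 1) * T) * (2 * D) + (A * 2 * k * (R / \<rho>)) * X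
      + (A * s * k * (R / \<rho>) - (k + 1) * R) * (2 * D') + (A * s * k * (k - 1) * (R / \<rho>\<^sup>2) - (k + 1) * k * (R / \<rho>)) * Y
      + (A * B * (k + 1) * k * (T / s)) * Z"
      unfolding X_def Y_def Z_def sums(1,2)[symmetric] by (simp only: sum.distrib sum_distrib_left)
    also have "\<dots> = A * (2 * D * R + 2 * k * (R / \<rho>) * X + s * (k * (R / \<rho>) * (2 * D') + k * (k - 1) * (R / \<rho>\<^sup>2) * Y)
      + B * ((k + 1) * T * (2 * D) + (k + 1) * k * (T / s) * Z)) - ((k + 1) * R * (2 * D') + (k + 1) * k * (R / \<rho>) * Y)"
      by (simp add: algebra_simps diff_divide_distrib)
    finally show ?thesis .
  qed
  have Y: "0 \<le> Y" "Y \<le> 4 * \<rho> * D'" using sums(4) by (auto simp: Y_def intro: sum_nonneg)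
  have Z: "0 \<le> Z" "Z \<le> 4 * s * D" using sums(3) by (auto simp: Z_def intro: sum_nonneg)
  \<comment> \<open>Young's inequality weighted by \<open>\<sigma>\<close>: the squares of
    \<open>r1\<close> are of size \<open>\<rho>\<close> and those of \<open>s1\<close> of size
    \<open>s = \<sigma>\<^sup>2 * \<rho>\<close>, so both halves come out of order
    \<open>\<sigma> * \<rho>\<close>.\<close>
  have X: "- X \<le> 2 * \<sigma> * \<rho> * (N + 1) * D"
  proof -
    have "- (s1 c * r1 c) \<le> (\<sigma> / 2) * (r1 c)\<^sup>2 + (1 / (2 * \<sigma>)) * (s1 c)\<^sup>2" for c
    proof -
      have "0 \<le> (\<sigma> * r1 c + s1 c)\<^sup>2 / (2 * \<sigma>)" using \<sigma> by simp
      also have "\<dots> = (\<sigma> / 2) * (r1 c)\<^sup>2 + (1 / (2 * \<sigma>)) * (s1 c)\<^sup>2 + s1 c * r1 c"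
        using \<sigma> by (simp add: field_simps power2_eq_square)
      finally show ?thesis by simp
    qed
    then have "(\<Sum>c\<in>J. - (s1 c * r1 c)) \<le> (\<Sum>c\<in>J. (\<sigma> / 2) * (r1 c)\<^sup>2 + (1 / (2 * \<sigma>)) * (s1 c)\<^sup>2)"
      by (intro sum_mono)
    then have "- X \<le> (\<sigma> / 2) * Y + (1 / (2 * \<sigma>)) * Z"
      by (simp add: X_def Y_def Z_def sum.distrib sum_distrib_left sum_negf)
    also have "\<dots> \<le> (\<sigma> / 2) * (4 * \<rho> * D') + (1 / (2 * \<sigma>)) * (4 * s * D)"
      using Y Z \<sigma> by (intro add_mono mult_left_mono) auto
    also have "\<dots> = 2 * \<sigma> * \<rho> * (D' + D)" using \<sigma> by (simp add: s field_simps power2_eq_square)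
    also have "\<dots> \<le> 2 * \<sigma> * \<rho> * ((N + 1) * D)" using D \<sigma> \<rho> by (intro mult_left_mono) (auto simp: algebra_simps)
    finally show ?thesis by (simp add: mult.assoc)
  qed
  have t1: "2 * k * (R / \<rho>) * X \<ge> - (4 * k * (N + 1) * \<sigma> * R * D)"
  proof -
    have "2 * k * (R / \<rho>) * (- X) \<le> 2 * k * (R / \<rho>) * (2 * \<sigma> * \<rho> * (N + 1) * D)"
      using X k R \<rho> by (intro mult_left_mono) auto
    also have "\<dots> = 4 * k * (N + 1) * \<sigma> * R * D" using \<rho> by simp
    finally show ?thesis by simp
  qed
  \<comment> \<open>Only the \<open>- k\<close> in \<open>k * (k - 1)\<close> is harmful. Its factor
    \<open>s / \<rho> = \<sigma>\<^sup>2\<close> is at most \<open>\<sigma>\<close>, the order of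
    the cross term; the two errors add up to \<open>C1\<close>.\<close>
  have t2: "s * (k * (R / \<rho>) * (2 * D') + k * (k - 1) * (R / \<rho>\<^sup>2) * Y) \<ge> - (4 * k * N * \<sigma> * R * D)"
  proof -
    have "k * (R / \<rho>\<^sup>2) * Y \<le> k * (R / \<rho>\<^sup>2) * (4 * \<rho> * (N * D))"
      using Y D k R \<rho> by (intro mult_left_mono order_trans[OF Y(2)]) auto
    then have "s * (k * (R / \<rho>\<^sup>2) * Y) \<le> s * (k * (R / \<rho>\<^sup>2) * (4 * \<rho> * (N * D)))"
      by (rule mult_left_mono) (use s0 in simp)
    also have "\<dots> = \<sigma> * (4 * k * N * \<sigma> * R * D)" using \<rho> by (simp add: s power2_eq_square)
    also have "\<dots> \<le> 1 * (4 * k * N * \<sigma> * R * D)" using \<sigma> k N R D by (intro mult_right_mono) auto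
    finally have 1: "s * (k * (R / \<rho>\<^sup>2) * Y) \<le> 4 * k * N * \<sigma> * R * D" by simp
    have 2: "0 \<le> s * (k * (R / \<rho>) * (2 * D'))" "0 \<le> s * (k * k * (R / \<rho>\<^sup>2) * Y)"
      using s0 k R \<rho> D Y by auto
    have "s * (k * (R / \<rho>) * (2 * D') + k * (k - 1) * (R / \<rho>\<^sup>2) * Y) =
      s * (k * (R / \<rho>) * (2 * D')) + s * (k * k * (R / \<rho>\<^sup>2) * Y) - s * (k * (R / \<rho>\<^sup>2) * Y)"
      by (simp add: algebra_simps diff_divide_distrib)
    then show ?thesis using 1 2 by linarith
  qed
  have t3: "B * ((k + 1) * T * (2 * D) + (k + 1) * k * (T / s) * Z) \<ge> B * T * D"
  proof -
    have a: "0 \<le> B * ((k + 1) * k * (T / s) * Z)" using B k T s0 Z by auto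
    have b: "0 \<le> B * T * D" "0 \<le> k * (B * T * D)" using B T D k by auto
    have "B * ((k + 1) * T * (2 * D) + (k + 1) * k * (T / s) * Z) =
      2 * (B * T * D) + 2 * (k * (B * T * D)) + B * ((k + 1) * k * (T / s) * Z)" by (simp add: algebra_simps)
    then show ?thesis using a b by linarith
  qed
  have t4: "(k + 1) * R * (2 * D') + (k + 1) * k * (R / \<rho>) * Y \<le> A * (R * D)"
  proof -
    have "(k + 1) * R * (2 * D') \<le> (k + 1) * R * (2 * (N * D))" using k R D by (intro mult_left_mono) auto
    moreover have "(k + 1) * k * (R / \<rho>) * Y \<le> (k + 1) * k * (R / \<rho>) * (4 * \<rho> * (N * D))"
      using Y D k R \<rho> by (intro mult_left_mono order_trans[OF Y(2)]) auto
    moreover have "(k + 1) * k * (R / \<rho>) * (4 * \<rho> * (N * D)) = 4 * (k + 1) * k * R * (N * D)" using \<rho> by simp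
    ultimately show ?thesis unfolding A by (simp add: algebra_simps)
  qed
  have RD: "R * D \<ge> 0" using R D by simp
  have t5: "R * D + B * T * D \<ge> C1 * \<sigma> * R * D"
  proof (cases "C1 * \<sigma> \<le> 1")
    case True
    have "C1 * \<sigma> * (R * D) \<le> 1 * (R * D)" using True RD by (intro mult_right_mono) auto
    moreover have "0 \<le> B * T * D" using B T D by simp
    ultimately show ?thesis by (simp add: mult.assoc)
  next
    case False
    then have "C1 * R * D \<le> B * T * D" using alt D by (intro mult_right_mono) auto
    moreover have "\<sigma> * (C1 * R * D) \<le> 1 * (C1 * R * D)"
      using \<sigma> k N R D unfolding C1 by (intro mult_right_mono) auto
    ultimately show ?thesis using RD by (simp add: mult_ac)
  qed
  \<comment> \<open>Of the main term \<open>2 * D * R\<close> one copy pays for the errors, with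
    help from \<open>B\<close>. The other, multiplied by \<open>A\<close>, outweighs the Laplacian
    of the subtracted power.\<close>
  have "R * D \<le> 2 * D * R + 2 * k * (R / \<rho>) * X + s * (k * (R / \<rho>) * (2 * D') + k * (k - 1) * (R / \<rho>\<^sup>2) * Y)
      + B * ((k + 1) * T * (2 * D) + (k + 1) * k * (T / s) * Z)"
  proof -
    have "C1 * \<sigma> * R * D = 4 * k * (N + 1) * \<sigma> * R * D + 4 * k * N * \<sigma> * R * D"
      by (simp add: C1 algebra_simps)
    moreover have "2 * D * R = 2 * (R * D)" by simp
    ultimately show ?thesis using t1 t2 t3 t5 by linarith
  qed
  moreover have "A \<ge> 0" unfolding A using k N by simp
  ultimately have "A * (R * D) \<le> A * (2 * D * R + 2 * k * (R / \<rho>) * X + s * (k * (R / \<rho>) * (2 * D') + k * (k - 1) * (R / \<rho>\<^sup>2) * Y)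
      + B * ((k + 1) * T * (2 * D) + (k + 1) * k * (T / s) * Z))" by (rule mult_left_mono)
  then show ?thesis unfolding eq using t4 by linarith
qed

section \<open>Calculus of pure second derivatives for the comparison function\<close>

lemma DERIV_powr_at0:
  assumes "(f has_real_derivative d) (at 0)" "f 0 > 0"
  shows "((\<lambda>r. f r powr k) has_real_derivative k * (f 0 powr k / f 0) * d) (at (0::real))"
proof -
  have "((\<lambda>z. z powr k) has_real_derivative k * f 0 powr (k - 1)) (at (f 0))"
    by (rule has_real_derivative_powr[OF assms(2)])
  from DERIV_chain2[OF this assms(1)]
  show ?thesis using assms(2) by (simp add: powr_diff)
qed

text \<open>The second derivatives are left in the shape that \<open>subharmonic_algebra\<close>
  sums. Powers are real because the exponent will be a half-integer in odd dimensions.\<close>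

lemma dir_C2_combination:
  fixes s \<rho> :: "'a::euclidean_space \<times> real \<Rightarrow> real"
  assumes s: "dir_C2 s s1 s2" "\<And>z. snd z > 0 \<Longrightarrow> s z > 0"
    and \<rho>: "dir_C2 \<rho> r1 r2" "\<And>z. snd z > 0 \<Longrightarrow> \<rho> z > 0"
  shows "dir_C2 (\<lambda>z. A * (s z * \<rho> z powr k + B * s z powr (k + 1)) - \<rho> z powr (k + 1))
    (\<lambda>c z. A * (s1 c z * \<rho> z powr k + s z * (k * (\<rho> z powr k / \<rho> z) * r1 c z) + B * ((k + 1) * s z powr k * s1 c z))
       - (k + 1) * \<rho> z powr k * r1 c z)
    (\<lambda>c z. A * (s2 c z * \<rho> z powr k + 2 * s1 c z * (k * (\<rho> z powr k / \<rho> z) * r1 c z)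
      + s z * (k * (\<rho> z powr k / \<rho> z) * r2 c z + k * (k - 1) * (\<rho> z powr k / (\<rho> z)\<^sup>2) * (r1 c z)\<^sup>2)
      + B * ((k + 1) * s z powr k * s2 c z + (k + 1) * k * (s z powr k / s z) * (s1 c z)\<^sup>2))
      - ((k + 1) * \<rho> z powr k * r2 c z + (k + 1) * k * (\<rho> z powr k / \<rho> z) * (r1 c z)\<^sup>2))"
  unfolding dir_C2_def
proof (intro allI impI conjI)
  fix z c :: "'a \<times> real" assume z: "snd z > 0" and c: "c \<in> Basis"
  note ds = dir_C2D[OF s(1) z c] and d\<rho> = dir_C2D[OF \<rho>(1) z c]
  have s0: "s (z + 0 *\<^sub>R c) > 0" "s z > 0" and \<rho>0: "\<rho> (z + 0 *\<^sub>R c) > 0" "\<rho> z > 0" using s(2) \<rho>(2) z by auto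
  note p = DERIV_powr_at0[OF d\<rho>(1) \<rho>0(1)] DERIV_powr_at0[OF ds(1) s0(1)]
  have k1: "x powr (k + 1) / x = x powr k" if "x > 0" for x :: real using that by (simp add: powr_add)
  have q: "((\<lambda>r. \<rho> (z + r *\<^sub>R c) powr (k + 1)) has_real_derivative (k + 1) * \<rho> z powr k * r1 c z) (at 0)"
    "((\<lambda>r. s (z + r *\<^sub>R c) powr (k + 1)) has_real_derivative (k + 1) * s z powr k * s1 c z) (at 0)"
    by (rule DERIV_cong[OF DERIV_powr_at0[OF d\<rho>(1) \<rho>0(1)]], use k1[OF \<rho>0(2)] in simp)
       (rule DERIV_cong[OF DERIV_powr_at0[OF ds(1) s0(1)]], use k1[OF s0(2)] in simp)
  show "((\<lambda>r. A * (s (z + r *\<^sub>R c) * \<rho> (z + r *\<^sub>R c) powr k + B * s (z + r *\<^sub>R c) powr (k + 1)) - \<rho> (z + r *\<^sub>R c) powr (k + 1))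
     has_real_derivative A * (s1 c z * \<rho> z powr k + s z * (k * (\<rho> z powr k / \<rho> z) * r1 c z) + B * ((k + 1) * s z powr k * s1 c z))
       - (k + 1) * \<rho> z powr k * r1 c z) (at 0)"
    by (rule DERIV_cong[OF DERIV_diff[OF DERIV_cmult[OF DERIV_add[OF DERIV_mult[OF ds(1) p(1)] DERIV_cmult[OF q(2)]]] q(1)]])
      (simp add: algebra_simps)
  have dq: "((\<lambda>r. \<rho> (z + r *\<^sub>R c) powr k / \<rho> (z + r *\<^sub>R c)) has_real_derivative (k - 1) * (\<rho> z powr k / (\<rho> z)\<^sup>2) * r1 c z) (at 0)"
    by (rule DERIV_cong[OF DERIV_divide[OF p(1) d\<rho>(1)]]) (use \<rho>0 in \<open>auto simp: power2_eq_square field_simps\<close>)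
  show "((\<lambda>r. A * (s1 c (z + r *\<^sub>R c) * \<rho> (z + r *\<^sub>R c) powr k + s (z + r *\<^sub>R c) * (k * (\<rho> (z + r *\<^sub>R c) powr k / \<rho> (z + r *\<^sub>R c)) * r1 c (z + r *\<^sub>R c))
         + B * ((k + 1) * s (z + r *\<^sub>R c) powr k * s1 c (z + r *\<^sub>R c))) - (k + 1) * \<rho> (z + r *\<^sub>R c) powr k * r1 c (z + r *\<^sub>R c))
     has_real_derivative A * (s2 c z * \<rho> z powr k + 2 * s1 c z * (k * (\<rho> z powr k / \<rho> z) * r1 c z)
      + s z * (k * (\<rho> z powr k / \<rho> z) * r2 c z + k * (k - 1) * (\<rho> z powr k / (\<rho> z)\<^sup>2) * (r1 c z)\<^sup>2)
      + B * ((k + 1) * s z powr k * s2 c z + (k + 1) * k * (s z powr k / s z) * (s1 c z)\<^sup>2))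
      - ((k + 1) * \<rho> z powr k * r2 c z + (k + 1) * k * (\<rho> z powr k / \<rho> z) * (r1 c z)\<^sup>2)) (at 0)"
    by (rule DERIV_cong[OF DERIV_diff[OF DERIV_cmult[OF DERIV_add[OF DERIV_add[OF DERIV_mult[OF ds(2) p(1)]
           DERIV_mult[OF ds(1) DERIV_mult[OF DERIV_cmult[OF dq] d\<rho>(2)]]] DERIV_cmult[OF DERIV_mult[OF DERIV_cmult[OF p(2)] ds(2)]]]]
           DERIV_mult[OF DERIV_cmult[OF p(1)] d\<rho>(2)]]])
      (simp add: algebra_simps power2_eq_square)
qed

lemma dir_C2_square:
  fixes v :: "'a::euclidean_space \<times> real \<Rightarrow> real"
  assumes "dir_C2 v v1 v2"
  shows "dir_C2 (\<lambda>z. (v z)\<^sup>2) (\<lambda>c z. 2 * (v z * v1 c z)) (\<lambda>c z. 2 * ((v1 c z)\<^sup>2 + v z * v2 c z))"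
  unfolding dir_C2_def
proof (intro allI impI conjI)
  fix z c :: "'a \<times> real" assume z: "snd z > 0" and c: "c \<in> Basis"
  note d = dir_C2D[OF assms z c]
  show "((\<lambda>s. (v (z + s *\<^sub>R c))\<^sup>2) has_real_derivative 2 * (v z * v1 c z)) (at 0)"
    by (rule DERIV_cong[OF DERIV_power[OF d(1)]]) simp
  show "((\<lambda>s. 2 * (v (z + s *\<^sub>R c) * v1 c (z + s *\<^sub>R c))) has_real_derivative 2 * ((v1 c z)\<^sup>2 + v z * v2 c z)) (at 0)"
    by (rule DERIV_cong[OF DERIV_cmult[OF DERIV_mult[OF d]]]) (simp add: power2_eq_square)
qed

lemma dir_C2_sum:
  fixes Y :: "'i \<Rightarrow> 'a::euclidean_space \<times> real \<Rightarrow> real"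
  assumes "\<And>i. i \<in> I \<Longrightarrow> dir_C2 (Y i) (Y1 i) (Y2 i)"
  shows "dir_C2 (\<lambda>z. \<Sum>i\<in>I. Y i z) (\<lambda>c z. \<Sum>i\<in>I. Y1 i c z) (\<lambda>c z. \<Sum>i\<in>I. Y2 i c z)"
  unfolding dir_C2_def by (intro allI impI conjI DERIV_sum dir_C2D[OF assms])

lemma dir_C2_add:
  fixes g h :: "'a::euclidean_space \<times> real \<Rightarrow> real"
  assumes "dir_C2 g G1 G2" "dir_C2 h H1 H2"
  shows "dir_C2 (\<lambda>z. g z + h z) (\<lambda>b z. G1 b z + H1 b z) (\<lambda>b z. G2 b z + H2 b z)"
  unfolding dir_C2_def
  by (intro allI impI conjI DERIV_add dir_C2D[OF assms(1)] dir_C2D[OF assms(2)])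

lemma sum_Basis_half:
  fixes F :: "'a::euclidean_space \<times> real \<Rightarrow> real"
  shows "(\<Sum>c\<in>Basis. F c) = (\<Sum>i\<in>Basis. F (i, 0)) + F (0, 1)"
proof -
  have "(Basis :: ('a \<times> real) set) = (\<lambda>u. (u, 0)) ` Basis \<union> {(0, 1)}" by (simp add: Basis_prod_def)
  moreover have "(\<lambda>u. (u, 0)) ` Basis \<inter> {(0 :: 'a, 1 :: real)} = {}" by auto
  ultimately have "(\<Sum>c\<in>Basis. F c) = (\<Sum>c\<in>(\<lambda>u. (u, 0)) ` Basis. F c) + (\<Sum>c\<in>{(0, 1)}. F c)"
    by (metis sum.union_disjoint finite_Basis finite_imageI finite.emptyI finite.insertI)
  also have "(\<Sum>c\<in>(\<lambda>u. (u, 0)) ` Basis. F c) = (\<Sum>i\<in>Basis. F (i, 0))"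
    by (subst sum.reindex) (auto intro!: inj_onI)
  finally show ?thesis by simp
qed

text \<open>Appends one coordinate to a Cauchy-Schwarz inequality of which only the outcome is
  known: by the arithmetic-geometric mean inequality the new cross term is at most
  \<open>s * w\<^sup>2 + P * v\<^sup>2\<close>.\<close>

lemma Cauchy_Schwarz_extra:
  fixes a s P v w :: real
  assumes "a\<^sup>2 \<le> s * P" "s \<ge> 0" "P \<ge> 0"
  shows "(a + v * w)\<^sup>2 \<le> (s + v\<^sup>2) * (P + w\<^sup>2)"
proof -
  have "(2 * a * v * w)\<^sup>2 \<le> (s * w\<^sup>2 + P * v\<^sup>2)\<^sup>2"
  proof -
    have "(2 * a * v * w)\<^sup>2 = 4 * a\<^sup>2 * (v\<^sup>2 * w\<^sup>2)" by (simp add: power_mult_distrib)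
    also have "\<dots> \<le> 4 * (s * P) * (v\<^sup>2 * w\<^sup>2)" using assms by (intro mult_right_mono) auto
    also have "\<dots> = (s * w\<^sup>2 + P * v\<^sup>2)\<^sup>2 - (s * w\<^sup>2 - P * v\<^sup>2)\<^sup>2" by (simp add: power2_eq_square algebra_simps)
    also have "\<dots> \<le> (s * w\<^sup>2 + P * v\<^sup>2)\<^sup>2" by simp
    finally show ?thesis .
  qed
  then have "2 * a * v * w \<le> s * w\<^sup>2 + P * v\<^sup>2"
    by (rule power2_le_imp_le) (intro add_nonneg_nonneg mult_nonneg_nonneg assms zero_le_power2)
  then show ?thesis using assms(1) by (simp add: power2_eq_square algebra_simps)
qed

text \<open>An instance of \<open>subharmonic_algebra\<close> with \<open>N = M + 1\<close>, since
  adding the gradient of \<open>v\<close> multiplies the squared gradient norm by at most that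
  factor. As \<open>s powr k\<close> equals \<open>\<sigma> powr (2 * k) * \<rho> powr k\<close>,
  the power of \<open>C1\<close> in \<open>B\<close> is the one that makes
  \<open>B * s powr k\<close> at least \<open>C1 * \<rho> powr k\<close> whenever
  \<open>C1 * \<sigma> > 1\<close>.\<close>

lemma gradient_system_subharmonic:
  fixes Y :: "'i \<Rightarrow> 'a::euclidean_space \<times> real \<Rightarrow> real" and v :: "'a \<times> real \<Rightarrow> real"
  assumes I: "finite I" and YC: "\<And>i. i \<in> I \<Longrightarrow> dir_C2 (Y i) (Y1 i) (Y2 i)" and vC: "dir_C2 v v1 v2"
    and Yh: "\<And>i z. i \<in> I \<Longrightarrow> snd z > 0 \<Longrightarrow> (\<Sum>c\<in>Basis. Y2 i c z) = 0"
    and vh: "\<And>z. snd z > 0 \<Longrightarrow> (\<Sum>c\<in>Basis. v2 c z) = 0"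
    and pos: "\<And>z. snd z > 0 \<Longrightarrow> \<exists>i\<in>I. Y i z \<noteq> 0"
    and dom: "\<And>z. snd z > 0 \<Longrightarrow> (\<Sum>c\<in>Basis. (v1 c z)\<^sup>2) \<le> M * (\<Sum>c\<in>Basis. \<Sum>i\<in>I. (Y1 i c z)\<^sup>2)"
    and M: "M \<ge> 0" and k: "k \<ge> 0"
    and C1: "C1 = 4 * k * (M + 2) + 4 * k * (M + 1)" and A: "A = (2 * (k + 1) + 4 * (k + 1) * k) * (M + 1)"
    and B: "B = C1 * C1 powr (2 * k)"
    and s: "s = (\<lambda>z. \<Sum>i\<in>I. (Y i z)\<^sup>2)" and \<rho>: "\<rho> = (\<lambda>z. (\<Sum>i\<in>I. (Y i z)\<^sup>2) + (v z)\<^sup>2)"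
  shows "\<exists>G1 G2. dir_C2 (\<lambda>z. A * (s z * \<rho> z powr k + B * s z powr (k + 1)) - \<rho> z powr (k + 1)) G1 G2 \<and>
     (\<forall>z. snd z > 0 \<longrightarrow> (\<Sum>c\<in>Basis. G2 c z) \<ge> 0)"
proof -
  define s1 where "s1 = (\<lambda>c z. \<Sum>i\<in>I. 2 * (Y i z * Y1 i c z))"
  define s2 where "s2 = (\<lambda>c z. \<Sum>i\<in>I. 2 * ((Y1 i c z)\<^sup>2 + Y i z * Y2 i c z))"
  define r1 where "r1 = (\<lambda>c z. s1 c z + 2 * (v z * v1 c z))"
  define r2 where "r2 = (\<lambda>c z. s2 c z + 2 * ((v1 c z)\<^sup>2 + v z * v2 c z))"
  have sC: "dir_C2 s s1 s2" unfolding s s1_def s2_def by (intro dir_C2_sum dir_C2_square YC)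
  from dir_C2_add[OF sC dir_C2_square[OF vC]] have \<rho>C: "dir_C2 \<rho> r1 r2" unfolding \<rho> r1_def r2_def s .
  have s_pos: "s z > 0" if z: "snd z > 0" for z
  proof -
    obtain i where i: "i \<in> I" "Y i z \<noteq> 0" using pos[OF z] by blast
    then have "0 < (Y i z)\<^sup>2" by simp
    also have "\<dots> \<le> s z" unfolding s using i I by (intro member_le_sum) auto
    finally show ?thesis .
  qed
  have \<rho>_ge: "\<rho> z \<ge> s z" for z by (simp add: \<rho> s)
  have \<rho>_pos: "\<rho> z > 0" if "snd z > 0" for z using s_pos[OF that] \<rho>_ge[of z] by linarith
  have "0 \<le> (\<Sum>c\<in>Basis. A * (s2 c z * \<rho> z powr k + 2 * s1 c z * (k * (\<rho> z powr k / \<rho> z) * r1 c z)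
      + s z * (k * (\<rho> z powr k / \<rho> z) * r2 c z + k * (k - 1) * (\<rho> z powr k / (\<rho> z)\<^sup>2) * (r1 c z)\<^sup>2)
      + B * ((k + 1) * s z powr k * s2 c z + (k + 1) * k * (s z powr k / s z) * (s1 c z)\<^sup>2))
      - ((k + 1) * \<rho> z powr k * r2 c z + (k + 1) * k * (\<rho> z powr k / \<rho> z) * (r1 c z)\<^sup>2))" if z: "snd z > 0" for z
  proof -
    define D where "D = (\<Sum>c\<in>Basis. \<Sum>i\<in>I. (Y1 i c z)\<^sup>2)"
    define E where "E = (\<Sum>c\<in>Basis. (v1 c z)\<^sup>2)"
    define \<sigma> where "\<sigma> = sqrt (s z / \<rho> z)"
    have s0: "s z > 0" and r0: "\<rho> z > 0" using s_pos \<rho>_pos z by auto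
    have \<sigma>: "0 < \<sigma>" "\<sigma> \<le> 1" "\<sigma>\<^sup>2 = s z / \<rho> z" using s0 r0 \<rho>_ge[of z] by (auto simp: \<sigma>_def)
    have D0: "D \<ge> 0" unfolding D_def by (intro sum_nonneg) auto
    have E0: "E \<ge> 0" unfolding E_def by (intro sum_nonneg) auto
    have s2: "(\<Sum>c\<in>Basis. s2 c z) = 2 * D"
    proof -
      have "(\<Sum>c\<in>Basis. s2 c z) = 2 * D + 2 * (\<Sum>c\<in>Basis. \<Sum>i\<in>I. Y i z * Y2 i c z)"
        by (simp add: s2_def D_def sum.distrib sum_distrib_left distrib_left)
      also have "(\<Sum>c\<in>Basis. \<Sum>i\<in>I. Y i z * Y2 i c z) = (\<Sum>i\<in>I. Y i z * (\<Sum>c\<in>Basis. Y2 i c z))"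
        by (subst sum.swap) (simp add: sum_distrib_left)
      also have "\<dots> = 0" using Yh z by simp
      finally show ?thesis by simp
    qed
    have r2: "(\<Sum>c\<in>Basis. r2 c z) = 2 * (D + E)"
    proof -
      have "(\<Sum>c\<in>Basis. r2 c z) = 2 * D + 2 * E + 2 * (v z * (\<Sum>c\<in>Basis. v2 c z))"
        by (simp add: r2_def s2 E_def sum.distrib sum_distrib_left distrib_left)
      then show ?thesis using vh[OF z] by simp
    qed
    have cs: "(\<Sum>i\<in>I. Y i z * Y1 i c z)\<^sup>2 \<le> s z * (\<Sum>i\<in>I. (Y1 i c z)\<^sup>2)" for c
      unfolding s by (rule Cauchy_Schwarz_ineq_sum)
    have s1: "(\<Sum>c\<in>Basis. (s1 c z)\<^sup>2) \<le> 4 * s z * D"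
    proof -
      have "(s1 c z)\<^sup>2 = 4 * (\<Sum>i\<in>I. Y i z * Y1 i c z)\<^sup>2" for c
        by (simp add: s1_def sum_distrib_left[symmetric] power_mult_distrib)
      then have "(\<Sum>c\<in>Basis. (s1 c z)\<^sup>2) \<le> (\<Sum>c\<in>Basis. 4 * (s z * (\<Sum>i\<in>I. (Y1 i c z)\<^sup>2)))"
        using cs by (intro sum_mono) simp
      then show ?thesis by (simp add: D_def sum_distrib_left mult.assoc)
    qed
    have r1: "(\<Sum>c\<in>Basis. (r1 c z)\<^sup>2) \<le> 4 * \<rho> z * (D + E)"
    proof -
      have "(r1 c z)\<^sup>2 = 4 * ((\<Sum>i\<in>I. Y i z * Y1 i c z) + v z * v1 c z)\<^sup>2" for c
        unfolding r1_def s1_def sum_distrib_left[symmetric] distrib_left[symmetric] power_mult_distrib by simp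
      moreover have "((\<Sum>i\<in>I. Y i z * Y1 i c z) + v z * v1 c z)\<^sup>2 \<le> (s z + (v z)\<^sup>2) * ((\<Sum>i\<in>I. (Y1 i c z)\<^sup>2) + (v1 c z)\<^sup>2)" for c
        using s0 by (intro Cauchy_Schwarz_extra cs sum_nonneg) auto
      ultimately have "(\<Sum>c\<in>Basis. (r1 c z)\<^sup>2) \<le> (\<Sum>c\<in>Basis. 4 * (\<rho> z * ((\<Sum>i\<in>I. (Y1 i c z)\<^sup>2) + (v1 c z)\<^sup>2)))"
        by (intro sum_mono) (simp add: \<rho> s)
      then show ?thesis by (simp add: D_def E_def sum_distrib_left sum.distrib distrib_left mult.assoc)
    qed
    show ?thesis
    proof (rule subharmonic_algebra[OF finite_Basis])
      show "s z = \<sigma>\<^sup>2 * \<rho> z" using r0 by (simp add: \<sigma>)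
      show "D + E \<le> (M + 1) * D" using dom[OF z] by (simp add: D_def E_def algebra_simps)
      show "C1 = 4 * k * ((M + 1) + 1) + 4 * k * (M + 1)" by (simp add: C1)
      have C10: "C1 \<ge> 0" unfolding C1 using k M by simp
      then show "B \<ge> 0" by (simp add: B)
      show "C1 * \<sigma> \<le> 1 \<or> C1 * \<rho> z powr k \<le> B * s z powr k"
      proof (cases "C1 * \<sigma> \<le> 1")
        case False
        then have C1p: "C1 > 0" using C10 \<sigma> by (cases "C1 = 0") auto
        have "s z = \<sigma> powr 2 * \<rho> z" using r0 \<sigma> by (simp add: powr_numeral)
        then have "s z powr k = (\<sigma> powr 2 * \<rho> z) powr k" by (rule arg_cong)
        also have "\<dots> = \<sigma> powr (2 * k) * \<rho> z powr k"
          using \<sigma> r0 by (simp only: powr_mult powr_powr)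
        finally have "s z powr k = \<sigma> powr (2 * k) * \<rho> z powr k" .
        then have "B * s z powr k = C1 * ((C1 * \<sigma>) powr (2 * k)) * \<rho> z powr k"
          using C1p \<sigma> by (simp add: B powr_mult)
        moreover have "(C1 * \<sigma>) powr (2 * k) \<ge> 1" using False k by (intro ge_one_powr_ge_zero) auto
        then have "C1 * 1 * \<rho> z powr k \<le> C1 * ((C1 * \<sigma>) powr (2 * k)) * \<rho> z powr k"
          using C1p by (intro mult_right_mono mult_left_mono) auto
        ultimately show ?thesis by simp
      qed simp
      show "0 \<le> D + E" "1 \<le> M + 1" using D0 E0 M by simp_all
      show "0 \<le> \<rho> z powr k" "0 \<le> s z powr k" by simp_all
    qed (fact r0 \<sigma> k D0 s2 r2 s1 r1 A)+
  qed
  note nonneg = this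
  show ?thesis
    using dir_C2_combination[OF sC s_pos \<rho>C \<rho>_pos, of A k B] nonneg by blast
qed

section \<open>Decay and integrability of the functions to be compared\<close>

lemma vanishing_add:
  assumes "vanishing g" "vanishing h"
  shows "vanishing (\<lambda>z. g z + h z)"
  unfolding vanishing_def
proof (intro allI impI)
  fix \<delta> :: real assume "\<delta> > 0"
  then have d: "\<delta> / 2 > 0" by simp
  obtain L1 where L1: "\<And>z. snd z \<ge> 0 \<Longrightarrow> norm z \<ge> L1 \<Longrightarrow> \<bar>g z\<bar> \<le> \<delta> / 2" using assms(1) d unfolding vanishing_def by blast
  obtain L2 where L2: "\<And>z. snd z \<ge> 0 \<Longrightarrow> norm z \<ge> L2 \<Longrightarrow> \<bar>h z\<bar> \<le> \<delta> / 2" using assms(2) d unfolding vanishing_def by blast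
  have "\<bar>g z + h z\<bar> \<le> \<delta>" if "snd z \<ge> 0" "norm z \<ge> max L1 L2" for z
  proof -
    have "norm z \<ge> L1" "norm z \<ge> L2" using that by auto
    then show ?thesis using L1[of z] L2[of z] that(1) by linarith
  qed
  then show "\<exists>L. \<forall>z. 0 \<le> snd z \<longrightarrow> L \<le> norm z \<longrightarrow> \<bar>g z + h z\<bar> \<le> \<delta>" by blast
qed

lemma vanishing_0: "vanishing (\<lambda>z. 0)"
  by (simp add: vanishing_def)

lemma vanishing_sum:
  assumes "finite I" "\<And>i. i \<in> I \<Longrightarrow> vanishing (g i)"
  shows "vanishing (\<lambda>z. \<Sum>i\<in>I. g i z)"
  using assms by (induction I rule: finite_induct) (auto intro: vanishing_add vanishing_0)

lemma vanishing_powr: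
  assumes "vanishing g" "q \<ge> 1" and nn: "\<And>z. snd z \<ge> 0 \<Longrightarrow> g z \<ge> 0"
  shows "vanishing (\<lambda>z. g z powr q)"
  unfolding vanishing_def
proof (intro allI impI)
  fix \<delta> :: real assume d: "\<delta> > 0"
  then have "min 1 \<delta> > 0" by simp
  then obtain L where L: "\<And>z. snd z \<ge> 0 \<Longrightarrow> norm z \<ge> L \<Longrightarrow> \<bar>g z\<bar> \<le> min 1 \<delta>"
    using assms(1) unfolding vanishing_def by blast
  have "\<bar>g z powr q\<bar> \<le> \<delta>" if "snd z \<ge> 0" "norm z \<ge> L" for z
  proof -
    have g: "0 \<le> g z" "g z \<le> 1" "g z \<le> \<delta>" using L[OF that] nn[OF that(1)] by auto
    have "g z powr q \<le> g z powr 1" by (rule powr_mono') (use g assms(2) in auto)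
    then show ?thesis using g by simp
  qed
  then show "\<exists>L. \<forall>z. 0 \<le> snd z \<longrightarrow> L \<le> norm z \<longrightarrow> \<bar>g z powr q\<bar> \<le> \<delta>" by blast
qed

lemma vanishing_square: "vanishing g \<Longrightarrow> vanishing (\<lambda>z. (g z)\<^sup>2)"
  using vanishing_powr[of "\<lambda>z. \<bar>g z\<bar>" 2] by (simp add: vanishing_def powr_numeral)

lemma abs_power_eq_square_powr: "n \<ge> 1 \<Longrightarrow> (x\<^sup>2) powr (real n / 2) = \<bar>x\<bar> ^ n" for x :: real
proof (cases "x = 0")
  case False
  have "\<bar>x\<bar> powr 2 = x\<^sup>2" using False by (simp add: powr_numeral)
  then have "(x\<^sup>2) powr (real n / 2) = (\<bar>x\<bar> powr 2) powr (real n / 2)" by simp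
  also have "\<dots> = \<bar>x\<bar> powr real n" unfolding powr_powr by simp
  finally show ?thesis using False by (simp add: powr_realpow)
qed simp

text \<open>The sum is at most \<open>card I\<close> times its largest term, and the corresponding
  power of that term is one of the summands on the right.\<close>

lemma sum_squares_powr_le:
  fixes x :: "'i \<Rightarrow> real"
  assumes I: "finite I" and n: "n \<ge> 1"
  shows "(\<Sum>i\<in>I. (x i)\<^sup>2) powr (real n / 2) \<le> real (card I) powr (real n / 2) * (\<Sum>i\<in>I. \<bar>x i\<bar> ^ n)"
proof (cases "I = {}")
  case False
  obtain j where j: "j \<in> I" "\<And>i. i \<in> I \<Longrightarrow> \<bar>x i\<bar> \<le> \<bar>x j\<bar>"
  proof -
    have "Max ((\<lambda>i. \<bar>x i\<bar>) ` I) \<in> (\<lambda>i. \<bar>x i\<bar>) ` I" using I False by (intro Max_in) auto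
    then obtain j where "j \<in> I" "Max ((\<lambda>i. \<bar>x i\<bar>) ` I) = \<bar>x j\<bar>" by auto
    then show ?thesis using that[of j] I by (metis (no_types, lifting) Max_ge finite_imageI imageI)
  qed
  have "(\<Sum>i\<in>I. (x i)\<^sup>2) \<le> (\<Sum>i\<in>I. (x j)\<^sup>2)"
    using j by (intro sum_mono) (simp add: abs_le_square_iff)
  then have "(\<Sum>i\<in>I. (x i)\<^sup>2) powr (real n / 2) \<le> (real (card I) * (x j)\<^sup>2) powr (real n / 2)"
    by (intro powr_mono2 sum_nonneg) auto
  also have "\<dots> = real (card I) powr (real n / 2) * ((x j)\<^sup>2) powr (real n / 2)" by (simp add: powr_mult)
  also have "((x j)\<^sup>2) powr (real n / 2) = \<bar>x j\<bar> ^ n" by (rule abs_power_eq_square_powr[OF n])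
  also have "real (card I) powr (real n / 2) * \<bar>x j\<bar> ^ n \<le> real (card I) powr (real n / 2) * (\<Sum>i\<in>I. \<bar>x i\<bar> ^ n)"
    using I j by (intro mult_left_mono member_le_sum[where f="\<lambda>i. \<bar>x i\<bar> ^ n"]) auto
  finally show ?thesis .
qed simp

lemma pkern_dir_C2: "dir_C2 (pkern :: 'a::euclidean_space \<times> real \<Rightarrow> real) (\<lambda>c. partial_deriv c pkern) (\<lambda>c. partial_deriv c (partial_deriv c pkern))"
  unfolding dir_C2_def
proof (intro allI impI conjI)
  fix z c :: "'a \<times> real" assume z: "snd z > 0" and c: "c \<in> Basis"
  have nz: "z \<noteq> 0" using z by auto
  show "((\<lambda>s. pkern (z + s *\<^sub>R c)) has_real_derivative partial_deriv c pkern z) (at 0)"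
    by (rule has_derivative_imp_directional[OF hom_kernel_has_derivative[OF hom_kernel_pkern nz] c])
  show "((\<lambda>s. partial_deriv c pkern (z + s *\<^sub>R c)) has_real_derivative partial_deriv c (partial_deriv c pkern) z) (at 0)"
    by (rule has_derivative_imp_directional[OF hom_kernel_has_derivative[OF hom_kernel_partial_deriv[OF hom_kernel_pkern c] nz] c])
qed

lemma pkern_shift_vanishing: "vanishing (\<lambda>z::'a::euclidean_space \<times> real. pkern (z + (0, 1)))"
  unfolding vanishing_def
proof (intro allI impI)
  fix \<delta> :: real assume d: "\<delta> > 0"
  show "\<exists>L. \<forall>z::'a \<times> real. 0 \<le> snd z \<longrightarrow> L \<le> norm z \<longrightarrow> \<bar>pkern (z + (0, 1))\<bar> \<le> \<delta>"
  proof (intro exI[of _ "1 / \<delta> + 2"] allI impI)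
    fix z :: "'a \<times> real" assume z: "0 \<le> snd z" "1 / \<delta> + 2 \<le> norm z"
    have "norm (0::'a, 1::real) = 1" by simp
    then have nz: "norm (z + (0, 1)) \<ge> 1 / \<delta> + 1" using z(2) norm_diff_ineq[of z "(0, 1)"] by linarith
    have d1: "1 / \<delta> > 0" using d by simp
    have ge1: "norm (z + (0, 1)) \<ge> 1" using nz d1 by linarith
    have "pkern (z + (0, 1)) \<le> 1 / norm (z + (0, 1)) ^ DIM('a)" using z by (intro pkern_le) simp
    also have "\<dots> \<le> 1 / (1 / \<delta>)"
    proof (rule divide_left_mono)
      have "norm (z + (0, 1)) ^ 1 \<le> norm (z + (0, 1)) ^ DIM('a)" using ge1 by (intro power_increasing) (auto simp: Suc_leI)
      then show "1 / \<delta> \<le> norm (z + (0, 1)) ^ DIM('a)" using nz by simp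
      show "0 < norm (z + (0, 1)) ^ DIM('a) * (1 / \<delta>)" using ge1 d by (intro mult_pos_pos zero_less_power) auto
    qed simp
    finally show "\<bar>pkern (z + (0, 1))\<bar> \<le> \<delta>" using z pkern_nonneg[of "z + (0, 1)"] by simp
  qed
qed

text \<open>One inverse power of the height comes from the gradient estimate. The other comes from
  Jensen's inequality, which bounds the \<open>n\<close>-th power of the Poisson integral of
  \<open>\<bar>f\<bar>\<close> by a multiple of \<open>1 / t ^ n\<close>. The exponent two is used
  for the comparison at \<open>(0, t)\<close> and for counting dyadic levels in the
  converse.\<close>

lemma poisson_grad_height_bound:
  fixes f :: "'a::euclidean_space \<Rightarrow> real"
  assumes f: "f \<in> borel_measurable borel" "integrable lborel (\<lambda>y. \<bar>f y\<bar> ^ DIM('a))" and b: "b \<in> Basis"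
  shows "\<exists>K\<ge>0. \<forall>z. snd z > 0 \<longrightarrow> \<bar>poisson_grad b f z\<bar> \<le> K / (snd z)\<^sup>2"
proof -
  have p: "DIM('a) \<ge> 1" by (simp add: Suc_leI)
  have adm: "poisson_admissible f" by (rule poisson_admissible_power[OF f p])
  obtain C where C: "C \<ge> 0" "\<And>z. snd z > 0 \<Longrightarrow> \<bar>poisson_grad b f z\<bar> \<le> C / snd z * half_conv pker1 (\<lambda>y. \<bar>f y\<bar>) z"
    using poisson_grad_bound[OF b] adm by blast
  define I where "I = 1 / poisson_mass TYPE('a) * (LINT y|lborel. \<bar>f y\<bar> ^ DIM('a))"
  have I0: "I \<ge> 0" unfolding I_def using poisson_mass_pos[where 'a='a]
    by (intro mult_nonneg_nonneg Bochner_Integration.integral_nonneg) auto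
  define L where "L = root DIM('a) I"
  have L: "L \<ge> 0" "L ^ DIM('a) = I" using I0 by (auto simp: L_def)
  have "\<bar>poisson_grad b f z\<bar> \<le> C * L / (snd z)\<^sup>2" if z: "snd z > 0" for z
  proof -
    have "half_conv pker1 (\<lambda>y. \<bar>f y\<bar>) z ^ DIM('a) \<le> half_conv pker1 (\<lambda>y. \<bar>f y\<bar> ^ DIM('a)) z"
      by (rule half_conv_pker1_power_le[OF f p z])
    also have "\<dots> \<le> 1 / poisson_mass TYPE('a) / snd z ^ DIM('a) * (LINT y|lborel. \<bar>f y\<bar> ^ DIM('a))"
      by (rule half_conv_pker1_L1_bound[OF f(2) _ z]) simp
    also have "\<dots> = (L / snd z) ^ DIM('a)" by (simp add: L power_divide I_def)
    finally have "half_conv pker1 (\<lambda>y. \<bar>f y\<bar>) z ^ DIM('a) \<le> (L / snd z) ^ DIM('a)" .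
    then have "half_conv pker1 (\<lambda>y. \<bar>f y\<bar>) z \<le> L / snd z"
      using power_le_imp_le_base[of _ "DIM('a) - 1" "L / snd z"] L z by simp
    then have "C / snd z * half_conv pker1 (\<lambda>y. \<bar>f y\<bar>) z \<le> C / snd z * (L / snd z)"
      using C z by (intro mult_left_mono) auto
    then show ?thesis using C(2)[OF z] by (simp add: power2_eq_square)
  qed
  then show ?thesis using C L by (intro exI[of _ "C * L"]) auto
qed

text \<open>Qualitative only: the dominating constant contains \<open>(C / e) ^ p\<close> and blows
  up as \<open>e\<close> tends to \<open>0\<close>. Bounds uniform in \<open>e\<close> need the
  hypotheses on the derivative.\<close>

lemma poisson_grad_slice_integrable:
  fixes f :: "'a::euclidean_space \<Rightarrow> real"
  assumes f: "f \<in> borel_measurable borel" "integrable lborel (\<lambda>y. \<bar>f y\<bar> ^ p)" and p: "p \<ge> 1"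
    and b: "b \<in> Basis" and e: "e > 0"
  shows "integrable lborel (\<lambda>y. \<bar>poisson_grad b f (y, e)\<bar> ^ p)"
proof -
  have adm: "poisson_admissible f" by (rule poisson_admissible_power[OF f p])
  obtain C where C: "C \<ge> 0" "\<And>z. snd z > 0 \<Longrightarrow> \<bar>poisson_grad b f z\<bar> \<le> C / snd z * half_conv pker1 (\<lambda>y. \<bar>f y\<bar>) z"
    using poisson_grad_bound[OF b] adm by blast
  have fm [measurable]: "f \<in> borel_measurable borel" by (rule f)
  have am: "(\<lambda>y. \<bar>f y\<bar>) \<in> borel_measurable borel" by measurable
  have "continuous_on UNIV (\<lambda>y. poisson_grad b f (y, e))"
    by (rule continuous_on_compose2[OF continuous_on_poisson_grad[OF adm b, of "{z. snd z > 0}"]])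
      (use e in \<open>auto intro!: continuous_intros\<close>)
  then have gm [measurable]: "(\<lambda>y. poisson_grad b f (y, e)) \<in> borel_measurable borel"
    by (rule borel_measurable_continuous_onI)
  have "(\<integral>\<^sup>+y. ennreal (\<bar>half_conv pker1 (\<lambda>y. \<bar>f y\<bar>) (y, e)\<bar> ^ p) \<partial>lborel) \<le> (\<integral>\<^sup>+y. ennreal (\<bar>\<bar>f y\<bar>\<bar> ^ p) \<partial>lborel)"
    by (rule half_conv_pker1_slice[OF am p e])
  also have "\<dots> < \<infinity>" using f(2) by (simp add: integrable_iff_bounded)
  finally have "integrable lborel (\<lambda>y. \<bar>half_conv pker1 (\<lambda>y. \<bar>f y\<bar>) (y, e)\<bar> ^ p)"
    using am by (simp add: integrable_iff_bounded)
  from integrable_mult_right[OF this, of "(C / e) ^ p"]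
  show ?thesis
  proof (rule Bochner_Integration.integrable_bound)
    show "AE y in lborel. norm (\<bar>poisson_grad b f (y, e)\<bar> ^ p) \<le> norm ((C / e) ^ p * \<bar>half_conv pker1 (\<lambda>y. \<bar>f y\<bar>) (y, e)\<bar> ^ p)"
    proof (rule AE_I2)
      fix y
      have "\<bar>poisson_grad b f (y, e)\<bar> \<le> C / e * \<bar>half_conv pker1 (\<lambda>y. \<bar>f y\<bar>) (y, e)\<bar>"
      proof -
        have "\<bar>poisson_grad b f (y, e)\<bar> \<le> C / e * half_conv pker1 (\<lambda>y. \<bar>f y\<bar>) (y, e)"
          using C(2)[of "(y, e)"] e by simp
        also have "\<dots> \<le> C / e * \<bar>half_conv pker1 (\<lambda>y. \<bar>f y\<bar>) (y, e)\<bar>"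
          by (rule mult_left_mono[OF abs_ge_self]) (use C e in simp)
        finally show ?thesis .
      qed
      then have "\<bar>poisson_grad b f (y, e)\<bar> ^ p \<le> (C / e * \<bar>half_conv pker1 (\<lambda>y. \<bar>f y\<bar>) (y, e)\<bar>) ^ p"
        by (intro power_mono) auto
      then have "norm (\<bar>poisson_grad b f (y, e)\<bar> ^ p) \<le> (C / e) ^ p * \<bar>half_conv pker1 (\<lambda>y. \<bar>f y\<bar>) (y, e)\<bar> ^ p"
        by (simp only: power_mult_distrib real_norm_def power_abs abs_abs)
      also have "\<dots> \<le> norm \<dots>" unfolding real_norm_def by (rule abs_ge_self)
      finally show "norm (\<bar>poisson_grad b f (y, e)\<bar> ^ p) \<le> norm ((C / e) ^ p * \<bar>half_conv pker1 (\<lambda>y. \<bar>f y\<bar>) (y, e)\<bar> ^ p)" .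
    qed
  qed measurable
qed

text \<open>The Hessian of a harmonic function is symmetric with trace zero. The mixed entries of
  the vertical row occur in the tangential rows, and the remaining entry is minus the sum of the
  tangential diagonal, whose square costs a factor \<open>DIM('a)\<close> by Cauchy-Schwarz.\<close>

lemma poisson_grad_vertical_dominated:
  fixes f :: "'a::euclidean_space \<Rightarrow> real" and w :: "'a \<times> real"
  assumes f: "poisson_admissible f" and w: "snd w > 0"
  shows "(\<Sum>c\<in>Basis. (half_conv (partial_deriv c (partial_deriv (0, 1) pkern)) f w)\<^sup>2) \<le>
    real DIM('a) * (\<Sum>c\<in>Basis. \<Sum>i\<in>Basis. (half_conv (partial_deriv c (partial_deriv (i, 0) pkern)) f w)\<^sup>2)"
proof -
  define h where "h = (\<lambda>b c :: 'a \<times> real. half_conv (partial_deriv c (partial_deriv b pkern)) f w)"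
  let ?e = "(0, 1) :: 'a \<times> real"
  have e: "?e \<in> Basis" by (simp add: Basis_prod_def)
  have iB: "(i, 0) \<in> (Basis :: ('a \<times> real) set)" if "i \<in> Basis" for i using that by (simp add: Basis_prod_def)
  have sym: "h b c = h c b" if "b \<in> Basis" "c \<in> Basis" for b c
    unfolding h_def by (rule poisson_grad_symmetric[OF that w])
  have "(\<Sum>c\<in>Basis. h c c) = 0" unfolding h_def by (rule half_conv_pkern_harmonic[OF f w])
  then have hee: "h ?e ?e = - (\<Sum>i\<in>Basis. h (i, 0) (i, 0))" unfolding sum_Basis_half by linarith
  have n1: "1 \<le> real DIM('a)" using DIM_positive[where 'a='a] by linarith
  have "(\<Sum>c\<in>Basis. (h ?e c)\<^sup>2) = (\<Sum>i\<in>Basis. (h (i, 0) ?e)\<^sup>2) + (\<Sum>i\<in>Basis. h (i, 0) (i, 0))\<^sup>2"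
    unfolding sum_Basis_half hee using sym[OF e iB] by (simp cong: sum.cong)
  also have "(\<Sum>i\<in>Basis. h (i, 0) (i, 0))\<^sup>2 \<le> (\<Sum>i\<in>Basis. (h (i, 0) (i, 0))\<^sup>2) * real DIM('a)"
    by (rule sum_squared_le_sum_of_squares)
  also have "(\<Sum>i\<in>Basis. (h (i, 0) ?e)\<^sup>2) + (\<Sum>i\<in>Basis. (h (i, 0) (i, 0))\<^sup>2) * real DIM('a)
     \<le> (\<Sum>i\<in>Basis. real DIM('a) * (\<Sum>c\<in>Basis. (h (i, 0) c)\<^sup>2))"
    unfolding sum_distrib_right sum.distrib[symmetric]
  proof (intro sum_mono)
    fix i :: 'a assume i: "i \<in> Basis"
    have "(h (i, 0) (i, 0))\<^sup>2 \<le> (\<Sum>j\<in>Basis. (h (i, 0) (j, 0))\<^sup>2)"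
      using i by (intro member_le_sum[where f="\<lambda>j. (h (i, 0) (j, 0))\<^sup>2"]) auto
    then have 1: "(h (i, 0) (i, 0))\<^sup>2 + (h (i, 0) ?e)\<^sup>2 \<le> (\<Sum>c\<in>Basis. (h (i, 0) c)\<^sup>2)"
      unfolding sum_Basis_half by simp
    have "(h (i, 0) ?e)\<^sup>2 + (h (i, 0) (i, 0))\<^sup>2 * real DIM('a) \<le> real DIM('a) * ((h (i, 0) (i, 0))\<^sup>2 + (h (i, 0) ?e)\<^sup>2)"
      using mult_right_mono[OF n1, of "(h (i, 0) ?e)\<^sup>2"] by (simp add: algebra_simps)
    also have "\<dots> \<le> real DIM('a) * (\<Sum>c\<in>Basis. (h (i, 0) c)\<^sup>2)" using 1 by (intro mult_left_mono) auto
    finally show "(h (i, 0) ?e)\<^sup>2 + (h (i, 0) (i, 0))\<^sup>2 * real DIM('a) \<le> real DIM('a) * (\<Sum>c\<in>Basis. (h (i, 0) c)\<^sup>2)" .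
  qed
  also have "\<dots> = real DIM('a) * (\<Sum>c\<in>Basis. \<Sum>i\<in>Basis. (h (i, 0) c)\<^sup>2)"
    by (subst sum.swap) (simp add: sum_distrib_left)
  finally show ?thesis by (simp add: h_def)
qed

lemma poisson_weight_tendsto:
  fixes y :: "'a::euclidean_space"
  shows "(\<lambda>j. (real (Suc j) / norm (- y, real (Suc j))) ^ m) \<longlonglongrightarrow> 1"
proof -
  have "(\<lambda>j. norm ((1 / real (Suc j)) *\<^sub>R (- y), 1::real)) \<longlonglongrightarrow> norm (0 *\<^sub>R (- y), 1::real)"
    using LIMSEQ_inverse_real_of_nat by (intro tendsto_intros) (simp add: inverse_eq_divide)
  then have lim: "(\<lambda>j. (1 / norm ((1 / real (Suc j)) *\<^sub>R (- y), 1::real)) ^ m) \<longlonglongrightarrow> (1 / 1) ^ m"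
    by (intro tendsto_intros) auto
  have "real (Suc j) / norm (- y, real (Suc j)) = 1 / norm ((1 / real (Suc j)) *\<^sub>R (- y), 1::real)" for j
  proof -
    have "(- y, real (Suc j)) = real (Suc j) *\<^sub>R ((1 / real (Suc j)) *\<^sub>R (- y), 1::real)"
      by (simp del: of_nat_Suc)
    then have "norm (- y, real (Suc j)) = real (Suc j) * norm ((1 / real (Suc j)) *\<^sub>R (- y), 1::real)"
      by (metis norm_scaleR abs_of_nat)
    then show ?thesis by simp
  qed
  then show ?thesis using lim by simp
qed

lemma integrable_real_bound:
  fixes f g :: "'b \<Rightarrow> real"
  assumes "integrable M g" "f \<in> borel_measurable M" "\<And>x. \<bar>f x\<bar> \<le> g x"
  shows "integrable M f"
  by (rule Bochner_Integration.integrable_bound[OF assms(1,2)])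
    (use assms(3) in \<open>auto intro: order_trans[OF _ abs_ge_self]\<close>)

text \<open>The subharmonic function \<open>H\<close> decays faster than \<open>t\<^sup>-\<^sup>n\<close> at \<open>(0, t)\<close>, while \<open>t\<^sup>n\<close> times the Poisson kernel tends to
  a constant; so the integral of \<open>H\<close> over the boundary is nonnegative.\<close>

lemma conjugate_bound:
  fixes Y :: "'i \<Rightarrow> 'a::euclidean_space \<times> real \<Rightarrow> real" and v :: "'a \<times> real \<Rightarrow> real"
  assumes n: "DIM('a) \<ge> 2" and I: "finite I"
    and YC: "\<And>i. i \<in> I \<Longrightarrow> dir_C2 (Y i) (Y1 i) (Y2 i)" and vC: "dir_C2 v v1 v2"
    and Yh: "\<And>i z. i \<in> I \<Longrightarrow> snd z > 0 \<Longrightarrow> (\<Sum>c\<in>Basis. Y2 i c z) = 0"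
    and vh: "\<And>z. snd z > 0 \<Longrightarrow> (\<Sum>c\<in>Basis. v2 c z) = 0"
    and pos: "\<And>z. snd z \<ge> 0 \<Longrightarrow> \<exists>i\<in>I. Y i z \<noteq> 0"
    and dom: "\<And>z. snd z > 0 \<Longrightarrow> (\<Sum>c\<in>Basis. (v1 c z)\<^sup>2) \<le> real DIM('a) * (\<Sum>c\<in>Basis. \<Sum>i\<in>I. (Y1 i c z)\<^sup>2)"
    and cont: "\<And>i. i \<in> I \<Longrightarrow> continuous_on {z. snd z \<ge> 0} (Y i)" "continuous_on {z. snd z \<ge> 0} v"
    and van: "\<And>i. i \<in> I \<Longrightarrow> vanishing (Y i)" "vanishing v"
    and int: "\<And>i. i \<in> I \<Longrightarrow> integrable lborel (\<lambda>y. \<bar>Y i (y, 0)\<bar> ^ DIM('a))" "integrable lborel (\<lambda>y. \<bar>v (y, 0)\<bar> ^ DIM('a))"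
    and height: "\<And>i t. i \<in> I \<Longrightarrow> t \<ge> 1 \<Longrightarrow> \<bar>Y i (0, t)\<bar> \<le> K / t\<^sup>2" "\<And>t. t \<ge> 1 \<Longrightarrow> \<bar>v (0, t)\<bar> \<le> K / t\<^sup>2"
    and k: "k = real DIM('a) / 2 - 1"
    and C1: "C1 = 4 * k * (real DIM('a) + 2) + 4 * k * (real DIM('a) + 1)" and A: "A = (2 * (k + 1) + 4 * (k + 1) * k) * (real DIM('a) + 1)"
    and B: "B = C1 * C1 powr (2 * k)"
  shows "(LINT y|lborel. \<bar>v (y, 0)\<bar> ^ DIM('a)) \<le>
    2 * (A * B + A * (2 * A) powr k) * real (card I) powr (k + 1) * (\<Sum>i\<in>I. LINT y|lborel. \<bar>Y i (y, 0)\<bar> ^ DIM('a))"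
proof -
  let ?n = "DIM('a)"
  define s where "s = (\<lambda>z. \<Sum>i\<in>I. (Y i z)\<^sup>2)"
  define \<rho> where "\<rho> = (\<lambda>z. (\<Sum>i\<in>I. (Y i z)\<^sup>2) + (v z)\<^sup>2)"
  define H where "H = (\<lambda>z. A * (s z * \<rho> z powr k + B * s z powr (k + 1)) - \<rho> z powr (k + 1))"
  have k0: "k \<ge> 0" using n k by simp
  have q: "k + 1 = real ?n / 2" using k by simp
  have C10: "C1 \<ge> 0" unfolding C1 using k0 by simp
  have B0: "B \<ge> 0" using C10 by (simp add: B)
  have A0: "A > 0" unfolding A
    by (rule mult_pos_pos[OF add_pos_nonneg]) (use k0 in auto)
  have "\<exists>G1 G2. dir_C2 H G1 G2 \<and> (\<forall>z. snd z > 0 \<longrightarrow> (\<Sum>c\<in>Basis. G2 c z) \<ge> 0)"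
    unfolding H_def
    by (rule gradient_system_subharmonic[OF I YC vC Yh vh pos dom _ k0 C1 A B s_def \<rho>_def]) auto
  then obtain G1 G2 where HC: "dir_C2 H G1 G2" and Hsub: "\<And>z. snd z > 0 \<Longrightarrow> (\<Sum>c\<in>Basis. G2 c z) \<ge> 0" by blast
  have s_nn: "s z \<ge> 0" for z unfolding s_def by (intro sum_nonneg) auto
  have \<rho>_ge: "s z \<le> \<rho> z" "(v z)\<^sup>2 \<le> \<rho> z" "\<rho> z \<ge> 0" for z
    using s_nn[of z] by (simp_all add: \<rho>_def s_def)
  have s_pos: "s z > 0" if z: "snd z \<ge> 0" for z
  proof -
    obtain i where i: "i \<in> I" "Y i z \<noteq> 0" using pos[OF z] by blast
    then have "0 < (Y i z)\<^sup>2" by simp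
    also have "\<dots> \<le> s z" unfolding s_def using i I by (intro member_le_sum) auto
    finally show ?thesis .
  qed
  have \<rho>_pos: "\<rho> z > 0" if "snd z \<ge> 0" for z using s_pos[OF that] \<rho>_ge[of z] by linarith
  define C3 where "C3 = A + A * B + 1"
  have C30: "C3 \<ge> 0" using A0 B0 by (simp add: C3_def)
  have mulk: "x * x powr k = x powr (k + 1)" if "x \<ge> 0" for x :: real
    using that by (cases "x = 0") (auto simp: powr_add)
  have Hbd: "\<bar>H z\<bar> \<le> C3 * \<rho> z powr (k + 1)" for z
  proof -
    have 1: "s z * \<rho> z powr k \<le> \<rho> z powr (k + 1)"
      using \<rho>_ge[of z] by (subst mulk[symmetric]) (auto intro!: mult_right_mono)
    have 2: "s z powr (k + 1) \<le> \<rho> z powr (k + 1)" using \<rho>_ge s_nn k0 by (intro powr_mono2) auto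
    have 3: "A * (s z * \<rho> z powr k) \<le> A * \<rho> z powr (k + 1)" "A * (B * s z powr (k + 1)) \<le> A * (B * \<rho> z powr (k + 1))"
      using 1 2 A0 B0 by (auto intro!: mult_left_mono)
    have 4: "0 \<le> A * (s z * \<rho> z powr k)" "0 \<le> A * (B * s z powr (k + 1))" "0 \<le> \<rho> z powr (k + 1)"
      using A0 B0 s_nn by auto
    have 5: "C3 * \<rho> z powr (k + 1) = A * \<rho> z powr (k + 1) + A * (B * \<rho> z powr (k + 1)) + \<rho> z powr (k + 1)"
      by (simp add: C3_def algebra_simps)
    have 6: "H z = A * (s z * \<rho> z powr k) + A * (B * s z powr (k + 1)) - \<rho> z powr (k + 1)"
      by (simp add: H_def algebra_simps)
    show ?thesis unfolding 5 6 using 3 4 by linarith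
  qed
  \<comment> \<open>Where \<open>\<rho> \<ge> 2 * A * s\<close>, half of the subtracted power
    absorbs \<open>A * s * \<rho> powr k\<close>. Elsewhere \<open>\<rho> powr k\<close> is bounded
    by a multiple of \<open>s powr k\<close>. Hence the constant in the conclusion.\<close>
  have Hup: "H z \<le> (A * B + A * (2 * A) powr k) * s z powr (k + 1) - \<rho> z powr (k + 1) / 2" for z
  proof -
    have "A * (s z * \<rho> z powr k) \<le> A * (2 * A) powr k * s z powr (k + 1) + \<rho> z powr (k + 1) / 2"
    proof (cases "2 * A * s z \<le> \<rho> z")
      case True
      then have "(2 * A * s z) * \<rho> z powr k \<le> \<rho> z * \<rho> z powr k" by (intro mult_right_mono) auto
      then have "A * (s z * \<rho> z powr k) \<le> \<rho> z powr (k + 1) / 2" using mulk[OF \<rho>_ge(3)[of z]] by simp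
      moreover have "0 \<le> A * (2 * A) powr k * s z powr (k + 1)" using A0 by simp
      ultimately show ?thesis by linarith
    next
      case False
      then have "\<rho> z powr k \<le> (2 * A * s z) powr k" using \<rho>_ge k0 by (intro powr_mono2) auto
      also have "\<dots> = (2 * A) powr k * s z powr k" using A0 s_nn by (simp add: powr_mult)
      finally have "s z * \<rho> z powr k \<le> s z * ((2 * A) powr k * s z powr k)" using s_nn by (intro mult_left_mono) auto
      also have "\<dots> = (2 * A) powr k * s z powr (k + 1)" using mulk[OF s_nn[of z]] by simp
      finally have "A * (s z * \<rho> z powr k) \<le> A * ((2 * A) powr k * s z powr (k + 1))" using A0 by (intro mult_left_mono) auto
      moreover have "0 \<le> \<rho> z powr (k + 1)" by simp
      ultimately show ?thesis unfolding mult.assoc by linarith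
    qed
    then show ?thesis by (simp add: H_def algebra_simps)
  qed
  have Hcont: "continuous_on {z. snd z \<ge> 0} H"
  proof -
    have cs: "continuous_on {z. snd z \<ge> 0} s" unfolding s_def by (intro continuous_intros cont)
    have c\<rho>: "continuous_on {z. snd z \<ge> 0} \<rho>" unfolding \<rho>_def by (intro continuous_intros cont)
    have "\<forall>z\<in>{z. snd z \<ge> 0}. s z \<noteq> 0" "\<forall>z\<in>{z. snd z \<ge> 0}. \<rho> z \<noteq> 0" using s_pos \<rho>_pos by (metis less_irrefl mem_Collect_eq)+
    then show ?thesis unfolding H_def
      by (intro continuous_on_diff continuous_on_mult continuous_on_add continuous_on_const continuous_on_powr cs c\<rho>)
  qed
  have Hvan: "vanishing H"
  proof (rule vanishing_bound[where C=C3])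
    have "vanishing \<rho>" unfolding \<rho>_def by (intro vanishing_add vanishing_sum I vanishing_square van)
    then show "vanishing (\<lambda>z. \<rho> z powr (k + 1))" using k0 \<rho>_ge by (intro vanishing_powr) auto
    show "\<bar>H z\<bar> \<le> C3 * \<bar>\<rho> z powr (k + 1)\<bar>" for z using Hbd[of z] by simp
  qed
  define h where "h = (\<lambda>y. H (y, 0))"
  have slice_cont: "continuous_on UNIV (\<lambda>y. g (y, 0))" if "continuous_on {z. snd z \<ge> 0} g" for g :: "'a \<times> real \<Rightarrow> real"
    by (rule continuous_on_compose2[OF that]) (auto intro!: continuous_intros)
  have hm [measurable]: "h \<in> borel_measurable borel"
    unfolding h_def by (rule borel_measurable_continuous_onI[OF slice_cont[OF Hcont]])
  have Ym [measurable]: "(\<lambda>y. Y i (y, 0)) \<in> borel_measurable borel" if "i \<in> I" for i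
    by (rule borel_measurable_continuous_onI[OF slice_cont[OF cont(1)[OF that]]])
  have vm [measurable]: "(\<lambda>y. v (y, 0)) \<in> borel_measurable borel"
    by (rule borel_measurable_continuous_onI[OF slice_cont[OF cont(2)]])
  have sm [measurable]: "(\<lambda>y. s (y, 0)) \<in> borel_measurable borel" unfolding s_def by measurable
  have \<rho>m [measurable]: "(\<lambda>y. \<rho> (y, 0)) \<in> borel_measurable borel" unfolding \<rho>_def by measurable
  have n1: "?n \<ge> 1" using n by simp
  have s_le: "s z powr (k + 1) \<le> real (card I) powr (k + 1) * (\<Sum>i\<in>I. \<bar>Y i z\<bar> ^ ?n)" for z
    unfolding s_def q by (rule sum_squares_powr_le[OF I n1])
  have s_int: "integrable lborel (\<lambda>y. s (y, 0) powr (k + 1))"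
  proof (rule integrable_real_bound)
    show "integrable lborel (\<lambda>y. real (card I) powr (k + 1) * (\<Sum>i\<in>I. \<bar>Y i (y, 0)\<bar> ^ ?n))"
      by (intro integrable_mult_right Bochner_Integration.integrable_sum int)
    show "\<bar>s (y, 0) powr (k + 1)\<bar> \<le> real (card I) powr (k + 1) * (\<Sum>i\<in>I. \<bar>Y i (y, 0)\<bar> ^ ?n)" for y
      using s_le[of "(y, 0)"] by (simp only: abs_of_nonneg powr_ge_zero)
  qed measurable
  have \<rho>_le: "\<rho> z powr (k + 1) \<le> 2 powr (k + 1) * (s z powr (k + 1) + \<bar>v z\<bar> ^ ?n)" for z
  proof -
    have "\<rho> z \<le> 2 * max (s z) ((v z)\<^sup>2)" by (simp add: \<rho>_def s_def)
    then have "\<rho> z powr (k + 1) \<le> (2 * max (s z) ((v z)\<^sup>2)) powr (k + 1)" using \<rho>_ge k0 by (intro powr_mono2) auto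
    also have "\<dots> = 2 powr (k + 1) * (max (s z) ((v z)\<^sup>2)) powr (k + 1)" using s_nn[of z] by (simp add: powr_mult)
    also have "(max (s z) ((v z)\<^sup>2)) powr (k + 1) \<le> s z powr (k + 1) + ((v z)\<^sup>2) powr (k + 1)"
      by (simp add: max_def)
    also have "((v z)\<^sup>2) powr (k + 1) = \<bar>v z\<bar> ^ ?n" unfolding q by (rule abs_power_eq_square_powr[OF n1])
    finally show ?thesis by simp
  qed
  have \<rho>_int: "integrable lborel (\<lambda>y. \<rho> (y, 0) powr (k + 1))"
  proof (rule integrable_real_bound)
    show "integrable lborel (\<lambda>y. 2 powr (k + 1) * (s (y, 0) powr (k + 1) + \<bar>v (y, 0)\<bar> ^ ?n))"
      by (intro integrable_mult_right Bochner_Integration.integrable_add int s_int)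
    show "\<bar>\<rho> (y, 0) powr (k + 1)\<bar> \<le> 2 powr (k + 1) * (s (y, 0) powr (k + 1) + \<bar>v (y, 0)\<bar> ^ ?n)" for y
      using \<rho>_le[of "(y, 0)"] by (simp only: abs_of_nonneg powr_ge_zero)
  qed measurable
  have h_int: "integrable lborel h"
  proof (rule integrable_real_bound)
    show "integrable lborel (\<lambda>y. C3 * \<rho> (y, 0) powr (k + 1))" by (intro integrable_mult_right \<rho>_int)
    show "\<bar>h y\<bar> \<le> C3 * \<rho> (y, 0) powr (k + 1)" for y
      using Hbd by (simp only: h_def)
  qed measurable
  have h_pos: "0 \<le> (LINT y|lborel. h y)"
  proof (rule LIMSEQ_le)
    \<comment> \<open>This is \<open>t ^ n\<close> times the unnormalised kernel between
      \<open>(0, t)\<close> and \<open>(y, 0)\<close>, for \<open>t = real (Suc j)\<close>. It takes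
      values in \<open>[0, 1]\<close> and tends to \<open>1\<close> pointwise, so dominated
      convergence gives the full integral of \<open>h\<close>.\<close>
    define w where "w = (\<lambda>j (y::'a). (real (Suc j) / norm (- y, real (Suc j))) ^ (?n + 1))"
    have w1: "0 \<le> w j y" "w j y \<le> 1" for j y
    proof -
      define t where "t = real (Suc j)"
      define N where "N = norm (- y, t)"
      have "norm t \<le> N" unfolding N_def by (rule norm_snd_le)
      then have t: "0 < t" "t \<le> N" by (simp_all add: t_def)
      then have r: "0 \<le> t / N" "t / N \<le> 1" by (simp_all add: divide_le_eq_1)
      show "0 \<le> w j y" "w j y \<le> 1" unfolding w_def t_def[symmetric] N_def[symmetric]
        by (rule zero_le_power[OF r(1)], rule power_le_one[OF r])
    qed
    have wm: "w j \<in> borel_measurable borel" for j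
    proof -
      have [measurable]: "(\<lambda>y::'a. (- y, real (Suc j))) \<in> borel_measurable borel"
        by (intro borel_measurable_continuous_onI continuous_intros)
      show ?thesis unfolding w_def by measurable
    qed
    show "(\<lambda>j. LINT y|lborel. w j y * h y) \<longlonglongrightarrow> (LINT y|lborel. h y)"
    proof (rule integral_dominated_convergence[where w="\<lambda>y. \<bar>h y\<bar>"])
      show "AE y in lborel. (\<lambda>j. w j y * h y) \<longlonglongrightarrow> h y"
      proof (rule AE_I2)
        fix y :: 'a
        have "(\<lambda>j. w j y * h y) \<longlonglongrightarrow> 1 * h y"
          unfolding w_def by (rule tendsto_mult[OF poisson_weight_tendsto tendsto_const])
        then show "(\<lambda>j. w j y * h y) \<longlonglongrightarrow> h y" by simp
      qed
      show "AE y in lborel. norm (w j y * h y) \<le> \<bar>h y\<bar>" for j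
      proof (rule AE_I2)
        fix y :: 'a
        have "\<bar>w j y\<bar> * \<bar>h y\<bar> \<le> 1 * \<bar>h y\<bar>" using w1[of j y] by (intro mult_right_mono) auto
        then show "norm (w j y * h y) \<le> \<bar>h y\<bar>" by (simp only: real_norm_def abs_mult mult_1_left)
      qed
    qed (use h_int wm in auto)
    define \<kappa> where "\<kappa> = poisson_mass TYPE('a)"
    have \<kappa>: "\<kappa> > 0" unfolding \<kappa>_def by (rule poisson_mass_pos)
    have le: "\<kappa> * real (Suc j) ^ ?n * H (0, real (Suc j)) \<le> (LINT y|lborel. w j y * h y)" for j
    proof -
      have t: "real (Suc j) > 0" by simp
      have "H (0, real (Suc j)) \<le> half_conv pker1 h (0, real (Suc j))"
        unfolding h_def by (rule subharmonic_le_poisson[OF HC Hsub Hcont Hvan]) auto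
      then have "\<kappa> * real (Suc j) ^ ?n * H (0, real (Suc j)) \<le> \<kappa> * real (Suc j) ^ ?n * half_conv pker1 h (0, real (Suc j))"
        using \<kappa> by (intro mult_left_mono) auto
      also have "\<dots> = (LINT y|lborel. \<kappa> * real (Suc j) ^ ?n * (pker1 ((0, real (Suc j)) - (y, 0)) * h y))"
        unfolding half_conv_def by simp
      also have "\<dots> = (LINT y|lborel. w j y * h y)"
      proof (rule Bochner_Integration.integral_cong[OF refl])
        fix y :: 'a
        have "\<kappa> * real (Suc j) ^ ?n * pker1 ((0, real (Suc j)) - (y, 0)) = w j y"
          using \<kappa> by (simp add: pker1_def pkern_def w_def \<kappa>_def[symmetric] power_divide del: of_nat_Suc)
        then show "\<kappa> * real (Suc j) ^ ?n * (pker1 ((0, real (Suc j)) - (y, 0)) * h y) = w j y * h y"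
          by (simp only: mult.assoc[symmetric])
      qed
      finally show ?thesis .
    qed
    then show "\<exists>N. \<forall>j\<ge>N. \<kappa> * real (Suc j) ^ ?n * H (0, real (Suc j)) \<le> (LINT y|lborel. w j y * h y)" by blast
    define L where "L = (real (card I) + 1) * K\<^sup>2"
    have L0: "L \<ge> 0" by (simp add: L_def)
    \<comment> \<open>At \<open>(0, t)\<close> the height bounds make \<open>\<rho>\<close> of order
      \<open>1 / t ^ 4\<close>, so \<open>\<rho> powr (n / 2)\<close> is of order
      \<open>1 / t ^ (2 * n)\<close>. This beats the factor \<open>t ^ n\<close>; of the surplus
      only \<open>1 / t\<close> is kept.\<close>
    have bound: "\<bar>\<kappa> * real (Suc j) ^ ?n * H (0, real (Suc j))\<bar> \<le> \<kappa> * C3 * L powr (k + 1) * (1 / real (Suc j))" for j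
    proof -
      let ?t = "real (Suc j)"
      have t: "?t \<ge> 1" by simp
      have sq: "x\<^sup>2 \<le> K\<^sup>2 / ?t ^ 4" if "\<bar>x\<bar> \<le> K / ?t\<^sup>2" for x :: real
      proof -
        have "\<bar>x\<bar>\<^sup>2 \<le> (K / ?t\<^sup>2)\<^sup>2" using that by (intro power_mono) auto
        then show ?thesis by (simp add: power_divide del: of_nat_Suc)
      qed
      have "\<rho> (0, ?t) \<le> (\<Sum>i\<in>I. K\<^sup>2 / ?t ^ 4) + K\<^sup>2 / ?t ^ 4"
        unfolding \<rho>_def using height t by (intro add_mono sum_mono sq) auto
      also have "\<dots> = L / ?t ^ 4" by (simp add: L_def algebra_simps add_divide_distrib del: of_nat_Suc)
      finally have "\<rho> (0, ?t) powr (k + 1) \<le> (L / ?t ^ 4) powr (k + 1)" using \<rho>_ge k0 by (intro powr_mono2) auto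
      also have "\<dots> = L powr (k + 1) / (?t ^ 4) powr (k + 1)" using L0 by (simp add: powr_divide del: of_nat_Suc)
      also have "(?t ^ 4) powr (k + 1) = ?t ^ (2 * ?n)"
      proof -
        have "(?t ^ 4) powr (k + 1) = (?t powr 4) powr (k + 1)" by (simp add: powr_numeral del: of_nat_Suc)
        also have "\<dots> = ?t powr (real (2 * ?n))" unfolding powr_powr q by simp
        also have "\<dots> = ?t ^ (2 * ?n)" by (rule powr_realpow) simp
        finally show ?thesis .
      qed
      finally have "\<bar>H (0, ?t)\<bar> \<le> C3 * (L powr (k + 1) / ?t ^ (2 * ?n))"
        using Hbd[of "(0, ?t)"] C30 by (meson mult_left_mono order_trans)
      then have "\<kappa> * ?t ^ ?n * \<bar>H (0, ?t)\<bar> \<le> \<kappa> * ?t ^ ?n * (C3 * (L powr (k + 1) / ?t ^ (2 * ?n)))"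
        using \<kappa> by (intro mult_left_mono) auto
      also have "\<dots> = \<kappa> * C3 * L powr (k + 1) * (1 / ?t ^ ?n)"
        by (simp add: mult_2 power_add del: of_nat_Suc)
      also have "\<dots> \<le> \<kappa> * C3 * L powr (k + 1) * (1 / ?t)"
      proof (intro mult_left_mono divide_left_mono)
        show "?t \<le> ?t ^ ?n" using t n1 by (intro self_le_power) auto
      qed (use \<kappa> C30 in auto)
      finally show ?thesis using \<kappa> by (simp add: abs_mult del: of_nat_Suc)
    qed
    have "(\<lambda>j. \<kappa> * C3 * L powr (k + 1) * (1 / real (Suc j))) \<longlonglongrightarrow> 0"
      using LIMSEQ_inverse_real_of_nat by (intro tendsto_mult_right_zero) (simp add: inverse_eq_divide)
    then show "(\<lambda>j. \<kappa> * real (Suc j) ^ ?n * H (0, real (Suc j))) \<longlonglongrightarrow> 0"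
      by (rule Lim_null_comparison[rotated]) (use bound in \<open>auto intro!: always_eventually\<close>)
  qed
  define C5 where "C5 = A * B + A * (2 * A) powr k"
  have C50: "C5 \<ge> 0" using A0 B0 by (simp add: C5_def)
  have "0 \<le> (LINT y|lborel. C5 * s (y, 0) powr (k + 1) - \<rho> (y, 0) powr (k + 1) / 2)"
    by (rule order_trans[OF h_pos integral_mono]) (use h_int s_int \<rho>_int Hup in \<open>auto simp: h_def C5_def\<close>)
  also have "\<dots> = C5 * (LINT y|lborel. s (y, 0) powr (k + 1)) - (LINT y|lborel. \<rho> (y, 0) powr (k + 1)) / 2"
    using s_int \<rho>_int by simp
  finally have 1: "(LINT y|lborel. \<rho> (y, 0) powr (k + 1)) \<le> 2 * C5 * (LINT y|lborel. s (y, 0) powr (k + 1))" by simp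
  have "(LINT y|lborel. \<bar>v (y, 0)\<bar> ^ ?n) \<le> (LINT y|lborel. \<rho> (y, 0) powr (k + 1))"
  proof (intro integral_mono int \<rho>_int)
    fix y
    have "((v (y, 0))\<^sup>2) powr (k + 1) \<le> \<rho> (y, 0) powr (k + 1)" using \<rho>_ge k0 by (intro powr_mono2) auto
    then show "\<bar>v (y, 0)\<bar> ^ ?n \<le> \<rho> (y, 0) powr (k + 1)" unfolding q abs_power_eq_square_powr[OF n1] .
  qed
  also note 1
  also have "2 * C5 * (LINT y|lborel. s (y, 0) powr (k + 1)) \<le> 2 * C5 * (LINT y|lborel. real (card I) powr (k + 1) * (\<Sum>i\<in>I. \<bar>Y i (y, 0)\<bar> ^ ?n))"
    using C50 by (intro mult_left_mono integral_mono s_int integrable_mult_right Bochner_Integration.integrable_sum int s_le) auto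
  also have "\<dots> = 2 * C5 * real (card I) powr (k + 1) * (\<Sum>i\<in>I. LINT y|lborel. \<bar>Y i (y, 0)\<bar> ^ ?n)"
    using int by (simp add: Bochner_Integration.integral_sum)
  finally show ?thesis by (simp add: C5_def)
qed

lemma pkern_unit_power_integral:
  assumes "m \<ge> 1"
  shows "integrable lborel (\<lambda>y::'a::euclidean_space. \<bar>pkern (y, 1)\<bar> ^ m)"
    and "(LINT y|lborel. \<bar>pkern (y::'a, 1)\<bar> ^ m) \<le> poisson_mass TYPE('a)"
proof -
  have mp: "poisson_mass TYPE('a) > 0" by (rule poisson_mass_pos)
  have eq: "(\<lambda>y::'a. pkern (y, 1)) = (\<lambda>y. poisson_mass TYPE('a) * pker1 (y, 1))"
    using mp by (simp add: pker1_def)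
  have i1: "integrable lborel (\<lambda>y::'a. pkern (y, 1))" "(LINT y|lborel. pkern (y::'a, 1)) = poisson_mass TYPE('a)"
    unfolding eq using pker1_integrable(3,4)[of 1, where 'a='a] by simp_all
  have le: "\<bar>pkern (y::'a, 1)\<bar> ^ m \<le> pkern (y, 1)" for y
  proof -
    have "0 \<le> pkern (y, 1)" "pkern (y, 1) \<le> 1" using pkern_nonneg[of "(y, 1)"] pkern_le_height[of "(y, 1)"] by auto
    then show ?thesis using power_decreasing[of 1 m "pkern (y, 1)"] assms by simp
  qed
  show i2: "integrable lborel (\<lambda>y::'a. \<bar>pkern (y, 1)\<bar> ^ m)"
    by (rule integrable_real_bound[OF i1(1)]) (use le in auto)
  show "(LINT y|lborel. \<bar>pkern (y::'a, 1)\<bar> ^ m) \<le> poisson_mass TYPE('a)"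
    unfolding i1(2)[symmetric] by (intro integral_mono i1 i2 le)
qed

text \<open>Adding a shifted Poisson kernel to the tangential derivatives keeps \<open>s\<close> away from \<open>0\<close>, so that its powers
  are smooth; it takes the place of the index \<open>(0, 1)\<close> in the family \<open>Y\<close>.\<close>

lemma poisson_grad_vertical_bound:
  fixes f :: "'a::euclidean_space \<Rightarrow> real"
  assumes n: "DIM('a) \<ge> 2" and f: "f \<in> borel_measurable borel" "integrable lborel (\<lambda>y. \<bar>f y\<bar> ^ DIM('a))"
    and S: "\<And>i e. i \<in> Basis \<Longrightarrow> e > 0 \<Longrightarrow> (LINT y|lborel. \<bar>poisson_grad (i, 0) f (y, e)\<bar> ^ DIM('a)) \<le> S"
  shows "\<exists>S'. \<forall>e>0. (LINT y|lborel. \<bar>poisson_grad (0, 1) f (y, e)\<bar> ^ DIM('a)) \<le> S'"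
proof -
  have p: "DIM('a) \<ge> 1" using n by simp
  have adm: "poisson_admissible f" by (rule poisson_admissible_power[OF f p])
  define k where "k = real DIM('a) / 2 - 1"
  define C1 where "C1 = 4 * k * (real DIM('a) + 2) + 4 * k * (real DIM('a) + 1)"
  define A where "A = (2 * (k + 1) + 4 * (k + 1) * k) * (real DIM('a) + 1)"
  define B where "B = C1 * C1 powr (2 * k)"
  define I where "I = (Basis :: ('a \<times> real) set)"
  define C where "C = 2 * (A * B + A * (2 * A) powr k) * real (card I) powr (k + 1)"
  have k0: "k \<ge> 0" using n by (simp add: k_def)
  have C0: "C \<ge> 0" unfolding C_def A_def B_def C1_def using k0 by (intro mult_nonneg_nonneg add_nonneg_nonneg) auto
  have eB: "(0, 1) \<in> (Basis :: ('a \<times> real) set)" by (simp add: Basis_prod_def)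
  have iB: "(i, 0) \<in> (Basis :: ('a \<times> real) set)" if "i \<in> Basis" for i using that by (simp add: Basis_prod_def)
  have "(LINT y|lborel. \<bar>poisson_grad (0, 1) f (y, e)\<bar> ^ DIM('a)) \<le> C * (real DIM('a) * S + poisson_mass TYPE('a))"
    if e: "e > 0" for e
  proof -
    define Y where "Y = (\<lambda>b :: 'a \<times> real. if b = (0, 1) then (\<lambda>z. pkern (z + (0, 1))) else (\<lambda>z. poisson_grad b f (z + (0, e))))"
    define Y1 where "Y1 = (\<lambda>b c :: 'a \<times> real. if b = (0, 1) then (\<lambda>z. partial_deriv c pkern (z + (0, 1)))
       else (\<lambda>z. half_conv (partial_deriv c (partial_deriv b pkern)) f (z + (0, e))))"
    define Y2 where "Y2 = (\<lambda>b c :: 'a \<times> real. if b = (0, 1) then (\<lambda>z. partial_deriv c (partial_deriv c pkern) (z + (0, 1)))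
       else (\<lambda>z. half_conv (partial_deriv c (partial_deriv c (partial_deriv b pkern))) f (z + (0, e))))"
    define v where "v = (\<lambda>z. poisson_grad (0, 1) f (z + (0, e)))"
    have pg: "dir_C2 (\<lambda>z. poisson_grad b f (z + (0, e))) (\<lambda>c z. half_conv (partial_deriv c (partial_deriv b pkern)) f (z + (0, e)))
       (\<lambda>c z. half_conv (partial_deriv c (partial_deriv c (partial_deriv b pkern))) f (z + (0, e)))" if "b \<in> Basis" for b
      using dir_C2_shift[OF poisson_grad_dir_C2[OF adm that], of e] e by simp
    have cont: "continuous_on {z. snd z \<ge> 0} (\<lambda>z. poisson_grad b f (z + (0, e)))" if "b \<in> Basis" for b
      by (rule continuous_on_compose2[OF continuous_on_poisson_grad[OF adm that, of "{z. snd z > 0}"]])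
        (use e in \<open>auto intro!: continuous_intros\<close>)
    have pk_cont: "continuous_on {z::'a \<times> real. snd z \<ge> 0} (\<lambda>z. pkern (z + (0, 1)))"
      unfolding pkern_def by (intro continuous_intros) (auto simp: prod_eq_iff)
    obtain K0 where K0: "\<And>b z. b \<in> Basis \<Longrightarrow> snd z > 0 \<Longrightarrow> \<bar>poisson_grad b f z\<bar> \<le> K0 b / (snd z)\<^sup>2" "\<And>b. b \<in> Basis \<Longrightarrow> K0 b \<ge> 0"
      using poisson_grad_height_bound[OF f] by metis
    \<comment> \<open>The summand \<open>1\<close> takes care of the shifted kernel, which is at
      most \<open>1 / t\<^sup>2\<close> at \<open>(0, t)\<close>.\<close>
    define K where "K = 1 + (\<Sum>b\<in>Basis. K0 b)"
    have K: "K0 b \<le> K" if "b \<in> Basis" for b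
      unfolding K_def using member_le_sum[of b Basis K0] that K0(2) by fastforce
    have K1: "1 \<le> K" unfolding K_def using K0(2) by (simp add: sum_nonneg)
    have gh: "\<bar>poisson_grad b f ((0, t) + (0, e))\<bar> \<le> K / t\<^sup>2" if "b \<in> Basis" "t \<ge> 1" for b t
    proof -
      have "\<bar>poisson_grad b f (0, t + e)\<bar> \<le> K0 b / (t + e)\<^sup>2" using K0(1)[OF that(1), of "(0, t + e)"] that e by simp
      also have "\<dots> \<le> K / t\<^sup>2" using K[OF that(1)] K1 that e by (intro frac_le power_mono) auto
      finally show ?thesis by simp
    qed
    have "(LINT y|lborel. \<bar>v (y, 0)\<bar> ^ DIM('a)) \<le> C * (\<Sum>i\<in>I. LINT y|lborel. \<bar>Y i (y, 0)\<bar> ^ DIM('a))"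
      unfolding C_def
    proof (rule conjugate_bound[OF n _ _ _ _ _ _ _ _ _ _ _ _ _ _ _ k_def C1_def A_def B_def])
      show "finite I" by (simp add: I_def)
      show "dir_C2 (Y i) (Y1 i) (Y2 i)" if "i \<in> I" for i
      proof (cases "i = (0, 1)")
        case True
        then show ?thesis using dir_C2_shift[OF pkern_dir_C2, of 1, where 'a='a] by (simp add: Y_def Y1_def Y2_def)
      next
        case False
        then show ?thesis using pg[of i] that by (simp add: Y_def Y1_def Y2_def I_def)
      qed
      show "dir_C2 v (\<lambda>c z. half_conv (partial_deriv c (partial_deriv (0, 1) pkern)) f (z + (0, e)))
         (\<lambda>c z. half_conv (partial_deriv c (partial_deriv c (partial_deriv (0, 1) pkern))) f (z + (0, e)))"
        unfolding v_def by (rule pg[OF eB])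
      show "(\<Sum>c\<in>Basis. Y2 i c z) = 0" if "i \<in> I" "snd z > 0" for i z
      proof (cases "i = (0, 1)")
        case True
        have "snd (z + (0, 1)) \<noteq> snd 0" using that by simp
        then have "z + (0, 1) \<noteq> 0" by metis
        then show ?thesis using True by (simp add: Y2_def pkern_laplacian)
      next
        case False
        have "snd (z + (0, e)) > 0" using that e by simp
        from poisson_grad_harmonic[OF adm _ this] show ?thesis using False that(1) by (simp add: Y2_def I_def)
      qed
      show "(\<Sum>c\<in>Basis. half_conv (partial_deriv c (partial_deriv c (partial_deriv (0, 1) pkern))) f (z + (0, e))) = 0" if "snd z > 0" for z
        by (rule poisson_grad_harmonic[OF adm eB]) (use that e in simp)
      show "\<exists>i\<in>I. Y i z \<noteq> 0" if "snd z \<ge> 0" for z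
        by (rule bexI[of _ "(0, 1)"]) (use pkern_pos[of "z + (0, 1)"] that eB in \<open>auto simp: Y_def I_def\<close>)
      show "(\<Sum>c\<in>Basis. (half_conv (partial_deriv c (partial_deriv (0, 1) pkern)) f (z + (0, e)))\<^sup>2)
         \<le> real DIM('a) * (\<Sum>c\<in>Basis. \<Sum>i\<in>I. (Y1 i c z)\<^sup>2)" if "snd z > 0" for z
      proof -
        have w: "snd (z + (0, e)) > 0" using that e by simp
        have "(\<Sum>c\<in>Basis. \<Sum>i\<in>Basis. (half_conv (partial_deriv c (partial_deriv (i, 0) pkern)) f (z + (0, e)))\<^sup>2)
           \<le> (\<Sum>c\<in>Basis. \<Sum>i\<in>I. (Y1 i c z)\<^sup>2)"
          unfolding I_def sum_Basis_half[where F="\<lambda>i. (Y1 i _ z)\<^sup>2"] by (intro sum_mono) (simp add: Y1_def)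
        then have "real DIM('a) * (\<Sum>c\<in>Basis. \<Sum>i\<in>Basis. (half_conv (partial_deriv c (partial_deriv (i, 0) pkern)) f (z + (0, e)))\<^sup>2)
          \<le> real DIM('a) * (\<Sum>c\<in>Basis. \<Sum>i\<in>I. (Y1 i c z)\<^sup>2)" by (rule mult_left_mono) simp
        then show ?thesis using poisson_grad_vertical_dominated[OF adm w] by linarith
      qed
      show "continuous_on {z. snd z \<ge> 0} (Y i)" if "i \<in> I" for i
        using cont[of i] pk_cont that by (auto simp: Y_def I_def)
      show "continuous_on {z. snd z \<ge> 0} v" unfolding v_def by (rule cont[OF eB])
      show "vanishing (Y i)" if "i \<in> I" for i
        using poisson_grad_vanishing[OF f p _ e, of i] pkern_shift_vanishing[where 'a='a] that by (auto simp: Y_def I_def)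
      show "vanishing v" unfolding v_def by (rule poisson_grad_vanishing[OF f p eB e])
      show "integrable lborel (\<lambda>y. \<bar>Y i (y, 0)\<bar> ^ DIM('a))" if "i \<in> I" for i
        using poisson_grad_slice_integrable[OF f p _ e, of i] pkern_unit_power_integral(1)[OF p] that by (auto simp: Y_def I_def)
      show "integrable lborel (\<lambda>y. \<bar>v (y, 0)\<bar> ^ DIM('a))"
        using poisson_grad_slice_integrable[OF f p eB e] by (simp add: v_def)
      show "\<bar>v (0, t)\<bar> \<le> K / t\<^sup>2" if "t \<ge> 1" for t
        unfolding v_def by (rule gh[OF eB that])
      show "\<bar>Y i (0, t)\<bar> \<le> K / t\<^sup>2" if i: "i \<in> I" and t: "t \<ge> 1" for i t
      proof (cases "i = (0, 1)")
        case True
        have "pkern (0::'a, t + 1) \<le> 1 / (t + 1) ^ DIM('a)" using pkern_le_height[of "(0::'a, t + 1)"] t by simp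
        also have "\<dots> \<le> K / t\<^sup>2"
        proof (rule frac_le)
          have "t\<^sup>2 \<le> (t + 1)\<^sup>2" using t by (intro power_mono) auto
          also have "\<dots> \<le> (t + 1) ^ DIM('a)" using t n by (intro power_increasing) auto
          finally show "t\<^sup>2 \<le> (t + 1) ^ DIM('a)" .
        qed (use K1 t in auto)
        finally show ?thesis using True pkern_nonneg[of "(0::'a, t + 1)"] t by (simp add: Y_def)
      next
        case False
        then show ?thesis using gh[of i t] i t by (simp add: Y_def I_def)
      qed
    qed
    \<comment> \<open>The auxiliary kernel contributes at most its mass. Like the tangential bound
      \<open>S\<close>, this is independent of \<open>e\<close>.\<close>
    also have "\<dots> \<le> C * (real DIM('a) * S + poisson_mass TYPE('a))"
    proof (rule mult_left_mono[OF _ C0])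
      have "(\<Sum>i\<in>I. LINT y|lborel. \<bar>Y i (y, 0)\<bar> ^ DIM('a)) =
         (\<Sum>i\<in>Basis. LINT y|lborel. \<bar>poisson_grad (i, 0) f (y, e)\<bar> ^ DIM('a)) + (LINT y|lborel. \<bar>pkern (y::'a, 1)\<bar> ^ DIM('a))"
        unfolding I_def sum_Basis_half by (simp add: Y_def)
      also have "\<dots> \<le> (\<Sum>i\<in>(Basis::'a set). S) + poisson_mass TYPE('a)"
        by (intro add_mono sum_mono S e pkern_unit_power_integral(2)[OF p])
      finally show "(\<Sum>i\<in>I. LINT y|lborel. \<bar>Y i (y, 0)\<bar> ^ DIM('a)) \<le> real DIM('a) * S + poisson_mass TYPE('a)" by simp
    qed
    finally show ?thesis by (simp add: v_def)
  qed
  then show ?thesis by blast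
qed

lemma C_k_of_closed:
  fixes f :: "'a::euclidean_space \<Rightarrow> real"
  assumes S: "\<And>f. f \<in> S \<Longrightarrow> f differentiable_on UNIV" "\<And>f b. f \<in> S \<Longrightarrow> b \<in> Basis \<Longrightarrow> partial_deriv b f \<in> S"
    and f: "f \<in> S"
  shows "C_k k f"
  using f
proof (induction k arbitrary: f)
  case 0
  then show ?case using S(1) differentiable_imp_continuous_on by auto
next
  case (Suc k)
  then show ?case using S by auto
qed

section \<open>Testing against the Poisson kernel\<close>

text \<open>The classical flat function \<open>exp (- 1 / s)\<close> divided by a power of
  \<open>s\<close>. Differentiation only raises the power, so derivatives are linear combinations of
  members of the family, including at \<open>0\<close>.\<close>

definition flat_exp :: "nat \<Rightarrow> real \<Rightarrow> real" where
  "flat_exp m s = (if s > 0 then exp (- 1 / s) / s ^ m else 0)"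

lemma flat_exp_tendsto: "((\<lambda>h. flat_exp m h / h) \<longlongrightarrow> 0) (at 0)"
proof -
  have "((\<lambda>x::real. x ^ (m + 1) / exp x) \<longlongrightarrow> 0) at_top" by (rule tendsto_power_div_exp_0)
  from filterlim_compose[OF this filterlim_inverse_at_top_right]
  have r: "((\<lambda>h::real. inverse h ^ (m + 1) / exp (inverse h)) \<longlongrightarrow> 0) (at_right 0)" .
  have "((\<lambda>h. flat_exp m h / h) \<longlongrightarrow> 0) (at_right 0)"
  proof (rule tendsto_cong[THEN iffD1, OF _ r])
    show "\<forall>\<^sub>F h in at_right 0. inverse h ^ (m + 1) / exp (inverse h) = flat_exp m h / h"
      using eventually_at_right_less[of 0]
      by eventually_elim (auto simp: flat_exp_def exp_minus field_simps)
  qed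
  moreover have "((\<lambda>h. flat_exp m h / h) \<longlongrightarrow> 0) (at_left 0)"
  proof (rule tendsto_eventually)
    have "\<forall>\<^sub>F h in at_left (0::real). h < 0" by (simp add: eventually_at_filter)
    then show "\<forall>\<^sub>F h in at_left 0. flat_exp m h / h = 0" by eventually_elim (simp add: flat_exp_def)
  qed
  ultimately show ?thesis by (simp add: filterlim_split_at)
qed

lemma flat_exp_deriv: "(flat_exp m has_real_derivative (flat_exp (m + 2) s - real m * flat_exp (m + 1) s)) (at s)"
proof -
  consider "s > 0" | "s < 0" | "s = 0" by linarith
  then show ?thesis
  proof cases
    case 1
    have "((\<lambda>s. exp (- 1 / s) * inverse (s ^ m)) has_real_derivative
        exp (- 1 / s) * (1 / s\<^sup>2) * inverse (s ^ m) + (- (inverse (s ^ m) * (real m * s ^ (m - Suc 0)) * inverse (s ^ m))) * exp (- 1 / s)) (at s)"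
      by (rule DERIV_mult DERIV_inverse_fun[OF DERIV_pow] | (auto intro!: derivative_eq_intros simp: power2_eq_square)[1] | use 1 in simp)+
    moreover have "exp (- 1 / s) * (1 / s\<^sup>2) * inverse (s ^ m) + (- (inverse (s ^ m) * (real m * s ^ (m - Suc 0)) * inverse (s ^ m))) * exp (- 1 / s)
      = flat_exp (m + 2) s - real m * flat_exp (m + 1) s"
      using 1 by (cases m) (auto simp: flat_exp_def field_simps power_add power2_eq_square)
    ultimately have d: "((\<lambda>s. exp (- 1 / s) * inverse (s ^ m)) has_real_derivative flat_exp (m + 2) s - real m * flat_exp (m + 1) s) (at s)" by simp
    show ?thesis
      by (rule DERIV_cong_ev[OF refl _ refl, THEN iffD1, OF _ d])
        (use 1 eventually_nhds_in_open[of "{0<..}" s] in \<open>auto simp: flat_exp_def field_simps elim!: eventually_mono\<close>)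
  next
    case 2
    have "((\<lambda>_. 0) has_real_derivative flat_exp (m + 2) s - real m * flat_exp (m + 1) s) (at s)"
      using 2 by (simp add: flat_exp_def)
    then show ?thesis
      by (rule DERIV_cong_ev[OF refl _ refl, THEN iffD1, rotated])
        (use 2 eventually_nhds_in_open[of "{..<0}" s] in \<open>auto simp: flat_exp_def elim!: eventually_mono\<close>)
  next
    case 3
    then show ?thesis using flat_exp_tendsto[of m] by (simp add: DERIV_def flat_exp_def)
  qed
qed

lemma flat_exp_nonneg: "flat_exp m s \<ge> 0"
  by (simp add: flat_exp_def)

lemma flat_exp_0_le: "flat_exp 0 s \<le> 1"
  by (simp add: flat_exp_def)

text \<open>The derivative of \<open>flat_exp 0\<close> is \<open>flat_exp 2\<close>, so this bounds
  the slope of the cut-off. With \<open>x = 1 / s\<close> it is the inequality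
  \<open>x\<^sup>2 / 2 \<le> exp x\<close>.\<close>

lemma flat_exp_2_le: "flat_exp 2 s \<le> 2"
proof (cases "s > 0")
  case True
  have p: "1 / s > 0" using True by simp
  then have "(1 / s)\<^sup>2 / 2 \<le> exp (1 / s)" using exp_lower_Taylor_quadratic[of "1 / s"] by linarith
  then have "(1 / s)\<^sup>2 \<le> 2 * exp (1 / s)" by linarith
  then have "1 / s\<^sup>2 \<le> 2 * exp (1 / s)" by (simp only: power_divide power_one)
  then have "1 / s\<^sup>2 * exp (- (1 / s)) \<le> 2 * exp (1 / s) * exp (- (1 / s))" by (intro mult_right_mono) auto
  also have "\<dots> = 2" by (simp add: exp_minus)
  finally show ?thesis using True by (simp add: flat_exp_def)
qed (simp add: flat_exp_def)

text \<open>An algebra closed under partial derivatives that contains the cut-off Poisson kernels; this yields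
  \<open>C_k\<close> for all \<open>k\<close> at once.\<close>

inductive_set smooth_alg :: "'a::euclidean_space \<Rightarrow> real \<Rightarrow> ('a \<Rightarrow> real) set" for x t where
  kernel: "hom_kernel j k \<Longrightarrow> (\<lambda>y. k (x - y, t)) \<in> smooth_alg x t"
| bump: "(\<lambda>y. flat_exp m (1 - d * (y \<bullet> y))) \<in> smooth_alg x t"
| inner: "(\<lambda>y. y \<bullet> b) \<in> smooth_alg x t"
| const: "(\<lambda>y. c) \<in> smooth_alg x t"
| add: "f \<in> smooth_alg x t \<Longrightarrow> g \<in> smooth_alg x t \<Longrightarrow> (\<lambda>y. f y + g y) \<in> smooth_alg x t"
| mult: "f \<in> smooth_alg x t \<Longrightarrow> g \<in> smooth_alg x t \<Longrightarrow> (\<lambda>y. f y * g y) \<in> smooth_alg x t"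

lemma kernel_translate_has_derivative:
  fixes k :: "'a::euclidean_space \<times> real \<Rightarrow> real"
  assumes k: "hom_kernel j k" and t: "t > 0"
  shows "((\<lambda>y. k (x - y, t)) has_derivative (\<lambda>h. \<Sum>b\<in>Basis. (h \<bullet> b) * (- 1 * partial_deriv (b, 0) k (x - y, t)))) (at y)"
proof -
  have nz: "(x - y, t) \<noteq> 0" using t by (simp add: zero_prod_def)
  have 1: "((\<lambda>y. (x - y, t)) has_derivative (\<lambda>h. (- h, 0))) (at y)"
    by (auto intro!: derivative_eq_intros)
  have "((\<lambda>y. k (x - y, t)) has_derivative (\<lambda>h. \<Sum>b\<in>Basis. ((- h, 0) \<bullet> b) * partial_deriv b k (x - y, t))) (at y)"
    by (rule has_derivative_compose[OF 1 hom_kernel_has_derivative[OF k nz]])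
  then show ?thesis unfolding sum_Basis_half by simp
qed

lemma bump_has_derivative:
  fixes y :: "'a::euclidean_space"
  shows "((\<lambda>y. flat_exp m (1 - d * (y \<bullet> y))) has_derivative
    (\<lambda>h. \<Sum>b\<in>Basis. (h \<bullet> b) * ((flat_exp (m + 2) (1 - d * (y \<bullet> y)) + (- real m) * flat_exp (m + 1) (1 - d * (y \<bullet> y))) * ((- 2 * d) * (y \<bullet> b))))) (at y)"
proof -
  have 1: "((\<lambda>y. 1 - d * (y \<bullet> y)) has_derivative (\<lambda>h. - 2 * d * (y \<bullet> h))) (at y)"
    by (auto intro!: derivative_eq_intros simp: inner_commute)
  let ?D = "flat_exp (m + 2) (1 - d * (y \<bullet> y)) - real m * flat_exp (m + 1) (1 - d * (y \<bullet> y))"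
  have "((\<lambda>y. flat_exp m (1 - d * (y \<bullet> y))) has_derivative (\<lambda>h. ?D * (- 2 * d * (y \<bullet> h)))) (at y)"
    using has_derivative_compose[OF 1 flat_exp_deriv[unfolded has_field_derivative_def]] .
  moreover have "?D * (- 2 * d * (y \<bullet> h)) = (\<Sum>b\<in>Basis. (h \<bullet> b) * ((flat_exp (m + 2) (1 - d * (y \<bullet> y)) + (- real m) * flat_exp (m + 1) (1 - d * (y \<bullet> y))) * ((- 2 * d) * (y \<bullet> b))))" (is "_ = ?R") for h
  proof -
    have "?R = (\<Sum>b\<in>Basis. (?D * (- 2 * d)) * ((y \<bullet> b) * (h \<bullet> b)))"
      by (intro sum.cong) (auto simp: algebra_simps)
    also have "\<dots> = (?D * (- 2 * d)) * (y \<bullet> h)"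
      by (simp only: sum_distrib_left[symmetric] euclidean_inner[symmetric])
    finally show ?thesis by (simp add: mult.assoc)
  qed
  ultimately show ?thesis by (simp only:)
qed

text \<open>The witnesses must be built by the rules of the algebra; signs and numerical factors of
  the derivatives therefore appear as multiplications by constant functions.\<close>

lemma smooth_alg_derivative:
  fixes x :: "'a::euclidean_space"
  assumes t: "t > 0" and f: "f \<in> smooth_alg x t"
  shows "\<exists>f'. (\<forall>b\<in>Basis. f' b \<in> smooth_alg x t) \<and> (\<forall>y. (f has_derivative (\<lambda>h. \<Sum>b\<in>Basis. (h \<bullet> b) * f' b y)) (at y))"
  using f
proof induction
  case (kernel j k)
  have "(b, 0) \<in> (Basis :: ('a \<times> real) set)" if "b \<in> Basis" for b using that by (simp add: Basis_prod_def)
  then have "(\<lambda>y. - 1 * partial_deriv (b, 0) k (x - y, t)) \<in> smooth_alg x t" if "b \<in> Basis" for b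
    using that by (intro smooth_alg.mult smooth_alg.const smooth_alg.kernel[OF hom_kernel_partial_deriv[OF kernel]])
  then show ?case using kernel_translate_has_derivative[OF kernel t]
    by (intro exI[of _ "\<lambda>b y. - 1 * partial_deriv (b, 0) k (x - y, t)"] conjI ballI allI) auto
next
  case (bump m d)
  show ?case
    by (rule exI[of _ "\<lambda>b y. (flat_exp (m + 2) (1 - d * (y \<bullet> y)) + (- real m) * flat_exp (m + 1) (1 - d * (y \<bullet> y))) * ((- 2 * d) * (y \<bullet> b))"])
      (intro conjI ballI allI bump_has_derivative smooth_alg.intros)
next
  case (inner b)
  have "((\<lambda>y. y \<bullet> b) has_derivative (\<lambda>h. \<Sum>c\<in>Basis. (h \<bullet> c) * (c \<bullet> b))) (at y)" for y
  proof -
    have "(\<Sum>c\<in>Basis. (h \<bullet> c) * (c \<bullet> b)) = h \<bullet> b" for h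
      by (simp only: euclidean_inner[of h b] inner_commute[of b])
    moreover have "((\<lambda>y. y \<bullet> b) has_derivative (\<lambda>h. h \<bullet> b)) (at y)" by (auto intro!: derivative_eq_intros)
    ultimately show ?thesis by (simp only:)
  qed
  then show ?case by (intro exI[of _ "\<lambda>c y. c \<bullet> b"] conjI ballI allI smooth_alg.const)
next
  case (const c)
  show ?case by (intro exI[of _ "\<lambda>c y. 0"] conjI ballI allI smooth_alg.const) (auto intro!: derivative_eq_intros)
next
  case (add f g)
  obtain f' where f: "\<forall>b\<in>Basis. f' b \<in> smooth_alg x t" "\<And>y. (f has_derivative (\<lambda>h. \<Sum>b\<in>Basis. (h \<bullet> b) * f' b y)) (at y)"
    using add.IH(1) by blast
  obtain g' where g: "\<forall>b\<in>Basis. g' b \<in> smooth_alg x t" "\<And>y. (g has_derivative (\<lambda>h. \<Sum>b\<in>Basis. (h \<bullet> b) * g' b y)) (at y)"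
    using add.IH(2) by blast
  have "((\<lambda>y. f y + g y) has_derivative (\<lambda>h. \<Sum>b\<in>Basis. (h \<bullet> b) * (f' b y + g' b y))) (at y)" for y
    using has_derivative_add[OF f(2) g(2)] by (simp add: sum.distrib distrib_left)
  then show ?case
    by (intro exI[of _ "\<lambda>b y. f' b y + g' b y"] conjI ballI allI smooth_alg.add f(1)[rule_format] g(1)[rule_format])
next
  case (mult f g)
  obtain f' where f: "\<forall>b\<in>Basis. f' b \<in> smooth_alg x t" "\<And>y. (f has_derivative (\<lambda>h. \<Sum>b\<in>Basis. (h \<bullet> b) * f' b y)) (at y)"
    using mult.IH(1) by blast
  obtain g' where g: "\<forall>b\<in>Basis. g' b \<in> smooth_alg x t" "\<And>y. (g has_derivative (\<lambda>h. \<Sum>b\<in>Basis. (h \<bullet> b) * g' b y)) (at y)"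
    using mult.IH(2) by blast
  have "((\<lambda>y. f y * g y) has_derivative (\<lambda>h. \<Sum>b\<in>Basis. (h \<bullet> b) * (f y * g' b y + f' b y * g y))) (at y)" for y
    using has_derivative_mult[OF f(2) g(2)] by (simp add: sum.distrib distrib_left sum_distrib_left sum_distrib_right mult_ac)
  then show ?case
    by (intro exI[of _ "\<lambda>b y. f y * g' b y + f' b y * g y"] conjI ballI allI smooth_alg.add smooth_alg.mult
        f(1)[rule_format] g(1)[rule_format] mult.hyps)
qed

lemma smooth_alg_C_k:
  assumes t: "t > 0" and f: "f \<in> smooth_alg x t"
  shows "C_k k f"
proof (rule C_k_of_closed[where S="smooth_alg x t"])
  fix f assume "f \<in> smooth_alg x t"
  then obtain f' where f': "\<And>b. b \<in> Basis \<Longrightarrow> f' b \<in> smooth_alg x t" "\<And>y. (f has_derivative (\<lambda>h. \<Sum>b\<in>Basis. (h \<bullet> b) * f' b y)) (at y)"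
    using smooth_alg_derivative[OF t] by blast
  show "f differentiable_on UNIV" using f'(2) by (auto simp: differentiable_on_def differentiable_def)
  show "partial_deriv b f \<in> smooth_alg x t" if "b \<in> Basis" for b
  proof -
    have "partial_deriv b f = f' b" using frechet_derivative_eq_sum[OF f'(2) that] by (intro ext)
    then show ?thesis using f'(1)[OF that] by simp
  qed
qed (rule f)

section \<open>Test functions and the transfer of a distributional derivative to the
  extension\<close>

lemma differentiable_has_derivative_sum:
  fixes f :: "'a::euclidean_space \<Rightarrow> real"
  assumes "f differentiable (at y)"
  shows "(f has_derivative (\<lambda>h. \<Sum>b\<in>Basis. (h \<bullet> b) * partial_deriv b f y)) (at y)"
proof -
  have d: "(f has_derivative frechet_derivative f (at y)) (at y)"
    using assms by (simp add: frechet_derivative_works)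
  then interpret bounded_linear "frechet_derivative f (at y)" by (rule has_derivative_bounded_linear)
  have "frechet_derivative f (at y) h = (\<Sum>b\<in>Basis. (h \<bullet> b) * partial_deriv b f y)" for h
  proof -
    have "frechet_derivative f (at y) h = frechet_derivative f (at y) (\<Sum>b\<in>Basis. (h \<bullet> b) *\<^sub>R b)"
      by (simp add: euclidean_representation)
    then show ?thesis by (simp add: sum scaleR partial_deriv_def)
  qed
  then have eq: "frechet_derivative f (at y) = (\<lambda>h. \<Sum>b\<in>Basis. (h \<bullet> b) * partial_deriv b f y)" by (rule ext)
  show ?thesis using d unfolding eq .
qed

lemma test_function_props:
  fixes \<phi> :: "'a::euclidean_space \<Rightarrow> real"
  assumes "\<phi> \<in> test_functions"
  shows "(\<phi> has_derivative (\<lambda>h. \<Sum>b\<in>Basis. (h \<bullet> b) * partial_deriv b \<phi> y)) (at y)"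
    and "continuous_on UNIV \<phi>"
    and "b \<in> Basis \<Longrightarrow> continuous_on UNIV (partial_deriv b \<phi>)"
    and "\<exists>R>0. (\<forall>y. norm y \<ge> R \<longrightarrow> \<phi> y = 0 \<and> (\<forall>b\<in>Basis. partial_deriv b \<phi> y = 0))"
proof -
  have C: "C_k k \<phi>" for k using assms by (simp add: test_functions_def)
  show c: "continuous_on UNIV \<phi>" using C[of 0] by simp
  have "\<phi> differentiable_on UNIV" using C[of 1] by simp
  then have d: "\<phi> differentiable (at y)" for y by (simp add: differentiable_on_def)
  show d': "(\<phi> has_derivative (\<lambda>h. \<Sum>b\<in>Basis. (h \<bullet> b) * partial_deriv b \<phi> y)) (at y)" for y
    by (rule differentiable_has_derivative_sum[OF d])
  show "b \<in> Basis \<Longrightarrow> continuous_on UNIV (partial_deriv b \<phi>)" for b using C[of 1] by simp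
  have "bounded (closure {x. \<phi> x \<noteq> 0})" using assms compact_imp_bounded by (auto simp: test_functions_def)
  then obtain R where R: "R > 0" "\<And>x. x \<in> closure {x. \<phi> x \<noteq> 0} \<Longrightarrow> norm x \<le> R" using bounded_pos by metis
  have z: "\<phi> y = 0" if "norm y > R" for y using R(2)[of y] closure_subset[of "{x. \<phi> x \<noteq> 0}"] that by force
  have z': "partial_deriv b \<phi> y = 0" if "norm y > R" for b y
  proof -
    have "partial_deriv b \<phi> y = partial_deriv b (\<lambda>_. 0) y"
      by (rule partial_deriv_cong_open[of "{y. norm y > R}", OF _ _ _ d'])
        (use that z in \<open>auto intro!: open_Collect_less continuous_intros\<close>)
    also have "\<dots> = 0" by (rule partial_deriv_eq) auto
    finally show ?thesis .
  qed
  show "\<exists>R>0. (\<forall>y. norm y \<ge> R \<longrightarrow> \<phi> y = 0 \<and> (\<forall>b\<in>Basis. partial_deriv b \<phi> y = 0))"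
    \<comment> \<open>Vanishing of the derivative is known on the open set \<open>norm y > R\<close>
      only; \<open>R + 1\<close> yields the weak inequality of the claim.\<close>
    by (rule exI[of _ "R + 1"]) (use R z z' in auto)
qed

text \<open>The identity is tested with the kernel \<open>y \<mapsto> pkern (x - y, t)\<close> times
  a smooth cut-off, which dominated convergence removes. Differentiating the kernel in
  \<open>y\<close> instead of \<open>x\<close> produces a sign that matches the one in the
  distributional identity.\<close>

lemma poisson_grad_eq_of_distributional:
  fixes f g :: "'a::euclidean_space \<Rightarrow> real"
  assumes b: "b \<in> Basis" and f: "poisson_admissible f" and g: "poisson_admissible g"
    and test: "\<And>\<phi>. \<phi> \<in> test_functions \<Longrightarrow> (LINT y|lborel. f y * partial_deriv b \<phi> y) = - (LINT y|lborel. g y * \<phi> y)"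
    and t: "t > 0"
  shows "poisson_grad (b, 0) f (x, t) = half_conv pkern g (x, t)"
proof -
  have bB: "(b, 0) \<in> (Basis :: ('a \<times> real) set)" using b by (simp add: Basis_prod_def)
  have fm [measurable]: "f \<in> borel_measurable borel" and gm [measurable]: "g \<in> borel_measurable borel"
    using f g by (simp_all add: poisson_admissible_measurable)
  \<comment> \<open>Normalises the bump to the value \<open>1\<close> at the origin, because
    \<open>flat_exp 0 1 = exp (- 1)\<close>.\<close>
  define E where "E = exp (1::real)"
  have E: "E > 0" by (simp add: E_def)
  \<comment> \<open>With this scale the bump vanishes for
    \<open>norm y \<ge> real (Suc j)\<close>.\<close>
  define d where "d = (\<lambda>j. (1 / real (Suc j))\<^sup>2)"
  define cut where "cut = (\<lambda>j (y::'a). E * flat_exp 0 (1 - d j * (y \<bullet> y)))"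
  define cut' where "cut' = (\<lambda>j (y::'a). E * (flat_exp 2 (1 - d j * (y \<bullet> y)) * ((- 2 * d j) * (y \<bullet> b))))"
  define P where "P = (\<lambda>y. pkern (x - y, t))"
  define Q where "Q = (\<lambda>y. partial_deriv (b, 0) pkern (x - y, t))"
  have pair: "(x, t) - (y, 0) = (x - y, t)" for y by simp
  have PI: "integrable lborel (\<lambda>y. P y * h y)" if "poisson_admissible h" for h
    using pkern_half_integrable[OF that, of "(x, t)"] t by (simp add: P_def)
  have QI: "integrable lborel (\<lambda>y. Q y * f y)"
    using hom_kernel_half_integrable[OF hom_kernel_partial_deriv[OF hom_kernel_pkern bB] _ f, of "(x, t)"] t
    by (simp add: Q_def)
  have [measurable]: "(\<lambda>y. (x - y, t)) \<in> borel_measurable borel"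
    by (intro borel_measurable_continuous_onI continuous_intros)
  have [measurable]: "partial_deriv (b, 0) pkern \<in> borel_measurable (borel :: ('a \<times> real) measure)"
    by (rule hom_kernel_measurable[OF hom_kernel_partial_deriv[OF hom_kernel_pkern bB]])
  have PQm [measurable]: "P \<in> borel_measurable borel" "Q \<in> borel_measurable borel"
    unfolding P_def Q_def by measurable
  have small: "d j * (y \<bullet> y) \<ge> 1" if "norm y \<ge> real (Suc j)" for j and y :: 'a
  proof -
    have "(real (Suc j))\<^sup>2 \<le> (norm y)\<^sup>2" using that by (intro power_mono) auto
    then show ?thesis by (simp add: d_def power2_norm_eq_inner[symmetric] power_divide field_simps del: of_nat_Suc)
  qed
  have cut_le: "0 \<le> cut j y" "cut j y \<le> E" for j y
    using E flat_exp_nonneg[of 0] flat_exp_0_le by (auto simp: cut_def)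
  \<comment> \<open>On the support of the cut-off \<open>d j * \<bar>y \<bullet> b\<bar>\<close> is
    at most \<open>1 / real (Suc j)\<close>; one factor \<open>2\<close> comes from differentiating
    \<open>y \<bullet> y\<close>, the other from \<open>flat_exp_2_le\<close>. The derivative of the
    cut-off thus disappears in the limit.\<close>
  have cut'_le: "\<bar>cut' j y\<bar> \<le> 4 * E * (1 / real (Suc j))" for j y
  proof (cases "norm y \<ge> real (Suc j)")
    case True
    then have "cut' j y = 0" using small[OF True] by (simp add: cut'_def flat_exp_def)
    then show ?thesis using E by simp
  next
    case False
    have "\<bar>y \<bullet> b\<bar> \<le> real (Suc j)" using Basis_le_norm[OF b, of y] False by linarith
    then have "d j * \<bar>y \<bullet> b\<bar> \<le> d j * real (Suc j)" by (intro mult_left_mono) (auto simp: d_def)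
    also have "\<dots> = 1 / real (Suc j)" by (simp add: d_def power2_eq_square del: of_nat_Suc)
    finally have 1: "d j * \<bar>y \<bullet> b\<bar> \<le> 1 / real (Suc j)" .
    have "\<bar>cut' j y\<bar> = E * (flat_exp 2 (1 - d j * (y \<bullet> y)) * (2 * (d j * \<bar>y \<bullet> b\<bar>)))"
      using E flat_exp_nonneg[of 2] by (simp add: cut'_def abs_mult d_def)
    also have "\<dots> \<le> E * (2 * (2 * (1 / real (Suc j))))"
      using E flat_exp_2_le flat_exp_nonneg[of 2] 1 by (intro mult_left_mono mult_mono) (auto simp: d_def)
    finally show ?thesis by (simp add: mult_ac del: of_nat_Suc)
  qed
  define \<phi> where "\<phi> = (\<lambda>j y. cut j y * P y)"
  have \<phi>S: "\<phi> j \<in> smooth_alg x t" for j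
    unfolding \<phi>_def cut_def P_def
    by (intro smooth_alg.mult smooth_alg.const smooth_alg.bump smooth_alg.kernel[OF hom_kernel_pkern])
  have \<phi>T: "\<phi> j \<in> test_functions" for j
  proof -
    have "norm y \<le> real (Suc j)" if "\<phi> j y \<noteq> 0" for y
    proof (rule ccontr)
      assume "\<not> norm y \<le> real (Suc j)"
      then have "\<phi> j y = 0" using small[of j y] by (simp add: \<phi>_def cut_def flat_exp_def del: of_nat_Suc)
      then show False using that by simp
    qed
    then have "bounded {y. \<phi> j y \<noteq> 0}" by (auto simp: bounded_iff simp del: of_nat_Suc)
    then show ?thesis using smooth_alg_C_k[OF t \<phi>S] by (simp add: test_functions_def)
  qed
  have \<phi>D: "partial_deriv b (\<phi> j) y = cut j y * (- Q y) + cut' j y * P y" for j y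
  proof -
    have 1: "(cut j has_derivative (\<lambda>h. E * (\<Sum>c\<in>Basis. (h \<bullet> c) * ((flat_exp (0 + 2) (1 - d j * (y \<bullet> y)) + (- real 0) * flat_exp (0 + 1) (1 - d j * (y \<bullet> y))) * ((- 2 * d j) * (y \<bullet> c)))))) (at y)"
      unfolding cut_def by (intro has_derivative_mult_right bump_has_derivative)
    have 2: "(P has_derivative (\<lambda>h. \<Sum>c\<in>Basis. (h \<bullet> c) * (- 1 * partial_deriv (c, 0) pkern (x - y, t)))) (at y)"
      unfolding P_def by (rule kernel_translate_has_derivative[OF hom_kernel_pkern t])
    have pick: "(\<Sum>c\<in>Basis. (b \<bullet> c) * F c) = F b" for F :: "'a \<Rightarrow> real"
    proof -
      have "(\<Sum>c\<in>Basis. (b \<bullet> c) * F c) = (\<Sum>c\<in>Basis. if c = b then F c else 0)"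
        using b by (intro sum.cong) (auto simp: inner_Basis)
      then show ?thesis using b by simp
    qed
    show ?thesis
      using partial_deriv_eq[OF has_derivative_mult[OF 1 2], of b] unfolding pick
      by (simp add: \<phi>_def Q_def cut'_def numeral_2_eq_2)
  qed
  have dm: "(\<lambda>j. d j * c) \<longlonglongrightarrow> 0" for c
  proof -
    have "(\<lambda>j. (1 / real (Suc j))\<^sup>2 * c) \<longlonglongrightarrow> 0\<^sup>2 * c"
      using LIMSEQ_inverse_real_of_nat by (intro tendsto_intros) (simp add: inverse_eq_divide)
    then show ?thesis by (simp add: d_def)
  qed
  have cut_lim: "(\<lambda>j. cut j y) \<longlonglongrightarrow> 1" for y
  proof -
    have "isCont (flat_exp 0) 1" using flat_exp_deriv DERIV_isCont by blast
    moreover have "(\<lambda>j. 1 - d j * (y \<bullet> y)) \<longlonglongrightarrow> 1 - 0" by (intro tendsto_intros dm)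
    ultimately have "(\<lambda>j. flat_exp 0 (1 - d j * (y \<bullet> y))) \<longlonglongrightarrow> flat_exp 0 1"
      using isCont_tendsto_compose by fastforce
    then have "(\<lambda>j. cut j y) \<longlonglongrightarrow> E * flat_exp 0 1" unfolding cut_def by (intro tendsto_intros)
    moreover have "E * flat_exp 0 1 = 1" by (simp add: E_def flat_exp_def exp_minus)
    ultimately show ?thesis by simp
  qed
  have cut'_lim: "(\<lambda>j. cut' j y) \<longlonglongrightarrow> 0" for y
  proof (rule Lim_null_comparison)
    show "\<forall>\<^sub>F j in sequentially. norm (cut' j y) \<le> 4 * E * (1 / real (Suc j))" using cut'_le by simp
    show "(\<lambda>j. 4 * E * (1 / real (Suc j))) \<longlonglongrightarrow> 0"
      using LIMSEQ_inverse_real_of_nat by (intro tendsto_mult_right_zero) (simp add: inverse_eq_divide)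
  qed
  have cutm [measurable]: "cut j \<in> borel_measurable borel" "cut' j \<in> borel_measurable borel" for j
  proof -
    have "continuous_on UNIV (flat_exp m)" for m
      using flat_exp_deriv DERIV_isCont continuous_at_imp_continuous_on by blast
    then have [measurable]: "flat_exp m \<in> borel_measurable borel" for m by (rule borel_measurable_continuous_onI)
    show "cut j \<in> borel_measurable borel" "cut' j \<in> borel_measurable borel" unfolding cut_def cut'_def by measurable
  qed
  have "(\<lambda>j. LINT y|lborel. f y * partial_deriv b (\<phi> j) y) \<longlonglongrightarrow> (LINT y|lborel. - (Q y * f y))"
  proof (rule integral_dominated_convergence[where w="\<lambda>y. E * \<bar>Q y * f y\<bar> + 4 * E * \<bar>P y * f y\<bar>"])
    have eq: "f y * partial_deriv b (\<phi> j) y = - cut j y * (Q y * f y) + cut' j y * (P y * f y)" for j y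
      by (simp add: \<phi>D algebra_simps)
    show "AE y in lborel. (\<lambda>j. f y * partial_deriv b (\<phi> j) y) \<longlonglongrightarrow> - (Q y * f y)"
    proof (rule AE_I2)
      fix y
      have "(\<lambda>j. - cut j y * (Q y * f y) + cut' j y * (P y * f y)) \<longlonglongrightarrow> - 1 * (Q y * f y) + 0 * (P y * f y)"
        by (intro tendsto_intros cut_lim cut'_lim)
      then show "(\<lambda>j. f y * partial_deriv b (\<phi> j) y) \<longlonglongrightarrow> - (Q y * f y)" by (simp add: eq)
    qed
    show "AE y in lborel. norm (f y * partial_deriv b (\<phi> j) y) \<le> E * \<bar>Q y * f y\<bar> + 4 * E * \<bar>P y * f y\<bar>" for j
    proof (rule AE_I2)
      fix y
      have "4 * E * (1 / real (Suc j)) \<le> 4 * E * 1" using E by (intro mult_left_mono) (auto simp: divide_le_eq_1)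
      then have c: "\<bar>cut' j y\<bar> \<le> 4 * E" using cut'_le[of j y] by linarith
      have "norm (f y * partial_deriv b (\<phi> j) y) \<le> \<bar>- cut j y * (Q y * f y)\<bar> + \<bar>cut' j y * (P y * f y)\<bar>"
        unfolding eq real_norm_def by (rule abs_triangle_ineq)
      also have "\<dots> = cut j y * \<bar>Q y * f y\<bar> + \<bar>cut' j y\<bar> * \<bar>P y * f y\<bar>"
        using cut_le(1)[of j y] by (simp only: abs_mult abs_minus_cancel abs_of_nonneg)
      also have "\<dots> \<le> E * \<bar>Q y * f y\<bar> + 4 * E * \<bar>P y * f y\<bar>"
        using cut_le(2)[of j y] c by (intro add_mono mult_right_mono) auto
      finally show "norm (f y * partial_deriv b (\<phi> j) y) \<le> E * \<bar>Q y * f y\<bar> + 4 * E * \<bar>P y * f y\<bar>" .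
    qed
    show "(\<lambda>y. f y * partial_deriv b (\<phi> j) y) \<in> borel_measurable lborel" for j
      unfolding eq
      by measurable
    show "integrable lborel (\<lambda>y. E * \<bar>Q y * f y\<bar> + 4 * E * \<bar>P y * f y\<bar>)"
      by (intro Bochner_Integration.integrable_add integrable_mult_right integrable_abs QI PI f)
    show "(\<lambda>y. - (Q y * f y)) \<in> borel_measurable lborel" using QI by auto
  qed
  moreover have "(\<lambda>j. LINT y|lborel. g y * \<phi> j y) \<longlonglongrightarrow> (LINT y|lborel. P y * g y)"
  proof (rule integral_dominated_convergence[where w="\<lambda>y. E * \<bar>P y * g y\<bar>"])
    have eq: "g y * \<phi> j y = cut j y * (P y * g y)" for j y by (simp add: \<phi>_def)
    show "AE y in lborel. (\<lambda>j. g y * \<phi> j y) \<longlonglongrightarrow> P y * g y"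
    proof (rule AE_I2)
      fix y
      have "(\<lambda>j. cut j y * (P y * g y)) \<longlonglongrightarrow> 1 * (P y * g y)" by (intro tendsto_intros cut_lim)
      then show "(\<lambda>j. g y * \<phi> j y) \<longlonglongrightarrow> P y * g y" by (simp add: eq)
    qed
    show "AE y in lborel. norm (g y * \<phi> j y) \<le> E * \<bar>P y * g y\<bar>" for j
    proof (rule AE_I2)
      fix y
      have "norm (g y * \<phi> j y) = cut j y * \<bar>P y * g y\<bar>"
        unfolding eq real_norm_def abs_mult[of "cut j y"] using cut_le(1)[of j y] by simp
      then show "norm (g y * \<phi> j y) \<le> E * \<bar>P y * g y\<bar>" using cut_le(2)[of j y] by (simp only: mult_right_mono abs_ge_zero)
    qed
    show "(\<lambda>y. g y * \<phi> j y) \<in> borel_measurable lborel" for j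
      unfolding eq by measurable
    show "integrable lborel (\<lambda>y. E * \<bar>P y * g y\<bar>)" by (intro integrable_mult_right integrable_abs PI g)
    show "(\<lambda>y. P y * g y) \<in> borel_measurable lborel" using PI[OF g] by auto
  qed
  then have "(\<lambda>j. LINT y|lborel. f y * partial_deriv b (\<phi> j) y) \<longlonglongrightarrow> - (LINT y|lborel. P y * g y)"
    unfolding test[OF \<phi>T] by (rule tendsto_minus)
  ultimately have "(LINT y|lborel. - (Q y * f y)) = - (LINT y|lborel. P y * g y)" by (rule LIMSEQ_unique)
  then show ?thesis using QI by (simp add: poisson_grad_def half_conv_def P_def Q_def)
qed

section \<open>Necessity of the weak-type condition\<close>

text \<open>The theorem speaks of Lebesgue measurable functions, while the kernel calculus is
  carried out for Borel functions and \<open>lborel\<close>. Integrals against Borel functions are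
  transferred along an almost everywhere equal Borel representative.\<close>

lemma lebesgue_integral_representative:
  fixes f f' k :: "'a::euclidean_space \<Rightarrow> real"
  assumes f: "f \<in> borel_measurable lebesgue" and f' [measurable]: "f' \<in> borel_measurable borel"
    and ae: "AE x in lborel. f x = f' x" and k [measurable]: "k \<in> borel_measurable borel"
  shows "(LINT y|lebesgue. f y * k y) = (LINT y|lborel. f' y * k y)"
proof -
  have kl: "k \<in> borel_measurable lebesgue" "f' \<in> borel_measurable lebesgue"
    using measurable_completion[of k lborel borel] measurable_completion[of f' lborel borel] by auto
  have "AE x in lebesgue. f x = f' x" by (rule AE_completion[OF ae])
  then have "(LINT y|lebesgue. f y * k y) = (LINT y|lebesgue. f' y * k y)"
    using f kl by (intro integral_cong_AE borel_measurable_times) auto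
  also have "\<dots> = (LINT y|lborel. f' y * k y)" by (rule integral_completion) measurable
  finally show ?thesis .
qed

lemma Lp_representative:
  fixes f :: "'a::euclidean_space \<Rightarrow> real"
  assumes f: "f \<in> Lp (real n) lebesgue" and n: "n \<ge> 1"
  obtains f' where "f' \<in> borel_measurable borel" "integrable lborel (\<lambda>y. \<bar>f' y\<bar> ^ n)" "AE x in lborel. f x = f' x"
proof -
  have fm: "f \<in> borel_measurable lebesgue" and fi: "integrable lebesgue (\<lambda>x. \<bar>f x\<bar> powr real n)"
    using f by (auto simp: Lp_def)
  obtain f' where f': "f' \<in> borel_measurable lborel" "AE x in lborel. f x = f' x"
    using completion_ex_borel_measurable_real[OF fm] by blast
  have fb [measurable]: "f' \<in> borel_measurable borel" using f'(1) by simp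
  have pw: "\<bar>x\<bar> powr real n = \<bar>x\<bar> ^ n" for x :: real
    using n by (cases "x = 0") (auto simp: powr_realpow)
  have "integrable lebesgue (\<lambda>x. \<bar>f' x\<bar> ^ n)"
  proof (rule integrable_cong_AE_imp[OF fi[unfolded pw]])
    show "(\<lambda>x. \<bar>f' x\<bar> ^ n) \<in> borel_measurable lebesgue"
      using measurable_completion[of "\<lambda>x. \<bar>f' x\<bar> ^ n" lborel borel] by simp
    show "AE x in lebesgue. \<bar>f x\<bar> ^ n = \<bar>f' x\<bar> ^ n"
      using AE_completion[OF f'(2)] by eventually_elim simp
  qed
  then have "integrable lborel (\<lambda>x. \<bar>f' x\<bar> ^ n)" by (subst (asm) integrable_completion) auto
  from that[OF fb this f'(2)] show thesis .
qed

lemma poisson_kernel_pkern: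
  fixes x :: "'a::euclidean_space"
  assumes t: "t > 0"
  shows "poisson_kernel t x = Gamma ((real DIM('a) + 1) / 2) / pi powr ((real DIM('a) + 1) / 2) * pkern (x, t)"
proof -
  have "norm (x, t) ^ (DIM('a) + 1) = ((norm (x, t))\<^sup>2) powr (real (DIM('a) + 1) / 2)"
    by (subst abs_power_eq_square_powr) auto
  also have "(norm (x, t))\<^sup>2 = t\<^sup>2 + (norm x)\<^sup>2" by (simp add: norm_Pair)
  finally have "norm (x, t) ^ (DIM('a) + 1) = (t\<^sup>2 + (norm x)\<^sup>2) powr ((real DIM('a) + 1) / 2)" by (simp add: add.commute)
  then show ?thesis by (simp only: poisson_kernel_def pkern_def powr_minus) (simp add: field_simps)
qed

lemma poisson_extension_half_conv:
  fixes f f' :: "'a::euclidean_space \<Rightarrow> real"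
  assumes f: "f \<in> borel_measurable lebesgue" and f': "f' \<in> borel_measurable borel"
    and ae: "AE x in lborel. f x = f' x" and z: "snd z > 0"
  shows "poisson_extension f z = Gamma ((real DIM('a) + 1) / 2) / pi powr ((real DIM('a) + 1) / 2) * half_conv pkern f' z"
proof -
  define c where "c = Gamma ((real DIM('a) + 1) / 2) / pi powr ((real DIM('a) + 1) / 2)"
  obtain x t where xt: "z = (x, t)" by (cases z)
  have t: "t > 0" using z by (simp add: xt)
  have [measurable]: "(\<lambda>y. (x - y, t)) \<in> borel_measurable borel"
    by (intro borel_measurable_continuous_onI continuous_intros)
  have "poisson_extension f z = (LINT y|lebesgue. f y * (c * pkern (x - y, t)))"
    unfolding poisson_extension_def xt case_prod_conv poisson_kernel_pkern[OF t] c_def[symmetric]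
    by (simp add: mult_ac)
  also have "\<dots> = (LINT y|lborel. f' y * (c * pkern (x - y, t)))"
    by (rule lebesgue_integral_representative[OF f f' ae]) measurable
  also have "\<dots> = (LINT y|lborel. c * (pkern (x - y, t) * f' y))" by (simp add: mult_ac)
  also have "\<dots> = c * half_conv pkern f' z" by (simp add: half_conv_def xt)
  finally show ?thesis by (simp add: c_def)
qed

lemma gradient_inner_Basis: "b \<in> Basis \<Longrightarrow> gradient u z \<bullet> b = partial_deriv b u z"
  by (simp add: gradient_def inner_sum_left inner_Basis if_distrib cong: if_cong)

lemma partial_deriv_half_conv:
  fixes f :: "'a::euclidean_space \<Rightarrow> real"
  assumes u: "\<And>z. snd z > 0 \<Longrightarrow> u z = c * half_conv pkern f z" and f: "poisson_admissible f"
    and z: "snd z > 0" and b: "b \<in> Basis"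
  shows "partial_deriv b u z = c * poisson_grad b f z"
proof -
  have "((\<lambda>z. c * half_conv pkern f z) has_derivative (\<lambda>h. c * (\<Sum>b\<in>Basis. (h \<bullet> b) * half_conv (partial_deriv b pkern) f z))) (at z)"
    by (intro has_derivative_mult_right half_conv_pkern_has_derivative f z)
  then have "(u has_derivative (\<lambda>h. c * (\<Sum>b\<in>Basis. (h \<bullet> b) * half_conv (partial_deriv b pkern) f z))) (at z)"
    by (rule has_derivative_transform_within_open[of _ _ _ _ "{z. snd z > 0}"])
      (use z u in \<open>auto intro!: open_Collect_less continuous_intros\<close>)
  then have "(u has_derivative (\<lambda>h. \<Sum>b\<in>Basis. (h \<bullet> b) * (c * poisson_grad b f z))) (at z)"
    by (simp add: sum_distrib_left poisson_grad_def mult_ac)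
  from frechet_derivative_eq_sum[OF this b] show ?thesis .
qed

text \<open>The length of the gradient is comparable to its coordinates. The upper bound is used to
  prove the weak-type condition, the lower bound to exploit it.\<close>

lemma norm_hyperbolic_gradient:
  fixes f :: "'a::euclidean_space \<Rightarrow> real"
  assumes u: "\<And>z. snd z > 0 \<Longrightarrow> u z = c * half_conv pkern f z" and f: "poisson_admissible f"
    and c: "c > 0" and z: "snd z > 0"
  shows "norm (hyperbolic_gradient u z) \<le> (\<Sum>b\<in>Basis. c * (snd z * \<bar>poisson_grad b f z\<bar>))"
    and "b \<in> Basis \<Longrightarrow> c * (snd z * \<bar>poisson_grad b f z\<bar>) \<le> norm (hyperbolic_gradient u z)"
proof -
  have "norm (hyperbolic_gradient u z) = snd z * norm (gradient u z)" using z by (simp add: hyperbolic_gradient_def)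
  also have "norm (gradient u z) \<le> (\<Sum>b\<in>Basis. \<bar>partial_deriv b u z\<bar>)"
    using norm_le_l1[of "gradient u z"] by (simp add: gradient_inner_Basis)
  also have "\<dots> = (\<Sum>b\<in>Basis. c * \<bar>poisson_grad b f z\<bar>)"
    using c by (simp add: partial_deriv_half_conv[OF u f z] abs_mult)
  finally show "norm (hyperbolic_gradient u z) \<le> (\<Sum>b\<in>Basis. c * (snd z * \<bar>poisson_grad b f z\<bar>))"
    using z by (simp add: sum_distrib_left mult_ac)
  show "c * (snd z * \<bar>poisson_grad b f z\<bar>) \<le> norm (hyperbolic_gradient u z)" if b: "b \<in> Basis"
  proof -
    have "c * \<bar>poisson_grad b f z\<bar> = \<bar>gradient u z \<bullet> b\<bar>"
      using c by (simp add: gradient_inner_Basis[OF b] partial_deriv_half_conv[OF u f z b] abs_mult)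
    also have "\<dots> \<le> norm (gradient u z)" by (rule Basis_le_norm[OF b])
    finally have "snd z * (c * \<bar>poisson_grad b f z\<bar>) \<le> snd z * norm (gradient u z)" using z by (intro mult_left_mono) auto
    then show ?thesis using z by (simp add: hyperbolic_gradient_def mult_ac)
  qed
qed

lemma hyperbolic_gradient_measurable:
  fixes f :: "'a::euclidean_space \<Rightarrow> real"
  assumes u: "\<And>z. snd z > 0 \<Longrightarrow> u z = c * half_conv pkern f z" and f: "poisson_admissible f"
  shows "(\<lambda>z. norm (hyperbolic_gradient u z)) \<in> borel_measurable hyperbolic_measure"
proof -
  have half: "(upper_half_space :: ('a \<times> real) set) = {z. snd z > 0}" by (auto simp: upper_half_space_def)
  have "continuous_on upper_half_space (\<lambda>z. norm (snd z *\<^sub>R (\<Sum>b\<in>Basis. (c * poisson_grad b f z) *\<^sub>R b)))"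
    by (intro continuous_intros continuous_on_poisson_grad f) (auto simp: half)
  also have "?this \<longleftrightarrow> continuous_on upper_half_space (\<lambda>z. norm (hyperbolic_gradient u z))"
    by (intro continuous_on_cong refl)
      (simp add: hyperbolic_gradient_def gradient_def half partial_deriv_half_conv[OF u f])
  finally have "(\<lambda>z. norm (hyperbolic_gradient u z)) \<in> borel_measurable (lebesgue_on upper_half_space)"
    using borel_open[OF upper_half_space_open] by (intro continuous_imp_measurable_on_sets_lebesgue) auto
  then show ?thesis unfolding hyperbolic_measure_def by simp
qed

lemma poisson_grad_level_set:
  fixes f :: "'a::euclidean_space \<Rightarrow> real"
  assumes f: "poisson_admissible f" and b: "b \<in> Basis"
  shows "{z. snd z > 0 \<and> snd z * \<bar>poisson_grad b f z\<bar> > s} \<in> sets borel"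
    and "{z. snd z > 0 \<and> snd z * \<bar>poisson_grad b f z\<bar> > s} \<in> sets hyperbolic_measure"
proof -
  have half_open: "open {z :: 'a \<times> real. snd z > 0}" by (intro open_Collect_less continuous_intros)
  have "continuous_on {z :: 'a \<times> real. snd z > 0} (\<lambda>z. snd z * \<bar>poisson_grad b f z\<bar>)"
    by (intro continuous_intros continuous_on_poisson_grad f b) auto
  from continuous_on_open_vimage[OF half_open, THEN iffD1, rule_format, OF this, of "{s<..}"]
  have "open ((\<lambda>z. snd z * \<bar>poisson_grad b f z\<bar>) -` {s<..} \<inter> {z. snd z > 0})" by simp
  moreover have "(\<lambda>z. snd z * \<bar>poisson_grad b f z\<bar>) -` {s<..} \<inter> {z. snd z > 0} = {z. snd z > 0 \<and> snd z * \<bar>poisson_grad b f z\<bar> > s}" by auto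
  ultimately show 1: "{z. snd z > 0 \<and> snd z * \<bar>poisson_grad b f z\<bar> > s} \<in> sets borel" by (metis borel_open)
  show "{z. snd z > 0 \<and> snd z * \<bar>poisson_grad b f z\<bar> > s} \<in> sets hyperbolic_measure"
    by (rule borel_in_hyperbolic[OF 1]) (auto simp: upper_half_space_def)
qed

text \<open>If the length of the gradient exceeds \<open>s\<close>, one of its
  \<open>DIM('a \<times> real)\<close> coordinates exceeds the proportional share of
  \<open>s\<close>, so the level set is covered by those of the coordinates, to which
  \<open>weak_type_of_semigroup\<close> applies.\<close>

lemma weak_Lp_of_slices:
  fixes f :: "'a::euclidean_space \<Rightarrow> real"
  assumes n: "DIM('a) \<ge> 2" and u: "\<And>z. snd z > 0 \<Longrightarrow> u z = c * half_conv pkern f z" and c: "c > 0"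
    and f: "f \<in> borel_measurable borel" "integrable lborel (\<lambda>y. \<bar>f y\<bar> ^ DIM('a))"
    and S: "\<And>b e. b \<in> Basis \<Longrightarrow> e > 0 \<Longrightarrow> (LINT y|lborel. \<bar>poisson_grad b f (y, e)\<bar> ^ DIM('a)) \<le> S"
  shows "(\<lambda>z. norm (hyperbolic_gradient u z)) \<in> weak_Lp (real DIM('a)) hyperbolic_measure"
proof -
  let ?n = "DIM('a)" and ?N = "DIM('a \<times> real)"
  have p: "?n \<ge> 1" using n by simp
  have adm: "poisson_admissible f" by (rule poisson_admissible_power[OF f p])
  obtain b0 :: "'a \<times> real" where b0: "b0 \<in> Basis" using nonempty_Basis by blast
  have "0 \<le> (LINT y|lborel. \<bar>poisson_grad b0 f (y, 1)\<bar> ^ ?n)" by (intro Bochner_Integration.integral_nonneg) auto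
  then have S0: "S \<ge> 0" using S[OF b0, of 1] by linarith
  have lev: "emeasure hyperbolic_measure {z. snd z > 0 \<and> snd z * \<bar>poisson_grad b f z\<bar> > s} \<le> ennreal ((2 / s) ^ ?n) * ennreal S"
    if b: "b \<in> Basis" and s: "s > 0" for b s
  proof (rule weak_type_of_semigroup[OF n _ _ _ s])
    show "continuous_on {z. snd z > 0} (poisson_grad b f)" by (rule continuous_on_poisson_grad[OF adm b]) simp
    show "poisson_grad b f (x, t + e) = half_conv pker1 (\<lambda>y. poisson_grad b f (y, e)) (x, t)" if "t > 0" "e > 0" for x t e
      by (rule poisson_grad_semigroup[OF f p b that(2,1)])
    show "(\<integral>\<^sup>+y. ennreal (\<bar>poisson_grad b f (y, e)\<bar> ^ ?n) \<partial>lborel) \<le> ennreal S" if "e > 0" for e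
      using S[OF b that] poisson_grad_slice_integrable[OF f p b that]
      by (subst nn_integral_eq_integral) (auto intro: ennreal_leI)
  qed
  define m where "m = c * real ?N"
  have m: "m > 0" using c by (simp add: m_def)
  \<comment> \<open>The \<open>n\<close>-th root turns the total
    \<open>real ?N * (2 * m / s) ^ n * S\<close> into the form \<open>(C / s) ^ n\<close> that
    \<open>weak_Lp\<close> demands.\<close>
  define C where "C = 2 * m * root ?n (real ?N * S)"
  have C0: "C \<ge> 0" using m S0 by (simp add: C_def)
  have "emeasure hyperbolic_measure {z \<in> space hyperbolic_measure. \<bar>norm (hyperbolic_gradient u z)\<bar> > s}
      \<le> ennreal (C powr real ?n / s powr real ?n)" if s: "s > 0" for s
  proof -
    define r where "r = s / m"
    have r: "r > 0" using s m by (simp add: r_def)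
    have "{z \<in> space hyperbolic_measure. \<bar>norm (hyperbolic_gradient u z)\<bar> > s} \<subseteq>
       (\<Union>b\<in>Basis. {z. snd z > 0 \<and> snd z * \<bar>poisson_grad b f z\<bar> > r})"
    proof
      fix z assume "z \<in> {z \<in> space hyperbolic_measure. \<bar>norm (hyperbolic_gradient u z)\<bar> > s}"
      then have z: "snd z > 0" "s < norm (hyperbolic_gradient u z)"
        by (auto simp: space_hyperbolic upper_half_space_def)
      show "z \<in> (\<Union>b\<in>Basis. {z. snd z > 0 \<and> snd z * \<bar>poisson_grad b f z\<bar> > r})"
      proof (rule ccontr)
        assume "\<not> ?thesis"
        then have le: "snd z * \<bar>poisson_grad b f z\<bar> \<le> r" if "b \<in> Basis" for b using that z(1) by force
        have "norm (hyperbolic_gradient u z) \<le> (\<Sum>b\<in>Basis. c * (snd z * \<bar>poisson_grad b f z\<bar>))"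
          by (rule norm_hyperbolic_gradient(1)[OF u adm c z(1)])
        also have "\<dots> \<le> (\<Sum>b\<in>(Basis :: ('a \<times> real) set). c * r)"
          using c le by (intro sum_mono mult_left_mono) auto
        also have "\<dots> = s" using c by (simp add: r_def m_def)
        finally show False using z(2) by simp
      qed
    qed
    then have "emeasure hyperbolic_measure {z \<in> space hyperbolic_measure. \<bar>norm (hyperbolic_gradient u z)\<bar> > s} \<le>
       emeasure hyperbolic_measure (\<Union>b\<in>Basis. {z. snd z > 0 \<and> snd z * \<bar>poisson_grad b f z\<bar> > r})"
      by (intro emeasure_mono sets.finite_UN poisson_grad_level_set(2)[OF adm]) auto
    also have "\<dots> \<le> (\<Sum>b\<in>Basis. emeasure hyperbolic_measure {z. snd z > 0 \<and> snd z * \<bar>poisson_grad b f z\<bar> > r})"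
      by (intro emeasure_subadditive_finite) (auto intro!: poisson_grad_level_set(2)[OF adm])
    also have "\<dots> \<le> (\<Sum>b\<in>(Basis :: ('a \<times> real) set). ennreal ((2 / r) ^ ?n * S))"
      using lev[OF _ r] S0 r by (intro sum_mono) (simp add: ennreal_mult)
    also have "\<dots> = ennreal (real ?N * ((2 / r) ^ ?n * S))"
      using S0 r by (subst sum_ennreal) auto
    also have "real ?N * ((2 / r) ^ ?n * S) = C powr real ?n / s powr real ?n"
    proof -
      have "C ^ ?n = (2 * m) ^ ?n * (real ?N * S)" using S0 by (simp only: C_def power_mult_distrib) (subst real_root_pow_pos2, auto)
      then have "(C / s) ^ ?n = (2 * m / s) ^ ?n * (real ?N * S)" by (simp add: power_divide)
      moreover have "2 * m / s = 2 / r" using s m by (simp add: r_def)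
      moreover have "C powr real ?n / s powr real ?n = (C / s) ^ ?n"
        using C0 s p by (cases "C = 0") (auto simp: powr_realpow power_divide)
      ultimately show ?thesis by simp
    qed
    finally show ?thesis .
  qed
  then show ?thesis
    using hyperbolic_gradient_measurable[OF u adm] C0 unfolding weak_Lp_def by blast
qed

lemma forward_direction:
  fixes f :: "'a::euclidean_space \<Rightarrow> real"
  assumes n: "DIM('a) \<ge> 2" and f: "f \<in> Lp (real DIM('a)) lebesgue"
    and grad: "distributional_gradient_in_Lp (real DIM('a)) f"
  shows "(\<lambda>z. norm (hyperbolic_gradient (poisson_extension f) z)) \<in> weak_Lp (real DIM('a)) hyperbolic_measure"
proof -
  let ?n = "DIM('a)"
  have p: "?n \<ge> 1" using n by simp
  have fl: "f \<in> borel_measurable lebesgue" using f by (simp add: Lp_def)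
  obtain f' where f': "f' \<in> borel_measurable borel" "integrable lborel (\<lambda>y. \<bar>f' y\<bar> ^ ?n)" "AE x in lborel. f x = f' x"
    using Lp_representative[OF f p] by blast
  have adm: "poisson_admissible f'" by (rule poisson_admissible_power[OF f'(1,2) p])
  define c where "c = Gamma ((real ?n + 1) / 2) / pi powr ((real ?n + 1) / 2)"
  have c: "c > 0" unfolding c_def by (intro divide_pos_pos Gamma_real_pos) auto
  have u: "poisson_extension f z = c * half_conv pkern f' z" if "snd z > 0" for z
    unfolding c_def by (rule poisson_extension_half_conv[OF fl f'(1,3) that])
  have "\<exists>S. \<forall>e>0. (LINT y|lborel. \<bar>poisson_grad (i, 0) f' (y, e)\<bar> ^ ?n) \<le> S" if i: "i \<in> Basis" for i
  proof -
    obtain g where g: "g \<in> Lp (real ?n) lebesgue" "has_distributional_partial i f g"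
      using grad i unfolding distributional_gradient_in_Lp_def by blast
    have gl: "g \<in> borel_measurable lebesgue" using g by (simp add: Lp_def)
    obtain g' where g': "g' \<in> borel_measurable borel" "integrable lborel (\<lambda>y. \<bar>g' y\<bar> ^ ?n)" "AE x in lborel. g x = g' x"
      using Lp_representative[OF g(1) p] by blast
    have admg: "poisson_admissible g'" by (rule poisson_admissible_power[OF g'(1,2) p])
    have test: "(LINT y|lborel. f' y * partial_deriv i \<phi> y) = - (LINT y|lborel. g' y * \<phi> y)" if \<phi>: "\<phi> \<in> test_functions" for \<phi>
    proof -
      have m: "partial_deriv i \<phi> \<in> borel_measurable borel" "\<phi> \<in> borel_measurable borel"
        using test_function_props(2,3)[OF \<phi>] i by (auto intro: borel_measurable_continuous_onI)
      have "(LINT x|lebesgue. f x * partial_deriv i \<phi> x) = - (LINT x|lebesgue. g x * \<phi> x)"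
        using g(2) \<phi> unfolding has_distributional_partial_def by blast
      then show ?thesis
        by (simp only: lebesgue_integral_representative[OF fl f'(1,3) m(1)] lebesgue_integral_representative[OF gl g'(1,3) m(2)])
    qed
    have iB: "(i, 0) \<in> (Basis :: ('a \<times> real) set)" using i by (simp add: Basis_prod_def)
    define \<kappa> where "\<kappa> = poisson_mass TYPE('a)"
    have \<kappa>: "\<kappa> > 0" unfolding \<kappa>_def by (rule poisson_mass_pos)
    have "(LINT y|lborel. \<bar>poisson_grad (i, 0) f' (y, e)\<bar> ^ ?n) \<le> \<kappa> ^ ?n * (LINT y|lborel. \<bar>g' y\<bar> ^ ?n)" if e: "e > 0" for e
    proof -
      have eq: "poisson_grad (i, 0) f' (y, e) = \<kappa> * half_conv pker1 g' (y, e)" for y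
        using poisson_grad_eq_of_distributional[OF i adm admg test e, of y] \<kappa> by (simp add: half_conv_pker1 \<kappa>_def)
      have i1: "integrable lborel (\<lambda>y. \<bar>poisson_grad (i, 0) f' (y, e)\<bar> ^ ?n)"
        by (rule poisson_grad_slice_integrable[OF f'(1,2) p iB e])
      then have "integrable lborel (\<lambda>y. \<kappa> ^ ?n * \<bar>half_conv pker1 g' (y, e)\<bar> ^ ?n)"
        using \<kappa> by (simp add: eq abs_mult power_mult_distrib)
      then have i2: "integrable lborel (\<lambda>y. \<bar>half_conv pker1 g' (y, e)\<bar> ^ ?n)"
        using \<kappa> by simp
      have "ennreal (LINT y|lborel. \<bar>half_conv pker1 g' (y, e)\<bar> ^ ?n) \<le> ennreal (LINT y|lborel. \<bar>g' y\<bar> ^ ?n)"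
        using half_conv_pker1_slice[OF g'(1) p e] i2 g'(2) by (simp add: nn_integral_eq_integral)
      then have "(LINT y|lborel. \<bar>half_conv pker1 g' (y, e)\<bar> ^ ?n) \<le> (LINT y|lborel. \<bar>g' y\<bar> ^ ?n)"
        by (subst (asm) ennreal_le_iff) (auto intro!: Bochner_Integration.integral_nonneg)
      then have "\<kappa> ^ ?n * (LINT y|lborel. \<bar>half_conv pker1 g' (y, e)\<bar> ^ ?n) \<le> \<kappa> ^ ?n * (LINT y|lborel. \<bar>g' y\<bar> ^ ?n)"
        using \<kappa> by (intro mult_left_mono) auto
      then show ?thesis using \<kappa> by (simp add: eq abs_mult power_mult_distrib)
    qed
    then show ?thesis by blast
  qed
  then obtain S0 where S0: "\<And>i e. i \<in> Basis \<Longrightarrow> e > 0 \<Longrightarrow> (LINT y|lborel. \<bar>poisson_grad (i, 0) f' (y, e)\<bar> ^ ?n) \<le> S0 i"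
    by metis
  define S1 where "S1 = (\<Sum>i\<in>Basis. \<bar>S0 i\<bar>)"
  have S1: "(LINT y|lborel. \<bar>poisson_grad (i, 0) f' (y, e)\<bar> ^ ?n) \<le> S1" if "i \<in> Basis" "e > 0" for i e
  proof -
    have "\<bar>S0 i\<bar> \<le> S1" unfolding S1_def using that by (intro member_le_sum) auto
    then show ?thesis using S0[OF that] by linarith
  qed
  obtain S2 where S2: "\<And>e. e > 0 \<Longrightarrow> (LINT y|lborel. \<bar>poisson_grad (0, 1) f' (y, e)\<bar> ^ ?n) \<le> S2"
    using poisson_grad_vertical_bound[OF n f'(1,2) S1] by blast
  show ?thesis
  proof (rule weak_Lp_of_slices[OF n u c f'(1,2)])
    fix b :: "'a \<times> real" and e :: real assume b: "b \<in> Basis" and e: "e > 0"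
    then consider i where "b = (i, 0)" "i \<in> Basis" | "b = (0, 1)" by (auto simp: Basis_prod_def)
    then show "(LINT y|lborel. \<bar>poisson_grad b f' (y, e)\<bar> ^ ?n) \<le> max S1 S2"
      by cases (use S1 S2 e in \<open>simp_all add: le_max_iff_disj\<close>)
  qed auto
qed

section \<open>Bounded slices from the weak-type condition\<close>

text \<open>A single level between \<open>2 ^ K * a\<close> and twice that value contributes at most
  its upper value to the \<open>n\<close>-th power times the weak-type bound at its lower value.
  This is \<open>2 ^ n * C\<close>, the same for all levels, so the moment grows only linearly in
  their number.\<close>

lemma weak_type_dyadic_moment:
  fixes F :: "'b \<Rightarrow> real"
  assumes [measurable]: "F \<in> borel_measurable M" and C: "C \<ge> 0"
    and weak: "\<And>s. s > 0 \<Longrightarrow> emeasure M {z \<in> space M. F z > s} \<le> ennreal (C / s ^ n)" and a: "a > 0"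
  shows "(\<integral>\<^sup>+z. ennreal (F z ^ n) * indicator {z \<in> space M. a < F z \<and> F z \<le> 2 ^ K * a} z \<partial>M) \<le> ennreal (real K * (2 ^ n * C))"
proof (induction K)
  case 0
  have "{z \<in> space M. a < F z \<and> F z \<le> 2 ^ 0 * a} = {}" by auto
  then show ?case by simp
next
  case (Suc K)
  let ?A = "\<lambda>K. {z \<in> space M. a < F z \<and> F z \<le> 2 ^ K * a}"
  let ?B = "{z \<in> space M. F z > 2 ^ K * a}"
  have pos: "2 ^ K * a > 0" using a by simp
  have "(\<integral>\<^sup>+z. ennreal (F z ^ n) * indicator (?A (Suc K)) z \<partial>M) \<le>
    (\<integral>\<^sup>+z. ennreal (F z ^ n) * indicator (?A K) z + ennreal ((2 ^ Suc K * a) ^ n) * indicator ?B z \<partial>M)"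
  proof (intro nn_integral_mono)
    fix z assume z: "z \<in> space M"
    show "ennreal (F z ^ n) * indicator (?A (Suc K)) z \<le> ennreal (F z ^ n) * indicator (?A K) z + ennreal ((2 ^ Suc K * a) ^ n) * indicator ?B z"
    proof (cases "z \<in> ?A (Suc K)")
      case True
      show ?thesis
      proof (cases "F z \<le> 2 ^ K * a")
        case True
        then have "z \<in> ?A K" using \<open>z \<in> ?A (Suc K)\<close> by simp
        then show ?thesis using \<open>z \<in> ?A (Suc K)\<close> by (simp only: indicator_simps) simp
      next
        case False
        have "F z ^ n \<le> (2 ^ Suc K * a) ^ n" using True a by (intro power_mono) auto
        then have "ennreal (F z ^ n) \<le> ennreal ((2 ^ Suc K * a) ^ n)" by (rule ennreal_leI)
        moreover have "z \<in> ?B" using False z by simp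
        ultimately show ?thesis using \<open>z \<in> ?A (Suc K)\<close> by (simp only: indicator_simps) (simp add: add_increasing)
      qed
    qed simp
  qed
  also have "\<dots> = (\<integral>\<^sup>+z. ennreal (F z ^ n) * indicator (?A K) z \<partial>M) + ennreal ((2 ^ Suc K * a) ^ n) * emeasure M ?B"
    by (subst nn_integral_add) (auto simp: nn_integral_cmult_indicator)
  also have "\<dots> \<le> ennreal (real K * (2 ^ n * C)) + ennreal ((2 ^ Suc K * a) ^ n) * ennreal (C / (2 ^ K * a) ^ n)"
    by (intro add_mono Suc.IH mult_left_mono weak pos) auto
  also have "ennreal ((2 ^ Suc K * a) ^ n) * ennreal (C / (2 ^ K * a) ^ n) = ennreal (2 ^ n * C)"
  proof -
    have "(2 ^ Suc K * a) ^ n * (C / (2 ^ K * a) ^ n) = 2 ^ n * C"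
    proof -
      have "2 ^ Suc K * a = 2 * (2 ^ K * a)" by simp
      then have "(2 ^ Suc K * a) ^ n = 2 ^ n * (2 ^ K * a) ^ n" by (simp only: power_mult_distrib)
      then show ?thesis using a by simp
    qed
    then show ?thesis using C a by (simp flip: ennreal_mult)
  qed
  also have "ennreal (real K * (2 ^ n * C)) + ennreal (2 ^ n * C) = ennreal (real (Suc K) * (2 ^ n * C))"
    using C by (simp add: algebra_simps flip: ennreal_plus)
  finally show ?case .
qed

text \<open>Each dyadic interval \<open>[a, 2 * a)\<close> contributes at least
  \<open>a / (2 * a) = 1 / 2\<close>; the exact value \<open>log 2\<close> is not important, only
  linear growth in \<open>m\<close> is.\<close>

lemma nn_integral_inverse_dyadic:
  assumes "T > 0"
  shows "ennreal (real m / 2) \<le> (\<integral>\<^sup>+t. ennreal (1 / t) * indicator {T / 2 ^ m..<T} t \<partial>lborel)"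
proof (induction m)
  case (Suc m)
  define a where "a = T / 2 ^ Suc m"
  have a: "a > 0" "T / 2 ^ m = 2 * a" using assms by (simp_all add: a_def)
  have "2 * a \<le> T" using assms a(2)[symmetric] by (simp add: divide_le_eq mult_le_cancel_left1)
  have "ennreal (1 / 2) = (\<integral>\<^sup>+t. ennreal (1 / (2 * a)) * indicator {a..<2 * a} t \<partial>lborel)"
    using a by (subst nn_integral_cmult_indicator) (auto simp flip: ennreal_mult)
  also have "\<dots> \<le> (\<integral>\<^sup>+t. ennreal (1 / t) * indicator {a..<2 * a} t \<partial>lborel)"
    using a by (intro nn_integral_mono) (auto simp: indicator_def intro!: ennreal_leI frac_le)
  finally have 1: "ennreal (1 / 2) \<le> (\<integral>\<^sup>+t. ennreal (1 / t) * indicator {a..<2 * a} t \<partial>lborel)" .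
  have "ennreal (real (Suc m) / 2) = ennreal (real m / 2) + ennreal (1 / 2)"
    by (subst ennreal_plus[symmetric]) (auto simp: field_simps)
  also have "\<dots> \<le> (\<integral>\<^sup>+t. ennreal (1 / t) * indicator {2 * a..<T} t \<partial>lborel) + (\<integral>\<^sup>+t. ennreal (1 / t) * indicator {a..<2 * a} t \<partial>lborel)"
    using Suc.IH 1 unfolding a(2) by (rule add_mono)
  also have "\<dots> = (\<integral>\<^sup>+t. ennreal (1 / t) * indicator {a..<T} t \<partial>lborel)"
    using \<open>2 * a \<le> T\<close> a by (subst nn_integral_add[symmetric]) (auto simp: indicator_def intro!: nn_integral_cong)
  finally show ?case by (simp add: a_def)
qed simp

lemma add_power_le: "(a + b) ^ n \<le> 2 ^ n * (a ^ n + b ^ n)" if "a \<ge> 0" "b \<ge> 0" for a b :: real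
proof -
  have "(a + b) ^ n \<le> (2 * max a b) ^ n" using that by (intro power_mono) auto
  also have "\<dots> = 2 ^ n * max a b ^ n" by (rule power_mult_distrib)
  also have "max a b ^ n \<le> a ^ n + b ^ n" using that by (simp add: max_def)
  finally show ?thesis by simp
qed

text \<open>The semigroup lets the fixed slice at height \<open>T\<close> be compared with every lower slice; only the part
  of a lower slice above the level \<open>\<eta>\<close> matters. Averaging over \<open>dt / t\<close> turns this into the
  truncated moment of the weak-type function, whose number of dyadic levels grows like \<open>2 m\<close> while
  the averaging interval has length \<open>m\<close>.\<close>

lemma slice_moment_on_ball:
  fixes w :: "'a::euclidean_space \<times> real \<Rightarrow> real"
  assumes n: "DIM('a) \<ge> 1" and wm [measurable]: "w \<in> borel_measurable borel"
    and cont: "continuous_on {z. snd z > 0} w"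
    and semi: "\<And>x t e. t > 0 \<Longrightarrow> e > 0 \<Longrightarrow> w (x, t + e) = half_conv pker1 (\<lambda>y. w (y, e)) (x, t)"
    and int: "\<And>e. e > 0 \<Longrightarrow> integrable lborel (\<lambda>y. \<bar>w (y, e)\<bar> ^ DIM('a))"
    and height: "\<And>z. snd z > 0 \<Longrightarrow> \<bar>w z\<bar> \<le> K0 / (snd z)\<^sup>2" and K0: "K0 > 0"
    and C: "C \<ge> 0" and weak: "\<And>s. s > 0 \<Longrightarrow> emeasure hyperbolic_measure {z. snd z > 0 \<and> snd z * \<bar>w z\<bar> > s} \<le> ennreal (C / s ^ DIM('a))"
    and T: "T > 0" and \<eta>: "\<eta> > 0"
  shows "(LINT y|lborel. indicator (ball 0 R) y * \<bar>w (y, T)\<bar> ^ DIM('a)) \<le>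
    4 * 4 ^ DIM('a) * C + 2 ^ DIM('a) * \<eta> ^ DIM('a) * measure lborel (ball (0::'a) R)"
proof (rule ccontr)
  let ?n = "DIM('a)"
  define V where "V = measure lborel (ball (0::'a) R)"
  define X where "X = (LINT y|lborel. indicator (ball 0 R) y * \<bar>w (y, T)\<bar> ^ ?n)"
  \<comment> \<open>The part of a lower slice below \<open>\<eta>\<close> contributes at most
    \<open>\<eta>\<close> to the slice at \<open>T\<close>. Over the ball this costs the subtracted
    term, finite because the ball has finite volume.\<close>
  define X' where "X' = X - 2 ^ ?n * \<eta> ^ ?n * V"
  assume "\<not> ?thesis"
  then have big: "X' > 4 * 4 ^ ?n * C" by (simp add: X'_def X_def V_def)
  have slm [measurable]: "(\<lambda>y. w (y, t)) \<in> borel_measurable borel" for t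
    using measurable_compose[OF half_slice_measurable wm] by simp
  define J where "J = (\<lambda>t. \<integral>\<^sup>+y. ennreal (\<bar>w (y, t)\<bar> ^ ?n) * indicator {y. \<bar>w (y, t)\<bar> > \<eta>} y \<partial>lborel)"
  have J: "ennreal X' \<le> ennreal (2 ^ ?n) * J t" if t: "0 < t" "t < T" for t
  proof -
    define h where "h = (\<lambda>y. \<bar>w (y, t)\<bar> * indicator {y. \<bar>w (y, t)\<bar> > \<eta>} y)"
    have hm [measurable]: "h \<in> borel_measurable borel" unfolding h_def by measurable
    have h0: "h y \<ge> 0" for y by (simp add: h_def)
    have hi: "integrable lborel (\<lambda>y. \<bar>h y\<bar> ^ ?n)"
    proof (rule integrable_real_bound[OF int[OF t(1)]])
      have "h y \<le> \<bar>w (y, t)\<bar>" for y by (simp add: h_def indicator_def)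
      then show "\<bar>\<bar>h y\<bar> ^ ?n\<bar> \<le> \<bar>w (y, t)\<bar> ^ ?n" for y using h0 by (simp add: power_mono)
    qed measurable
    have adm: "poisson_admissible h" by (rule poisson_admissible_power[OF hm hi n])
    have admw: "poisson_admissible (\<lambda>y. w (y, t))" by (rule poisson_admissible_power[OF slm int[OF t(1)] n])
    have Tt: "T - t > 0" using t by simp
    have le: "\<bar>w (x, T)\<bar> \<le> half_conv pker1 h (x, T - t) + \<eta>" for x
    proof -
      have z: "snd (x, T - t) > 0" using Tt by simp
      have "w (x, T) = half_conv pker1 (\<lambda>y. w (y, t)) (x, T - t)" using semi[OF Tt t(1), of x] by simp
      then have "\<bar>w (x, T)\<bar> \<le> half_conv pker1 (\<lambda>y. \<bar>w (y, t)\<bar>) (x, T - t)" using half_conv_pker1_abs_le[OF z] by simp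
      also have "\<dots> \<le> (LINT y|lborel. pker1 ((x, T - t) - (y, 0)) * h y + \<eta> * pker1 ((x, T - t) - (y, 0)))"
        unfolding half_conv_def
      proof (intro integral_mono pker1_half_integrable poisson_admissible_abs admw adm z Bochner_Integration.integrable_add integrable_mult_right)
        show "integrable lborel (\<lambda>y. pker1 ((x, T - t) - (y, 0)))" using pker1_integrable(1)[OF Tt, of x] by simp
        fix y
        have "\<bar>w (y, t)\<bar> \<le> h y + \<eta>" using \<eta> by (auto simp: h_def indicator_def)
        then have "pker1 ((x, T - t) - (y, 0)) * \<bar>w (y, t)\<bar> \<le> pker1 ((x, T - t) - (y, 0)) * (h y + \<eta>)"
          using Tt by (intro mult_left_mono pker1_nonneg) auto
        then show "pker1 ((x, T - t) - (y, 0)) * \<bar>w (y, t)\<bar> \<le> pker1 ((x, T - t) - (y, 0)) * h y + \<eta> * pker1 ((x, T - t) - (y, 0))"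
          by (simp add: algebra_simps)
      qed
      also have "\<dots> = half_conv pker1 h (x, T - t) + \<eta>"
        using pker1_half_integrable[OF adm z] pker1_integrable(1,2)[OF Tt, of x]
        by (subst Bochner_Integration.integral_add) (auto simp: half_conv_def)
      finally show ?thesis .
    qed
    have slice: "(\<integral>\<^sup>+x. ennreal (\<bar>half_conv pker1 h (x, T - t)\<bar> ^ ?n) \<partial>lborel) \<le> (\<integral>\<^sup>+y. ennreal (\<bar>h y\<bar> ^ ?n) \<partial>lborel)"
      by (rule half_conv_pker1_slice[OF hm n Tt])
    have hc: "integrable lborel (\<lambda>x. \<bar>half_conv pker1 h (x, T - t)\<bar> ^ ?n)"
      using le_less_trans[OF slice, of \<infinity>] hi by (simp add: integrable_iff_bounded)
    have "X \<le> (LINT x|lborel. 2 ^ ?n * (\<bar>half_conv pker1 h (x, T - t)\<bar> ^ ?n + \<eta> ^ ?n * indicator (ball 0 R) x))"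
      unfolding X_def
    proof (rule integral_mono)
      show "integrable lborel (\<lambda>y. indicator (ball 0 R) y * \<bar>w (y, T)\<bar> ^ ?n)"
        by (rule integrable_real_bound[OF int[OF T]]) (auto simp: indicator_def)
      show "integrable lborel (\<lambda>x. 2 ^ ?n * (\<bar>half_conv pker1 h (x, T - t)\<bar> ^ ?n + \<eta> ^ ?n * indicator (ball 0 R) x))"
        by (intro integrable_mult_right Bochner_Integration.integrable_add hc integrable_real_indicator)
          (auto simp: emeasure_bounded_finite[unfolded infinity_ennreal_def])
      fix x :: 'a
      have "\<bar>w (x, T)\<bar> ^ ?n \<le> (\<bar>half_conv pker1 h (x, T - t)\<bar> + \<eta>) ^ ?n"
        using le[of x] by (intro power_mono) auto
      also have "\<dots> \<le> 2 ^ ?n * (\<bar>half_conv pker1 h (x, T - t)\<bar> ^ ?n + \<eta> ^ ?n)" using \<eta> by (intro add_power_le) auto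
      finally show "indicator (ball 0 R) x * \<bar>w (x, T)\<bar> ^ ?n \<le> 2 ^ ?n * (\<bar>half_conv pker1 h (x, T - t)\<bar> ^ ?n + \<eta> ^ ?n * indicator (ball 0 R) x)"
        by (simp add: indicator_def)
    qed
    also have "\<dots> = 2 ^ ?n * (LINT x|lborel. \<bar>half_conv pker1 h (x, T - t)\<bar> ^ ?n) + 2 ^ ?n * \<eta> ^ ?n * V"
      using hc by (simp add: V_def Bochner_Integration.integral_add emeasure_bounded_finite[unfolded infinity_ennreal_def] distrib_left)
    finally have "X' \<le> 2 ^ ?n * (LINT x|lborel. \<bar>half_conv pker1 h (x, T - t)\<bar> ^ ?n)" by (simp add: X'_def)
    then have "ennreal X' \<le> ennreal (2 ^ ?n) * ennreal (LINT x|lborel. \<bar>half_conv pker1 h (x, T - t)\<bar> ^ ?n)"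
      by (simp add: ennreal_leI flip: ennreal_mult'')
    also have "ennreal (LINT x|lborel. \<bar>half_conv pker1 h (x, T - t)\<bar> ^ ?n) = (\<integral>\<^sup>+x. ennreal (\<bar>half_conv pker1 h (x, T - t)\<bar> ^ ?n) \<partial>lborel)"
      by (rule nn_integral_eq_integral[symmetric, OF hc]) simp
    also have "ennreal (2 ^ ?n) * \<dots> \<le> ennreal (2 ^ ?n) * J t"
    proof (rule mult_left_mono[OF order_trans[OF slice]])
      show "(\<integral>\<^sup>+y. ennreal (\<bar>h y\<bar> ^ ?n) \<partial>lborel) \<le> J t"
        unfolding J_def using n by (intro nn_integral_mono) (auto simp: h_def indicator_def)
    qed simp
    finally show ?thesis .
  qed
  define F where "F = (\<lambda>z::'a \<times> real. snd z * \<bar>w z\<bar>)"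
  have Fm [measurable]: "F \<in> borel_measurable borel" unfolding F_def by measurable
  have half_open: "open {z :: 'a \<times> real. snd z > 0}" by (intro open_Collect_less continuous_intros)
  have hyp_m: "F \<in> borel_measurable hyperbolic_measure"
  proof -
    have "F \<in> borel_measurable lebesgue" using measurable_completion[of F lborel borel] by simp
    then show ?thesis unfolding hyperbolic_measure_def by (simp add: measurable_restrict_space1)
  qed
  have weakF: "emeasure hyperbolic_measure {z \<in> space hyperbolic_measure. F z > s} \<le> ennreal (C / s ^ ?n)" if "s > 0" for s
  proof -
    have "{z \<in> space hyperbolic_measure. F z > s} = {z. snd z > 0 \<and> snd z * \<bar>w z\<bar> > s}"
      by (auto simp: space_hyperbolic upper_half_space_def F_def)
    then show ?thesis using weak[OF that] by simp
  qed
  \<comment> \<open>At a height \<open>t\<close> between \<open>T / 2 ^ m\<close> and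
    \<open>T\<close> the height bound gives \<open>F \<le> K0 / t \<le> K0 * 2 ^ m / T\<close>,
    while points with \<open>\<bar>w\<bar> > \<eta>\<close> have
    \<open>F > T / 2 ^ m * \<eta>\<close>. The ratio of the two is
    \<open>K0 / (T\<^sup>2 * \<eta>) * 2 ^ (2 * m)\<close>, hence \<open>2 * m + K1\<close> dyadic
    levels.\<close>
  obtain K1 where K1: "K0 / (T\<^sup>2 * \<eta>) \<le> 2 ^ K1"
    using real_arch_pow[of 2 "K0 / (T\<^sup>2 * \<eta>)"] by (auto intro: less_imp_le)
  have est: "X' * (real m / 2) \<le> 4 ^ ?n * C * real (2 * m + K1)" for m
  proof -
    define a where "a = T / 2 ^ m * \<eta>"
    have a: "a > 0" using T \<eta> by (simp add: a_def)
    let ?A = "{z \<in> space hyperbolic_measure. a < F z \<and> F z \<le> 2 ^ (2 * m + K1) * a}"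
    have Am [measurable]: "?A \<in> sets borel"
    proof -
      have [measurable]: "(upper_half_space :: ('a \<times> real) set) \<in> sets borel"
        by (rule borel_open[OF upper_half_space_open])
      have "?A = upper_half_space \<inter> {z \<in> space borel. a < F z \<and> F z \<le> 2 ^ (2 * m + K1) * a}"
        by (auto simp: space_hyperbolic)
      also have "\<dots> \<in> sets borel" by measurable
      finally show ?thesis .
    qed
    have "ennreal X' * ennreal (real m / 2) \<le> ennreal X' * (\<integral>\<^sup>+t. ennreal (1 / t) * indicator {T / 2 ^ m..<T} t \<partial>lborel)"
      by (intro mult_left_mono nn_integral_inverse_dyadic T) simp
    also have "\<dots> = (\<integral>\<^sup>+t. ennreal X' * (ennreal (1 / t) * indicator {T / 2 ^ m..<T} t) \<partial>lborel)"
      by (subst nn_integral_cmult) auto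
    \<comment> \<open>The slice moments weighted by \<open>1 / t\<close> become a hyperbolic
      integral of \<open>F ^ n\<close>, since \<open>F ^ n / t ^ (n + 1)\<close> equals
      \<open>\<bar>w\<bar> ^ n / t\<close>.\<close>
    also have "\<dots> \<le> (\<integral>\<^sup>+t. ennreal (2 ^ ?n) * (indicator {0<..} t * (\<integral>\<^sup>+x. ennreal (1 / t ^ (?n + 1)) * (ennreal (F (x, t) ^ ?n) * indicator ?A (x, t)) \<partial>lborel)) \<partial>lborel)"
    proof (intro nn_integral_mono)
      fix t :: real
      show "ennreal X' * (ennreal (1 / t) * indicator {T / 2 ^ m..<T} t) \<le>
         ennreal (2 ^ ?n) * (indicator {0<..} t * (\<integral>\<^sup>+x. ennreal (1 / t ^ (?n + 1)) * (ennreal (F (x, t) ^ ?n) * indicator ?A (x, t)) \<partial>lborel))"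
      proof (cases "t \<in> {T / 2 ^ m..<T}")
        case True
        then have t: "T / 2 ^ m \<le> t" "t < T" by auto
        have "T / 2 ^ m > 0" using T by simp
        then have t0: "t > 0" using t by linarith
        have pt: "ennreal (1 / t) * (ennreal (\<bar>w (y, t)\<bar> ^ ?n) * indicator {y. \<bar>w (y, t)\<bar> > \<eta>} y) \<le>
          ennreal (1 / t ^ (?n + 1)) * (ennreal (F (y, t) ^ ?n) * indicator ?A (y, t))" for y
        proof (cases "\<bar>w (y, t)\<bar> > \<eta>")
          case True
          have "a \<le> t * \<eta>" unfolding a_def using t(1) \<eta> by (intro mult_right_mono) auto
          also have "t * \<eta> < t * \<bar>w (y, t)\<bar>" using True t0 by simp
          finally have 1: "a < F (y, t)" by (simp add: F_def)
          have "F (y, t) \<le> t * (K0 / t\<^sup>2)" unfolding F_def using height[of "(y, t)"] t0 by (simp add: mult_left_mono del: times_divide_eq_right)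
          also have "\<dots> = K0 / t" using t0 by (simp add: power2_eq_square)
          also have "\<dots> \<le> K0 / (T / 2 ^ m)" using t t0 T K0 by (intro divide_left_mono) auto
          also have "\<dots> = K0 / (T\<^sup>2 * \<eta>) * (2 ^ m * 2 ^ m * a)" using T \<eta> by (simp add: a_def power2_eq_square)
          also have "\<dots> \<le> 2 ^ K1 * (2 ^ m * 2 ^ m * a)" using K1 a by (intro mult_right_mono) auto
          also have "\<dots> = 2 ^ (2 * m + K1) * a" by (simp add: power_add mult_2)
          finally have 2: "F (y, t) \<le> 2 ^ (2 * m + K1) * a" .
          have "(y, t) \<in> ?A" using 1 2 t0 by (simp add: space_hyperbolic upper_half_space_def)
          moreover have "1 / t * \<bar>w (y, t)\<bar> ^ ?n = 1 / t ^ (?n + 1) * F (y, t) ^ ?n"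
            using t0 by (simp add: F_def power_mult_distrib)
          ultimately show ?thesis using t0 True by (simp add: F_def flip: ennreal_mult)
        qed simp
        have "ennreal X' * ennreal (1 / t) \<le> (ennreal (2 ^ ?n) * J t) * ennreal (1 / t)"
          using J[OF t0 t(2)] by (intro mult_right_mono) auto
        also have "\<dots> = ennreal (2 ^ ?n) * (\<integral>\<^sup>+y. ennreal (1 / t) * (ennreal (\<bar>w (y, t)\<bar> ^ ?n) * indicator {y. \<bar>w (y, t)\<bar> > \<eta>} y) \<partial>lborel)"
          unfolding J_def by (subst nn_integral_cmult) (auto simp: mult_ac)
        also have "\<dots> \<le> ennreal (2 ^ ?n) * (\<integral>\<^sup>+x. ennreal (1 / t ^ (?n + 1)) * (ennreal (F (x, t) ^ ?n) * indicator ?A (x, t)) \<partial>lborel)"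
          using pt by (intro mult_left_mono nn_integral_mono) auto
        finally show ?thesis using True t0 by (simp only: indicator_simps) simp
      qed simp
    qed
    also have "\<dots> = ennreal (2 ^ ?n) * (\<integral>\<^sup>+t. indicator {0<..} t * (\<integral>\<^sup>+x. ennreal (1 / t ^ (?n + 1)) * (ennreal (F (x, t) ^ ?n) * indicator ?A (x, t)) \<partial>lborel) \<partial>lborel)"
    proof (rule nn_integral_cmult)
      have "(\<lambda>t. \<integral>\<^sup>+x. (\<lambda>p. ennreal (1 / fst p ^ (?n + 1)) * (ennreal (F (snd p, fst p) ^ ?n) * indicator ?A (snd p, fst p))) (t, x) \<partial>lborel) \<in> borel_measurable borel"
      proof (intro lborel.borel_measurable_nn_integral)
        have [measurable]: "(\<lambda>p :: real \<times> 'a. (snd p, fst p)) \<in> borel_measurable (borel \<Otimes>\<^sub>M borel)"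
          unfolding borel_prod by (intro borel_measurable_continuous_onI continuous_intros)
        have "(\<lambda>z. ennreal (F z ^ ?n) * indicator ?A z) \<in> borel_measurable borel" by measurable
        then have [measurable]: "(\<lambda>p :: real \<times> 'a. ennreal (F (snd p, fst p) ^ ?n) * indicator ?A (snd p, fst p)) \<in> borel_measurable (borel \<Otimes>\<^sub>M borel)"
          by (rule measurable_compose[rotated]) measurable
        show "case_prod (\<lambda>t x. (\<lambda>p. ennreal (1 / fst p ^ (?n + 1)) * (ennreal (F (snd p, fst p) ^ ?n) * indicator ?A (snd p, fst p))) (t, x)) \<in> borel_measurable (borel \<Otimes>\<^sub>M lborel)"
          by (simp add: split_beta')
      qed
      then show "(\<lambda>t. indicator {0<..} t * (\<integral>\<^sup>+x. ennreal (1 / t ^ (?n + 1)) * (ennreal (F (x, t) ^ ?n) * indicator ?A (x, t)) \<partial>lborel)) \<in> borel_measurable lborel"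
        by simp
    qed
    also have "\<dots> = ennreal (2 ^ ?n) * (\<integral>\<^sup>+z. ennreal (F z ^ ?n) * indicator ?A z \<partial>hyperbolic_measure)"
      by (subst nn_integral_hyperbolic) auto
    also have "\<dots> \<le> ennreal (2 ^ ?n) * ennreal (real (2 * m + K1) * (2 ^ ?n * C))"
      by (intro mult_left_mono weak_type_dyadic_moment[OF hyp_m C weakF a]) auto
    also have "\<dots> = ennreal (4 ^ ?n * C * real (2 * m + K1))"
    proof -
      have "(4::real) ^ ?n = 2 ^ ?n * 2 ^ ?n" by (simp flip: power_mult_distrib)
      then show ?thesis using C by (simp add: mult_ac flip: ennreal_mult)
    qed
    finally have "ennreal X' * ennreal (real m / 2) \<le> ennreal (4 ^ ?n * C * real (2 * m + K1))" .
    moreover have "X' \<ge> 0" using big C by (smt (verit) mult_nonneg_nonneg zero_le_power)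
    ultimately show ?thesis using C by (simp flip: ennreal_mult)
  qed
  \<comment> \<open>Both sides of \<open>est\<close> are affine in \<open>m\<close>, and
    \<open>d\<close> is the difference of the slopes. It is positive by the assumption to be
    refuted, so large \<open>m\<close> give a contradiction; this accounts for the constant
    \<open>4 * 4 ^ n * C\<close>.\<close>
  define d where "d = X' / 2 - 2 * 4 ^ ?n * C"
  have d: "d > 0" using big by (simp add: d_def)
  have "real m * d \<le> 4 ^ ?n * C * real K1" for m
    using est[of m] by (simp add: d_def algebra_simps)
  moreover obtain m :: nat where "4 ^ ?n * C * real K1 / d < real m" using reals_Archimedean2 by blast
  ultimately show False using d by (metis divide_less_eq not_less)
qed

text \<open>The order of the limits matters: with the ball fixed, \<open>\<eta>\<close> tends to
  \<open>0\<close> and removes the volume term; only then does the radius grow.\<close>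

lemma slice_moment_bound:
  fixes w :: "'a::euclidean_space \<times> real \<Rightarrow> real"
  assumes n: "DIM('a) \<ge> 1" and wm: "w \<in> borel_measurable borel"
    and int: "integrable lborel (\<lambda>y. \<bar>w (y, T)\<bar> ^ DIM('a))"
    and ball: "\<And>R \<eta>. \<eta> > 0 \<Longrightarrow> (LINT y|lborel. indicator (ball 0 R) y * \<bar>w (y, T)\<bar> ^ DIM('a)) \<le>
      B + 2 ^ DIM('a) * \<eta> ^ DIM('a) * measure lborel (ball (0::'a) R)"
  shows "(LINT y|lborel. \<bar>w (y, T)\<bar> ^ DIM('a)) \<le> B"
proof -
  let ?n = "DIM('a)"
  have b: "(LINT y|lborel. indicator (ball 0 R) y * \<bar>w (y, T)\<bar> ^ ?n) \<le> B" for R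
  proof (rule LIMSEQ_le_const)
    have l0: "(\<lambda>k. 1 / real (Suc k)) \<longlonglongrightarrow> 0" using LIMSEQ_inverse_real_of_nat by (simp add: inverse_eq_divide)
    have "(\<lambda>k. B + 2 ^ ?n * (1 / real (Suc k)) ^ ?n * measure lborel (ball (0::'a) R)) \<longlonglongrightarrow> B + 2 ^ ?n * 0 ^ ?n * measure lborel (ball (0::'a) R)"
      by (intro tendsto_intros l0)
    then show "(\<lambda>k. B + 2 ^ ?n * (1 / real (Suc k)) ^ ?n * measure lborel (ball (0::'a) R)) \<longlonglongrightarrow> B"
      using n by (simp add: power_0_left)
  qed (use ball in auto)
  have "(\<lambda>k. LINT y|lborel. indicator (ball 0 (real k)) y * \<bar>w (y, T)\<bar> ^ ?n) \<longlonglongrightarrow> (LINT y|lborel. \<bar>w (y, T)\<bar> ^ ?n)"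
  proof (rule integral_dominated_convergence[where w="\<lambda>y. \<bar>w (y, T)\<bar> ^ ?n"])
    show "AE y in lborel. (\<lambda>k. indicator (ball 0 (real k)) y * \<bar>w (y, T)\<bar> ^ ?n) \<longlonglongrightarrow> \<bar>w (y, T)\<bar> ^ ?n"
    proof (rule AE_I2)
      fix y :: 'a
      obtain N where N: "norm y < real N" using reals_Archimedean2 by blast
      have "\<forall>\<^sub>F k in sequentially. indicator (ball 0 (real k)) y * \<bar>w (y, T)\<bar> ^ ?n = \<bar>w (y, T)\<bar> ^ ?n"
        using eventually_ge_at_top[of N] by eventually_elim (use N in \<open>auto simp: indicator_def\<close>)
      then show "(\<lambda>k. indicator (ball 0 (real k)) y * \<bar>w (y, T)\<bar> ^ ?n) \<longlonglongrightarrow> \<bar>w (y, T)\<bar> ^ ?n" by (rule tendsto_eventually)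
    qed
  qed (use int in \<open>auto simp: indicator_def\<close>)
  then show ?thesis by (rule LIMSEQ_le_const2) (use b in auto)
qed

section \<open>Convergence of the slices\<close>

lemma powr_mean_le:
  fixes u v q :: real
  assumes "u \<ge> 0" "v \<ge> 0" "q \<ge> 1"
  shows "((u + v) / 2) powr q \<le> (u powr q + v powr q) / 2"
proof (cases "u = 0 \<or> v = 0")
  case True
  have half: "(w / 2) powr q \<le> w powr q / 2" if "w \<ge> 0" for w
  proof -
    have "2 powr 1 \<le> (2::real) powr q" using assms(3) by (intro powr_mono) auto
    then have "w powr q / 2 powr q \<le> w powr q / 2" by (intro divide_left_mono) auto
    then show ?thesis using that by (simp add: powr_divide)
  qed
  show ?thesis using True half[OF assms(1)] half[OF assms(2)] by auto
next
  case False
  then have "u \<in> {0<..}" "v \<in> {0<..}" using assms by auto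
  from convex_onD[OF powr_convex[OF assms(3)], of "1/2" u v] this
  show ?thesis by (simp add: field_simps)
qed

text \<open>One factor is split off each power, and the remaining power with exponent
  \<open>q - 1 \<ge> 0\<close> is enlarged to that of \<open>u + v\<close>.\<close>

lemma powr_superadditive:
  fixes u v q :: real
  assumes "u \<ge> 0" "v \<ge> 0" "q \<ge> 1"
  shows "u powr q + v powr q \<le> (u + v) powr q"
proof -
  have split: "w powr q = w * w powr (q - 1)" if "w \<ge> 0" for w
    using that by (cases "w = 0") (auto simp: powr_diff)
  have "u * u powr (q - 1) \<le> u * (u + v) powr (q - 1)" "v * v powr (q - 1) \<le> v * (u + v) powr (q - 1)"
    using assms by (intro mult_left_mono powr_mono2; simp)+
  then show ?thesis
    using assms split[of u] split[of v] split[of "u + v"] by (simp add: distrib_right)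
qed

text \<open>With \<open>q = n / 2 \<ge> 1\<close> applied to squares: superadditivity of the power,
  the parallelogram identity, then convexity of the power.\<close>

lemma clarkson:
  fixes a b :: real
  assumes n: "n \<ge> 2"
  shows "\<bar>(a + b) / 2\<bar> ^ n + \<bar>(a - b) / 2\<bar> ^ n \<le> (\<bar>a\<bar> ^ n + \<bar>b\<bar> ^ n) / 2"
proof -
  define q where "q = real n / 2"
  have q: "q \<ge> 1" using n by (simp add: q_def)
  have pw: "\<bar>x\<bar> ^ n = (x\<^sup>2) powr q" for x :: real
    unfolding q_def by (rule abs_power_eq_square_powr[symmetric]) (use n in simp)
  have "(((a + b) / 2)\<^sup>2) powr q + (((a - b) / 2)\<^sup>2) powr q \<le> (((a + b) / 2)\<^sup>2 + ((a - b) / 2)\<^sup>2) powr q"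
    by (intro powr_superadditive q) auto
  also have "((a + b) / 2)\<^sup>2 + ((a - b) / 2)\<^sup>2 = (a\<^sup>2 + b\<^sup>2) / 2" by (simp add: power2_eq_square field_simps)
  also have "((a\<^sup>2 + b\<^sup>2) / 2) powr q \<le> ((a\<^sup>2) powr q + (b\<^sup>2) powr q) / 2"
    by (intro powr_mean_le q) auto
  finally show ?thesis unfolding pw .
qed

lemma integrable_power_add:
  fixes f g :: "'b \<Rightarrow> real"
  assumes "f \<in> borel_measurable M" "g \<in> borel_measurable M"
    "integrable M (\<lambda>x. \<bar>f x\<bar> ^ n)" "integrable M (\<lambda>x. \<bar>g x\<bar> ^ n)"
  shows "integrable M (\<lambda>x. \<bar>f x + g x\<bar> ^ n)" "integrable M (\<lambda>x. \<bar>f x - g x\<bar> ^ n)"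
proof -
  have i: "integrable M (\<lambda>x. 2 ^ n * (\<bar>f x\<bar> ^ n + \<bar>g x\<bar> ^ n))"
    by (intro integrable_mult_right Bochner_Integration.integrable_add assms)
  have le: "\<bar>y\<bar> ^ n \<le> 2 ^ n * (\<bar>u\<bar> ^ n + \<bar>v\<bar> ^ n)" if "\<bar>y\<bar> \<le> \<bar>u\<bar> + \<bar>v\<bar>" for y u v :: real
    by (rule order_trans[OF power_mono[OF that] add_power_le]) auto
  show "integrable M (\<lambda>x. \<bar>f x + g x\<bar> ^ n)" "integrable M (\<lambda>x. \<bar>f x - g x\<bar> ^ n)"
    by (rule integrable_real_bound[OF i]; use assms(1,2) le in \<open>force simp: power_abs intro!: borel_measurable_power\<close>)+
qed

lemma fatou_power:
  fixes h :: "nat \<Rightarrow> 'b \<Rightarrow> real" and g :: "'b \<Rightarrow> real"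
  assumes hm: "\<And>i. h i \<in> borel_measurable M" and gm: "g \<in> borel_measurable M"
    and hi: "\<And>i. integrable M (\<lambda>x. \<bar>h i x\<bar> ^ n)"
    and lim: "AE x in M. (\<lambda>i. h i x) \<longlonglongrightarrow> g x"
    and bd: "\<forall>\<^sub>F i in sequentially. (LINT x|M. \<bar>h i x\<bar> ^ n) \<le> B"
  shows "integrable M (\<lambda>x. \<bar>g x\<bar> ^ n)" "(LINT x|M. \<bar>g x\<bar> ^ n) \<le> B"
proof -
  have [measurable]: "h i \<in> borel_measurable M" "g \<in> borel_measurable M" for i by (fact hm gm)+
  have B0: "B \<ge> 0"
  proof -
    obtain i where "(LINT x|M. \<bar>h i x\<bar> ^ n) \<le> B" using bd by (auto simp: eventually_sequentially)
    moreover have "0 \<le> (LINT x|M. \<bar>h i x\<bar> ^ n)" by (intro Bochner_Integration.integral_nonneg) auto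
    ultimately show ?thesis by linarith
  qed
  have "(\<integral>\<^sup>+x. ennreal (\<bar>g x\<bar> ^ n) \<partial>M) \<le> (\<integral>\<^sup>+x. liminf (\<lambda>i. ennreal (\<bar>h i x\<bar> ^ n)) \<partial>M)"
  proof (rule nn_integral_mono_AE)
    show "AE x in M. ennreal (\<bar>g x\<bar> ^ n) \<le> liminf (\<lambda>i. ennreal (\<bar>h i x\<bar> ^ n))"
      using lim
    proof eventually_elim
      case (elim x)
      then have "(\<lambda>i. ennreal (\<bar>h i x\<bar> ^ n)) \<longlonglongrightarrow> ennreal (\<bar>g x\<bar> ^ n)" by (intro tendsto_intros)
      then show ?case using lim_imp_Liminf[OF sequentially_bot] by (metis order_refl)
    qed
  qed
  also have "\<dots> \<le> liminf (\<lambda>i. \<integral>\<^sup>+x. ennreal (\<bar>h i x\<bar> ^ n) \<partial>M)" by (rule nn_integral_liminf) measurable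
  also have "\<dots> = liminf (\<lambda>i. ennreal (LINT x|M. \<bar>h i x\<bar> ^ n))"
    using hi by (simp add: nn_integral_eq_integral)
  also have "\<dots> \<le> liminf (\<lambda>i::nat. ennreal B)"
    using bd by (intro Liminf_mono) (auto elim!: eventually_mono intro: ennreal_leI)
  also have "\<dots> = ennreal B" by (simp add: Liminf_const)
  finally have le: "(\<integral>\<^sup>+x. ennreal (\<bar>g x\<bar> ^ n) \<partial>M) \<le> ennreal B" .
  then show i: "integrable M (\<lambda>x. \<bar>g x\<bar> ^ n)"
    by (auto simp: integrable_iff_bounded intro: le_less_trans)
  then show "(LINT x|M. \<bar>g x\<bar> ^ n) \<le> B"
    using le B0 by (simp add: nn_integral_eq_integral)
qed

text \<open>The Riesz-Fischer argument for a family indexed by positive heights: along rapidly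
  chosen heights the consecutive differences are summable almost everywhere, and Fatou's lemma
  upgrades pointwise convergence to convergence of the moments.\<close>

lemma Lp_Cauchy_limit:
  fixes W :: "real \<Rightarrow> 'b \<Rightarrow> real"
  assumes Wm: "\<And>s. s > 0 \<Longrightarrow> W s \<in> borel_measurable M" and Wi: "\<And>s. s > 0 \<Longrightarrow> integrable M (\<lambda>x. \<bar>W s x\<bar> ^ n)"
    and n: "n \<ge> 1"
    and Cauchy: "\<And>\<delta>. \<delta> > 0 \<Longrightarrow> \<exists>r>0. \<forall>s s'. 0 < s \<longrightarrow> s < r \<longrightarrow> 0 < s' \<longrightarrow> s' < r \<longrightarrow> (LINT x|M. \<bar>W s x - W s' x\<bar> ^ n) \<le> \<delta>"
  shows "\<exists>g r. g \<in> borel_measurable M \<and> integrable M (\<lambda>x. \<bar>g x\<bar> ^ n) \<and> (\<forall>j. r j > 0) \<and> r \<longlonglongrightarrow> 0 \<and>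
    (\<lambda>j. LINT x|M. \<bar>W (r j) x - g x\<bar> ^ n) \<longlonglongrightarrow> 0"
proof -
  \<comment> \<open>The first factor pays for the weight \<open>(2 ^ j) ^ n\<close> introduced
    below, the second keeps the weighted series summable. Terms of a convergent weighted series are
    eventually below \<open>1\<close>, which forces consecutive differences below
    \<open>(1 / 2) ^ j\<close>.\<close>
  define \<epsilon> where "\<epsilon> = (\<lambda>j::nat. (1 / 2) ^ (j * n) * (1 / 2) ^ j :: real)"
  have \<epsilon>: "\<epsilon> j > 0" for j by (simp add: \<epsilon>_def)
  obtain \<rho> where \<rho>: "\<And>j. \<rho> j > 0" "\<And>j s s'. 0 < s \<Longrightarrow> s < \<rho> j \<Longrightarrow> 0 < s' \<Longrightarrow> s' < \<rho> j \<Longrightarrow> (LINT x|M. \<bar>W s x - W s' x\<bar> ^ n) \<le> \<epsilon> j"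
    using choice[of "\<lambda>j r. 0 < r \<and> (\<forall>s s'. 0 < s \<longrightarrow> s < r \<longrightarrow> 0 < s' \<longrightarrow> s' < r \<longrightarrow> (LINT x|M. \<bar>W s x - W s' x\<bar> ^ n) \<le> \<epsilon> j)"] Cauchy[OF \<epsilon>]
    by blast
  \<comment> \<open>The minimum over all earlier thresholds makes later heights satisfy the earlier
    conditions too; \<open>1 / real (Suc j)\<close> forces convergence to \<open>0\<close>, and the
    division by two gives strict inequalities.\<close>
  define r where "r = (\<lambda>j. min (Min (\<rho> ` {..j})) (1 / real (Suc j)) / 2)"
  have r0: "r j > 0" for j unfolding r_def using \<rho>(1) by simp
  have r\<rho>: "r i < \<rho> j" if "j \<le> i" for i j
  proof -
    have "Min (\<rho> ` {..i}) \<le> \<rho> j" using that by (intro Min_le) auto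
    then have "r i \<le> \<rho> j / 2" by (simp add: r_def)
    then show ?thesis using \<rho>(1)[of j] by linarith
  qed
  have rlim: "r \<longlonglongrightarrow> 0"
  proof (rule tendsto_sandwich[of "\<lambda>_. 0"])
    show "\<forall>\<^sub>F j in sequentially. r j \<le> 1 / real (Suc j)"
    proof (intro always_eventually allI)
      fix j
      have "r j \<le> 1 / real (Suc j) / 2" unfolding r_def by (intro divide_right_mono) auto
      also have "\<dots> \<le> 1 / real (Suc j)" by (simp add: field_simps)
      finally show "r j \<le> 1 / real (Suc j)" .
    qed
    show "(\<lambda>j. 1 / real (Suc j)) \<longlonglongrightarrow> 0" using LIMSEQ_inverse_real_of_nat by (simp add: inverse_eq_divide)
  qed (use r0 in \<open>auto intro!: always_eventually less_imp_le\<close>)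
  have Wrm [measurable]: "W (r j) \<in> borel_measurable M" for j by (rule Wm[OF r0])
  have close: "(LINT x|M. \<bar>W (r i) x - W (r j) x\<bar> ^ n) \<le> \<epsilon> j" if "j \<le> i" for i j
    using \<rho>(2)[OF r0 r\<rho>[OF that] r0 r\<rho>[OF order_refl]] .
  have di: "integrable M (\<lambda>x. \<bar>W (r i) x - W (r j) x\<bar> ^ n)" for i j
    by (intro integrable_power_add Wm Wi r0)
  have "(\<integral>\<^sup>+x. (\<Sum>j. ennreal ((2 ^ j * \<bar>W (r (Suc j)) x - W (r j) x\<bar>) ^ n)) \<partial>M) =
     (\<Sum>j. \<integral>\<^sup>+x. ennreal ((2 ^ j * \<bar>W (r (Suc j)) x - W (r j) x\<bar>) ^ n) \<partial>M)"
    by (rule nn_integral_suminf) measurable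
  also have "\<dots> \<le> (\<Sum>j. ennreal ((1 / 2) ^ j))"
  proof (intro suminf_le summableI)
    fix j
    have "(\<integral>\<^sup>+x. ennreal ((2 ^ j * \<bar>W (r (Suc j)) x - W (r j) x\<bar>) ^ n) \<partial>M) =
      (\<integral>\<^sup>+x. ennreal ((2 ^ j) ^ n * \<bar>W (r (Suc j)) x - W (r j) x\<bar> ^ n) \<partial>M)" by (simp only: power_mult_distrib)
    also have "\<dots> = ennreal (LINT x|M. (2 ^ j) ^ n * \<bar>W (r (Suc j)) x - W (r j) x\<bar> ^ n)"
      by (intro nn_integral_eq_integral integrable_mult_right di) auto
    also have "(LINT x|M. (2 ^ j) ^ n * \<bar>W (r (Suc j)) x - W (r j) x\<bar> ^ n) \<le> (2 ^ j) ^ n * \<epsilon> j"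
      using close[of j "Suc j"] by simp
    also have "(2 ^ j) ^ n * \<epsilon> j = (1 / 2) ^ j" by (simp add: \<epsilon>_def power_mult power_one_over)
    finally show "(\<integral>\<^sup>+x. ennreal ((2 ^ j * \<bar>W (r (Suc j)) x - W (r j) x\<bar>) ^ n) \<partial>M) \<le> ennreal ((1 / 2) ^ j)"
      by (simp add: ennreal_leI)
  qed
  also have "\<dots> < \<infinity>" by (subst suminf_ennreal2) auto
  finally have "AE x in M. (\<Sum>j. ennreal ((2 ^ j * \<bar>W (r (Suc j)) x - W (r j) x\<bar>) ^ n)) \<noteq> \<infinity>"
    by (intro nn_integral_PInf_AE; (measurable | simp add: less_top))
  then have conv: "AE x in M. convergent (\<lambda>j. W (r j) x)"
  proof eventually_elim
    case (elim x)
    have "summable (\<lambda>j. (2 ^ j * \<bar>W (r (Suc j)) x - W (r j) x\<bar>) ^ n)"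
      using elim by (intro summable_suminf_not_top) (auto simp: infinity_ennreal_def)
    then have "(\<lambda>j. (2 ^ j * \<bar>W (r (Suc j)) x - W (r j) x\<bar>) ^ n) \<longlonglongrightarrow> 0" by (rule summable_LIMSEQ_zero)
    from order_tendstoD(2)[OF this, of 1]
    have ev: "\<forall>\<^sub>F j in sequentially. (2 ^ j * \<bar>W (r (Suc j)) x - W (r j) x\<bar>) ^ n < 1" by simp
    have "\<forall>\<^sub>F j in sequentially. norm (W (r (Suc j)) x - W (r j) x) \<le> (1 / 2) ^ j"
      using ev
    proof eventually_elim
      case (elim j)
      have "2 ^ j * \<bar>W (r (Suc j)) x - W (r j) x\<bar> \<le> 1"
        using elim one_le_power[of "2 ^ j * \<bar>W (r (Suc j)) x - W (r j) x\<bar>" n] by linarith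
      then show ?case by (simp add: field_simps power_one_over)
    qed
    then have "summable (\<lambda>j. W (r (Suc j)) x - W (r j) x)"
      by (rule summable_comparison_test_ev) (simp add: summable_geometric)
    then have "convergent (\<lambda>m. \<Sum>j<m. W (r (Suc j)) x - W (r j) x)" by (simp add: summable_iff_convergent)
    then have "convergent (\<lambda>m. W (r m) x - W (r 0) x)"
      unfolding sum_lessThan_telescope[of "\<lambda>j. W (r j) x"] .
    from convergent_add[OF this convergent_const[of "W (r 0) x"]] show ?case by simp
  qed
  define g where "g = (\<lambda>x. lim (\<lambda>j. W (r j) x))"
  have gm [measurable]: "g \<in> borel_measurable M" unfolding g_def by measurable
  have glim: "AE x in M. (\<lambda>j. W (r j) x) \<longlonglongrightarrow> g x"
    using conv by eventually_elim (simp add: g_def convergent_LIMSEQ_iff)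
  have bd: "integrable M (\<lambda>x. \<bar>W (r j) x - g x\<bar> ^ n) \<and> (LINT x|M. \<bar>W (r j) x - g x\<bar> ^ n) \<le> \<epsilon> j" for j
  proof -
    have 1: "AE x in M. (\<lambda>i. W (r j) x - W (r i) x) \<longlonglongrightarrow> W (r j) x - g x"
      using glim by eventually_elim (intro tendsto_intros)
    have swap: "\<bar>W (r j) x - W (r i) x\<bar> = \<bar>W (r i) x - W (r j) x\<bar>" for i x by (rule abs_minus_commute)
    have 2: "\<forall>\<^sub>F i in sequentially. (LINT x|M. \<bar>W (r j) x - W (r i) x\<bar> ^ n) \<le> \<epsilon> j"
      using eventually_ge_at_top[of j] unfolding swap by eventually_elim (rule close)
    show ?thesis
      using fatou_power[OF _ _ di 1 2] by simp
  qed
  have "(\<lambda>j. LINT x|M. \<bar>W (r j) x - g x\<bar> ^ n) \<longlonglongrightarrow> 0"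
  proof (rule tendsto_sandwich[of "\<lambda>_. 0"])
    show "\<forall>\<^sub>F j in sequentially. (LINT x|M. \<bar>W (r j) x - g x\<bar> ^ n) \<le> (1 / 2) ^ j"
    proof (intro always_eventually allI)
      fix j
      have "\<epsilon> j \<le> 1 * (1 / 2) ^ j" unfolding \<epsilon>_def by (intro mult_right_mono power_le_one) auto
      then show "(LINT x|M. \<bar>W (r j) x - g x\<bar> ^ n) \<le> (1 / 2) ^ j" using bd[of j] by linarith
    qed
  qed (auto intro!: LIMSEQ_power_zero Bochner_Integration.integral_nonneg)
  moreover have "integrable M (\<lambda>x. \<bar>g x\<bar> ^ n)"
    using integrable_power_add(2)[OF Wrm[of 0] _ Wi[OF r0[of 0]], of "\<lambda>x. W (r 0) x - g x"] bd[of 0] by simp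
  ultimately show ?thesis using gm r0 rlim by blast
qed

text \<open>Uniform convexity: by Clarkson's inequality the family is Cauchy as soon as the midpoints
  have norm close to the supremum, and the contractivity of the semigroup pushes the midpoint norms up.\<close>

lemma contractive_slices_Cauchy:
  fixes W :: "real \<Rightarrow> 'b \<Rightarrow> real"
  assumes Wm: "\<And>s. s > 0 \<Longrightarrow> W s \<in> borel_measurable M" and Wi: "\<And>s. s > 0 \<Longrightarrow> integrable M (\<lambda>x. \<bar>W s x\<bar> ^ n)"
    and n: "n \<ge> 2" and S: "\<And>s. s > 0 \<Longrightarrow> (LINT x|M. \<bar>W s x\<bar> ^ n) \<le> S"
    and contr: "\<And>s s' t. s > 0 \<Longrightarrow> s' > 0 \<Longrightarrow> t > 0 \<Longrightarrow>
      (LINT x|M. \<bar>(W (s + t) x + W (s' + t) x) / 2\<bar> ^ n) \<le> (LINT x|M. \<bar>(W s x + W s' x) / 2\<bar> ^ n)"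
    and cont: "\<And>t x X. t > 0 \<Longrightarrow> X \<longlonglongrightarrow> t \<Longrightarrow> (\<And>k. X k > 0) \<Longrightarrow> (\<lambda>k::nat. W (X k) x) \<longlonglongrightarrow> W t x"
    and \<delta>: "\<delta> > 0"
  shows "\<exists>r>0. \<forall>s s'. 0 < s \<longrightarrow> s < r \<longrightarrow> 0 < s' \<longrightarrow> s' < r \<longrightarrow> (LINT x|M. \<bar>W s x - W s' x\<bar> ^ n) \<le> \<delta>"
proof -
  define N where "N = (\<lambda>s. LINT x|M. \<bar>W s x\<bar> ^ n)"
  \<comment> \<open>Clarkson's inequality will bound the moment of the half difference by
    \<open>d\<close>; undoing the halving multiplies it by \<open>2 ^ n\<close>, which stays below
    \<open>\<delta>\<close>.\<close>
  define d where "d = \<delta> / (2 * 2 ^ n)"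
  have d: "d > 0" using \<delta> by (simp add: d_def)
  have bdd: "bdd_above (N ` {0<..})" using S by (auto simp: N_def intro!: bdd_aboveI2)
  define S0 where "S0 = Sup (N ` {0<..})"
  have NS0: "N s \<le> S0" if "s > 0" for s unfolding S0_def using that bdd by (intro cSup_upper) auto
  have "S0 - d < Sup (N ` {0<..})" using d by (simp add: S0_def)
  then obtain t where t: "t > 0" "N t > S0 - d" using less_cSup_iff[OF _ bdd] by auto
  have mid_i: "integrable M (\<lambda>x. \<bar>(W s x + W s' x) / 2\<bar> ^ n)" "integrable M (\<lambda>x. \<bar>(W s x - W s' x) / 2\<bar> ^ n)"
    if "s > 0" "s' > 0" for s s'
    using integrable_power_add[OF Wm[OF that(1)] Wm[OF that(2)] Wi[OF that(1)] Wi[OF that(2)]]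
    by (auto simp: power_divide)
  define Q where "Q = (\<lambda>s s'. LINT x|M. \<bar>(W (s + t) x + W (s' + t) x) / 2\<bar> ^ n)"
  \<comment> \<open>Otherwise there are heights \<open>a\<close> and \<open>b\<close> tending to
    \<open>0\<close> whose midpoints, pushed up by \<open>t\<close>, all have moment at most
    \<open>S0 - d\<close>. They tend pointwise to \<open>W t\<close>, and Fatou's lemma contradicts
    the choice of \<open>t\<close>.\<close>
  have "\<exists>r>0. \<forall>s s'. 0 < s \<longrightarrow> s < r \<longrightarrow> 0 < s' \<longrightarrow> s' < r \<longrightarrow> Q s s' > S0 - d"
  proof (rule ccontr)
    assume neg: "\<not> ?thesis"
    have "\<exists>p. 0 < fst p \<and> fst p < 1 / real (Suc k) \<and> 0 < snd p \<and> snd p < 1 / real (Suc k) \<and> Q (fst p) (snd p) \<le> S0 - d" for k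
    proof -
      have "1 / real (Suc k) > 0" by simp
      with neg obtain s s' where "0 < s" "s < 1 / real (Suc k)" "0 < s'" "s' < 1 / real (Suc k)" "\<not> Q s s' > S0 - d"
        by blast
      then show ?thesis by (intro exI[of _ "(s, s')"]) (simp del: of_nat_Suc)
    qed
    then obtain p where p: "\<And>k. 0 < fst (p k) \<and> fst (p k) < 1 / real (Suc k) \<and> 0 < snd (p k) \<and> snd (p k) < 1 / real (Suc k) \<and> Q (fst (p k)) (snd (p k)) \<le> S0 - d"
      using choice[of "\<lambda>k p. 0 < fst p \<and> fst p < 1 / real (Suc k) \<and> 0 < snd p \<and> snd p < 1 / real (Suc k) \<and> Q (fst p) (snd p) \<le> S0 - d"] by blast
    define a b where "a = (\<lambda>k. fst (p k))" and "b = (\<lambda>k. snd (p k))"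
    have ab: "0 < a k" "a k < 1 / real (Suc k)" "0 < b k" "b k < 1 / real (Suc k)"
      "(LINT x|M. \<bar>(W (a k + t) x + W (b k + t) x) / 2\<bar> ^ n) \<le> S0 - d" for k
      using p[of k] unfolding a_def b_def Q_def by blast+
    have l0: "(\<lambda>k. 1 / real (Suc k)) \<longlonglongrightarrow> 0" using LIMSEQ_inverse_real_of_nat by (simp add: inverse_eq_divide)
    have ab0: "a \<longlonglongrightarrow> 0" "b \<longlonglongrightarrow> 0"
      by (rule tendsto_sandwich[OF _ _ tendsto_const l0]; use ab in \<open>auto intro!: always_eventually less_imp_le simp del: of_nat_Suc\<close>)+
    have at: "(\<lambda>k. a k + t) \<longlonglongrightarrow> 0 + t" "(\<lambda>k. b k + t) \<longlonglongrightarrow> 0 + t"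
      by (rule tendsto_add[OF ab0(1) tendsto_const], rule tendsto_add[OF ab0(2) tendsto_const])
    have pos: "a k + t > 0" "b k + t > 0" for k using ab t by (auto intro: add_pos_pos)
    have lim: "(\<lambda>k. (W (a k + t) x + W (b k + t) x) / 2) \<longlonglongrightarrow> W t x" for x
    proof -
      have "(\<lambda>k. (W (a k + t) x + W (b k + t) x) / 2) \<longlonglongrightarrow> (W t x + W t x) / 2"
        using at pos t by (intro tendsto_intros cont) auto
      then show ?thesis by simp
    qed
    have "(LINT x|M. \<bar>W t x\<bar> ^ n) \<le> S0 - d"
    proof (rule fatou_power(2)[where h="\<lambda>k x. (W (a k + t) x + W (b k + t) x) / 2"])
      show "(\<lambda>x. (W (a k + t) x + W (b k + t) x) / 2) \<in> borel_measurable M" for k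
        using Wm[OF pos(1)[of k]] Wm[OF pos(2)[of k]] by measurable
      show "integrable M (\<lambda>x. \<bar>(W (a k + t) x + W (b k + t) x) / 2\<bar> ^ n)" for k by (rule mid_i(1)[OF pos])
    qed (use Wm t lim ab in auto)
    then show False using t by (simp add: N_def)
  qed
  then obtain r where r: "r > 0" "\<And>s s'. 0 < s \<Longrightarrow> s < r \<Longrightarrow> 0 < s' \<Longrightarrow> s' < r \<Longrightarrow> Q s s' > S0 - d"
    by blast
  have "(LINT x|M. \<bar>W s x - W s' x\<bar> ^ n) \<le> \<delta>" if s: "0 < s" "s < r" "0 < s'" "s' < r" for s s'
  proof -
    have "(LINT x|M. \<bar>(W s x + W s' x) / 2\<bar> ^ n + \<bar>(W s x - W s' x) / 2\<bar> ^ n) \<le> (LINT x|M. (\<bar>W s x\<bar> ^ n + \<bar>W s' x\<bar> ^ n) / 2)"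
      using s by (intro integral_mono Bochner_Integration.integrable_add mid_i clarkson n integrable_divide_zero Wi) auto
    then have "(LINT x|M. \<bar>(W s x + W s' x) / 2\<bar> ^ n) + (LINT x|M. \<bar>(W s x - W s' x) / 2\<bar> ^ n) \<le> (N s + N s') / 2"
      using mid_i[OF s(1,3)] Wi[OF s(1)] Wi[OF s(3)] by (simp add: N_def)
    moreover have "(LINT x|M. \<bar>(W s x + W s' x) / 2\<bar> ^ n) > S0 - d" using r(2)[OF s] contr[OF s(1,3) t(1)] unfolding Q_def by linarith
    moreover have "N s \<le> S0" "N s' \<le> S0" using NS0 s by auto
    moreover have "X \<le> d" if "Y + X \<le> (N s + N s') / 2" "S0 - d < Y" "N s \<le> S0" "N s' \<le> S0" for X Y
      using that by (simp add: field_simps)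
    ultimately have "(LINT x|M. \<bar>(W s x - W s' x) / 2\<bar> ^ n) \<le> d" by blast
    then have "(LINT x|M. \<bar>W s x - W s' x\<bar> ^ n) / 2 ^ n \<le> d" by (simp add: power_divide)
    then have "(LINT x|M. \<bar>W s x - W s' x\<bar> ^ n) \<le> d * 2 ^ n" by (simp add: divide_le_eq)
    also have "\<dots> \<le> \<delta>" using \<delta> by (simp add: d_def)
    finally show ?thesis .
  qed
  then show ?thesis using r(1) by blast
qed

section \<open>Identification of the distributional derivative\<close>

lemma compact_support_bound:
  fixes G :: "'a::euclidean_space \<Rightarrow> real"
  assumes cont: "continuous_on (cball 0 R) G" and R: "\<And>y. norm y > R \<Longrightarrow> G y = 0"
  obtains M where "M \<ge> 0" "\<And>y. \<bar>G y\<bar> \<le> M * indicator (cball 0 R) y"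
proof -
  have "bounded (G ` cball 0 R)" by (intro compact_imp_bounded compact_continuous_image cont compact_cball)
  then obtain M where "\<forall>v\<in>G ` cball 0 R. norm v \<le> M" unfolding bounded_iff by blast
  then have M: "\<bar>G y\<bar> \<le> M" if "y \<in> cball 0 R" for y using imageI[OF that, of G] by force
  have "\<bar>G y\<bar> \<le> \<bar>M\<bar> * indicator (cball 0 R) y" for y
  proof (cases "y \<in> cball 0 R")
    case True
    then show ?thesis using M[OF True] by simp
  next
    case False
    then have "norm y > R" by simp
    with R[OF this] show ?thesis by simp
  qed
  then show ?thesis using that[of "\<bar>M\<bar>"] by simp
qed

lemma integrable_cball_bound:
  fixes G :: "'a::euclidean_space \<Rightarrow> real"
  assumes "G \<in> borel_measurable borel" "\<And>y. \<bar>G y\<bar> \<le> M * indicator (cball 0 R) y"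
  shows "integrable lborel G"
proof (rule integrable_real_bound[OF _ _ assms(2)])
  have "emeasure lborel (cball (0::'a) R) < \<infinity>" by (intro emeasure_bounded_finite bounded_cball)
  then show "integrable lborel (\<lambda>y::'a. M * indicator (cball 0 R) y)"
    by (intro integrable_mult_right integrable_real_indicator) auto
  show "G \<in> borel_measurable lborel" using assms(1) by simp
qed

text \<open>The difference quotients of \<open>G\<close> have integral zero by translation
  invariance, and dominated convergence passes to the derivative. Steps of length at most one
  enlarge the support from radius \<open>R\<close> to \<open>R + 1\<close>.\<close>

lemma integral_directional_derivative_eq_0:
  fixes G D :: "'a::euclidean_space \<Rightarrow> real"
  assumes b: "norm b \<le> 1"
    and der: "\<And>y. ((\<lambda>s. G (y + s *\<^sub>R b)) has_real_derivative D y) (at 0)"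
    and G: "continuous_on UNIV G" "\<And>y. norm y \<ge> R \<Longrightarrow> G y = 0"
    and D: "continuous_on UNIV D" "\<And>y. norm y \<ge> R \<Longrightarrow> D y = 0"
  shows "(LINT y|lborel. D y) = 0"
proof -
  have [measurable]: "G \<in> borel_measurable borel" "D \<in> borel_measurable borel"
    using G(1) D(1) by (auto intro: borel_measurable_continuous_onI)
  obtain M where M: "M \<ge> 0" "\<And>y. \<bar>D y\<bar> \<le> M * indicator (cball 0 R) y"
    using compact_support_bound[of R D] D by (metis continuous_on_subset less_imp_le subset_UNIV)
  obtain M' where M': "M' \<ge> 0" "\<And>y. \<bar>G y\<bar> \<le> M' * indicator (cball 0 R) y"
    using compact_support_bound[of R G] G by (metis continuous_on_subset less_imp_le subset_UNIV)
  have DM: "\<bar>D y\<bar> \<le> M" for y using M(2)[of y] M(1) by (auto simp: indicator_def of_bool_def split: if_splits)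
  have Gi: "integrable lborel G" by (rule integrable_cball_bound[OF _ M'(2)]) simp
  define h where "h = (\<lambda>k. 1 / real (Suc k))"
  have h0: "h k > 0" "h k \<le> 1" for k by (auto simp: h_def)
  have hlim: "h \<longlonglongrightarrow> 0" unfolding h_def using LIMSEQ_inverse_real_of_nat by (simp add: inverse_eq_divide)
  define q where "q = (\<lambda>k y. (G (y + h k *\<^sub>R b) - G y) / h k)"
  have qm [measurable]: "q k \<in> borel_measurable borel" for k unfolding q_def by measurable
  have shift: "integrable lborel (\<lambda>y. G (y + c))" "(LINT y|lborel. G (y + c)) = (LINT y|lborel. G y)" for c
  proof -
    have i: "integrable (distr lborel borel ((+) c)) G" unfolding lborel_distr_plus by (rule Gi)
    show "integrable lborel (\<lambda>y. G (y + c))"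
      using integrable_distr[OF _ i] by (simp add: add.commute)
    have "(LINT y|lborel. G y) = (LINT y|distr lborel borel ((+) c). G y)" unfolding lborel_distr_plus ..
    also have "\<dots> = (LINT y|lborel. G (c + y))" by (rule integral_distr) auto
    finally show "(LINT y|lborel. G (y + c)) = (LINT y|lborel. G y)" by (simp add: add.commute)
  qed
  have q0: "(LINT y|lborel. q k y) = 0" for k
    unfolding q_def using shift[of "h k *\<^sub>R b"] Gi by simp
  have qb: "\<bar>q k y\<bar> \<le> M * indicator (cball 0 (R + 1)) y" for k y
  proof (cases "y \<in> cball 0 (R + 1)")
    case True
    have d: "((\<lambda>s. G (y + s *\<^sub>R b)) has_real_derivative D (y + s *\<^sub>R b)) (at s)" for s
      by (rule dir_derivative_shift[OF der])
    obtain \<xi> where "G (y + h k *\<^sub>R b) - G (y + 0 *\<^sub>R b) = (h k - 0) * D (y + \<xi> *\<^sub>R b)"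
      using MVT2[OF h0(1)[of k], of "\<lambda>s. G (y + s *\<^sub>R b)" "\<lambda>s. D (y + s *\<^sub>R b)"] d by auto
    then have "q k y = D (y + \<xi> *\<^sub>R b)" using h0[of k] by (simp add: q_def)
    then show ?thesis using DM True by simp
  next
    case False
    then have y: "norm y > R + 1" by simp
    have "norm (h k *\<^sub>R b) \<le> 1 * 1" unfolding norm_scaleR using h0[of k] b by (intro mult_mono) auto
    then have "norm (y + h k *\<^sub>R b) \<ge> R" using y norm_diff_ineq[of y "h k *\<^sub>R b"] by linarith
    then have "q k y = 0" using G(2)[of y] G(2)[of "y + h k *\<^sub>R b"] y by (simp add: q_def)
    then show ?thesis using M(1) by simp
  qed
  have "(\<lambda>k. LINT y|lborel. q k y) \<longlonglongrightarrow> (LINT y|lborel. D y)"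
  proof (rule integral_dominated_convergence[where w = "\<lambda>y. M * indicator (cball 0 (R + 1)) y"])
    show "integrable lborel (\<lambda>y::'a. M * indicator (cball 0 (R + 1)) y)"
    proof (rule integrable_cball_bound)
      show "\<bar>M * indicator (cball 0 (R + 1)) y\<bar> \<le> M * indicator (cball 0 (R + 1)) y" for y :: 'a
        using M(1) by (simp add: abs_mult)
    qed (intro borel_measurable_times borel_measurable_const borel_measurable_indicator, simp)
    show "AE y in lborel. (\<lambda>k. q k y) \<longlonglongrightarrow> D y"
    proof (intro AE_I2)
      fix y
      have "((\<lambda>s. (G (y + s *\<^sub>R b) - G y) / s) \<longlongrightarrow> D y) (at 0)"
        using der[of y] by (simp add: has_field_derivative_iff)
      then show "(\<lambda>k. q k y) \<longlonglongrightarrow> D y" unfolding q_def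
        by (rule filterlim_compose) (use h0 hlim in \<open>simp add: filterlim_at eventually_sequentially less_imp_neq[symmetric]\<close>)
    qed
  qed (use qb in auto)
  then show ?thesis using q0 LIMSEQ_const_iff[of 0 "LINT y|lborel. D y"] by simp
qed

text \<open>Symmetry of the kernel moves the Poisson integral from \<open>f\<close> to the test
  function. Absolute integrability holds because the Poisson integral of
  \<open>\<bar>f\<bar>\<close> is continuous, hence bounded on the support.\<close>

lemma half_conv_pker1_Fubini:
  fixes f \<psi> :: "'a::euclidean_space \<Rightarrow> real"
  assumes f: "poisson_admissible f" and \<psi> [measurable]: "\<psi> \<in> borel_measurable borel"
    and M: "\<And>y. \<bar>\<psi> y\<bar> \<le> M * indicator (cball 0 R) y" and s: "s > 0"
  shows "(LINT x|lborel. half_conv pker1 f (x, s) * \<psi> x) = (LINT y|lborel. f y * half_conv pker1 \<psi> (y, s))"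
proof -
  have fm [measurable]: "f \<in> borel_measurable borel" using f by (rule poisson_admissible_measurable)
  have adm: "poisson_admissible (\<lambda>y. \<bar>f y\<bar>)" by (rule poisson_admissible_abs[OF f])
  define F where "F = (\<lambda>p::'a \<times> 'a. pker1 (fst p - snd p, s) * f (snd p) * \<psi> (fst p))"
  have Fm [measurable]: "F \<in> borel_measurable (lborel \<Otimes>\<^sub>M lborel)" unfolding F_def by measurable
  have cont: "continuous_on (cball 0 R) (\<lambda>x::'a. half_conv pker1 (\<lambda>y. \<bar>f y\<bar>) (x, s))"
  proof -
    have "continuous_on {z::'a \<times> real. snd z > 0} (half_conv pkern (\<lambda>y. \<bar>f y\<bar>))"
      by (intro continuous_at_imp_continuous_on ballI has_derivative_continuous[OF half_conv_pkern_has_derivative[OF adm]]) simp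
    then have "continuous_on (cball 0 R) (\<lambda>x::'a. half_conv pkern (\<lambda>y. \<bar>f y\<bar>) (x, s))"
      by (rule continuous_on_compose2) (use s in \<open>auto intro!: continuous_intros\<close>)
    then show ?thesis unfolding half_conv_pker1 using poisson_mass_pos[where 'a='a]
      by (intro continuous_intros) auto
  qed
  define H where "H = (\<lambda>x::'a. half_conv pker1 (\<lambda>y. \<bar>f y\<bar>) (x, s) * \<bar>\<psi> x\<bar>)"
  have "bounded ((\<lambda>x::'a. half_conv pker1 (\<lambda>y. \<bar>f y\<bar>) (x, s)) ` cball 0 R)"
    by (intro compact_imp_bounded compact_continuous_image cont compact_cball)
  then obtain B where "\<forall>v\<in>(\<lambda>x::'a. half_conv pker1 (\<lambda>y. \<bar>f y\<bar>) (x, s)) ` cball 0 R. norm v \<le> B"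
    unfolding bounded_iff by blast
  then have B: "\<bar>half_conv pker1 (\<lambda>y. \<bar>f y\<bar>) (x, s)\<bar> \<le> B" if "x \<in> cball 0 R" for x :: 'a
    unfolding real_norm_def using that by (rule bspec[OF _ imageI])
  have Hi: "integrable lborel H"
  proof (rule integrable_cball_bound)
    show "H \<in> borel_measurable borel" unfolding H_def
      by (intro borel_measurable_times measurable_compose[OF half_slice_measurable half_conv_pker1_measurable]) measurable
    show "\<bar>H y\<bar> \<le> (B * M) * indicator (cball 0 R) y" for y
    proof (cases "y \<in> cball 0 R")
      case True
      have "\<bar>half_conv pker1 (\<lambda>y. \<bar>f y\<bar>) (y, s)\<bar> * \<bar>\<psi> y\<bar> \<le> B * M"
        using B[OF True] M[of y] True by (intro mult_mono) auto
      then show ?thesis using True by (simp add: H_def abs_mult)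
    next
      case False
      then show ?thesis using M[of y] by (simp add: H_def)
    qed
  qed
  have Fi: "integrable (lborel \<Otimes>\<^sub>M lborel) F"
  proof (rule lborel_pair.Fubini_integrable[OF Fm])
    have eq: "(LINT y|lborel. norm (F (x, y))) = H x" for x
    proof -
      have "norm (F (x, y)) = pker1 ((x, s) - (y, 0)) * \<bar>f y\<bar> * \<bar>\<psi> x\<bar>" for y
        using pker1_nonneg[of "(x - y, s)"] s by (simp add: F_def abs_mult half_point_pair)
      then show ?thesis by (simp add: H_def half_conv_def)
    qed
    show "integrable lborel (\<lambda>x. LINT y|lborel. norm (F (x, y)))" unfolding eq by (rule Hi)
    show "AE x in lborel. integrable lborel (\<lambda>y. F (x, y))"
    proof (intro AE_I2)
      fix x :: 'a
      have "integrable lborel (\<lambda>y. pker1 ((x, s) - (y, 0)) * f y * \<psi> x)"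
        using pker1_half_integrable[OF f, of "(x, s)"] s by (intro integrable_mult_left) simp
      then show "integrable lborel (\<lambda>y. F (x, y))" by (simp add: F_def half_point_pair)
    qed
  qed
  have "(LINT x|lborel. half_conv pker1 f (x, s) * \<psi> x) = (LINT x|lborel. LINT y|lborel. F (x, y))"
    by (simp add: F_def half_conv_def half_point_pair)
  also have "\<dots> = (LINT y|lborel. LINT x|lborel. F (x, y))"
    using lborel_pair.Fubini_integral[of "\<lambda>x y. F (x, y)"] Fi by simp
  also have "\<dots> = (LINT y|lborel. f y * half_conv pker1 \<psi> (y, s))"
  proof (rule arg_cong[where f="integral\<^sup>L lborel"], rule ext)
    fix y
    have "(LINT x|lborel. F (x, y)) = (LINT x|lborel. f y * (pker1 (y - x, s) * \<psi> x))"
      unfolding F_def by (rule Bochner_Integration.integral_cong) (auto simp: pker1_diff_commute[of y] mult_ac)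
    then show "(LINT x|lborel. F (x, y)) = f y * half_conv pker1 \<psi> (y, s)"
      by (simp add: half_conv_def half_point_pair)
  qed
  finally show ?thesis .
qed

text \<open>The semigroup law for the kernel itself, again by uniqueness of the harmonic
  extension.\<close>

lemma half_conv_pker1_pkern:
  fixes z :: "'a::euclidean_space \<times> real"
  assumes z: "snd z > 0"
  shows "half_conv pker1 (\<lambda>y. pkern (y, 1)) z = pkern (z + (0, 1))"
proof -
  define g where "g = (\<lambda>z::'a \<times> real. pkern (z + (0, 1)))"
  have cont: "continuous_on {z. snd z \<ge> 0} g"
  proof -
    have "continuous_on {z::'a \<times> real. z \<noteq> 0} pkern"
      by (intro continuous_at_imp_continuous_on ballI has_derivative_continuous[OF hom_kernel_has_derivative[OF hom_kernel_pkern]]) simp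
    then show ?thesis unfolding g_def
      by (rule continuous_on_compose2) (auto intro!: continuous_intros simp: prod_eq_iff)
  qed
  have C2: "dir_C2 g (\<lambda>b z. partial_deriv b pkern (z + (0, 1))) (\<lambda>b z. partial_deriv b (partial_deriv b pkern) (z + (0, 1)))"
    unfolding g_def by (rule dir_C2_shift[OF pkern_dir_C2 zero_le_one])
  have "g z = half_conv pker1 (\<lambda>y. g (y, 0)) z"
  proof (rule harmonic_eq_poisson[OF C2 _ cont _ z])
    show "vanishing g" unfolding g_def by (rule pkern_shift_vanishing)
    show "(\<Sum>b\<in>Basis. partial_deriv b (partial_deriv b pkern) (w + (0, 1))) = 0" if "snd w > 0" for w :: "'a \<times> real"
      by (rule pkern_laplacian) (use that in \<open>auto simp: prod_eq_iff\<close>)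
  qed
  then show ?thesis by (simp add: g_def)
qed

text \<open>A compactly supported function is dominated by a multiple of \<open>pkern (y, 1)\<close>, whose Poisson integral is known.\<close>

lemma half_conv_pker1_compact_bound:
  fixes \<psi> :: "'a::euclidean_space \<Rightarrow> real"
  assumes \<psi> [measurable]: "\<psi> \<in> borel_measurable borel"
    and M: "\<And>y. \<bar>\<psi> y\<bar> \<le> M * indicator (cball 0 R) y" "M \<ge> 0" and R: "R \<ge> 0"
  shows "\<exists>K\<ge>0. \<forall>y s. 0 < s \<longrightarrow> s \<le> 1 \<longrightarrow> \<bar>half_conv pker1 \<psi> (y, s)\<bar> \<le> K / norm (y, 1::real) ^ (DIM('a) + 1)"
proof -
  let ?n = "DIM('a) + 1"
  define L where "L = M * (R + 1) ^ ?n"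
  have L: "L \<ge> 0" unfolding L_def using M(2) R by simp
  have le: "\<bar>\<psi> x\<bar> \<le> L * pkern (x, 1)" for x
  proof (cases "x \<in> cball 0 R")
    case True
    have "norm (x, 1::real) \<le> norm x + norm (1::real)" by (rule norm_Pair_le)
    then have 1: "norm (x, 1::real) \<le> R + 1" using True by simp
    have pos: "norm (x, 1::real) > 0" by (simp add: prod_eq_iff)
    have "M * norm (x, 1::real) ^ ?n \<le> L" unfolding L_def using 1 M(2) by (intro mult_left_mono power_mono) auto
    then have "M \<le> L * pkern (x, 1)" using pos by (simp add: pkern_def le_divide_eq)
    then show ?thesis using M(1)[of x] True by simp
  next
    case False
    then show ?thesis using M(1)[of x] L pkern_nonneg[of "(x, 1::real)"] by simp
  qed
  have bd: "\<bar>pkern (y, 1)\<bar> \<le> 1" for y :: 'a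
    using pkern_le_height[of "(y, 1::real)"] pkern_nonneg[of "(y, 1::real)"] by simp
  have adm1: "poisson_admissible (\<lambda>y::'a. pkern (y, 1))" by (rule poisson_admissible_bounded[OF _ bd]) measurable
  have adm\<psi>: "poisson_admissible \<psi>"
  proof (rule poisson_admissible_bounded[OF \<psi>])
    show "\<bar>\<psi> y\<bar> \<le> M" for y using M(1)[of y] M(2) by (auto simp: indicator_def of_bool_def split: if_splits)
  qed
  have "\<bar>half_conv pker1 \<psi> (y, s)\<bar> \<le> 2 * L / norm (y, 1::real) ^ ?n" if s: "0 < s" "s \<le> 1" for y s
  proof -
    have "\<bar>half_conv pker1 \<psi> (y, s)\<bar> \<le> half_conv pker1 (\<lambda>x. \<bar>\<psi> x\<bar>) (y, s)" using s by (intro half_conv_pker1_abs_le) simp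
    also have "\<dots> \<le> (LINT x|lborel. L * (pker1 ((y, s) - (x, 0)) * pkern (x, 1)))"
      unfolding half_conv_def
    proof (rule integral_mono)
      show "integrable lborel (\<lambda>x. pker1 ((y, s) - (x, 0)) * \<bar>\<psi> x\<bar>)"
        using s by (intro pker1_half_integrable poisson_admissible_abs adm\<psi>) simp
      show "integrable lborel (\<lambda>x. L * (pker1 ((y, s) - (x, 0)) * pkern (x, 1)))"
        using s by (intro integrable_mult_right pker1_half_integrable adm1) simp
      fix x
      have "pker1 ((y, s) - (x, 0)) * \<bar>\<psi> x\<bar> \<le> pker1 ((y, s) - (x, 0)) * (L * pkern (x, 1))"
        using s by (intro mult_left_mono le pker1_nonneg) simp
      then show "pker1 ((y, s) - (x, 0)) * \<bar>\<psi> x\<bar> \<le> L * (pker1 ((y, s) - (x, 0)) * pkern (x, 1))"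
        by (simp add: mult_ac)
    qed
    also have "\<dots> = L * half_conv pker1 (\<lambda>x. pkern (x, 1)) (y, s)" by (simp add: half_conv_def)
    also have "half_conv pker1 (\<lambda>x. pkern (x, 1)) (y, s) = pkern (y, s + 1)" using half_conv_pker1_pkern[of "(y, s)"] s by simp
    also have "pkern (y, s + 1) \<le> 2 / norm (y, 1::real) ^ ?n"
    proof -
      have 1: "norm (y, 1::real) \<le> norm (y, s + 1)" unfolding norm_Pair using s
        by (intro real_sqrt_le_mono add_left_mono power_mono) auto
      have 2: "norm (y, 1::real) > 0" by (simp add: prod_eq_iff)
      show ?thesis unfolding pkern_def snd_conv using s 1 2
        by (intro frac_le power_mono zero_less_power) auto
    qed
    finally have "\<bar>half_conv pker1 \<psi> (y, s)\<bar> \<le> L * (2 / norm (y, 1::real) ^ ?n)" using L by (simp add: mult_left_mono)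
    then show ?thesis by (simp add: mult_ac)
  qed
  then show ?thesis using L by (intro exI[of _ "2 * L"]) auto
qed

text \<open>After \<open>half_conv_pker1_Fubini\<close> the Poisson integral acts on the continuous
  function \<open>\<psi>\<close>, where the limit is pointwise through
  \<open>poisson_closure\<close>. The bound \<open>half_conv_pker1_compact_bound\<close> supplies a
  dominating function, integrable against an admissible \<open>f\<close>.\<close>

lemma half_conv_pker1_weak_limit:
  fixes f \<psi> :: "'a::euclidean_space \<Rightarrow> real"
  assumes f: "poisson_admissible f" and \<psi>: "continuous_on UNIV \<psi>" "\<And>y. norm y \<ge> R \<Longrightarrow> \<psi> y = 0" and R: "R \<ge> 0"
    and r: "\<And>j. r j > 0" "r \<longlonglongrightarrow> 0"
  shows "(\<lambda>j. LINT x|lborel. half_conv pker1 f (x, r j) * \<psi> x) \<longlonglongrightarrow> (LINT y|lborel. f y * \<psi> y)"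
proof -
  have \<psi>m [measurable]: "\<psi> \<in> borel_measurable borel" using \<psi>(1) by (rule borel_measurable_continuous_onI)
  have fm [measurable]: "f \<in> borel_measurable borel" using f by (rule poisson_admissible_measurable)
  have \<psi>R: "norm y > R \<Longrightarrow> \<psi> y = 0" for y using \<psi>(2)[of y] by simp
  obtain M where M: "M \<ge> 0" "\<And>y. \<bar>\<psi> y\<bar> \<le> M * indicator (cball 0 R) y"
    using compact_support_bound[OF continuous_on_subset[OF \<psi>(1) subset_UNIV] \<psi>R] by blast
  have \<psi>M: "\<bar>\<psi> y\<bar> \<le> M" for y using M(2)[of y] M(1) by (auto simp: indicator_def of_bool_def split: if_splits)
  obtain K where K: "K \<ge> 0" "\<And>y s. 0 < s \<Longrightarrow> s \<le> 1 \<Longrightarrow> \<bar>half_conv pker1 \<psi> (y, s)\<bar> \<le> K / norm (y, 1::real) ^ (DIM('a) + 1)"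
    using half_conv_pker1_compact_bound[OF \<psi>m M(2,1) R] by blast
  \<comment> \<open>The dominating function is valid for heights up to \<open>1\<close>; the
    finitely many larger heights are skipped by an offset.\<close>
  obtain N where N: "\<And>j. j \<ge> N \<Longrightarrow> r j < 1"
    using order_tendstoD(2)[OF r(2), of 1] by (auto simp: eventually_sequentially)
  have eq: "norm ((0, 1::real) - (y, 0)) = norm (y, 1::real)" for y :: 'a by (simp add: norm_Pair)
  have "(\<lambda>j. LINT y|lborel. f y * half_conv pker1 \<psi> (y, r (j + N))) \<longlonglongrightarrow> (LINT y|lborel. f y * \<psi> y)"
  proof (rule integral_dominated_convergence[where w = "\<lambda>y. K * (\<bar>f y\<bar> / norm (y, 1::real) ^ (DIM('a) + 1))"])
    show "integrable lborel (\<lambda>y. K * (\<bar>f y\<bar> / norm (y, 1::real) ^ (DIM('a) + 1)))"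
      using poisson_admissible_integrable[OF f, of "(0, 1)"] unfolding eq by (intro integrable_mult_right) simp
    show "(\<lambda>y. f y * half_conv pker1 \<psi> (y, r (j + N))) \<in> borel_measurable lborel" for j
    proof -
      have "(\<lambda>y. half_conv pker1 \<psi> (y, r (j + N))) \<in> borel_measurable borel"
        by (rule measurable_compose[OF half_slice_measurable half_conv_pker1_measurable[OF \<psi>m]])
      then show ?thesis by simp
    qed
    show "AE y in lborel. (\<lambda>j. f y * half_conv pker1 \<psi> (y, r (j + N))) \<longlonglongrightarrow> f y * \<psi> y"
    proof (intro AE_I2 tendsto_mult tendsto_const)
      fix y :: 'a
      have "continuous_on UNIV (poisson_closure \<psi>)" by (rule poisson_closure_continuous[OF \<psi>(1) \<psi>M])
      moreover have "(\<lambda>j. (y, r (j + N))) \<longlonglongrightarrow> (y, 0)" by (intro tendsto_Pair tendsto_const LIMSEQ_ignore_initial_segment r(2))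
      ultimately have "(\<lambda>j. poisson_closure \<psi> (y, r (j + N))) \<longlonglongrightarrow> poisson_closure \<psi> (y, 0)"
        by (rule continuous_on_tendsto_compose) simp_all
      then show "(\<lambda>j. half_conv pker1 \<psi> (y, r (j + N))) \<longlonglongrightarrow> \<psi> y"
        using r(1) by (simp add: poisson_closure_eq[OF \<psi>m] poisson_closure_boundary)
    qed
    show "AE y in lborel. norm (f y * half_conv pker1 \<psi> (y, r (j + N))) \<le> K * (\<bar>f y\<bar> / norm (y, 1::real) ^ (DIM('a) + 1))" for j
    proof (intro AE_I2)
      fix y :: 'a
      have "\<bar>f y\<bar> * \<bar>half_conv pker1 \<psi> (y, r (j + N))\<bar> \<le> \<bar>f y\<bar> * (K / norm (y, 1::real) ^ (DIM('a) + 1))"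
        using K(2)[OF r(1), of "j + N" y] N[of "j + N"] by (intro mult_left_mono) auto
      then show "norm (f y * half_conv pker1 \<psi> (y, r (j + N))) \<le> K * (\<bar>f y\<bar> / norm (y, 1::real) ^ (DIM('a) + 1))"
        by (simp add: abs_mult mult_ac)
    qed
  qed measurable
  then have "(\<lambda>j. LINT y|lborel. f y * half_conv pker1 \<psi> (y, r j)) \<longlonglongrightarrow> (LINT y|lborel. f y * \<psi> y)"
    by (rule LIMSEQ_offset)
  then show ?thesis unfolding half_conv_pker1_Fubini[OF f \<psi>m M(2) r(1)] .
qed

text \<open>Where \<open>\<bar>d\<bar>\<close> exceeds \<open>\<epsilon>\<close> it is at most
  \<open>\<bar>d\<bar> ^ n / \<epsilon> ^ (n - 1)\<close>, elsewhere it is at most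
  \<open>\<epsilon>\<close>. Fixing a small \<open>\<epsilon>\<close> and then letting the moments
  of \<open>d\<close> tend to \<open>0\<close> yields
  \<open>integral_mult_tendsto_0\<close>.\<close>

lemma integrable_power_mult:
  fixes d \<phi> :: "'a::euclidean_space \<Rightarrow> real"
  assumes d: "d \<in> borel_measurable lborel" "integrable lborel (\<lambda>x. \<bar>d x\<bar> ^ n)" and n: "n \<ge> 1"
    and \<phi>: "integrable lborel \<phi>" "\<And>x. \<bar>\<phi> x\<bar> \<le> M"
  shows "integrable lborel (\<lambda>x. d x * \<phi> x)"
    and "\<epsilon> > 0 \<Longrightarrow> \<bar>LINT x|lborel. d x * \<phi> x\<bar> \<le> \<epsilon> * (LINT x|lborel. \<bar>\<phi> x\<bar>) + M / \<epsilon> ^ (n - 1) * (LINT x|lborel. \<bar>d x\<bar> ^ n)"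
proof -
  have M0: "M \<ge> 0" using \<phi>(2)[of 0] by linarith
  have le: "\<bar>d x * \<phi> x\<bar> \<le> \<epsilon> * \<bar>\<phi> x\<bar> + M / \<epsilon> ^ (n - 1) * \<bar>d x\<bar> ^ n" if e: "\<epsilon> > 0" for \<epsilon> x
  proof (cases "\<bar>d x\<bar> \<le> \<epsilon>")
    case True
    have "\<bar>d x\<bar> * \<bar>\<phi> x\<bar> \<le> \<epsilon> * \<bar>\<phi> x\<bar>" by (rule mult_right_mono[OF True]) simp
    moreover have "0 \<le> M / \<epsilon> ^ (n - 1) * \<bar>d x\<bar> ^ n" using M0 e by simp
    ultimately show ?thesis unfolding abs_mult by linarith
  next
    case False
    have "\<bar>d x\<bar> * \<epsilon> ^ (n - 1) \<le> \<bar>d x\<bar> * \<bar>d x\<bar> ^ (n - 1)" using False e by (intro mult_left_mono power_mono) auto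
    also have "\<dots> = \<bar>d x\<bar> ^ n" using n by (cases n) auto
    finally have "\<bar>d x\<bar> \<le> \<bar>d x\<bar> ^ n / \<epsilon> ^ (n - 1)" using e by (simp add: le_divide_eq)
    then have "\<bar>d x\<bar> * \<bar>\<phi> x\<bar> \<le> \<bar>d x\<bar> ^ n / \<epsilon> ^ (n - 1) * M" using \<phi>(2) e by (intro mult_mono) auto
    moreover have "0 \<le> \<epsilon> * \<bar>\<phi> x\<bar>" using e by simp
    ultimately show ?thesis unfolding abs_mult by (simp add: mult.commute)
  qed
  have bi: "integrable lborel (\<lambda>x. \<epsilon> * \<bar>\<phi> x\<bar> + M / \<epsilon> ^ (n - 1) * \<bar>d x\<bar> ^ n)" for \<epsilon>
    by (intro Bochner_Integration.integrable_add integrable_mult_right integrable_abs \<phi> d)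
  show i: "integrable lborel (\<lambda>x. d x * \<phi> x)"
    by (rule integrable_real_bound[OF bi[of 1] _ le]) (intro borel_measurable_times d(1) borel_measurable_integrable \<phi>(1), simp)
  show "\<bar>LINT x|lborel. d x * \<phi> x\<bar> \<le> \<epsilon> * (LINT x|lborel. \<bar>\<phi> x\<bar>) + M / \<epsilon> ^ (n - 1) * (LINT x|lborel. \<bar>d x\<bar> ^ n)"
    if e: "\<epsilon> > 0"
  proof -
    have "\<bar>LINT x|lborel. d x * \<phi> x\<bar> \<le> (LINT x|lborel. \<bar>d x * \<phi> x\<bar>)" by (rule integral_abs_bound)
    also have "\<dots> \<le> (LINT x|lborel. \<epsilon> * \<bar>\<phi> x\<bar> + M / \<epsilon> ^ (n - 1) * \<bar>d x\<bar> ^ n)"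
      by (intro integral_mono integrable_abs i bi le[OF e])
    also have "\<dots> = \<epsilon> * (LINT x|lborel. \<bar>\<phi> x\<bar>) + M / \<epsilon> ^ (n - 1) * (LINT x|lborel. \<bar>d x\<bar> ^ n)"
      by (subst Bochner_Integration.integral_add) (simp_all add: \<phi>(1) d)
    finally show ?thesis .
  qed
qed

lemma integral_mult_tendsto_0:
  fixes d :: "nat \<Rightarrow> 'a::euclidean_space \<Rightarrow> real" and \<phi> :: "'a \<Rightarrow> real"
  assumes dm: "\<And>j. d j \<in> borel_measurable lborel" and di: "\<And>j. integrable lborel (\<lambda>x. \<bar>d j x\<bar> ^ n)" and n: "n \<ge> 1"
    and lim: "(\<lambda>j. LINT x|lborel. \<bar>d j x\<bar> ^ n) \<longlonglongrightarrow> 0"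
    and \<phi>: "integrable lborel \<phi>" "\<And>x. \<bar>\<phi> x\<bar> \<le> M"
  shows "(\<lambda>j. LINT x|lborel. d j x * \<phi> x) \<longlonglongrightarrow> 0"
proof (rule tendstoI)
  fix e :: real assume e: "e > 0"
  define I where "I = (LINT x|lborel. \<bar>\<phi> x\<bar>)"
  have I0: "I \<ge> 0" unfolding I_def by (intro Bochner_Integration.integral_nonneg) simp
  define \<epsilon> where "\<epsilon> = e / (2 * (I + 1))"
  have \<epsilon>: "\<epsilon> > 0" using e I0 by (simp add: \<epsilon>_def)
  have "\<epsilon> * I \<le> \<epsilon> * (I + 1)" using \<epsilon> by simp
  also have "\<dots> = e / 2" using I0 by (simp add: \<epsilon>_def field_simps)
  finally have half: "\<epsilon> * I \<le> e / 2" .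
  have "(\<lambda>j. M / \<epsilon> ^ (n - 1) * (LINT x|lborel. \<bar>d j x\<bar> ^ n)) \<longlonglongrightarrow> M / \<epsilon> ^ (n - 1) * 0"
    by (rule tendsto_mult_left[OF lim])
  then have "\<forall>\<^sub>F j in sequentially. M / \<epsilon> ^ (n - 1) * (LINT x|lborel. \<bar>d j x\<bar> ^ n) < e / 2"
    by (rule order_tendstoD(2)) (use e in simp)
  then show "\<forall>\<^sub>F j in sequentially. dist (LINT x|lborel. d j x * \<phi> x) 0 < e"
  proof eventually_elim
    case (elim j)
    then show ?case using integrable_power_mult(2)[OF dm di n \<phi> \<epsilon>, of j, folded I_def] half
      unfolding dist_real_def diff_0_right by linarith
  qed
qed

text \<open>At positive height the Poisson integral is differentiable, so by the product rule the
  two integrands add up to a directional derivative of a compactly supported function.\<close>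

lemma poisson_grad_by_parts:
  fixes f \<phi> :: "'a::euclidean_space \<Rightarrow> real"
  assumes f: "poisson_admissible f" and i: "i \<in> Basis" and \<phi>: "\<phi> \<in> test_functions" and s: "s > 0"
  shows "(LINT y|lborel. poisson_grad (i, 0) f (y, s) * \<phi> y) =
    - (LINT y|lborel. half_conv pkern f (y, s) * partial_deriv i \<phi> y)"
proof -
  have iB: "(i, 0) \<in> (Basis :: ('a \<times> real) set)" using i by (simp add: Basis_prod_def)
  obtain R where R: "R > 0" "\<And>y. norm y \<ge> R \<Longrightarrow> \<phi> y = 0" "\<And>y. norm y \<ge> R \<Longrightarrow> partial_deriv i \<phi> y = 0"
    using test_function_props(4)[OF \<phi>] i by blast
  have c1: "continuous_on UNIV \<phi>" and c2: "continuous_on UNIV (partial_deriv i \<phi>)"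
    using test_function_props(2,3)[OF \<phi>] i by blast+
  have slice: "continuous_on UNIV (\<lambda>y::'a. g (y, s))" if "continuous_on {z. snd z > 0} g" for g :: "'a \<times> real \<Rightarrow> real"
    by (rule continuous_on_compose2[OF that]) (use s in \<open>auto intro!: continuous_intros\<close>)
  have c3: "continuous_on UNIV (\<lambda>y. poisson_grad (i, 0) f (y, s))"
    by (rule slice, rule continuous_on_poisson_grad[OF f iB]) simp
  have c4: "continuous_on UNIV (\<lambda>y. half_conv pkern f (y, s))"
    by (rule slice, intro continuous_at_imp_continuous_on ballI has_derivative_continuous[OF half_conv_pkern_has_derivative[OF f]]) simp
  have int: "integrable lborel G" if G: "continuous_on UNIV G" "\<And>y. norm y \<ge> R \<Longrightarrow> G y = 0" for G :: "'a \<Rightarrow> real"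
  proof -
    obtain M where "\<And>y. \<bar>G y\<bar> \<le> M * indicator (cball 0 R) y"
      using compact_support_bound[OF continuous_on_subset[OF G(1) subset_UNIV] G(2)[OF less_imp_le]] by blast
    then show ?thesis by (rule integrable_cball_bound[OF borel_measurable_continuous_onI[OF G(1)]])
  qed
  have "(LINT y|lborel. poisson_grad (i, 0) f (y, s) * \<phi> y + half_conv pkern f (y, s) * partial_deriv i \<phi> y) = 0"
  proof (rule integral_directional_derivative_eq_0[where b = i and R = R and G = "\<lambda>y. half_conv pkern f (y, s) * \<phi> y"])
    fix y :: 'a
    have "((\<lambda>\<sigma>. half_conv pkern f ((y, s) + \<sigma> *\<^sub>R (i, 0))) has_real_derivative poisson_grad (i, 0) f (y, s)) (at 0)"
      unfolding poisson_grad_def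
      by (rule has_derivative_imp_directional[OF half_conv_pkern_has_derivative[OF f] iB]) (use s in simp)
    then have d1: "((\<lambda>\<sigma>. half_conv pkern f (y + \<sigma> *\<^sub>R i, s)) has_real_derivative poisson_grad (i, 0) f (y, s)) (at 0)" by simp
    have d2: "((\<lambda>\<sigma>. \<phi> (y + \<sigma> *\<^sub>R i)) has_real_derivative partial_deriv i \<phi> y) (at 0)"
      by (rule has_derivative_imp_directional[OF test_function_props(1)[OF \<phi>] i])
    show "((\<lambda>\<sigma>. half_conv pkern f (y + \<sigma> *\<^sub>R i, s) * \<phi> (y + \<sigma> *\<^sub>R i)) has_real_derivative
      poisson_grad (i, 0) f (y, s) * \<phi> y + half_conv pkern f (y, s) * partial_deriv i \<phi> y) (at 0)"
      using DERIV_mult[OF d1 d2] by (simp add: add.commute mult.commute)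
  next
    show "continuous_on UNIV (\<lambda>y. half_conv pkern f (y, s) * \<phi> y)" by (intro continuous_intros c1 c4)
    show "continuous_on UNIV (\<lambda>y. poisson_grad (i, 0) f (y, s) * \<phi> y + half_conv pkern f (y, s) * partial_deriv i \<phi> y)"
      by (intro continuous_intros c1 c2 c3 c4)
  qed (use i R in simp_all)
  moreover have "integrable lborel (\<lambda>y. poisson_grad (i, 0) f (y, s) * \<phi> y)"
    by (rule int) (intro continuous_intros c1 c3, use R in simp)
  moreover have "integrable lborel (\<lambda>y. half_conv pkern f (y, s) * partial_deriv i \<phi> y)"
    by (rule int) (intro continuous_intros c2 c4, use R in simp)
  ultimately show ?thesis by simp
qed

text \<open>Integration by parts at positive heights passes to the limit: the slices of the
  derivative converge in norm along some sequence, the slices of the extension against test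
  functions. As the derivative is taken of \<open>pkern\<close>, the limit is divided by the mass
  \<open>\<kappa>\<close>.\<close>

lemma weak_partial_of_bounded_slices:
  fixes f :: "'a::euclidean_space \<Rightarrow> real"
  assumes n: "n \<ge> 2" and f: "f \<in> borel_measurable borel" "integrable lborel (\<lambda>y. \<bar>f y\<bar> ^ n)" and i: "i \<in> Basis"
    and S: "\<And>e. e > 0 \<Longrightarrow> (LINT y|lborel. \<bar>poisson_grad (i, 0) f (y, e)\<bar> ^ n) \<le> S"
  shows "\<exists>g. g \<in> borel_measurable borel \<and> integrable lborel (\<lambda>y. \<bar>g y\<bar> ^ n) \<and>
    (\<forall>\<phi>\<in>test_functions. (LINT y|lborel. f y * partial_deriv i \<phi> y) = - (LINT y|lborel. g y * \<phi> y))"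
proof -
  have p: "n \<ge> 1" using n by simp
  have iB: "(i, 0) \<in> (Basis :: ('a \<times> real) set)" using i by (simp add: Basis_prod_def)
  have adm: "poisson_admissible f" by (rule poisson_admissible_power[OF f p])
  define \<kappa> where "\<kappa> = poisson_mass TYPE('a)"
  have \<kappa>: "\<kappa> > 0" unfolding \<kappa>_def by (rule poisson_mass_pos)
  define W where "W = (\<lambda>s y. poisson_grad (i, 0) f (y, s))"
  have "poisson_grad (i, 0) f \<in> borel_measurable borel" unfolding poisson_grad_def
    by (intro half_conv_measurable f(1) hom_kernel_measurable[OF hom_kernel_partial_deriv[OF hom_kernel_pkern iB]])
  then have Wm [measurable]: "W s \<in> borel_measurable borel" for s
    unfolding W_def by (rule measurable_compose[OF half_slice_measurable])
  have Wi: "integrable lborel (\<lambda>y. \<bar>W s y\<bar> ^ n)" if "s > 0" for s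
    unfolding W_def by (rule poisson_grad_slice_integrable[OF f p iB that])
  have Wadm: "poisson_admissible (W s)" if "s > 0" for s by (rule poisson_admissible_power[OF Wm Wi[OF that] p])
  have contr: "(LINT x|lborel. \<bar>(W (s + t) x + W (s' + t) x) / 2\<bar> ^ n) \<le> (LINT x|lborel. \<bar>(W s x + W s' x) / 2\<bar> ^ n)"
    if s: "s > 0" "s' > 0" and t: "t > 0" for s s' t
  proof -
    define h where "h = (\<lambda>y. (W s y + W s' y) / 2)"
    have hm [measurable]: "h \<in> borel_measurable borel" unfolding h_def by measurable
    have mid: "integrable lborel (\<lambda>x. \<bar>(W a x + W b x) / 2\<bar> ^ n)" if "a > 0" "b > 0" for a b
      using integrable_power_add(1)[of "W a" lborel "W b", OF _ _ Wi[OF that(1)] Wi[OF that(2)]] by (simp add: power_divide)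
    have W1: "W (a + t) x = half_conv pker1 (W a) (x, t)" if "a > 0" for a x
      using poisson_grad_semigroup[OF f p iB that t, of x] by (simp add: W_def add.commute)
    \<comment> \<open>By linearity, averaging two slices commutes with moving both of them up by
      \<open>t\<close>; contractivity of the Poisson integral then applies to the average.\<close>
    have eq: "(W (s + t) x + W (s' + t) x) / 2 = half_conv pker1 h (x, t)" for x
    proof -
      have "half_conv pker1 h (x, t) = (LINT y|lborel. (pker1 ((x, t) - (y, 0)) * W s y + pker1 ((x, t) - (y, 0)) * W s' y) / 2)"
        unfolding half_conv_def h_def by (rule Bochner_Integration.integral_cong) (auto simp: distrib_left)
      also have "\<dots> = (W (s + t) x + W (s' + t) x) / 2"
        using pker1_half_integrable[OF Wadm, of _ "(x, t)"] s t by (simp add: W1 half_conv_def)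
      finally show ?thesis by simp
    qed
    have i2: "integrable lborel (\<lambda>x. \<bar>half_conv pker1 h (x, t)\<bar> ^ n)"
      unfolding eq[symmetric] using s t by (intro mid) auto
    have i1: "integrable lborel (\<lambda>x. \<bar>h x\<bar> ^ n)" unfolding h_def by (rule mid[OF s])
    have "ennreal (LINT x|lborel. \<bar>half_conv pker1 h (x, t)\<bar> ^ n) \<le> ennreal (LINT x|lborel. \<bar>h x\<bar> ^ n)"
      using half_conv_pker1_slice[OF hm p t] i1 i2 by (simp add: nn_integral_eq_integral)
    then have "(LINT x|lborel. \<bar>half_conv pker1 h (x, t)\<bar> ^ n) \<le> (LINT x|lborel. \<bar>h x\<bar> ^ n)"
      by (subst (asm) ennreal_le_iff) (auto intro!: Bochner_Integration.integral_nonneg)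
    then show ?thesis unfolding eq h_def .
  qed
  have Wcont: "(\<lambda>k::nat. W (X k) x) \<longlonglongrightarrow> W t x" if "t > 0" "X \<longlonglongrightarrow> t" "\<And>k. X k > 0" for t x X
  proof -
    have "continuous_on {z. snd z > 0} (poisson_grad (i, 0) f)" by (rule continuous_on_poisson_grad[OF adm iB]) simp
    moreover have "(\<lambda>k. (x, X k)) \<longlonglongrightarrow> (x, t)" by (intro tendsto_Pair tendsto_const that(2))
    ultimately show ?thesis unfolding W_def
      by (rule continuous_on_tendsto_compose) (use that in auto)
  qed
  have Wm': "W s \<in> borel_measurable lborel" for s by simp
  have SW: "(LINT y|lborel. \<bar>W s y\<bar> ^ n) \<le> S" if "s > 0" for s unfolding W_def by (rule S[OF that])
  have "\<exists>g r. g \<in> borel_measurable lborel \<and> integrable lborel (\<lambda>x. \<bar>g x\<bar> ^ n) \<and> (\<forall>j. r j > 0) \<and> r \<longlonglongrightarrow> 0 \<and>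
    (\<lambda>j. LINT x|lborel. \<bar>W (r j) x - g x\<bar> ^ n) \<longlonglongrightarrow> 0"
    by (rule Lp_Cauchy_limit[OF Wm' Wi p], assumption,
      rule contractive_slices_Cauchy[OF Wm' Wi n SW contr Wcont])
  then obtain g r where g: "g \<in> borel_measurable lborel" "integrable lborel (\<lambda>x. \<bar>g x\<bar> ^ n)"
    and r: "\<And>j. r j > 0" "r \<longlonglongrightarrow> 0" and lim: "(\<lambda>j. LINT x|lborel. \<bar>W (r j) x - g x\<bar> ^ n) \<longlonglongrightarrow> 0" by blast
  have di: "integrable lborel (\<lambda>x. \<bar>W (r j) x - g x\<bar> ^ n)" for j
    by (rule integrable_power_add(2)[OF Wm' g(1) Wi[OF r(1)] g(2)])
  have test: "(LINT y|lborel. g y * \<phi> y) = - (\<kappa> * (LINT y|lborel. f y * partial_deriv i \<phi> y))" if \<phi>: "\<phi> \<in> test_functions" for \<phi>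
  proof -
    obtain R where R: "R > 0" "\<And>y. norm y \<ge> R \<Longrightarrow> \<phi> y = 0" "\<And>y. norm y \<ge> R \<Longrightarrow> partial_deriv i \<phi> y = 0"
      using test_function_props(4)[OF \<phi>] i by blast
    have c1: "continuous_on UNIV \<phi>" and c2: "continuous_on UNIV (partial_deriv i \<phi>)"
      using test_function_props(2,3)[OF \<phi>] i by blast+
    obtain M where M: "M \<ge> 0" "\<And>y. \<bar>\<phi> y\<bar> \<le> M * indicator (cball 0 R) y"
      using compact_support_bound[OF continuous_on_subset[OF c1 subset_UNIV] R(2)[OF less_imp_le]] by blast
    have \<phi>i: "integrable lborel \<phi>" by (rule integrable_cball_bound[OF borel_measurable_continuous_onI[OF c1] M(2)])
    have \<phi>M: "\<bar>\<phi> y\<bar> \<le> M" for y using M(2)[of y] M(1) by (auto simp: indicator_def of_bool_def split: if_splits)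
    have dm: "(\<lambda>x. W (r j) x - g x) \<in> borel_measurable lborel" for j using g(1) by simp
    note di0 = integrable_power_mult(1)[OF dm di p \<phi>i \<phi>M]
    have lim00: "integrable lborel (\<lambda>x. g x * \<phi> x)"
      by (rule integrable_power_mult(1)[OF g p \<phi>i \<phi>M])
    have "(\<lambda>j. (LINT x|lborel. (W (r j) x - g x) * \<phi> x) + (LINT x|lborel. g x * \<phi> x)) \<longlonglongrightarrow> 0 + (LINT x|lborel. g x * \<phi> x)"
      by (intro tendsto_add tendsto_const integral_mult_tendsto_0[OF dm di p lim \<phi>i \<phi>M])
    moreover have "(LINT x|lborel. (W (r j) x - g x) * \<phi> x) + (LINT x|lborel. g x * \<phi> x) = (LINT x|lborel. W (r j) x * \<phi> x)" for j
      by (subst Bochner_Integration.integral_add[symmetric, OF di0 lim00]) (simp add: algebra_simps)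
    ultimately have l1: "(\<lambda>j. LINT x|lborel. W (r j) x * \<phi> x) \<longlonglongrightarrow> (LINT x|lborel. g x * \<phi> x)" by simp
    have "(\<lambda>j. - (\<kappa> * (LINT x|lborel. half_conv pker1 f (x, r j) * partial_deriv i \<phi> x))) \<longlonglongrightarrow> - (\<kappa> * (LINT y|lborel. f y * partial_deriv i \<phi> y))"
      by (intro tendsto_minus tendsto_mult_left half_conv_pker1_weak_limit[OF adm c2 R(3) less_imp_le[OF R(1)] r])
    moreover have "(LINT x|lborel. W (r j) x * \<phi> x) = - (\<kappa> * (LINT x|lborel. half_conv pker1 f (x, r j) * partial_deriv i \<phi> x))" for j
      using poisson_grad_by_parts[OF adm i \<phi> r(1)] \<kappa> by (simp add: W_def half_conv_pker1 \<kappa>_def)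
    ultimately show ?thesis using l1 LIMSEQ_unique by simp
  qed
  show ?thesis
  proof (intro exI[of _ "\<lambda>y. g y / \<kappa>"] conjI ballI)
    show "(\<lambda>y. g y / \<kappa>) \<in> borel_measurable borel" using g(1) by simp
    show "integrable lborel (\<lambda>y. \<bar>g y / \<kappa>\<bar> ^ n)" using g(2) by (simp add: power_divide)
    show "(LINT y|lborel. f y * partial_deriv i \<phi> y) = - (LINT y|lborel. g y / \<kappa> * \<phi> y)" if "\<phi> \<in> test_functions" for \<phi>
      using test[OF that] \<kappa> by simp
  qed
qed

text \<open>A compact set has finite measure, and
  \<open>\<bar>x\<bar> \<le> 1 + \<bar>x\<bar> powr p\<close>.\<close>

lemma locally_integrable_Lp:
  fixes f :: "'a::euclidean_space \<Rightarrow> real"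
  assumes f: "f \<in> Lp p lebesgue" and p: "p \<ge> 1"
  shows "locally_integrable f"
  unfolding locally_integrable_def set_integrable_def
proof (intro allI impI)
  fix K :: "'a set" assume K: "compact K"
  have Ks: "K \<in> sets lebesgue" using K by (simp add: compact_imp_closed)
  have Ke: "emeasure lebesgue K < \<infinity>" using emeasure_bounded_finite[OF compact_imp_bounded[OF K]] K
    by (simp add: compact_imp_closed)
  show "integrable lebesgue (\<lambda>x. indicat_real K x *\<^sub>R f x)"
  proof (rule integrable_real_bound)
    show "integrable lebesgue (\<lambda>x. indicat_real K x + \<bar>f x\<bar> powr p)"
      using f Ks Ke by (intro Bochner_Integration.integrable_add integrable_real_indicator) (auto simp: Lp_def)
    show "(\<lambda>x. indicat_real K x *\<^sub>R f x) \<in> borel_measurable lebesgue"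
      using f Ks by (intro borel_measurable_scaleR borel_measurable_indicator) (auto simp: Lp_def)
    show "\<bar>indicat_real K x *\<^sub>R f x\<bar> \<le> indicat_real K x + \<bar>f x\<bar> powr p" for x
    proof (cases "x \<in> K")
      case True
      have "\<bar>f x\<bar> \<le> 1 + \<bar>f x\<bar> powr p"
      proof (cases "\<bar>f x\<bar> \<le> 1")
        case False
        then have "\<bar>f x\<bar> powr 1 \<le> \<bar>f x\<bar> powr p" using p by (intro powr_mono) auto
        then show ?thesis using False by simp
      next
        case True
        then show ?thesis using powr_ge_zero[of "\<bar>f x\<bar>" p] by linarith
      qed
      then show ?thesis using True by simp
    qed simp
  qed
qed

lemma backward_direction:
  fixes f :: "'a::euclidean_space \<Rightarrow> real"
  assumes n: "DIM('a) \<ge> 2" and f: "f \<in> Lp (real DIM('a)) lebesgue"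
    and weak: "(\<lambda>z. norm (hyperbolic_gradient (poisson_extension f) z)) \<in> weak_Lp (real DIM('a)) hyperbolic_measure"
  shows "distributional_gradient_in_Lp (real DIM('a)) f"
proof -
  let ?n = "DIM('a)"
  have p: "?n \<ge> 1" using n by simp
  have fl: "f \<in> borel_measurable lebesgue" using f by (simp add: Lp_def)
  obtain f' where f': "f' \<in> borel_measurable borel" "integrable lborel (\<lambda>y. \<bar>f' y\<bar> ^ ?n)" "AE x in lborel. f x = f' x"
    using Lp_representative[OF f p] by blast
  have adm: "poisson_admissible f'" by (rule poisson_admissible_power[OF f'(1,2) p])
  define c where "c = Gamma ((real ?n + 1) / 2) / pi powr ((real ?n + 1) / 2)"
  have c: "c > 0" unfolding c_def by (intro divide_pos_pos Gamma_real_pos) auto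
  have u: "poisson_extension f z = c * half_conv pkern f' z" if "snd z > 0" for z
    unfolding c_def by (rule poisson_extension_half_conv[OF fl f'(1,3) that])
  let ?N = "\<lambda>z. norm (hyperbolic_gradient (poisson_extension f) z)"
  obtain C0 where C0: "C0 \<ge> 0" and m: "?N \<in> borel_measurable hyperbolic_measure"
    and wk: "\<And>s. s > 0 \<Longrightarrow> emeasure hyperbolic_measure {a \<in> space hyperbolic_measure. \<bar>?N a\<bar> > s} \<le> ennreal (C0 powr real ?n / s powr real ?n)"
    using weak unfolding weak_Lp_def by blast
  define C where "C = (C0 / c) powr real ?n"
  have C: "C \<ge> 0" by (simp add: C_def)
  show ?thesis unfolding distributional_gradient_in_Lp_def
  proof
    fix i :: 'a assume i: "i \<in> Basis"
    have iB: "(i, 0) \<in> (Basis :: ('a \<times> real) set)" using i by (simp add: Basis_prod_def)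
    define w where "w = poisson_grad (i, 0) f'"
    have wm: "w \<in> borel_measurable borel" unfolding w_def poisson_grad_def
      by (intro half_conv_measurable f'(1) hom_kernel_measurable[OF hom_kernel_partial_deriv[OF hom_kernel_pkern iB]])
    have wcont: "continuous_on {z. snd z > 0} w" unfolding w_def by (rule continuous_on_poisson_grad[OF adm iB]) simp
    have wsemi: "w (x, t + e) = half_conv pker1 (\<lambda>y. w (y, e)) (x, t)" if "t > 0" "e > 0" for x t e
      unfolding w_def by (rule poisson_grad_semigroup[OF f'(1,2) p iB that(2,1)])
    have wint: "integrable lborel (\<lambda>y. \<bar>w (y, e)\<bar> ^ ?n)" if "e > 0" for e
      unfolding w_def by (rule poisson_grad_slice_integrable[OF f'(1,2) p iB that])
    obtain K where K: "K \<ge> 0" "\<And>z. snd z > 0 \<Longrightarrow> \<bar>w z\<bar> \<le> K / (snd z)\<^sup>2"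
      using poisson_grad_height_bound[OF f'(1,2) iB] unfolding w_def by blast
    \<comment> \<open>The constant is enlarged by one because \<open>slice_moment_on_ball\<close>
      asks for a strictly positive one.\<close>
    have height: "\<bar>w z\<bar> \<le> (K + 1) / (snd z)\<^sup>2" if "snd z > 0" for z
      by (rule order_trans[OF K(2)[OF that] divide_right_mono]) auto
    have weakw: "emeasure hyperbolic_measure {z. snd z > 0 \<and> snd z * \<bar>w z\<bar> > s} \<le> ennreal (C / s ^ ?n)" if s: "s > 0" for s
    proof -
      have "emeasure hyperbolic_measure {z. snd z > 0 \<and> snd z * \<bar>w z\<bar> > s} \<le>
        emeasure hyperbolic_measure {a \<in> space hyperbolic_measure. \<bar>?N a\<bar> > c * s}"
      proof (rule emeasure_mono)
        show "{z. snd z > 0 \<and> snd z * \<bar>w z\<bar> > s} \<subseteq> {a \<in> space hyperbolic_measure. \<bar>?N a\<bar> > c * s}"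
        proof
          fix z assume "z \<in> {z. snd z > 0 \<and> snd z * \<bar>w z\<bar> > s}"
          then have z: "snd z > 0" "snd z * \<bar>w z\<bar> > s" by auto
          have "c * s < c * (snd z * \<bar>w z\<bar>)" by (rule mult_strict_left_mono[OF z(2) c])
          also have "\<dots> \<le> ?N z" unfolding w_def by (rule norm_hyperbolic_gradient(2)[OF u adm c z(1) iB])
          finally show "z \<in> {a \<in> space hyperbolic_measure. \<bar>?N a\<bar> > c * s}"
            using z(1) by (cases z) (auto simp: space_hyperbolic upper_half_space_def)
        qed
        have "(\<lambda>a. \<bar>?N a\<bar>) \<in> borel_measurable hyperbolic_measure" using m by (rule borel_measurable_abs)
        then show "{a \<in> space hyperbolic_measure. \<bar>?N a\<bar> > c * s} \<in> sets hyperbolic_measure"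
          by (rule borel_measurable_less[OF borel_measurable_const])
      qed
      also have "\<dots> \<le> ennreal (C0 powr real ?n / (c * s) powr real ?n)" by (rule wk) (use c s in simp)
      also have "C0 powr real ?n / (c * s) powr real ?n = C / s ^ ?n"
        using C0 c s by (simp add: C_def powr_mult powr_divide powr_realpow)
      finally show ?thesis .
    qed
    have S: "(LINT y|lborel. \<bar>poisson_grad (i, 0) f' (y, e)\<bar> ^ ?n) \<le> 4 * 4 ^ ?n * C" if e: "e > 0" for e
    proof (fold w_def, rule slice_moment_bound[OF p wm wint[OF e]])
      show "(LINT y|lborel. indicator (ball 0 R) y * \<bar>w (y, e)\<bar> ^ ?n) \<le>
        4 * 4 ^ ?n * C + 2 ^ ?n * \<eta> ^ ?n * measure lborel (ball (0::'a) R)" if "\<eta> > 0" for R \<eta>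
        by (rule slice_moment_on_ball[OF p wm wcont wsemi wint height _ C weakw e that]) (use K(1) in simp_all)
    qed
    obtain g where g: "g \<in> borel_measurable borel" "integrable lborel (\<lambda>y. \<bar>g y\<bar> ^ ?n)"
      and test: "\<And>\<phi>. \<phi> \<in> test_functions \<Longrightarrow> (LINT y|lborel. f' y * partial_deriv i \<phi> y) = - (LINT y|lborel. g y * \<phi> y)"
      using weak_partial_of_bounded_slices[OF n f'(1,2) i S] by blast
    have gl: "g \<in> borel_measurable lebesgue" by (rule measurable_completion) (use g(1) in simp)
    have gLp: "g \<in> Lp (real ?n) lebesgue"
    proof -
      have "\<bar>x\<bar> powr real ?n = \<bar>x\<bar> ^ ?n" for x :: real using p by (cases "x = 0") (auto simp: powr_realpow)
      then show ?thesis unfolding Lp_def using gl g by (simp add: integrable_completion)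
    qed
    have "has_distributional_partial i f g" unfolding has_distributional_partial_def
    proof (intro conjI ballI)
      show "locally_integrable f" "locally_integrable g" by (rule locally_integrable_Lp[OF f] locally_integrable_Lp[OF gLp]; use p in simp)+
      fix \<phi> :: "'a \<Rightarrow> real" assume \<phi>: "\<phi> \<in> test_functions"
      have m: "partial_deriv i \<phi> \<in> borel_measurable borel" "\<phi> \<in> borel_measurable borel"
        using test_function_props(2,3)[OF \<phi>] i by (auto intro: borel_measurable_continuous_onI)
      have ae: "AE x in lborel. g x = g x" by simp
      show "(LINT x|lebesgue. f x * partial_deriv i \<phi> x) = - (LINT x|lebesgue. g x * \<phi> x)"
        unfolding lebesgue_integral_representative[OF fl f'(1,3) m(1)] lebesgue_integral_representative[OF gl g(1) ae m(2)]
        by (rule test[OF \<phi>])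
    qed
    then show "\<exists>g\<in>Lp (real ?n) lebesgue. has_distributional_partial i f g" using gLp by blast
  qed
qed

theorem corollary6p4:
  fixes f :: "real ^ 'n \<Rightarrow> real" and u :: "(real ^ 'n) \<times> real \<Rightarrow> real"
  assumes "CARD('n) \<ge> 2"
    and "f \<in> Lp (real CARD('n)) lebesgue"
    and "u = poisson_extension f"
  shows "distributional_gradient_in_Lp (real CARD('n)) f \<longleftrightarrow>
         (\<lambda>z. norm (hyperbolic_gradient u z)) \<in> weak_Lp (real CARD('n)) hyperbolic_measure"
proof -
  have "DIM(real ^ 'n) = CARD('n)" by simp
  then show ?thesis
    using forward_direction[of f] backward_direction[of f] assms by metis
qed

end
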